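(* Assume that the functions $h^0_{l,k}$, $(l,k)\in[K]^2$, are in $C^\beta([0,A])$ for some $\beta\in(0,1]$, extended to functions $h^{0,e}_{l,k}\in C^\beta_b(\mathbb R)$ as in the context. Let $(\xi,\mathbf g)=(\Gamma^e)^{-1}(\xi',\mathbf g')$ with $\xi'\in\mathbb R^K$ and $\mathbf g'\in C^\beta_b(\mathbb R)^{K^2}$. Let $\mathcal K:\mathbb R\to\mathbb R$ be a bounded function, supported on $[-1,1]$, symmetric about $0$, with a bounded (weak) derivative on $\mathbb R$ and $\int\mathcal K(x)dx=1$; for $n\ge1$ let $\mathcal K_n(x)=n\mathcal K(nx)$, $\mathcal K_ng(x)=\int\mathcal K_n(y)g(x-y)dy$, and $\mathcal K_n\mathbf g=(\mathcal K_ng_{l,k})_{l,k}$. Then $$\|\mathbf g-\mathcal K_n\mathbf g\|_\infty\le C(\mathbf g)\,n^{-\beta}$$ for some constant $C(\mathbf g)>0$ that depends only on $\mathbf g$. Consequently the functions $g_{l,k}$ belong to the Besov space $\mathcal B^\beta_{\infty,\infty}(\mathbb R)$, and thus $$(\Gamma^e)^{-1}\big(\mathbb R^K\times C^\beta_b(\mathbb R)^{K^2}\big)\subseteq\mathbb R^K\times\mathcal B^\beta_{\infty,\infty,b}(\mathbb R)^{K^2}.$$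
   Context: Fix $K\ge1$, $[K]=\{1,\dots,K\}$, $A>0$. Under $\mathbb P_0$ (expectation $\mathbb E_0$), $N=(N^1,\dots,N^K)$ is the stationary linear multivariate Hawkes process on $\mathbb R$ with parameter $f^0=(\nu^0,\mathbf h^0)$: $\nu^0\in(0,\infty)^K$, $\mathbf h^0=(h^0_{l,k})$ non-negative functions supported in $[0,A]$, the matrix $(\int_0^Ah^0_{l,k})_{l,k}$ has spectral radius $<1$; intensities $\lambda^k_t(f^0_k)=\nu^0_k+\sum_l\int_{[t-A,t)}h^0_{l,k}(t-u)dN^l_u$. $\mu^0_l=\mathbb E_0[N^l([0,1])]$. For a matrix of functions $\mathbf g=(g_{l,k})$ with columns $\mathbf g_k$, $\tilde\lambda^k_A(0,\mathbf g_k)=\sum_l\int_{[0,A)}g_{l,k}(A-u)dN^l_u$. $\mathbb E_0^{(u,l)}$ is expectation under the Palm distribution $\mathbb P_0^{(u,l)}$ of $N$ at a point $u$ of mark $l$: for measurable $\Phi\ge0$, $\mathbb E_0[\sum_l\int\Phi(u,l,N)dN^l_u]=\sum_l\mu^0_l\int\mathbb E_0^{(u,l)}[\Phi(u,l,N)]du$, with $\mathbb P_0^{(u,l)}$ the law of $N$ shifted by $u$ under $\mathbb P_0^{(0,l)}$. $C^\beta_b(\mathbb R)=C^\beta(\mathbb R)\cap L_\infty(\mathbb R)$ (for $\beta\in(0,1]$, $C^\beta$ is the space of $\beta$-Hölder functions), $\mathcal B^\beta_{\infty,\infty,b}(\mathbb R)=\mathcal B^\beta_{\infty,\infty}(\mathbb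 R)\cap L_\infty(\mathbb R)$. The extensions $h^{0,e}_{l,k}$ coincide with $h^0_{l,k}$ on $[0,A]$, belong to $C^\beta_b(\mathbb R)$ and satisfy $h^{0,e}_{l,k}\ge-\nu^0_k/2$. For $t,u\in\mathbb R$, $\lambda^{k,e}_t(f^0_k,(u,l))=\lambda^k_t(f^0_k)+h^{0,e}_{l,k}(t-u)\mathbf 1_{u\notin[t-A,t)}$, $$p^e_{l,k}(A-u)=\mathbb E_0^{(u,l)}\Big[\frac1{\lambda^{k,e}_A(f^0_k,(u,l))}\Big],\qquad \zeta^e_{l,j,k}(g)(A-u)=\mathbb E_0^{(u,l)}\Big[\int_0^A\mathbf 1_{(s,j)\ne(u,l)}\,g(A-s)\frac{dN^j_s}{\lambda^{k,e}_A(f^0_k,(u,l))}\Big],\quad u\in\mathbb R.$$ $\Gamma^e:\mathbb R^K\times L_\infty(\mathbb R)^{K^2}\to\mathbb R^K\times L_\infty(\mathbb R)^{K^2}$ is the linear operator $\Gamma^e(\xi,\mathbf g)=(\xi',\mathbf g')$ with $$\xi'_k=\xi_k\mathbb E_0\Big[\frac1{\lambda^k_A(f^0_k)}\Big]+\mathbb E_0\Big[\frac{\tilde\lambda^k_A(0,\mathbf g_k)}{\lambda^k_A(f^0_k)}\Big],\qquad g'_{l,k}=\mu^0_lp^e_{l,k}g_{l,k}+\mu^0_lp^e_{l,k}\xi_k+\mu^0_l\sum_{j=1}^K\zeta^e_{l,j,k}(g_{j,k});$$ it is bounded and bijective with bounded inverse. *)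

theory Defs
  imports "HOL-Probability.Probability" "Jordan_Normal_Form.Spectral_Radius"
begin

section \<open>Point configurations with marks\<close>

text \<open>
  The marks \<open>[K]\<close>, \<open>K \<ge> 1\<close>, are the elements of a finite type \<open>'k\<close>. A realisation of
  \<open>N = (N\<^sup>1, \<dots>, N\<^sup>K)\<close> is encoded by its sets of points: \<open>c l\<close> is the set of points of mark
  \<open>l\<close>, so that \<open>dN\<^sup>l\<close> is the counting measure on \<open>c l\<close> and the integral of a function against
  \<open>dN\<^sup>l\<close> over a bounded window is a finite sum.
\<close>

type_synonym 'k conf = "'k \<Rightarrow> real set"

definition configurations :: "'k conf set" where
  "configurations = {c. \<forall>k a b. finite (c k \<inter> {a..b})}"

text \<open>The \<open>\<sigma>\<close>-algebra generated by the numbers of points in bounded Borel subsets of \<open>S\<close>.\<close>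

definition conf_algebra :: "real set \<Rightarrow> 'k conf measure" where
  "conf_algebra S = sigma configurations
     {{c \<in> configurations. card (c k \<inter> B) = n} | k B n. B \<in> sets borel \<and> bounded B \<and> B \<subseteq> S}"

abbreviation conf_borel :: "'k conf measure" where
  "conf_borel \<equiv> conf_algebra UNIV"

definition shift_conf :: "real \<Rightarrow> 'k conf \<Rightarrow> 'k conf" where
  "shift_conf u c = (\<lambda>k. (\<lambda>s. s + u) ` c k)"


section \<open>The stationary linear Hawkes process\<close>

text \<open>\<open>intensity A \<nu> h k t c\<close> is \<open>\<lambda>\<^sup>k\<^sub>t(f\<^sub>k)\<close> for \<open>f = (\<nu>, h)\<close>, evaluated at the configuration \<open>c\<close>.\<close>

definition intensity ::
  "real \<Rightarrow> ('k::finite \<Rightarrow> real) \<Rightarrow> ('k \<Rightarrow> 'k \<Rightarrow> real \<Rightarrow> real) \<Rightarrow> 'k \<Rightarrow> real \<Rightarrow> 'k conf \<Rightarrow> real" where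
  "intensity A \<nu> h k t c = \<nu> k + (\<Sum>l\<in>UNIV. \<Sum>u\<in>c l \<inter> {t - A..<t}. h l k (t - u))"

text \<open>
  The library's spectral radius is about matrices indexed by \<open>{0..<n}\<close>; the marks are therefore
  enumerated, which does not affect the spectral radius.
\<close>

definition interaction_matrix ::
  "real \<Rightarrow> ('k::finite \<Rightarrow> 'k \<Rightarrow> real \<Rightarrow> real) \<Rightarrow> complex mat" where
  "interaction_matrix A h = mat CARD('k) CARD('k)
     (\<lambda>(i, j). complex_of_real
        (LINT x:{0..A}|lborel. h (from_nat_into UNIV i) (from_nat_into UNIV j) x))"

definition hawkes_parameter ::
  "real \<Rightarrow> ('k::finite \<Rightarrow> real) \<Rightarrow> ('k \<Rightarrow> 'k \<Rightarrow> real \<Rightarrow> real) \<Rightarrow> bool" where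
  "hawkes_parameter A \<nu> h \<longleftrightarrow>
     (\<forall>k. \<nu> k > 0) \<and>
     (\<forall>l k. h l k \<in> borel_measurable borel \<and> (\<forall>x. h l k x \<ge> 0) \<and> (\<forall>x. x \<notin> {0..A} \<longrightarrow> h l k x = 0) \<and>
            set_integrable lborel {0..A} (h l k)) \<and>
     spectral_radius (interaction_matrix A h) < 1"

text \<open>
  \<open>P\<close> is the law of \<open>N\<close>. The last clause says that \<open>\<lambda>\<^sup>k\<close> is the intensity of \<open>N\<^sup>k\<close> with respect to
  the history of \<open>N\<close>; together with the absence of common points of different marks (part
  of the notion of a multivariate point process) it characterises the process.
\<close>

definition stationary_hawkes ::
  "real \<Rightarrow> ('k::finite \<Rightarrow> real) \<Rightarrow> ('k \<Rightarrow> 'k \<Rightarrow> real \<Rightarrow> real) \<Rightarrow> 'k conf measure \<Rightarrow> bool" where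
  "stationary_hawkes A \<nu> h P \<longleftrightarrow>
     hawkes_parameter A \<nu> h \<and>
     prob_space P \<and> sets P = sets conf_borel \<and>
     (\<forall>u. distr P conf_borel (shift_conf u) = P) \<and>
     (\<forall>l. integrable P (\<lambda>c. real (card (c l \<inter> {0..1})))) \<and>
     (AE c in P. \<forall>l k. l \<noteq> k \<longrightarrow> c l \<inter> c k = {}) \<and>
     (\<forall>k s t. s < t \<longrightarrow> (\<forall>F\<in>sets (conf_algebra {..s}).
        (\<integral>\<^sup>+c. indicator F c * of_nat (card (c k \<inter> {s<..t})) \<partial>P) =
        (\<integral>\<^sup>+c. indicator F c * (\<integral>\<^sup>+v\<in>{s<..t}. ennreal (intensity A \<nu> h k v c) \<partial>lborel) \<partial>P)))"

definition mean_rate :: "'k conf measure \<Rightarrow> 'k \<Rightarrow> real" where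
  "mean_rate P l = (\<integral>c. real (card (c l \<inter> {0..1})) \<partial>P)"

text \<open>\<open>Q u l\<close> is the Palm distribution of \<open>N\<close> at a point \<open>u\<close> of mark \<open>l\<close>.\<close>

definition palm_distributions ::
  "'k::finite conf measure \<Rightarrow> (real \<Rightarrow> 'k \<Rightarrow> 'k conf measure) \<Rightarrow> bool" where
  "palm_distributions P Q \<longleftrightarrow>
     (\<forall>u l. prob_space (Q u l) \<and> sets (Q u l) = sets conf_borel) \<and>
     (\<forall>u l. Q u l = distr (Q 0 l) conf_borel (shift_conf u)) \<and>
     (\<forall>\<Phi> :: real \<times> 'k \<times> 'k conf \<Rightarrow> ennreal.
        \<Phi> \<in> borel_measurable (borel \<Otimes>\<^sub>M count_space UNIV \<Otimes>\<^sub>M conf_borel) \<longrightarrow>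
        (\<integral>\<^sup>+c. (\<Sum>l\<in>UNIV. \<integral>\<^sup>+u. \<Phi> (u, l, c) \<partial>count_space (c l)) \<partial>P) =
        (\<Sum>l\<in>UNIV. ennreal (mean_rate P l) * (\<integral>\<^sup>+u. (\<integral>\<^sup>+c. \<Phi> (u, l, c) \<partial>Q u l) \<partial>lborel)))"


section \<open>Function spaces\<close>

text \<open>
  Elements of \<open>L\<^sub>\<infinity>(\<real>)\<close> are represented by Borel functions; equality in \<open>L\<^sub>\<infinity>\<close> is equality almost
  everywhere.
\<close>

definition Linf_norm :: "(real \<Rightarrow> real) \<Rightarrow> ereal" where
  "Linf_norm f = esssup lborel (\<lambda>x. ereal \<bar>f x\<bar>)"

definition Linf :: "(real \<Rightarrow> real) set" where
  "Linf = {f \<in> borel_measurable borel. Linf_norm f < \<infinity>}"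

definition Linf_mat_norm :: "('k::finite \<Rightarrow> 'k \<Rightarrow> real \<Rightarrow> real) \<Rightarrow> ereal" where
  "Linf_mat_norm g = (SUP l. SUP k. Linf_norm (g l k))"

definition holder_on :: "real \<Rightarrow> real set \<Rightarrow> (real \<Rightarrow> real) \<Rightarrow> bool" where
  "holder_on \<beta> S f \<longleftrightarrow> (\<exists>L. \<forall>x\<in>S. \<forall>y\<in>S. \<bar>f x - f y\<bar> \<le> L * \<bar>x - y\<bar> powr \<beta>)"

definition holder_b :: "real \<Rightarrow> (real \<Rightarrow> real) set" where
  "holder_b \<beta> = {f. holder_on \<beta> UNIV f \<and> bounded (range f)}"

definition finite_difference :: "nat \<Rightarrow> real \<Rightarrow> (real \<Rightarrow> real) \<Rightarrow> real \<Rightarrow> real" where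
  "finite_difference r y f x = (\<Sum>i\<le>r. (-1) ^ (r - i) * real (r choose i) * f (x + real i * y))"

text \<open>
  The Besov space \<open>B\<^sup>\<beta>\<^sub>\<infinity>\<^sub>,\<^sub>\<infinity>(\<real>)\<close> by moduli of smoothness of the smallest integer order
  greater than \<open>\<beta>\<close>: Hoelder differences for \<open>\<beta> < 1\<close>, the Zygmund class for \<open>\<beta> = 1\<close>.
\<close>

definition besov_inf_inf :: "real \<Rightarrow> (real \<Rightarrow> real) set" where
  "besov_inf_inf \<beta> = {f \<in> Linf. \<exists>B. \<forall>y. y \<noteq> 0 \<longrightarrow>
     Linf_norm (finite_difference (nat \<lfloor>\<beta>\<rfloor> + 1) y f) \<le> ereal (B * \<bar>y\<bar> powr \<beta>)}"

definition besov_inf_inf_b :: "real \<Rightarrow> (real \<Rightarrow> real) set" where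
  "besov_inf_inf_b \<beta> = besov_inf_inf \<beta> \<inter> Linf"


section \<open>Operators on \<open>\<real>\<^sup>K \<times> L\<^sub>\<infinity>(\<real>)\<close> matrices\<close>

type_synonym 'k param = "('k \<Rightarrow> real) \<times> ('k \<Rightarrow> 'k \<Rightarrow> real \<Rightarrow> real)"

definition params :: "(real \<Rightarrow> real) set \<Rightarrow> 'k param set" where
  "params F = {(\<xi>, g). \<forall>l k. g l k \<in> F}"

definition param_eq :: "'k param \<Rightarrow> 'k param \<Rightarrow> bool" where
  "param_eq z w \<longleftrightarrow> fst z = fst w \<and> (\<forall>l k. AE x in lborel. snd z l k x = snd w l k x)"

definition param_norm :: "'k::finite param \<Rightarrow> ereal" where
  "param_norm z = max (SUP k. ereal \<bar>fst z k\<bar>) (Linf_mat_norm (snd z))"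

text \<open>Bounded and bijective with bounded inverse, as an operator on classes modulo \<open>param_eq\<close>.\<close>

definition bounded_bijective :: "('k::finite param \<Rightarrow> 'k param) \<Rightarrow> bool" where
  "bounded_bijective T \<longleftrightarrow>
     (\<forall>z\<in>params Linf. T z \<in> params Linf) \<and>
     (\<exists>B::real. \<forall>z\<in>params Linf. param_norm (T z) \<le> ereal B * param_norm z) \<and>
     (\<forall>z\<in>params Linf. \<forall>z'\<in>params Linf. param_eq (T z) (T z') \<longrightarrow> param_eq z z') \<and>
     (\<forall>w\<in>params Linf. \<exists>z\<in>params Linf. param_eq (T z) w) \<and>
     (\<exists>B::real. \<forall>z\<in>params Linf. param_norm z \<le> ereal B * param_norm (T z))"

text \<open>\<open>is_inverse_at T w z\<close> says \<open>z = T\<^sup>-\<^sup>1 w\<close> as classes.\<close>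

definition is_inverse_at :: "('k param \<Rightarrow> 'k param) \<Rightarrow> 'k param \<Rightarrow> 'k param \<Rightarrow> bool" where
  "is_inverse_at T w z \<longleftrightarrow> z \<in> params Linf \<and> param_eq (T z) w"


section \<open>The operator \<open>\<Gamma>\<^sup>e\<close>\<close>

text \<open>\<open>lin_intensity A g k c\<close> is the linear part \<open>\<lambda>\<^sup>k\<^sub>A(0, g\<^sub>k)\<close> (with tilde).\<close>

definition lin_intensity ::
  "real \<Rightarrow> ('k::finite \<Rightarrow> 'k \<Rightarrow> real \<Rightarrow> real) \<Rightarrow> 'k \<Rightarrow> 'k conf \<Rightarrow> real" where
  "lin_intensity A g k c = (\<Sum>l\<in>UNIV. \<Sum>u\<in>c l \<inter> {0..<A}. g l k (A - u))"

definition intensity_ext ::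
  "real \<Rightarrow> ('k::finite \<Rightarrow> real) \<Rightarrow> ('k \<Rightarrow> 'k \<Rightarrow> real \<Rightarrow> real) \<Rightarrow> ('k \<Rightarrow> 'k \<Rightarrow> real \<Rightarrow> real) \<Rightarrow>
   'k \<Rightarrow> real \<Rightarrow> real \<times> 'k \<Rightarrow> 'k conf \<Rightarrow> real" where
  "intensity_ext A \<nu> h he k t = (\<lambda>(u, l) c.
     intensity A \<nu> h k t c + he l k (t - u) * of_bool (u \<notin> {t - A..<t}))"

text \<open>In the next two definitions the argument is \<open>x = A - u\<close>.\<close>

definition p_ext ::
  "real \<Rightarrow> ('k::finite \<Rightarrow> real) \<Rightarrow> ('k \<Rightarrow> 'k \<Rightarrow> real \<Rightarrow> real) \<Rightarrow> ('k \<Rightarrow> 'k \<Rightarrow> real \<Rightarrow> real) \<Rightarrow>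
   (real \<Rightarrow> 'k \<Rightarrow> 'k conf measure) \<Rightarrow> 'k \<Rightarrow> 'k \<Rightarrow> real \<Rightarrow> real" where
  "p_ext A \<nu> h he Q l k x =
     (let u = A - x in \<integral>c. 1 / intensity_ext A \<nu> h he k A (u, l) c \<partial>Q u l)"

definition zeta_ext ::
  "real \<Rightarrow> ('k::finite \<Rightarrow> real) \<Rightarrow> ('k \<Rightarrow> 'k \<Rightarrow> real \<Rightarrow> real) \<Rightarrow> ('k \<Rightarrow> 'k \<Rightarrow> real \<Rightarrow> real) \<Rightarrow>
   (real \<Rightarrow> 'k \<Rightarrow> 'k conf measure) \<Rightarrow> 'k \<Rightarrow> 'k \<Rightarrow> 'k \<Rightarrow> (real \<Rightarrow> real) \<Rightarrow> real \<Rightarrow> real" where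
  "zeta_ext A \<nu> h he Q l j k g x =
     (let u = A - x in \<integral>c. (\<Sum>s\<in>c j \<inter> {0..<A}. of_bool ((s, j) \<noteq> (u, l)) * g (A - s))
                           / intensity_ext A \<nu> h he k A (u, l) c \<partial>Q u l)"

definition Gamma_ext ::
  "real \<Rightarrow> ('k::finite \<Rightarrow> real) \<Rightarrow> ('k \<Rightarrow> 'k \<Rightarrow> real \<Rightarrow> real) \<Rightarrow> ('k \<Rightarrow> 'k \<Rightarrow> real \<Rightarrow> real) \<Rightarrow>
   'k conf measure \<Rightarrow> (real \<Rightarrow> 'k \<Rightarrow> 'k conf measure) \<Rightarrow> 'k param \<Rightarrow> 'k param" where
  "Gamma_ext A \<nu> h he P Q = (\<lambda>(\<xi>, g).
     (\<lambda>k. \<xi> k * (\<integral>c. 1 / intensity A \<nu> h k A c \<partial>P)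
           + (\<integral>c. lin_intensity A g k c / intensity A \<nu> h k A c \<partial>P),
      \<lambda>l k x. mean_rate P l * p_ext A \<nu> h he Q l k x * g l k x
           + mean_rate P l * p_ext A \<nu> h he Q l k x * \<xi> k
           + mean_rate P l * (\<Sum>j\<in>UNIV. zeta_ext A \<nu> h he Q l j k (g j k) x)))"


section \<open>Smoothing kernels\<close>

text \<open>Weak derivatives are tested against continuously differentiable functions with compact support.\<close>

definition weak_derivative :: "(real \<Rightarrow> real) \<Rightarrow> (real \<Rightarrow> real) \<Rightarrow> bool" where
  "weak_derivative f f' \<longleftrightarrow>
     (\<forall>R. set_integrable lborel {-R..R} f \<and> set_integrable lborel {-R..R} f') \<and>
     (\<forall>\<phi> \<phi>'. (\<forall>x. (\<phi> has_real_derivative \<phi>' x) (at x)) \<and> continuous_on UNIV \<phi>' \<and>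
        (\<exists>R. \<forall>x. \<bar>x\<bar> > R \<longrightarrow> \<phi> x = 0) \<longrightarrow>
        (\<integral>x. f x * \<phi>' x \<partial>lborel) = - (\<integral>x. f' x * \<phi> x \<partial>lborel))"

definition smoothing_kernel :: "(real \<Rightarrow> real) \<Rightarrow> bool" where
  "smoothing_kernel \<K> \<longleftrightarrow>
     \<K> \<in> borel_measurable borel \<and> bounded (range \<K>) \<and>
     (\<forall>x. x \<notin> {-1..1} \<longrightarrow> \<K> x = 0) \<and> (\<forall>x. \<K> (- x) = \<K> x) \<and>
     (\<exists>\<K>'. weak_derivative \<K> \<K>' \<and> bounded (range \<K>')) \<and>
     (\<integral>x. \<K> x \<partial>lborel) = 1"

definition scaled_kernel :: "(real \<Rightarrow> real) \<Rightarrow> nat \<Rightarrow> real \<Rightarrow> real" where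
  "scaled_kernel \<K> n x = real n * \<K> (real n * x)"

definition smooth :: "(real \<Rightarrow> real) \<Rightarrow> nat \<Rightarrow> (real \<Rightarrow> real) \<Rightarrow> real \<Rightarrow> real" where
  "smooth \<K> n g x = (\<integral>y. scaled_kernel \<K> n y * g (x - y) \<partial>lborel)"

end

theory Submission
  imports Defs
begin

text \<open>
  Let \<open>g\<close> be the second component of \<open>(\<Gamma>\<^sup>e)\<inverse> (\<xi>', g')\<close>. Everything follows from the estimate
  \<open>\<parallel>g(\<cdot> - y) - g\<parallel>\<^sub>\<infinity> \<le> C \<bar>y\<bar>\<^sup>\<beta>\<close> for all \<open>y\<close> (lemma \<open>translation_bound\<close>). The Besov seminorm is
  a supremum of such differences (\<open>besov_from_translations\<close>), and as the kernel has integral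
  \<open>1\<close> and lives on \<open>[-1/n, 1/n]\<close>, smoothing averages translates of \<open>g\<close> by at most \<open>1/n\<close>
  (\<open>smoothing_from_translations\<close>).

  For the estimate, it is enough to bound \<open>\<Gamma>\<^sup>e (0, g(\<cdot> - y) - g)\<close>, because the inverse of
  \<open>\<Gamma>\<^sup>e\<close> is bounded. Were \<open>\<Gamma>\<^sup>e\<close> to commute with translations, the second component of this
  would be \<open>g'(\<cdot> - y) - g'\<close>, which is small since \<open>g'\<close> is Hoelder. So the task is to show that
  \<open>\<Gamma>\<^sup>e\<close> commutes with translations up to \<open>O(\<bar>y\<bar>\<^sup>\<beta>)\<close> in the supremum norm (\<open>palm_commutator\<close>);
  the first component of \<open>\<Gamma>\<^sup>e (0, g(\<cdot> - y) - g)\<close> is small by the stationarity of the process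
  (\<open>stationary_commutator\<close>).

  In \<open>p\<^sup>e\<close> and \<open>\<zeta>\<^sup>e\<close>, shift the Palm point to the origin. The law is then always \<open>Q 0 l\<close>, and
  a translation by \<open>y\<close> only moves the window \<open>[x - A, x)\<close> in which the other points are seen.
  The extension \<open>h\<^sup>e\<close> is what makes this work: the contribution of the Palm point itself
  becomes \<open>h\<^sup>e(x)\<close>, which is Hoelder in \<open>x\<close>, whereas without the extension it would jump as
  the window passes over that point. For the other points, those that stay in the window
  contribute Hoelder differences, and those that enter or leave it lie in two intervals of
  length \<open>y\<close> (\<open>error_controls_differences\<close>). The intensities are at least \<open>\<nu>/2\<close>, so that
  quotients do no harm.

  It remains to bound moments of the number of points in a window, and to show that the Palm
  expectation of this number times the number of points in an interval of length \<open>y\<close>, the Palm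
  point excluded, is \<open>O(y)\<close> (\<open>Q_window_bound\<close>, \<open>Q_pair_bound\<close>). By the definition of the Palm
  distribution, the latter is a statement on pairs of distinct points, hence on pairs of
  disjoint short cells, under the stationary law.

  Under the stationary law, everything comes from the compensator. Over a short time \<open>d\<close>, the
  conditional moments of the number of new points are \<open>O(d)\<close> times a power of the number of
  points in the last \<open>A\<close> units of time, called \<open>load\<close> below (\<open>cond_le_births\<close>,
  \<open>cond_le_moment\<close>). To control the load at all times, let every point carry the weighted mean
  number of the children that it has yet to produce, plus a slowly decreasing reserve. Since
  the spectral radius is below \<open>1\<close>, the weights can be chosen such that the sum of what the
  points carry is a supermartingale up to constants (\<open>drift\<close>). This yields finite moments of
  the load of all orders (\<open>load_moment_finite\<close>), and bounds on its later moments by its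
  present ones (\<open>load_moment_propagates\<close>). Together with the short-time estimates, they give
  the bound for pairs of cells (\<open>pair_load_bound\<close>).
\<close>

section \<open>Subcritical weights\<close>

text \<open>
  \<open>M\<^sup>m\<close> applied to the vector of ones.
\<close>

primrec mat_iterate :: "('k::finite \<Rightarrow> 'k \<Rightarrow> real) \<Rightarrow> nat \<Rightarrow> 'k \<Rightarrow> real" where
  "mat_iterate M 0 = (\<lambda>_. 1)"
| "mat_iterate M (Suc m) = (\<lambda>l. \<Sum>k\<in>UNIV. M l k * mat_iterate M m k)"

lemma spectral_radius_smult_less_1:
  fixes B :: "complex mat"
  assumes B: "B \<in> carrier_mat n n" and n: "n > 0" and r: "spectral_radius B < r" "0 < r"
  shows "spectral_radius (complex_of_real (1 / r) \<cdot>\<^sub>m B) < 1"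
proof -
  let ?C = "complex_of_real (1 / r) \<cdot>\<^sub>m B"
  have C: "?C \<in> carrier_mat n n" using B by simp
  have "spectral_radius ?C \<in> norm ` spectrum ?C"
    using spectral_radius_mem_max(1)[OF C n] .
  then obtain ev where ev: "eigenvalue ?C ev" and eq: "spectral_radius ?C = norm ev"
    by (auto simp: spectrum_def)
  from ev obtain v where v: "v \<in> carrier_vec n" "v \<noteq> 0\<^sub>v n" "?C *\<^sub>v v = ev \<cdot>\<^sub>v v"
    using C unfolding eigenvalue_def eigenvector_def by auto
  have "B *\<^sub>v v = (complex_of_real r * ev) \<cdot>\<^sub>v v"
  proof (rule eq_vecI)
    fix i assume i: "i < dim_vec ((complex_of_real r * ev) \<cdot>\<^sub>v v)"
    then have i': "i < n" using v by auto
    have "(?C *\<^sub>v v) $ i = complex_of_real (1 / r) * ((B *\<^sub>v v) $ i)"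
      using i' B v(1) by (simp add: scalar_prod_def sum_distrib_left mult.assoc)
    moreover have "(?C *\<^sub>v v) $ i = ev * v $ i" using i' v by simp
    ultimately show "(B *\<^sub>v v) $ i = ((complex_of_real r * ev) \<cdot>\<^sub>v v) $ i"
      using r i' v by (simp add: field_simps)
  qed (use B v in auto)
  then have "eigenvalue B (complex_of_real r * ev)"
    using v B unfolding eigenvalue_def eigenvector_def by auto
  then have "norm (complex_of_real r * ev) \<le> spectral_radius B"
    using spectral_radius_mem_max(2)[OF B n] by (auto simp: spectrum_def)
  then have "r * norm ev \<le> spectral_radius B" using r by (simp add: norm_mult)
  then have "r * norm ev < r * 1" using r(1) by linarith
  then have "norm ev < 1" using r(2) by (simp only: mult_less_cancel_left_pos)
  then show ?thesis using eq by simp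
qed

text \<open>
  Divided by a number \<open>r\<close> strictly between its spectral radius and \<open>1\<close>, the matrix still has
  spectral radius below \<open>1\<close>, and the powers of such a matrix are bounded, as is seen from its
  triangular form.
\<close>

lemma mat_iterate_bound:
  fixes M :: "'k::finite \<Rightarrow> 'k \<Rightarrow> real"
  assumes sr: "spectral_radius (mat CARD('k) CARD('k)
       (\<lambda>(i, j). complex_of_real (M (from_nat_into UNIV i) (from_nat_into UNIV j)))) < 1"
  shows "\<exists>c r. 0 < r \<and> r < 1 \<and> (\<forall>m l. \<bar>mat_iterate M m l\<bar> \<le> c * r ^ m)"
proof -
  define n where "n = CARD('k)"
  define e where "e = (from_nat_into UNIV :: nat \<Rightarrow> 'k)"
  define B where "B = mat n n (\<lambda>(i, j). complex_of_real (M (e i) (e j)))"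
  have n: "n > 0" unfolding n_def by simp
  have e: "bij_betw e {..<n} UNIV"
    unfolding e_def n_def by (rule bij_betw_from_nat_into_finite) auto
  have B: "B \<in> carrier_mat n n" unfolding B_def by simp
  have srB: "spectral_radius B < 1" using sr unfolding B_def n_def e_def .
  define r where "r = (max 0 (spectral_radius B) + 1) / 2"
  have r: "0 < r" "r < 1" "spectral_radius B < r" using srB unfolding r_def by auto
  define C where "C = complex_of_real (1 / r) \<cdot>\<^sub>m B"
  have C: "C \<in> carrier_mat n n" unfolding C_def using B by simp
  have "spectral_radius C < 1" unfolding C_def by (rule spectral_radius_smult_less_1[OF B n r(3,1)])
  then obtain c where c: "\<And>k. norm_bound (C ^\<^sub>m k) c"
    using spectral_radius_jnf_norm_bound_less_1_upper_triangular[OF C] by blast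
  define one where "one = vec n (\<lambda>_. 1 :: complex)"
  have one: "one \<in> carrier_vec n" unfolding one_def by simp
  have Cm: "C ^\<^sub>m m \<in> carrier_mat n n" for m using C by (rule pow_carrier_mat)
  have step: "C ^\<^sub>m m * C = C * C ^\<^sub>m m" for m
  proof (induction m)
    case (Suc m)
    then show ?case using C Cm[of m] by (simp add: assoc_mult_mat[of _ n n _ n _ n])
  qed (use C in simp)
  have val: "i < n \<Longrightarrow> (C ^\<^sub>m m *\<^sub>v one) $ i = complex_of_real (mat_iterate M m (e i) / r ^ m)" for m i
  proof (induction m arbitrary: i)
    case 0
    then show ?case using C one by (simp add: one_def)
  next
    case (Suc m)
    have "C ^\<^sub>m Suc m *\<^sub>v one = C *\<^sub>v (C ^\<^sub>m m *\<^sub>v one)"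
      using C one Cm[of m] step[of m] by (simp add: assoc_mult_mat_vec[of _ n n _ n])
    also have "\<dots> $ i = (\<Sum>j<n. C $$ (i, j) * (C ^\<^sub>m m *\<^sub>v one) $ j)"
    proof -
      have "C ^\<^sub>m m *\<^sub>v one \<in> carrier_vec n" using Cm[of m] one by simp
      then show ?thesis using Suc.prems C
        by (simp add: scalar_prod_def lessThan_atLeast0)
    qed
    also have "\<dots> = (\<Sum>j<n. complex_of_real (M (e i) (e j) * mat_iterate M m (e j) / r ^ Suc m))"
      using Suc.prems Suc.IH r by (intro sum.cong) (auto simp: C_def B_def)
    also have "\<dots> = complex_of_real ((\<Sum>j<n. M (e i) (e j) * mat_iterate M m (e j)) / r ^ Suc m)"
      by (simp only: of_real_sum[symmetric] sum_divide_distrib)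
    also have "(\<Sum>j<n. M (e i) (e j) * mat_iterate M m (e j)) = mat_iterate M (Suc m) (e i)"
      using sum.reindex_bij_betw[OF e, of "\<lambda>k. M (e i) k * mat_iterate M m k"] by simp
    finally show ?case .
  qed
  have "\<bar>mat_iterate M m l\<bar> \<le> (real n * c) * r ^ m" for m l
  proof -
    obtain i where i: "i < n" "l = e i" using e by (metis UNIV_I bij_betw_imp_surj_on imageE lessThan_iff)
    have "norm ((C ^\<^sub>m m *\<^sub>v one) $ i) = norm (\<Sum>j<n. (C ^\<^sub>m m) $$ (i, j))"
      using i C Cm[of m] one by (simp add: scalar_prod_def one_def lessThan_atLeast0)
    also have "\<dots> \<le> (\<Sum>j<n. norm ((C ^\<^sub>m m) $$ (i, j)))" by (rule norm_sum)
    also have "\<dots> \<le> (\<Sum>j<n. c)"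
      using c[of m] i C by (intro sum_mono) (auto simp: norm_bound_def)
    finally have "\<bar>mat_iterate M m l\<bar> / r ^ m \<le> real n * c"
      unfolding val[OF i(1)] i(2) using r by (simp add: norm_divide norm_power)
    then show ?thesis using r by (simp add: field_simps)
  qed
  then show ?thesis using r by blast
qed

text \<open>
  A truncated Neumann series \<open>w = \<Sum>i<m. M\<^sup>i 1\<close> will do: applying \<open>M\<close> to it removes the summand
  \<open>1\<close> and adds \<open>M\<^sup>m 1\<close>, which is at most \<open>1/2\<close> if \<open>m\<close> is large.
\<close>

lemma subcritical_weights:
  fixes M :: "'k::finite \<Rightarrow> 'k \<Rightarrow> real"
  assumes sr: "spectral_radius (mat CARD('k) CARD('k)
       (\<lambda>(i, j). complex_of_real (M (from_nat_into UNIV i) (from_nat_into UNIV j)))) < 1"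
    and nonneg: "\<And>l k. 0 \<le> M l k"
  shows "\<exists>w. \<forall>l. 1 \<le> w l \<and> (\<Sum>k\<in>UNIV. M l k * w k) \<le> w l - 1 / 2"
proof -
  obtain c r where r: "0 < r" "r < (1::real)" and b: "\<And>m l. \<bar>mat_iterate M m l\<bar> \<le> c * r ^ m"
    using mat_iterate_bound[OF sr] by blast
  have "(\<lambda>m. c * r ^ m) \<longlonglongrightarrow> c * 0" using r by (intro tendsto_intros LIMSEQ_realpow_zero) auto
  then have "\<forall>\<^sub>F m in sequentially. c * r ^ m < 1 / 2"
    by (intro order_tendstoD(2)) auto
  then have "\<forall>\<^sub>F m in sequentially. c * r ^ m < 1 / 2 \<and> m \<ge> 1"
    using eventually_ge_at_top[of 1] by eventually_elim auto
  then obtain m where m: "c * r ^ m < 1 / 2" "m \<ge> 1"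
    using eventually_happens'[OF sequentially_bot] by blast
  have nn: "0 \<le> mat_iterate M i l" for i l
    by (induction i arbitrary: l) (auto intro!: sum_nonneg mult_nonneg_nonneg nonneg)
  define w where "w l = (\<Sum>i<m. mat_iterate M i l)" for l
  have "1 \<le> w l" for l
  proof -
    have "mat_iterate M 0 l \<le> w l" unfolding w_def
      using m(2) nn by (intro member_le_sum) auto
    then show ?thesis by simp
  qed
  moreover have "(\<Sum>k\<in>UNIV. M l k * w k) \<le> w l - 1 / 2" for l
  proof -
    have "(\<Sum>k\<in>UNIV. M l k * w k) = (\<Sum>i<m. mat_iterate M (Suc i) l)"
      unfolding w_def sum_distrib_left by (subst sum.swap) simp
    also have "\<dots> = w l - mat_iterate M 0 l + mat_iterate M m l"
      unfolding w_def by (induction m) auto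
    also have "\<dots> \<le> w l - 1 / 2" using b[of m l] m(1) by simp
    finally show ?thesis .
  qed
  ultimately show ?thesis by blast
qed

section \<open>Measurability of counting functionals\<close>

lemma space_conf_algebra [simp]: "space (conf_algebra S) = configurations"
  unfolding conf_algebra_def by (auto simp: space_measure_of_conv)

lemma conf_finite:
  assumes "c \<in> configurations" "bounded B"
  shows "finite (c k \<inter> B)"
proof -
  obtain a where "\<forall>x\<in>B. \<bar>x\<bar> \<le> a" using assms(2) unfolding bounded_real by blast
  then have "B \<subseteq> {-a..a}" by (auto simp: abs_le_iff)
  moreover have "finite (c k \<inter> {-a..a})" using assms(1) by (auto simp: configurations_def)
  ultimately show ?thesis by (meson finite_subset inf.mono order_refl)
qed

lemma conf_algebra_sets:
  "sets (conf_algebra S) = sigma_sets configurations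
     {{c \<in> configurations. card (c k \<inter> B) = n} | k B n. B \<in> sets borel \<and> bounded B \<and> B \<subseteq> S}"
  unfolding conf_algebra_def by (intro sets_measure_of) auto

lemma conf_algebra_mono: "S \<subseteq> T \<Longrightarrow> sets (conf_algebra S) \<subseteq> sets (conf_algebra T)"
  unfolding conf_algebra_sets by (intro sigma_sets_mono') blast

lemma measurable_card_conf:
  assumes "B \<in> sets borel" "bounded B" "B \<subseteq> S"
  shows "(\<lambda>c. card (c k \<inter> B)) \<in> conf_algebra S \<rightarrow>\<^sub>M count_space UNIV"
proof (rule measurableI)
  fix X :: "nat set"
  have "(\<lambda>c. card (c k \<inter> B)) -` X \<inter> configurations
      = (\<Union>n\<in>X. {c \<in> configurations. card (c k \<inter> B) = n})" by auto
  also have "\<dots> \<in> sets (conf_algebra S)"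
    by (intro sets.countable_UN') (use assms in \<open>auto simp: conf_algebra_sets intro!: sigma_sets.Basic\<close>)
  finally show "(\<lambda>c. card (c k \<inter> B)) -` X \<inter> space (conf_algebra S) \<in> sets (conf_algebra S)" by simp
qed simp

lemma measurable_sum_conf:
  fixes f :: "real \<Rightarrow> real"
  assumes f: "f \<in> borel_measurable borel" and B: "B \<in> sets borel" "bounded B" "B \<subseteq> S"
  shows "(\<lambda>c. \<Sum>s\<in>c k \<inter> B. f s) \<in> borel_measurable (conf_algebra S)"
proof -
  have pos: "(\<lambda>c. \<Sum>s\<in>c k \<inter> B. u s) \<in> borel_measurable (conf_algebra S)"
    if u: "u \<in> borel_measurable borel" "\<And>x. 0 \<le> u x" for u :: "real \<Rightarrow> real"
    using u
  proof (induction rule: borel_measurable_induct_real)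
    case (set E)
    have eq: "(\<Sum>s\<in>c k \<inter> B. indicator E s) = real (card (c k \<inter> (E \<inter> B)))"
      if "c \<in> space (conf_algebra S)" for c
    proof -
      have "finite (c k \<inter> B)" using conf_finite that B by simp
      then have "(\<Sum>s\<in>c k \<inter> B. indicator E s :: real) = real (card ((c k \<inter> B) \<inter> E))"
        by (simp add: indicator_def sum.If_cases)
      then show ?thesis by (simp add: Int_ac)
    qed
    have "(\<lambda>c. real (card (c k \<inter> (E \<inter> B)))) \<in> borel_measurable (conf_algebra S)"
      using set B by (intro measurable_compose[OF measurable_card_conf])
        (auto intro: bounded_subset)
    then show ?case by (subst measurable_cong[OF eq]) auto
  next
    case (mult u a)
    then show ?case by (simp add: sum_distrib_left[symmetric])
  next
    case (add u v)
    then show ?case by (simp add: sum.distrib)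
  next
    case (seq U)
    show ?case
      by (rule borel_measurable_LIMSEQ_real[where u="\<lambda>i c. \<Sum>s\<in>c k \<inter> B. U i s"])
        (use seq in \<open>auto intro!: tendsto_sum\<close>)
  qed
  have "(\<lambda>c. (\<Sum>s\<in>c k \<inter> B. max 0 (f s)) - (\<Sum>s\<in>c k \<inter> B. max 0 (- f s))) \<in> borel_measurable (conf_algebra S)"
    using f by (intro borel_measurable_diff pos) auto
  moreover have "(\<Sum>s\<in>c k \<inter> B. max 0 (f s)) - (\<Sum>s\<in>c k \<inter> B. max 0 (- f s)) = (\<Sum>s\<in>c k \<inter> B. f s)" for c
    unfolding sum_subtractf[symmetric] by (rule sum.cong) (auto simp: max_def)
  ultimately show ?thesis by simp
qed

lemma shift_conf_count: "card (shift_conf u c k \<inter> B) = card (c k \<inter> {s. s + u \<in> B})"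
proof -
  have "shift_conf u c k \<inter> B = (\<lambda>s. s + u) ` (c k \<inter> {s. s + u \<in> B})"
    unfolding shift_conf_def by auto
  then show ?thesis by (simp add: card_image inj_on_def)
qed

lemma shift_conf_sum:
  "(\<Sum>s\<in>shift_conf u c k \<inter> B. f s) = (\<Sum>s\<in>c k \<inter> {s. s + u \<in> B}. f (s + u))"
proof -
  have "shift_conf u c k \<inter> B = (\<lambda>s. s + u) ` (c k \<inter> {s. s + u \<in> B})"
    unfolding shift_conf_def by auto
  then show ?thesis by (simp add: sum.reindex inj_on_def o_def)
qed

lemma bounded_shift_vimage:
  fixes B :: "real set"
  assumes "bounded B"
  shows "bounded {s. s + u \<in> B}"
proof -
  have "{s. s + u \<in> B} = (\<lambda>b. b - u) ` B" by force
  then show ?thesis using bounded_translation_minus[OF assms, of u] by simp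
qed

lemma shift_conf_in_configurations:
  assumes "c \<in> configurations"
  shows "shift_conf u c \<in> configurations"
  unfolding configurations_def
proof (clarify)
  fix k and a b :: real
  have "shift_conf u c k \<inter> {a..b} = (\<lambda>s. s + u) ` (c k \<inter> {s. s + u \<in> {a..b}})"
    unfolding shift_conf_def by auto
  then show "finite (shift_conf u c k \<inter> {a..b})"
    using conf_finite[OF assms bounded_shift_vimage[of "{a..b}" u]] by simp
qed

lemma shift_conf_add: "shift_conf u (shift_conf v c) = shift_conf (u + v) c"
  unfolding shift_conf_def by (auto simp: image_image add_ac)

lemma shift_conf_0 [simp]: "shift_conf 0 c = c"
  unfolding shift_conf_def by simp

lemma eventually_no_point_right:
  assumes "finite (X :: real set)" "f \<longlonglongrightarrow> (t::real)" "\<And>n. t < f n"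
  shows "\<forall>\<^sub>F n in sequentially. X \<inter> {t<..f n} = {}"
proof -
  obtain d where d: "d > 0" "\<And>x. x \<in> X \<Longrightarrow> x \<noteq> t \<Longrightarrow> d \<le> dist t x"
    using finite_set_avoid[OF assms(1), of t] by blast
  have "\<forall>\<^sub>F n in sequentially. f n < t + d"
    using assms(2) d(1) by (intro order_tendstoD(2)) auto
  then show ?thesis
  proof eventually_elim
    case (elim n)
    { fix x assume x: "x \<in> X" "t < x" "x \<le> f n"
      then have "d \<le> x - t" using d(2)[of x] by (auto simp: dist_real_def)
      then have False using elim x by simp }
    then show ?case by auto
  qed
qed

text \<open>
  The number of points in \<open>{a - u<..b - u}\<close> is right continuous in \<open>-u\<close>, because a locally
  finite set has no points in \<open>{t<..t + \<epsilon>}\<close> for small \<open>\<epsilon>\<close>. It is therefore the limit of its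
  values along dyadic approximations of \<open>-u\<close> from the right.
\<close>

lemma measurable_shifted_interval_count:
  "(\<lambda>(u, c). real (card (c k \<inter> {s. s + u \<in> {a<..b}}))) \<in> borel_measurable (borel \<Otimes>\<^sub>M conf_borel)"
proof -
  \<comment> \<open>the first dyadic number of level n strictly to the right of -u\<close>
  define T where "T n u = (of_int \<lfloor>2 ^ n * (- u)\<rfloor> + 1) / (2 ^ n :: real)" for n :: nat and u :: real
  have Tgt: "- u < T n u" for n u
    unfolding T_def by (simp add: field_simps) linarith
  have Tle: "T n u \<le> - u + (1 / 2) ^ n" for n u
  proof -
    have "of_int \<lfloor>2 ^ n * (- u)\<rfloor> + 1 \<le> 2 ^ n * (- u) + 1" by simp
    then have "T n u \<le> (2 ^ n * (- u) + 1) / 2 ^ n"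
      unfolding T_def by (intro divide_right_mono) auto
    also have "\<dots> = - u + (1 / 2) ^ n" by (simp add: field_simps power_divide)
    finally show ?thesis .
  qed
  have Tlim: "(\<lambda>n. T n u) \<longlonglongrightarrow> - u" for u
  proof (rule tendsto_sandwich[of "\<lambda>_. - u" _ _ "\<lambda>n. - u + (1 / 2) ^ n"])
    have "(\<lambda>n. - u + (1 / 2) ^ n) \<longlonglongrightarrow> - u + 0"
      by (intro tendsto_intros LIMSEQ_realpow_zero) auto
    then show "(\<lambda>n. - u + (1 / 2) ^ n) \<longlonglongrightarrow> - u" by simp
    show "\<forall>\<^sub>F n in sequentially. T n u \<le> - u + (1 / 2) ^ n"
      by (intro always_eventually allI Tle)
  qed (simp_all add: less_imp_le[OF Tgt])
  have "(\<lambda>x. real (card (snd x k \<inter> {a - fst x<..b - fst x}))) \<in> borel_measurable (borel \<Otimes>\<^sub>M conf_borel)"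
  proof (rule borel_measurable_LIMSEQ_real[where u="\<lambda>n x. real (card (snd x k \<inter> {a + T n (fst x)<..b + T n (fst x)}))"])
    fix n
    have "(\<lambda>x. real (card (snd x k \<inter> {a + (of_int i + 1) / 2 ^ n<..b + (of_int i + 1) / 2 ^ n})))
        \<in> borel_measurable (borel \<Otimes>\<^sub>M conf_borel)" for i :: int
      by (intro measurable_compose[OF measurable_snd measurable_compose[OF measurable_card_conf]])
        auto
    then show "(\<lambda>x. real (card (snd x k \<inter> {a + T n (fst x)<..b + T n (fst x)}))) \<in> borel_measurable (borel \<Otimes>\<^sub>M conf_borel)"
      unfolding T_def
      by (rule measurable_compose_countable[where g="\<lambda>x. \<lfloor>2 ^ n * (- fst x)\<rfloor>"]) measurable
  next
    fix x :: "real \<times> 'a conf" assume "x \<in> space (borel \<Otimes>\<^sub>M conf_borel)"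
    then have c: "snd x \<in> configurations" by (auto simp: space_pair_measure)
    let ?u = "fst x"
    have ev: "\<forall>\<^sub>F n in sequentially. snd x k \<inter> {p - ?u - 1..p - ?u + 1} \<inter> {p - ?u<..p + T n ?u} = {}" for p
      using tendsto_add[OF tendsto_const[of p] Tlim[of ?u]] Tgt[of ?u]
      by (intro eventually_no_point_right conf_finite[OF c]) auto
    have one: "\<forall>\<^sub>F n in sequentially. T n ?u < - ?u + 1"
      using Tlim[of ?u] by (intro order_tendstoD(2)) auto
    have "\<forall>\<^sub>F n in sequentially. real (card (snd x k \<inter> {a + T n ?u<..b + T n ?u})) = real (card (snd x k \<inter> {a - ?u<..b - ?u}))"
      using ev[of a] ev[of b] one
    proof eventually_elim
      case (elim n)
      have no: "\<not> (s \<in> snd x k \<and> p - ?u < s \<and> s \<le> p + T n ?u)"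
        if "snd x k \<inter> {p - ?u - 1..p - ?u + 1} \<inter> {p - ?u<..p + T n ?u} = {}" for s p
        using that elim(3) by force
      have "snd x k \<inter> {a + T n ?u<..b + T n ?u} = snd x k \<inter> {a - ?u<..b - ?u}"
      proof (rule Set.set_eqI)
        fix s
        show "s \<in> snd x k \<inter> {a + T n ?u<..b + T n ?u} \<longleftrightarrow> s \<in> snd x k \<inter> {a - ?u<..b - ?u}"
        proof (cases "s \<in> snd x k")
          case True
          then have "\<not> (a - ?u < s \<and> s \<le> a + T n ?u)" "\<not> (b - ?u < s \<and> s \<le> b + T n ?u)"
            using no[OF elim(1)] no[OF elim(2)] by blast+
          then show ?thesis using Tgt[of ?u n] True by auto
        qed auto
      qed
      then show ?case by simp
    qed
    then show "(\<lambda>n. real (card (snd x k \<inter> {a + T n ?u<..b + T n ?u}))) \<longlonglongrightarrow> real (card (snd x k \<inter> {a - ?u<..b - ?u}))"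
      by (rule tendsto_eventually)
  qed
  moreover have "{s. s + u \<in> {a<..b}} = {a - u<..b - u}" for u by auto
  ultimately show ?thesis by (simp add: split_beta)
qed

text \<open>
  The joint measurability passes from half-open intervals to bounded Borel sets by a Dynkin
  argument.
\<close>

lemma measurable_shift_conf_joint:
  "(\<lambda>(u, c). shift_conf u c) \<in> borel \<Otimes>\<^sub>M conf_borel \<rightarrow>\<^sub>M (conf_borel :: 'k conf measure)"
proof -
  let ?M = "borel \<Otimes>\<^sub>M conf_borel :: (real \<times> 'k conf) measure"
  define cnt where "cnt k B x = emeasure (count_space UNIV) (snd x k \<inter> {s. s + fst x \<in> B})"
    for k :: 'k and B and x :: "real \<times> 'k conf"
  have fin: "finite (snd x k \<inter> {s. s + fst x \<in> B})" if "x \<in> space ?M" "bounded B" for x k B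
    using that by (intro conf_finite bounded_shift_vimage) (auto simp: space_pair_measure)
  have cnt_card: "cnt k B x = ennreal (real (card (snd x k \<inter> {s. s + fst x \<in> B})))"
    if "x \<in> space ?M" "bounded B" for k B x
    using fin[OF that] by (simp add: cnt_def emeasure_count_space_finite ennreal_of_nat_eq_real_of_nat)
  have ioc: "cnt k {a<..b} \<in> borel_measurable ?M" for k and a b :: real
  proof -
    have "(\<lambda>x. ennreal (real (card (snd x k \<inter> {s. s + fst x \<in> {a<..b}})))) \<in> borel_measurable ?M"
      using measurable_shifted_interval_count[of k a b] by (simp add: split_beta)
    then show ?thesis by (subst measurable_cong[OF cnt_card]) auto
  qed
  have main: "cnt k (B \<inter> {-m<..m}) \<in> borel_measurable ?M" if "B \<in> sets borel" for B k and m :: real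
  proof -
    have gen: "B \<in> sigma_sets UNIV (range (\<lambda>(a, b). {a<..b::real}))"
      using that unfolding borel_sigma_sets_Ioc by simp
    have stable: "Int_stable (range (\<lambda>(a, b). {a<..b::real}))"
      by (auto simp: Int_stable_def image_iff)
    have "range (\<lambda>(a, b). {a<..b::real}) \<subseteq> Pow UNIV" by simp
    from stable this gen show ?thesis
    proof (induction rule: sigma_sets_induct_disjoint)
      case (basic B)
      then obtain a b where "B = {a<..b}" by auto
      then have "B \<inter> {-m<..m} = {max a (-m)<..min b m}" by auto
      then show ?case using ioc by simp
    next
      case empty
      then show ?case by (simp add: cnt_def)
    next
      case (compl B)
      have eq: "cnt k ((UNIV - B) \<inter> {-m<..m}) x = cnt k {-m<..m} x - cnt k (B \<inter> {-m<..m}) x"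
        if x: "x \<in> space ?M" for x
      proof -
        have "snd x k \<inter> {s. s + fst x \<in> (UNIV - B) \<inter> {-m<..m}}
            = (snd x k \<inter> {s. s + fst x \<in> {-m<..m}}) - (snd x k \<inter> {s. s + fst x \<in> B \<inter> {-m<..m}})"
          by auto
        moreover have "emeasure (count_space UNIV) (snd x k \<inter> {s. s + fst x \<in> B \<inter> {-m<..m}}) \<noteq> \<infinity>"
          using fin[OF x bounded_Int[OF disjI2[OF bounded_Ioc]], of k B]
          by (simp only: emeasure_count_space_finite subset_UNIV) simp
        ultimately show ?thesis
          unfolding cnt_def by (simp only:) (rule emeasure_Diff, auto)
      qed
      show ?case by (subst measurable_cong[OF eq]) (use compl ioc in auto)
    next
      case (union D)
      have "cnt k (\<Union> (range D) \<inter> {-m<..m}) x = (\<Sum>i. cnt k (D i \<inter> {-m<..m}) x)" for x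
      proof -
        have "snd x k \<inter> {s. s + fst x \<in> \<Union> (range D) \<inter> {-m<..m}}
            = (\<Union>i. snd x k \<inter> {s. s + fst x \<in> D i \<inter> {-m<..m}})" by auto
        moreover have "disjoint_family (\<lambda>i. snd x k \<inter> {s. s + fst x \<in> D i \<inter> {-m<..m}})"
          using union(1) unfolding disjoint_family_on_def by blast
        ultimately show ?thesis unfolding cnt_def by (simp add: suminf_emeasure)
      qed
      then have "cnt k (\<Union> (range D) \<inter> {-m<..m}) = (\<lambda>x. \<Sum>i. cnt k (D i \<inter> {-m<..m}) x)" by auto
      then show ?case using union by simp
    qed
  qed
  have bd: "cnt k B \<in> borel_measurable ?M" if B: "B \<in> sets borel" "bounded B" for k B
  proof -
    obtain a where "\<forall>x\<in>B. \<bar>x\<bar> \<le> a" using B(2) unfolding bounded_real by blast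
    then have "B \<inter> {- (a + 1)<..a + 1} = B" by (auto simp: abs_le_iff)
    then show ?thesis using main[OF B(1), of k "a + 1"] by simp
  qed
  show ?thesis
  proof (rule measurable_sigma_sets[OF conf_algebra_sets], goal_cases)
    case 1
    then show ?case by auto
  next
    case 2
    then show ?case by (auto simp: space_pair_measure shift_conf_in_configurations)
  next
    case (3 Y)
    then obtain k B n where Y: "Y = {c \<in> configurations. card (c k \<inter> B) = n}" "B \<in> sets borel" "bounded B"
      by auto
    have "(\<lambda>(u, c). shift_conf u c) -` Y \<inter> space ?M = {x \<in> space ?M. cnt k B x = ennreal (real n)}"
      using Y cnt_card[of _ B k]
      by (auto simp: shift_conf_count shift_conf_in_configurations space_pair_measure)
    also have "\<dots> \<in> sets ?M" using bd[OF Y(2,3)] by measurable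
    finally show ?case .
  qed
qed

lemma measurable_shift_conf: "shift_conf u \<in> conf_borel \<rightarrow>\<^sub>M conf_borel"
  using measurable_compose_Pair1[OF _ measurable_shift_conf_joint, of u] by simp

definition tot :: "'k::finite conf \<Rightarrow> real set \<Rightarrow> nat" where
  "tot c B = (\<Sum>k\<in>UNIV. card (c k \<inter> B))"

lemma tot_mono: "c \<in> configurations \<Longrightarrow> bounded B' \<Longrightarrow> B \<subseteq> B' \<Longrightarrow> tot c B \<le> tot c B'"
  unfolding tot_def by (intro sum_mono card_mono conf_finite) auto

lemma tot_Un_le: "tot c (B \<union> B') \<le> tot c B + tot c B'"
  unfolding tot_def sum.distrib[symmetric] Int_Un_distrib by (intro sum_mono card_Un_le)

lemma tot_Un_disjoint:
  "c \<in> configurations \<Longrightarrow> bounded B \<Longrightarrow> bounded B' \<Longrightarrow> B \<inter> B' = {} \<Longrightarrow> tot c (B \<union> B') = tot c B + tot c B'"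
  unfolding tot_def sum.distrib[symmetric] Int_Un_distrib
  by (intro sum.cong refl card_Un_disjoint conf_finite) auto

lemma card_le_tot: "card (c k \<inter> B) \<le> tot c B"
  unfolding tot_def by (rule member_le_sum) auto

lemma tot_empty [simp]: "tot c {} = 0"
  by (simp add: tot_def)

lemma tot_shift: "tot (shift_conf u c) B = tot c {s. s + u \<in> B}"
  by (simp add: tot_def shift_conf_count)

lemma measurable_tot:
  assumes "B \<in> sets borel" "bounded B" "B \<subseteq> S"
  shows "(\<lambda>c. real (tot c B)) \<in> borel_measurable (conf_algebra S)"
  unfolding tot_def of_nat_sum
  by (intro borel_measurable_sum measurable_compose[OF measurable_card_conf[OF assms]]) auto

lemma measurable_conf_algebra_mono:
  assumes "f \<in> borel_measurable (conf_algebra S)" "S \<subseteq> T"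
  shows "f \<in> borel_measurable (conf_algebra T)"
  by (rule measurable_from_subalg[OF _ assms(1)]) (simp add: subalgebra_def conf_algebra_mono[OF assms(2)])

section \<open>Short-time conditional estimates\<close>

text \<open>
  This compares conditional expectations with respect to \<open>G\<close> without forming them, so that no
  integrability is involved.
\<close>

lemma nn_integral_weighted_le:
  fixes f g :: "'a \<Rightarrow> ennreal"
  assumes sp: "space G = space M" "sets G \<subseteq> sets M"
    and f: "f \<in> borel_measurable M" "g \<in> borel_measurable M"
    and le: "\<And>F. F \<in> sets G \<Longrightarrow> (\<integral>\<^sup>+x. indicator F x * f x \<partial>M) \<le> (\<integral>\<^sup>+x. indicator F x * g x \<partial>M)"
    and Z: "Z \<in> borel_measurable G"
  shows "(\<integral>\<^sup>+x. Z x * f x \<partial>M) \<le> (\<integral>\<^sup>+x. Z x * g x \<partial>M)"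
proof -
  have ZM: "Z \<in> borel_measurable M" if "Z \<in> borel_measurable G" for Z :: "'a \<Rightarrow> ennreal"
    by (rule measurable_from_subalg[OF _ that]) (simp add: subalgebra_def sp)
  show ?thesis using Z
  proof (induction rule: borel_measurable_induct)
    case (cong f' g')
    have "(\<integral>\<^sup>+x. f' x * q x \<partial>M) = (\<integral>\<^sup>+x. g' x * q x \<partial>M)" for q
      using cong.hyps(3) sp(1) by (intro nn_integral_cong) simp
    then show ?case using cong.IH by simp
  next
    case (set F)
    then show ?case by (rule le)
  next
    case (mult u a)
    have "(\<integral>\<^sup>+x. a * u x * q x \<partial>M) = a * (\<integral>\<^sup>+x. u x * q x \<partial>M)"
      if "q \<in> borel_measurable M" for q
      unfolding mult.assoc by (rule nn_integral_cmult) (intro borel_measurable_times_ennreal ZM[OF mult.hyps(2)] that)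
    then show ?case using f mult.IH by (simp only: mult_left_mono zero_le)
  next
    case (add u v)
    have "(\<integral>\<^sup>+x. (v x + u x) * q x \<partial>M) = (\<integral>\<^sup>+x. v x * q x \<partial>M) + (\<integral>\<^sup>+x. u x * q x \<partial>M)"
      if "q \<in> borel_measurable M" for q
      unfolding distrib_right
      by (rule nn_integral_add) (intro borel_measurable_times_ennreal ZM[OF add.hyps(1)] ZM[OF add.hyps(3)] that)+
    then show ?case using f add.IH by (simp only: add_mono)
  next
    case (seq U)
    have m: "\<And>i. U i \<in> borel_measurable M" using ZM[OF seq.hyps(1)] .
    have "(\<integral>\<^sup>+x. (SUP i. U i) x * f x \<partial>M) = (\<integral>\<^sup>+x. (SUP i. U i x * f x) \<partial>M)"
      by (simp add: SUP_mult_right_ennreal image_comp)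
    also have "\<dots> = (SUP i. \<integral>\<^sup>+x. U i x * f x \<partial>M)"
      using seq.hyps(3) m f(1) by (intro nn_integral_monotone_convergence_SUP)
        (auto simp: incseq_def le_fun_def intro!: mult_right_mono)
    also have "\<dots> \<le> (SUP i. \<integral>\<^sup>+x. U i x * g x \<partial>M)"
      using seq.IH by (intro SUP_mono) blast
    also have "\<dots> = (\<integral>\<^sup>+x. (SUP i. U i x * g x) \<partial>M)"
      using seq.hyps(3) m f(2) by (intro nn_integral_monotone_convergence_SUP[symmetric])
        (auto simp: incseq_def le_fun_def intro!: mult_right_mono)
    also have "\<dots> = (\<integral>\<^sup>+x. (SUP i. U i) x * g x \<partial>M)"
      by (simp add: SUP_mult_right_ennreal image_comp)
    finally show ?case by (simp add: image_comp)
  qed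
qed

lemma ennreal_double_sum:
  fixes f :: "'a \<Rightarrow> 'b \<Rightarrow> real"
  assumes "\<And>l u. 0 \<le> f l u"
  shows "(\<Sum>l\<in>I. \<Sum>u\<in>S l. ennreal (f l u)) = ennreal (\<Sum>l\<in>I. \<Sum>u\<in>S l. f l u)"
  using assms by (simp add: sum_ennreal sum_nonneg)

lemma ennreal_absorb_half:
  fixes X a :: ennreal
  assumes "X \<le> a + ennreal (1 / 2) * X" "X < \<infinity>"
  shows "X \<le> ennreal 2 * a"
proof (cases "a = \<infinity>")
  case False
  obtain x where x: "X = ennreal x" "0 \<le> x" using assms(2) by (cases X) auto
  obtain b where b: "a = ennreal b" "0 \<le> b" using False by (cases a) auto
  have "ennreal (1 / 2) * ennreal x = ennreal (1 / 2 * x)"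
    by (rule ennreal_mult[symmetric]) (use x in auto)
  then have "ennreal x \<le> ennreal b + ennreal (1 / 2 * x)"
    using assms(1) unfolding x(1) b(1) by argo
  also have "\<dots> = ennreal (b + x / 2)" using x b by (simp add: ennreal_plus[symmetric] del: ennreal_plus)
  finally have "ennreal x \<le> ennreal (b + x / 2)" .
  then have "x \<le> b + x / 2" using x b by (simp only: ennreal_le_iff)
  then have "x \<le> 2 * b" by simp
  then have "ennreal x \<le> ennreal (2 * b)" by (rule ennreal_leI)
  also have "\<dots> = ennreal 2 * ennreal b" by (rule ennreal_mult) (use b in auto)
  finally show ?thesis unfolding x(1) b(1) .
qed (simp add: ennreal_mult_eq_top_iff)

text \<open>
  A bound \<open>H\<close> on the interaction functions exists as soon as they are Hoelder continuous on
  \<open>[0, A]\<close>.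
\<close>

locale linear_hawkes =
  fixes A :: real and \<nu> :: "'k::finite \<Rightarrow> real" and h :: "'k \<Rightarrow> 'k \<Rightarrow> real \<Rightarrow> real"
    and P :: "'k conf measure" and H :: real
  assumes A_pos: "0 < A"
    and hawkes: "stationary_hawkes A \<nu> h P"
    and H_pos: "0 < H"
    and h_le: "\<And>l k x. h l k x \<le> H"
begin

lemma param: "hawkes_parameter A \<nu> h" and prob: "prob_space P" and sets_P: "sets P = sets conf_borel"
  and stationary: "distr P conf_borel (shift_conf u) = P"
  and integrable_count: "integrable P (\<lambda>c. real (card (c l \<inter> {0..1})))"
  and AE_disjoint: "AE c in P. \<forall>l k. l \<noteq> k \<longrightarrow> c l \<inter> c k = {}"
  and compensator: "s < t \<Longrightarrow> F \<in> sets (conf_algebra {..s}) \<Longrightarrow>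
        (\<integral>\<^sup>+c. indicator F c * of_nat (card (c k \<inter> {s<..t})) \<partial>P) =
        (\<integral>\<^sup>+c. indicator F c * (\<integral>\<^sup>+v\<in>{s<..t}. ennreal (intensity A \<nu> h k v c) \<partial>lborel) \<partial>P)"
  using hawkes unfolding stationary_hawkes_def by blast+

lemma \<nu>_pos: "0 < \<nu> k" and h_meas [measurable]: "h l k \<in> borel_measurable borel" and h_nonneg: "0 \<le> h l k x"
  and h_supp: "x \<notin> {0..A} \<Longrightarrow> h l k x = 0" and h_int: "set_integrable lborel {0..A} (h l k)"
  and subcritical: "spectral_radius (interaction_matrix A h) < 1"
  using param unfolding hawkes_parameter_def by blast+

lemma space_P: "space P = configurations"
  using sets_eq_imp_space_eq[OF sets_P] by simp

lemma measurable_P_eq: "measurable P N = measurable conf_borel N"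
  by (rule measurable_cong_sets[OF sets_P refl])

lemma measurable_P: "f \<in> borel_measurable (conf_algebra S) \<Longrightarrow> f \<in> borel_measurable P"
  unfolding measurable_P_eq by (erule measurable_conf_algebra_mono) simp

lemma nn_integral_shift:
  assumes "f \<in> borel_measurable P"
  shows "(\<integral>\<^sup>+c. f (shift_conf u c) \<partial>P) = (\<integral>\<^sup>+c. f c \<partial>P)"
proof -
  have "shift_conf u \<in> P \<rightarrow>\<^sub>M conf_borel"
    unfolding measurable_P_eq by (rule measurable_shift_conf)
  moreover have "f \<in> borel_measurable conf_borel"
    using assms unfolding measurable_P_eq .
  ultimately have "(\<integral>\<^sup>+c. f c \<partial>distr P conf_borel (shift_conf u)) = (\<integral>\<^sup>+c. f (shift_conf u c) \<partial>P)"
    by (intro nn_integral_distr) simp_all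
  then show ?thesis by (simp add: stationary)
qed

lemma measurable_tot_P: "B \<in> sets borel \<Longrightarrow> bounded B \<Longrightarrow> (\<lambda>c. real (tot c B)) \<in> borel_measurable P"
  using measurable_P[OF measurable_tot[of B UNIV]] by simp

text \<open>
  By stationarity, every unit interval has the same finite mean number of points as \<open>[0, 1]\<close>.
\<close>

lemma integral_tot_finite:
  assumes "bounded B"
  shows "(\<integral>\<^sup>+c. ennreal (real (tot c B)) \<partial>P) < \<infinity>"
proof -
  have unit: "(\<integral>\<^sup>+c. ennreal (real (tot c {x..x + 1})) \<partial>P) < \<infinity>" for x
  proof -
    have "{s. s + (- x) \<in> {0..1}} = {x..x + 1}" by auto
    then have "(\<integral>\<^sup>+c. ennreal (real (tot c {x..x + 1})) \<partial>P) = (\<integral>\<^sup>+c. ennreal (real (tot (shift_conf (- x) c) {0..1})) \<partial>P)"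
      by (simp only: tot_shift)
    also have "\<dots> = (\<integral>\<^sup>+c. ennreal (real (tot c {0..1})) \<partial>P)"
      by (rule nn_integral_shift) (use measurable_tot_P[of "{0..1}"] in simp)
    also have "integrable P (\<lambda>c. real (tot c {0..1}))"
      unfolding tot_def of_nat_sum using integrable_count by (intro Bochner_Integration.integrable_sum) auto
    then have "(\<integral>\<^sup>+c. ennreal (real (tot c {0..1})) \<partial>P) < \<infinity>"
      using nn_integral_eq_integral[of P "\<lambda>c. real (tot c {0..1})"] by simp
    finally show ?thesis .
  qed
  obtain a where a: "\<forall>x\<in>B. \<bar>x\<bar> \<le> a" using assms unfolding bounded_real by blast
  define N where "N = nat \<lceil>2 * \<bar>a\<bar>\<rceil> + 1"
  have cover: "B \<subseteq> (\<Union>i<N. {- \<bar>a\<bar> + real i..- \<bar>a\<bar> + real i + 1})"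
  proof
    fix x assume "x \<in> B"
    then have x: "- \<bar>a\<bar> \<le> x" "x \<le> \<bar>a\<bar>" using a by fastforce+
    let ?i = "nat \<lfloor>x + \<bar>a\<bar>\<rfloor>"
    have "?i < N" unfolding N_def using x by linarith
    moreover have "- \<bar>a\<bar> + real ?i \<le> x" "x \<le> - \<bar>a\<bar> + real ?i + 1" using x by linarith+
    ultimately show "x \<in> (\<Union>i<N. {- \<bar>a\<bar> + real i..- \<bar>a\<bar> + real i + 1})"
      by (intro UN_I[of ?i]) (simp_all only: lessThan_iff atLeastAtMost_iff simp_thms)
  qed
  have sub: "tot c (\<Union>i<n. X i) \<le> (\<Sum>i<n. tot c (X i))" for c :: "'k conf" and X and n :: nat
  proof (induction n)
    case (Suc n)
    have "tot c (\<Union>i<Suc n. X i) \<le> tot c (X n) + tot c (\<Union>i<n. X i)"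
      using tot_Un_le[of c "X n" "\<Union>i<n. X i"] by (simp add: lessThan_Suc)
    then show ?case using Suc by simp
  qed simp
  have "(\<integral>\<^sup>+c. ennreal (real (tot c B)) \<partial>P) \<le> (\<integral>\<^sup>+c. (\<Sum>i<N. ennreal (real (tot c {- \<bar>a\<bar> + real i..- \<bar>a\<bar> + real i + 1}))) \<partial>P)"
  proof (rule nn_integral_mono)
    fix c assume "c \<in> space P"
    then have "tot c B \<le> tot c (\<Union>i<N. {- \<bar>a\<bar> + real i..- \<bar>a\<bar> + real i + 1})"
      using cover by (intro tot_mono) (auto simp: space_P)
    also have "\<dots> \<le> (\<Sum>i<N. tot c {- \<bar>a\<bar> + real i..- \<bar>a\<bar> + real i + 1})" by (rule sub)
    finally have "real (tot c B) \<le> (\<Sum>i<N. real (tot c {- \<bar>a\<bar> + real i..- \<bar>a\<bar> + real i + 1}))"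
      unfolding of_nat_sum[symmetric] by (simp only: of_nat_le_iff)
    then show "ennreal (real (tot c B)) \<le> (\<Sum>i<N. ennreal (real (tot c {- \<bar>a\<bar> + real i..- \<bar>a\<bar> + real i + 1})))"
      by (subst sum_ennreal) (auto intro: ennreal_leI)
  qed
  also have "\<dots> = (\<Sum>i<N. \<integral>\<^sup>+c. ennreal (real (tot c {- \<bar>a\<bar> + real i..- \<bar>a\<bar> + real i + 1})) \<partial>P)"
    by (rule nn_integral_sum) (simp add: measurable_tot_P)
  also have "\<dots> < \<infinity>" using unit by simp
  finally show ?thesis .
qed

text \<open>
  The mean number of children of mark \<open>k\<close> that a point of mark \<open>l\<close> and age \<open>a\<close> has yet to
  produce.
\<close>

definition tail_mass :: "'k \<Rightarrow> 'k \<Rightarrow> real \<Rightarrow> real" where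
  "tail_mass l k a = (LINT x:{a<..}|lborel. h l k x)"

lemma h_integrable: "integrable lborel (h l k)"
proof -
  have "h l k = (\<lambda>x. indicator {0..A} x *\<^sub>R h l k x)"
    using h_supp by (auto simp: indicator_def fun_eq_iff)
  moreover have "integrable lborel (\<lambda>x. indicator {0..A} x *\<^sub>R h l k x)"
    using h_int[of l k] unfolding set_integrable_def .
  ultimately show ?thesis by (simp only:)
qed

lemma h_set_integrable: "S \<in> sets borel \<Longrightarrow> set_integrable lborel S (h l k)"
  unfolding set_integrable_def using h_integrable by (intro integrable_mult_indicator) auto

lemma tail_mass_diff:
  assumes "a \<le> b"
  shows "tail_mass l k a - tail_mass l k b = (LINT x:{a<..b}|lborel. h l k x)"
proof -
  have "{a<..} = {a<..b} \<union> {b<..}" using assms by auto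
  moreover have "(LINT x:{a<..b} \<union> {b<..}|lborel. h l k x) = (LINT x:{a<..b}|lborel. h l k x) + (LINT x:{b<..}|lborel. h l k x)"
    by (rule set_integral_Un[OF _ h_set_integrable h_set_integrable]) auto
  ultimately have "tail_mass l k a = (LINT x:{a<..b}|lborel. h l k x) + tail_mass l k b"
    unfolding tail_mass_def by (simp only:)
  then show ?thesis by simp
qed

lemma tail_mass_nonneg: "0 \<le> tail_mass l k a"
  unfolding tail_mass_def set_lebesgue_integral_def by (intro integral_nonneg_AE) (auto simp: h_nonneg)

lemma tail_mass_diff_nonneg: "a \<le> b \<Longrightarrow> 0 \<le> tail_mass l k a - tail_mass l k b"
  unfolding tail_mass_diff set_lebesgue_integral_def by (intro integral_nonneg_AE) (auto simp: h_nonneg)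

lemma nn_integral_h_window:
  assumes "0 \<le> d"
  shows "(\<integral>\<^sup>+v. ennreal (h l k (v - u)) * indicator {s<..s + d} v \<partial>lborel)
       = ennreal (tail_mass l k (s - u) - tail_mass l k (s + d - u))"
proof -
  have "(\<integral>\<^sup>+v. ennreal (h l k (v - u)) * indicator {s<..s + d} v \<partial>lborel)
      = (\<integral>\<^sup>+x. ennreal (h l k x) * indicator {s<..s + d} (u + x) \<partial>lborel)"
    by (subst nn_integral_real_affine[where c=1 and t=u]) auto
  also have "\<dots> = (\<integral>\<^sup>+x. ennreal (indicator {s - u<..s + d - u} x *\<^sub>R h l k x) \<partial>lborel)"
    by (intro nn_integral_cong) (auto simp: indicator_def)
  also have "\<dots> = ennreal (LINT x:{s - u<..s + d - u}|lborel. h l k x)"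
    unfolding set_lebesgue_integral_def
    using h_set_integrable[of "{s - u<..s + d - u}" l k] unfolding set_integrable_def
    by (intro nn_integral_eq_integral) (auto simp: h_nonneg)
  finally show ?thesis using tail_mass_diff[of "s - u" "s + d - u"] assms by simp
qed

lemma tail_mass_diff_le:
  assumes "0 \<le> d"
  shows "tail_mass l k a - tail_mass l k (a + d) \<le> H * d"
proof -
  have "ennreal (tail_mass l k (a - 0) - tail_mass l k (a + d - 0))
      = (\<integral>\<^sup>+v. ennreal (h l k (v - 0)) * indicator {a<..a + d} v \<partial>lborel)"
    using nn_integral_h_window[OF assms, of l k 0 a] by simp
  also have "\<dots> \<le> (\<integral>\<^sup>+v. ennreal H * indicator {a<..a + d} v \<partial>lborel)"
    by (intro nn_integral_mono mult_right_mono ennreal_leI h_le) auto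
  also have "\<dots> = ennreal (H * d)" using assms H_pos by (simp add: nn_integral_cmult_indicator ennreal_mult)
  finally show ?thesis using assms H_pos by (simp add: ennreal_le_iff)
qed

lemma tail_mass_measurable [measurable]: "tail_mass l k \<in> borel_measurable borel"
proof -
  have "mono (\<lambda>a. - tail_mass l k a)"
    using tail_mass_diff_nonneg by (fastforce simp: mono_def)
  then have "(\<lambda>a. - tail_mass l k a) \<in> borel_measurable borel" by (rule borel_measurable_mono)
  then have "(\<lambda>a. - (- tail_mass l k a)) \<in> borel_measurable borel" by (rule borel_measurable_uminus)
  then show ?thesis by simp
qed

text \<open>
  The mean number of children of mark \<open>k\<close> that the points present in \<open>[s - A, s]\<close> produce during
  \<open>(s, s + d]\<close>.
\<close>

definition inherited :: "'k \<Rightarrow> real \<Rightarrow> real \<Rightarrow> 'k conf \<Rightarrow> real" where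
  "inherited k s d c = (\<Sum>l\<in>UNIV. \<Sum>u\<in>c l \<inter> {s - A..s}. tail_mass l k (s - u) - tail_mass l k (s + d - u))"

lemma inherited_nonneg: "0 \<le> d \<Longrightarrow> 0 \<le> inherited k s d c"
  unfolding inherited_def by (intro sum_nonneg tail_mass_diff_nonneg) simp

lemma inherited_le:
  assumes "0 \<le> d"
  shows "inherited k s d c \<le> H * d * real (tot c {s - A..s})"
proof -
  have "inherited k s d c \<le> (\<Sum>l\<in>UNIV. \<Sum>u\<in>c l \<inter> {s - A..s}. H * d)"
    unfolding inherited_def
  proof (intro sum_mono)
    fix l u
    show "tail_mass l k (s - u) - tail_mass l k (s + d - u) \<le> H * d"
      using tail_mass_diff_le[OF assms, of l k "s - u"] by (simp add: algebra_simps)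
  qed
  then show ?thesis by (simp add: tot_def sum_distrib_left mult.commute)
qed

lemma inherited_measurable: "inherited k s d \<in> borel_measurable (conf_algebra {..s})"
  unfolding inherited_def by (intro borel_measurable_sum measurable_sum_conf) auto

lemma intensity_le_inherited:
  assumes c: "c \<in> configurations" and v: "s < v" "v \<le> s + d"
  shows "intensity A \<nu> h k v c \<le> \<nu> k + (\<Sum>l\<in>UNIV. \<Sum>u\<in>c l \<inter> {s - A..s}. h l k (v - u)) + H * real (tot c {s<..s + d})"
proof -
  have "(\<Sum>u\<in>c l \<inter> {v - A..<v}. h l k (v - u))
      \<le> (\<Sum>u\<in>c l \<inter> {s - A..s}. h l k (v - u)) + H * real (card (c l \<inter> {s<..s + d}))" for l
  proof -
    have fin: "finite (c l \<inter> {s - A..s})" "finite (c l \<inter> {s<..s + d})"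
      using conf_finite[OF c] by auto
    have "(\<Sum>u\<in>c l \<inter> {v - A..<v}. h l k (v - u)) \<le> (\<Sum>u\<in>(c l \<inter> {s - A..s}) \<union> (c l \<inter> {s<..s + d}). h l k (v - u))"
      using fin v by (intro sum_mono2) (auto simp: h_nonneg)
    also have "\<dots> = (\<Sum>u\<in>c l \<inter> {s - A..s}. h l k (v - u)) + (\<Sum>u\<in>c l \<inter> {s<..s + d}. h l k (v - u))"
      using fin by (intro sum.union_disjoint) auto
    also have "(\<Sum>u\<in>c l \<inter> {s<..s + d}. h l k (v - u)) \<le> (\<Sum>u\<in>c l \<inter> {s<..s + d}. H)"
      by (intro sum_mono h_le)
    finally show ?thesis by (simp add: mult.commute)
  qed
  then have "(\<Sum>l\<in>UNIV. \<Sum>u\<in>c l \<inter> {v - A..<v}. h l k (v - u))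
      \<le> (\<Sum>l\<in>UNIV. (\<Sum>u\<in>c l \<inter> {s - A..s}. h l k (v - u)) + H * real (card (c l \<inter> {s<..s + d})))"
    by (intro sum_mono)
  then show ?thesis
    unfolding intensity_def by (simp add: sum.distrib tot_def sum_distrib_left)
qed

text \<open>
  Each of the points born after \<open>s\<close> raises the intensity by at most \<open>H\<close>, for a time of at most
  \<open>d\<close>.
\<close>

lemma compensator_le_inherited:
  assumes c: "c \<in> configurations" and d: "0 \<le> d"
  shows "(\<integral>\<^sup>+v\<in>{s<..s + d}. ennreal (intensity A \<nu> h k v c) \<partial>lborel)
       \<le> ennreal (\<nu> k * d + inherited k s d c + H * d * real (tot c {s<..s + d}))"
proof -
  let ?T = "real (tot c {s<..s + d})"
  let ?J = "indicator {s<..s + d} :: real \<Rightarrow> ennreal"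
  have fin: "finite (c l \<inter> {s - A..s})" for l using conf_finite[OF c] by auto
  have "(\<integral>\<^sup>+v\<in>{s<..s + d}. ennreal (intensity A \<nu> h k v c) \<partial>lborel)
      \<le> (\<integral>\<^sup>+v. ennreal (\<nu> k + H * ?T) * ?J v + (\<Sum>l\<in>UNIV. \<Sum>u\<in>c l \<inter> {s - A..s}. ennreal (h l k (v - u)) * ?J v) \<partial>lborel)"
  proof (rule nn_integral_mono)
    fix v :: real
    show "ennreal (intensity A \<nu> h k v c) * ?J v
       \<le> ennreal (\<nu> k + H * ?T) * ?J v + (\<Sum>l\<in>UNIV. \<Sum>u\<in>c l \<inter> {s - A..s}. ennreal (h l k (v - u)) * ?J v)"
    proof (cases "v \<in> {s<..s + d}")
      case True
      have "ennreal (intensity A \<nu> h k v c) \<le> ennreal ((\<nu> k + H * ?T) + (\<Sum>l\<in>UNIV. \<Sum>u\<in>c l \<inter> {s - A..s}. h l k (v - u)))"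
        using intensity_le_inherited[OF c, of s v d k] True by (intro ennreal_leI) auto
      also have "\<dots> = ennreal (\<nu> k + H * ?T) + ennreal (\<Sum>l\<in>UNIV. \<Sum>u\<in>c l \<inter> {s - A..s}. h l k (v - u))"
        using \<nu>_pos[of k] H_pos h_nonneg by (intro ennreal_plus sum_nonneg) (auto intro: add_nonneg_nonneg less_imp_le)
      also have "ennreal (\<Sum>l\<in>UNIV. \<Sum>u\<in>c l \<inter> {s - A..s}. h l k (v - u))
           = (\<Sum>l\<in>UNIV. \<Sum>u\<in>c l \<inter> {s - A..s}. ennreal (h l k (v - u)))"
        by (subst sum_ennreal[symmetric], simp add: sum_nonneg h_nonneg)
           (intro sum.cong refl, simp add: sum_ennreal h_nonneg)
      finally show ?thesis using True by simp
    qed simp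
  qed
  also have "\<dots> = ennreal (\<nu> k + H * ?T) * ennreal d + (\<Sum>l\<in>UNIV. \<Sum>u\<in>c l \<inter> {s - A..s}.
       ennreal (tail_mass l k (s - u) - tail_mass l k (s + d - u)))"
    using d by (subst nn_integral_add) (auto simp: nn_integral_sum nn_integral_h_window nn_integral_cmult_indicator)
  also have "(\<Sum>l\<in>UNIV. \<Sum>u\<in>c l \<inter> {s - A..s}. ennreal (tail_mass l k (s - u) - tail_mass l k (s + d - u)))
      = ennreal (inherited k s d c)"
    unfolding inherited_def using d
    by (intro ennreal_double_sum tail_mass_diff_nonneg) simp
  also have "ennreal (\<nu> k + H * ?T) * ennreal d + ennreal (inherited k s d c)
      = ennreal ((\<nu> k + H * ?T) * d + inherited k s d c)"
    using d \<nu>_pos[of k] H_pos inherited_nonneg[OF d, of k s c]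
    by (subst ennreal_plus) (auto simp: ennreal_mult intro!: mult_nonneg_nonneg add_nonneg_nonneg less_imp_le)
  finally show ?thesis by (simp add: algebra_simps)
qed

end

lemma conf_separation:
  fixes c :: "'k::finite conf"
  assumes c: "c \<in> configurations" and B: "bounded B"
  shows "\<exists>\<eta>>0. \<forall>k l x y. x \<in> c k \<inter> B \<longrightarrow> y \<in> c l \<inter> B \<longrightarrow> x \<noteq> y \<longrightarrow> \<eta> \<le> \<bar>x - y\<bar>"
proof -
  define U where "U = (\<Union>k. c k \<inter> B)"
  have fin: "finite U" unfolding U_def by (rule finite_UN_I[OF finite conf_finite[OF c B]])
  define D where "D = insert 1 ((\<lambda>(x, y). \<bar>x - y\<bar>) ` {z \<in> U \<times> U. fst z \<noteq> snd z})"
  have D: "finite D" "D \<noteq> {}" unfolding D_def using fin by auto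
  have "Min D > 0" using D by (subst Min_gr_iff) (auto simp: D_def)
  moreover have "Min D \<le> \<bar>x - y\<bar>" if "x \<in> c k \<inter> B" "y \<in> c l \<inter> B" "x \<noteq> y" for k l x y
  proof (rule Min_le[OF D(1)])
    have "(x, y) \<in> {z \<in> U \<times> U. fst z \<noteq> snd z}" using that unfolding U_def by auto
    then show "\<bar>x - y\<bar> \<in> D" unfolding D_def by force
  qed
  ultimately show ?thesis by blast
qed

lemma tot_le_1:
  fixes c :: "'k::finite conf"
  assumes fin: "\<And>k. finite (c k \<inter> B)" and dis: "\<And>l k. l \<noteq> k \<Longrightarrow> c l \<inter> c k = {}"
    and one: "\<And>x y k l. x \<in> c k \<inter> B \<Longrightarrow> y \<in> c l \<inter> B \<Longrightarrow> x = y"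
  shows "tot c B \<le> 1"
proof -
  have "tot c B = card (\<Union>k\<in>UNIV. c k \<inter> B)"
    unfolding tot_def by (rule card_UN_disjoint[symmetric]) (use fin dis in auto)
  also have "\<dots> \<le> Suc 0"
  proof (subst card_le_Suc0_iff_eq)
    show "finite (\<Union>k. c k \<inter> B)" by (rule finite_UN_I[OF finite fin])
    show "\<forall>x\<in>\<Union>k. c k \<inter> B. \<forall>y\<in>\<Union>k. c k \<inter> B. x = y" using one by blast
  qed
  finally show ?thesis by simp
qed

text \<open>
  A discrete stochastic integral: once the mesh separates the points, a cell holds at most one
  of them, and the cell of the \<open>k\<close>-th point (counted from \<open>0\<close>) contributes \<open>\<phi> k\<close>. Through it,
  estimates for single short cells turn into estimates for functions of the total count.
\<close>

lemma mesh_sum_eventually: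
  fixes c :: "'k::finite conf" and \<phi> :: "nat \<Rightarrow> real"
  assumes c: "c \<in> configurations" and dis: "\<And>l k. l \<noteq> k \<Longrightarrow> c l \<inter> c k = {}" and d: "0 < d"
  shows "\<forall>\<^sub>F q in sequentially.
    (\<Sum>i<Suc q. \<phi> (tot c {s<..s + d * real i / real (Suc q)})
        * real (tot c {s + d * real i / real (Suc q)<..s + d * real (Suc i) / real (Suc q)}))
    = (\<Sum>k<tot c {s<..s + d}. \<phi> k)"
proof -
  obtain \<eta> where \<eta>: "\<eta> > 0"
    and sep: "\<And>k l x y. x \<in> c k \<inter> {s<..s + d} \<Longrightarrow> y \<in> c l \<inter> {s<..s + d} \<Longrightarrow> x \<noteq> y \<Longrightarrow> \<eta> \<le> \<bar>x - y\<bar>"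
    using conf_separation[OF c bounded_Ioc[of s "s + d"]] by blast
  have "(\<lambda>q. d / real (Suc q)) \<longlonglongrightarrow> 0"
    by (rule LIMSEQ_Suc) (rule lim_const_over_n)
  then have "\<forall>\<^sub>F q in sequentially. d / real (Suc q) < \<eta>"
    using \<eta> by (intro order_tendstoD(2)) auto
  then show ?thesis
  proof eventually_elim
    case (elim q)
    define t where "t i = s + d * real i / real (Suc q)" for i
    have t_step: "t (Suc i) = t i + d / real (Suc q)" for i
      unfolding t_def of_nat_Suc[of i] distrib_left add_divide_distrib by simp
    have t0: "t 0 = s" and tq: "t (Suc q) = s + d" unfolding t_def by simp_all
    have t_mono: "i \<le> j \<Longrightarrow> t i \<le> t j" for i j
      unfolding t_def using d by (simp add: divide_right_mono)
    have cell: "tot c {t i<..t (Suc i)} \<le> 1" if i: "i < Suc q" for i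
    proof (rule tot_le_1[OF conf_finite[OF c] dis])
      fix x y k l assume xy: "x \<in> c k \<inter> {t i<..t (Suc i)}" "y \<in> c l \<inter> {t i<..t (Suc i)}"
      have sub: "{t i<..t (Suc i)} \<subseteq> {s<..s + d}"
        using t_mono[of 0 i] t_mono[of "Suc i" "Suc q"] i t0 tq by auto
      have "\<bar>x - y\<bar> < \<eta>" using xy t_step[of i] elim by auto
      then show "x = y" using sep[of x k y l] xy sub by fastforce
    qed auto
    have N: "tot c {s<..t (Suc i)} = tot c {s<..t i} + tot c {t i<..t (Suc i)}" for i
    proof -
      have "{s<..t (Suc i)} = {s<..t i} \<union> {t i<..t (Suc i)}"
        using t_mono[of 0 i] t_mono[of i "Suc i"] t0 by auto
      then show ?thesis using tot_Un_disjoint[OF c, of "{s<..t i}" "{t i<..t (Suc i)}"] by auto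
    qed
    have "(\<Sum>i<n. \<phi> (tot c {s<..t i}) * real (tot c {t i<..t (Suc i)})) = (\<Sum>k<tot c {s<..t n}. \<phi> k)"
      if "n \<le> Suc q" for n
      using that
    proof (induction n)
      case 0
      then show ?case by (simp add: t0)
    next
      case (Suc n)
      have "tot c {t n<..t (Suc n)} = 0 \<or> tot c {t n<..t (Suc n)} = 1" using cell[of n] Suc.prems by linarith
      then show ?case using Suc N[of n] by auto
    qed
    from this[of "Suc q"] show ?case unfolding tq by (simp only: t_def order_refl)
  qed
qed

lemma increment_power_mono:
  fixes a b :: real
  assumes "0 \<le> a" "a \<le> b"
  shows "(a + 1) ^ p - a ^ p \<le> (b + 1) ^ p - b ^ p"
proof -
  have "(x + 1) ^ p - x ^ p = (\<Sum>i<p. x ^ (p - Suc i) * (x + 1) ^ i)" for x :: real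
    using power_diff_sumr2[of "x + 1" p x] by simp
  then show ?thesis using assms by (simp only:) (intro sum_mono mult_mono power_mono, auto)
qed

text \<open>
  \<open>\<mu>\<close> stands for a number of points, whence the gap between \<open>0\<close> and \<open>1\<close>. The point of the
  right-hand side is that \<open>\<mu> ^ p\<close> appears without the factor \<open>L\<close>, so that it can be absorbed
  when the inequality is multiplied by a small number.
\<close>

lemma increment_power_le:
  fixes \<mu> L :: real
  assumes \<mu>: "\<mu> = 0 \<or> 1 \<le> \<mu>" and L: "1 \<le> L" and p: "0 < p"
  shows "((\<mu> + 1) ^ p - \<mu> ^ p) * (L + \<mu>) \<le> (real p * 2 ^ p) * (\<mu> ^ p + (L * \<mu> ^ (p - 1) + L))"
  using \<mu>
proof
  assume "\<mu> = 0"
  have "1 \<le> real p * 2 ^ p" using p by (intro mult_ge1_I) auto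
  then have "L \<le> (real p * 2 ^ p) * L" using L by simp
  also have "\<dots> \<le> (real p * 2 ^ p) * (0 ^ p + (L * 0 ^ (p - 1) + L))"
    using L by (intro mult_left_mono) (auto simp: power_0_left)
  finally show ?thesis using \<open>\<mu> = 0\<close> p by (simp add: power_0_left)
next
  assume m: "1 \<le> \<mu>"
  have "(\<mu> + 1) ^ p - \<mu> ^ p = (\<Sum>i<p. \<mu> ^ (p - Suc i) * (\<mu> + 1) ^ i)"
    using power_diff_sumr2[of "\<mu> + 1" p \<mu>] by simp
  also have "\<dots> \<le> (\<Sum>i<p. 2 ^ p * \<mu> ^ (p - 1))"
  proof (rule sum_mono)
    fix i assume i: "i \<in> {..<p}"
    have "(\<mu> + 1) ^ i \<le> (2 * \<mu>) ^ i" using m by (intro power_mono) auto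
    also have "\<dots> = 2 ^ i * \<mu> ^ i" by (simp add: power_mult_distrib)
    finally have "\<mu> ^ (p - Suc i) * (\<mu> + 1) ^ i \<le> \<mu> ^ (p - Suc i) * (2 ^ i * \<mu> ^ i)"
      using m by (intro mult_left_mono) auto
    also have "\<dots> = 2 ^ i * \<mu> ^ (p - Suc i + i)" by (simp add: power_add)
    also have "p - Suc i + i = p - 1" using i by auto
    also have "2 ^ i * \<mu> ^ (p - 1) \<le> 2 ^ p * \<mu> ^ (p - 1)"
      using m i by (intro mult_right_mono power_increasing) auto
    finally show "\<mu> ^ (p - Suc i) * (\<mu> + 1) ^ i \<le> 2 ^ p * \<mu> ^ (p - 1)" .
  qed
  finally have "((\<mu> + 1) ^ p - \<mu> ^ p) * (L + \<mu>) \<le> (real p * (2 ^ p * \<mu> ^ (p - 1))) * (L + \<mu>)"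
    using L m by (intro mult_right_mono) auto
  also have "\<dots> = (real p * 2 ^ p) * (\<mu> ^ (p - 1) * \<mu> + L * \<mu> ^ (p - 1))" by (simp add: algebra_simps)
  also have "\<mu> ^ (p - 1) * \<mu> = \<mu> ^ p" using p by (simp add: power_eq_if mult.commute)
  also have "(real p * 2 ^ p) * (\<mu> ^ p + L * \<mu> ^ (p - 1)) \<le> (real p * 2 ^ p) * (\<mu> ^ p + (L * \<mu> ^ (p - 1) + L))"
    using L by (intro mult_left_mono) auto
  finally show ?thesis .
qed

lemma sum_increment_power:
  assumes "0 < p"
  shows "(\<Sum>k<n. if k < M then (real k + 1) ^ p - real k ^ p else 0) = real (min n M) ^ p"
proof (induction n)
  case 0
  then show ?case using assms by simp
next
  case (Suc n)
  show ?case
  proof (cases "n < M")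
    case True
    then have "min (Suc n) M = Suc n" "min n M = n" by auto
    then show ?thesis using Suc True by (simp add: add.commute)
  next
    case False
    then have "min (Suc n) M = M" "min n M = M" by auto
    then show ?thesis using Suc False by simp
  qed
qed

context linear_hawkes
begin

text \<open>
  The summand \<open>1\<close> accounts for immigration and makes the powers of the load increase with the
  exponent.
\<close>

definition load :: "real \<Rightarrow> 'k conf \<Rightarrow> real" where
  "load s c = 1 + real (tot c {s - A..s})"

text \<open>
  \<open>E[f | F\<^sub>s] \<le> E[g | F\<^sub>s]\<close>, where \<open>F\<^sub>s\<close> is the history up to time \<open>s\<close>, expressed by nonnegative
  weights \<open>Z\<close> that depend on the history. Infinite expectations are allowed, which matters as
  long as no moments are known to be finite.
\<close>

definition cond_le :: "real \<Rightarrow> ('k conf \<Rightarrow> real) \<Rightarrow> ('k conf \<Rightarrow> real) \<Rightarrow> bool" where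
  "cond_le s f g \<longleftrightarrow> (\<forall>Z\<in>borel_measurable (conf_algebra {..s}).
     (\<integral>\<^sup>+c. Z c * ennreal (f c) \<partial>P) \<le> (\<integral>\<^sup>+c. Z c * ennreal (g c) \<partial>P))"

lemma load_ge_1: "1 \<le> load s c"
  by (simp add: load_def)

lemma load_measurable: "s \<le> t \<Longrightarrow> load s \<in> borel_measurable (conf_algebra {..t})"
  unfolding load_def by (intro borel_measurable_add borel_measurable_const measurable_tot) auto

lemma load_P [measurable]: "load s \<in> borel_measurable P"
  using measurable_P[OF load_measurable[of s s]] by simp

lemma tot_P [measurable]:
  "(\<lambda>c. real (tot c {a..b})) \<in> borel_measurable P" "(\<lambda>c. real (tot c {a<..b})) \<in> borel_measurable P"
  by (auto intro!: measurable_tot_P)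

lemma cond_leD:
  "cond_le s f g \<Longrightarrow> Z \<in> borel_measurable (conf_algebra {..s}) \<Longrightarrow>
    (\<integral>\<^sup>+c. Z c * ennreal (f c) \<partial>P) \<le> (\<integral>\<^sup>+c. Z c * ennreal (g c) \<partial>P)"
  unfolding cond_le_def by blast

lemma cond_le_trans [trans]: "cond_le s f g \<Longrightarrow> cond_le s g k \<Longrightarrow> cond_le s f k"
  unfolding cond_le_def by (meson order_trans)

lemma cond_le_mono:
  assumes "\<And>c. c \<in> configurations \<Longrightarrow> f c \<le> g c"
  shows "cond_le s f g"
  unfolding cond_le_def using assms
  by (intro ballI nn_integral_mono mult_left_mono ennreal_leI) (auto simp: space_P)

lemma cond_le_later: "cond_le t f g \<Longrightarrow> s \<le> t \<Longrightarrow> cond_le s f g"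
  unfolding cond_le_def using measurable_conf_algebra_mono[of _ "{..s}" "{..t}"] by auto

lemma cond_le_mult:
  assumes fg: "cond_le s f g" and W: "W \<in> borel_measurable (conf_algebra {..s})" "\<And>c. 0 \<le> W c"
  shows "cond_le s (\<lambda>c. W c * f c) (\<lambda>c. W c * g c)"
  unfolding cond_le_def
proof
  fix Z :: "'k conf \<Rightarrow> ennreal" assume Z: "Z \<in> borel_measurable (conf_algebra {..s})"
  have "(\<lambda>c. Z c * ennreal (W c)) \<in> borel_measurable (conf_algebra {..s})"
    using Z W(1) by (intro borel_measurable_times_ennreal measurable_compose[OF W(1) measurable_ennreal])
  from cond_leD[OF fg this] show "(\<integral>\<^sup>+c. Z c * ennreal (W c * f c) \<partial>P) \<le> (\<integral>\<^sup>+c. Z c * ennreal (W c * g c) \<partial>P)"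
    using W(2) by (simp add: ennreal_mult' mult.assoc)
qed

lemma cond_le_cmult: "cond_le s f g \<Longrightarrow> 0 \<le> a \<Longrightarrow> cond_le s (\<lambda>c. a * f c) (\<lambda>c. a * g c)"
  by (rule cond_le_mult) auto

lemma cond_le_add:
  assumes "cond_le s f g" "cond_le s f' g'"
    and m: "f \<in> borel_measurable P" "g \<in> borel_measurable P" "f' \<in> borel_measurable P" "g' \<in> borel_measurable P"
    and nn: "\<And>c. 0 \<le> f c" "\<And>c. 0 \<le> g c" "\<And>c. 0 \<le> f' c" "\<And>c. 0 \<le> g' c"
  shows "cond_le s (\<lambda>c. f c + f' c) (\<lambda>c. g c + g' c)"
  unfolding cond_le_def
proof
  fix Z :: "'k conf \<Rightarrow> ennreal" assume Z: "Z \<in> borel_measurable (conf_algebra {..s})"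
  then have ZP: "Z \<in> borel_measurable P"
    unfolding measurable_P_eq by (rule measurable_conf_algebra_mono) simp
  have eq: "(\<integral>\<^sup>+c. Z c * ennreal (a c + b c) \<partial>P) = (\<integral>\<^sup>+c. Z c * ennreal (a c) \<partial>P) + (\<integral>\<^sup>+c. Z c * ennreal (b c) \<partial>P)"
    if ab: "a \<in> borel_measurable P" "b \<in> borel_measurable P" "\<And>c. 0 \<le> a c" "\<And>c. 0 \<le> b c" for a b
  proof -
    have "(\<integral>\<^sup>+c. Z c * ennreal (a c + b c) \<partial>P) = (\<integral>\<^sup>+c. Z c * ennreal (a c) + Z c * ennreal (b c) \<partial>P)"
      using ab(3,4) by (simp add: distrib_left)
    also have "\<dots> = (\<integral>\<^sup>+c. Z c * ennreal (a c) \<partial>P) + (\<integral>\<^sup>+c. Z c * ennreal (b c) \<partial>P)"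
      by (rule nn_integral_add) (intro borel_measurable_times_ennreal ZP measurable_compose[OF _ measurable_ennreal] ab)+
    finally show ?thesis .
  qed
  show "(\<integral>\<^sup>+c. Z c * ennreal (f c + f' c) \<partial>P) \<le> (\<integral>\<^sup>+c. Z c * ennreal (g c + g' c) \<partial>P)"
    unfolding eq[OF m(1,3) nn(1,3)] eq[OF m(2,4) nn(2,4)]
    using assms(1,2) Z by (intro add_mono cond_leD)
qed

lemma cond_leI:
  assumes m: "f \<in> borel_measurable P" "g \<in> borel_measurable P"
    and le: "\<And>F. F \<in> sets (conf_algebra {..s}) \<Longrightarrow>
      (\<integral>\<^sup>+c. indicator F c * ennreal (f c) \<partial>P) \<le> (\<integral>\<^sup>+c. indicator F c * ennreal (g c) \<partial>P)"
  shows "cond_le s f g"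
  unfolding cond_le_def
proof
  fix Z :: "'k conf \<Rightarrow> ennreal" assume Z: "Z \<in> borel_measurable (conf_algebra {..s})"
  have sub: "sets (conf_algebra {..s}) \<subseteq> sets P"
    unfolding sets_P by (rule conf_algebra_mono) simp
  have m': "(\<lambda>c. ennreal (f c)) \<in> borel_measurable P" "(\<lambda>c. ennreal (g c)) \<in> borel_measurable P"
    by (intro measurable_compose[OF _ measurable_ennreal] m)+
  show "(\<integral>\<^sup>+c. Z c * ennreal (f c) \<partial>P) \<le> (\<integral>\<^sup>+c. Z c * ennreal (g c) \<partial>P)"
    by (rule nn_integral_weighted_le[OF _ sub m' le Z]) (simp_all add: space_P)
qed

lemma card_P: "(\<lambda>c. real (card (c k \<inter> {s<..s + d}))) \<in> borel_measurable P"
  by (intro measurable_P[of _ UNIV] measurable_compose[OF measurable_card_conf]) auto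

lemma inherited_P [measurable]: "inherited k s d \<in> borel_measurable P"
  by (rule measurable_P[OF inherited_measurable])

lemma cond_le_compensator:
  assumes d: "0 < d" and a: "\<And>k. 0 \<le> a k"
  shows "cond_le s (\<lambda>c. \<Sum>k\<in>UNIV. a k * real (card (c k \<inter> {s<..s + d})))
    (\<lambda>c. \<Sum>k\<in>UNIV. a k * (\<nu> k * d + inherited k s d c + H * d * real (tot c {s<..s + d})))"
proof (rule cond_leI)
  show "(\<lambda>c. \<Sum>k\<in>UNIV. a k * real (card (c k \<inter> {s<..s + d}))) \<in> borel_measurable P"
    by (intro borel_measurable_sum borel_measurable_times borel_measurable_const card_P)
  show "(\<lambda>c. \<Sum>k\<in>UNIV. a k * (\<nu> k * d + inherited k s d c + H * d * real (tot c {s<..s + d}))) \<in> borel_measurable P"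
    by (intro borel_measurable_sum borel_measurable_times borel_measurable_add borel_measurable_const inherited_P tot_P)
  fix F :: "'k conf set" assume F: "F \<in> sets (conf_algebra {..s})"
  let ?b = "\<lambda>k c. \<nu> k * d + inherited k s d c + H * d * real (tot c {s<..s + d})"
  have FP: "(indicator F :: _ \<Rightarrow> ennreal) \<in> borel_measurable P"
    unfolding measurable_P_eq
    by (rule measurable_conf_algebra_mono[OF borel_measurable_indicator[OF F]]) simp
  have b: "0 \<le> ?b k c" for k c
    using d \<nu>_pos[of k] H_pos inherited_nonneg[of d k s c] by (intro add_nonneg_nonneg mult_nonneg_nonneg) auto
  have one: "(\<integral>\<^sup>+c. indicator F c * ennreal (real (card (c k \<inter> {s<..s + d}))) \<partial>P)
      \<le> (\<integral>\<^sup>+c. indicator F c * ennreal (?b k c) \<partial>P)" for k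
  proof -
    have "(\<integral>\<^sup>+c. indicator F c * ennreal (real (card (c k \<inter> {s<..s + d}))) \<partial>P)
       = (\<integral>\<^sup>+c. indicator F c * (\<integral>\<^sup>+v\<in>{s<..s + d}. ennreal (intensity A \<nu> h k v c) \<partial>lborel) \<partial>P)"
      using compensator[OF _ F, of "s + d" k] d by (simp add: ennreal_of_nat_eq_real_of_nat)
    also have "\<dots> \<le> (\<integral>\<^sup>+c. indicator F c * ennreal (?b k c) \<partial>P)"
      using d by (intro nn_integral_mono mult_left_mono compensator_le_inherited) (auto simp: space_P)
    finally show ?thesis .
  qed
  have split: "(\<integral>\<^sup>+c. indicator F c * ennreal (\<Sum>k\<in>UNIV. a k * r k c) \<partial>P)
      = (\<Sum>k\<in>UNIV. ennreal (a k) * (\<integral>\<^sup>+c. indicator F c * ennreal (r k c) \<partial>P))"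
    if r: "\<And>k c. 0 \<le> r k c" "\<And>k. r k \<in> borel_measurable P" for r
  proof -
    have "(\<integral>\<^sup>+c. indicator F c * ennreal (\<Sum>k\<in>UNIV. a k * r k c) \<partial>P)
        = (\<integral>\<^sup>+c. (\<Sum>k\<in>UNIV. ennreal (a k) * (indicator F c * ennreal (r k c))) \<partial>P)"
    proof (rule nn_integral_cong)
      fix c
      have "ennreal (\<Sum>k\<in>UNIV. a k * r k c) = (\<Sum>k\<in>UNIV. ennreal (a k) * ennreal (r k c))"
        using a r(1) by (subst sum_ennreal[symmetric]) (auto simp: ennreal_mult)
      then show "indicator F c * ennreal (\<Sum>k\<in>UNIV. a k * r k c) = (\<Sum>k\<in>UNIV. ennreal (a k) * (indicator F c * ennreal (r k c)))"
        by (simp add: sum_distrib_left mult_ac)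
    qed
    also have "\<dots> = (\<Sum>k\<in>UNIV. \<integral>\<^sup>+c. ennreal (a k) * (indicator F c * ennreal (r k c)) \<partial>P)"
      by (rule nn_integral_sum)
        (intro borel_measurable_times_ennreal borel_measurable_const FP measurable_compose[OF r(2) measurable_ennreal])
    also have "\<dots> = (\<Sum>k\<in>UNIV. ennreal (a k) * (\<integral>\<^sup>+c. indicator F c * ennreal (r k c) \<partial>P))"
      by (intro sum.cong refl nn_integral_cmult)
        (intro borel_measurable_times_ennreal FP measurable_compose[OF r(2) measurable_ennreal])
    finally show ?thesis .
  qed
  have bP: "?b k \<in> borel_measurable P" for k
    by (intro borel_measurable_times borel_measurable_add borel_measurable_const inherited_P tot_P)
  show "(\<integral>\<^sup>+c. indicator F c * ennreal (\<Sum>k\<in>UNIV. a k * real (card (c k \<inter> {s<..s + d}))) \<partial>P)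
     \<le> (\<integral>\<^sup>+c. indicator F c * ennreal (\<Sum>k\<in>UNIV. a k * ?b k c) \<partial>P)"
    using split[of "\<lambda>k c. real (card (c k \<inter> {s<..s + d}))"] split[of ?b] card_P b bP one
    by (simp only: of_nat_0_le_iff) (intro sum_mono mult_left_mono, auto)
qed

end

lemma measurable_tot_nat:
  assumes "B \<in> sets borel" "bounded B" "B \<subseteq> S"
  shows "(\<lambda>c. tot c B) \<in> conf_algebra S \<rightarrow>\<^sub>M count_space UNIV"
proof -
  have "(\<lambda>x :: real. nat \<lfloor>x\<rfloor>) \<in> borel \<rightarrow>\<^sub>M count_space UNIV" by measurable
  from measurable_compose[OF measurable_tot[OF assms] this] show ?thesis by simp
qed

context linear_hawkes
begin

lemma cond_le_sum:
  assumes "finite I" "\<And>i. i \<in> I \<Longrightarrow> cond_le s (f i) (g i)"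
    and "\<And>i. i \<in> I \<Longrightarrow> f i \<in> borel_measurable P" "\<And>i. i \<in> I \<Longrightarrow> g i \<in> borel_measurable P"
    and "\<And>i c. i \<in> I \<Longrightarrow> 0 \<le> f i c" "\<And>i c. i \<in> I \<Longrightarrow> 0 \<le> g i c"
  shows "cond_le s (\<lambda>c. \<Sum>i\<in>I. f i c) (\<lambda>c. \<Sum>i\<in>I. g i c)"
  using assms
proof (induction I rule: finite_induct)
  case empty
  show ?case by (rule cond_le_mono) simp
next
  case (insert i I)
  have "cond_le s (\<lambda>c. f i c + (\<Sum>i\<in>I. f i c)) (\<lambda>c. g i c + (\<Sum>i\<in>I. g i c))"
    by (rule cond_le_add) (use insert in \<open>auto intro!: sum_nonneg borel_measurable_sum\<close>)
  then show ?case using insert by simp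
qed

text \<open>
  Fatou's lemma; in the applications, the approximating functions are eventually constant.
\<close>

lemma cond_le_limit:
  assumes le: "\<And>q :: nat. cond_le s (f q) g" and m: "\<And>q. f q \<in> borel_measurable P"
    and lim: "AE c in P. \<forall>\<^sub>F q in sequentially. f q c = F c"
  shows "cond_le s F g"
  unfolding cond_le_def
proof
  fix Z :: "'k conf \<Rightarrow> ennreal" assume Z: "Z \<in> borel_measurable (conf_algebra {..s})"
  then have ZP: "Z \<in> borel_measurable P"
    unfolding measurable_P_eq by (rule measurable_conf_algebra_mono) simp
  have "(\<integral>\<^sup>+c. Z c * ennreal (F c) \<partial>P) = (\<integral>\<^sup>+c. liminf (\<lambda>q. Z c * ennreal (f q c)) \<partial>P)"
  proof (rule nn_integral_cong_AE, rule AE_mp[OF lim], rule AE_I2, rule impI)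
    fix c assume "\<forall>\<^sub>F q in sequentially. f q c = F c"
    then have "\<forall>\<^sub>F q in sequentially. Z c * ennreal (f q c) = Z c * ennreal (F c)"
      by (rule eventually_mono) simp
    then have "(\<lambda>q. Z c * ennreal (f q c)) \<longlonglongrightarrow> Z c * ennreal (F c)"
      by (rule tendsto_eventually)
    then show "Z c * ennreal (F c) = liminf (\<lambda>q. Z c * ennreal (f q c))"
      by (simp add: lim_imp_Liminf)
  qed
  also have "\<dots> \<le> liminf (\<lambda>q. \<integral>\<^sup>+c. Z c * ennreal (f q c) \<partial>P)"
    by (rule nn_integral_liminf) (intro borel_measurable_times_ennreal ZP measurable_compose[OF m measurable_ennreal])
  also have "\<dots> \<le> limsup (\<lambda>q. \<integral>\<^sup>+c. Z c * ennreal (f q c) \<partial>P)"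
    by (rule Liminf_le_Limsup) simp
  also have "\<dots> \<le> (\<integral>\<^sup>+c. Z c * ennreal (g c) \<partial>P)"
    by (rule Limsup_bounded) (intro always_eventually allI cond_leD[OF le Z])
  finally show "(\<integral>\<^sup>+c. Z c * ennreal (F c) \<partial>P) \<le> (\<integral>\<^sup>+c. Z c * ennreal (g c) \<partial>P)" .
qed

text \<open>
  Finiteness of the expectation of \<open>f\<close> is what allows to subtract \<open>f/2\<close> on both sides.
\<close>

lemma cond_le_absorb:
  assumes le: "cond_le s f (\<lambda>c. g c + 1 / 2 * f c)"
    and m: "f \<in> borel_measurable P" "g \<in> borel_measurable P"
    and nn: "\<And>c. 0 \<le> f c" "\<And>c. 0 \<le> g c"
    and fin: "(\<integral>\<^sup>+c. ennreal (f c) \<partial>P) < \<infinity>"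
  shows "cond_le s f (\<lambda>c. 2 * g c)"
proof (rule cond_leI)
  fix F :: "'k conf set" assume F: "F \<in> sets (conf_algebra {..s})"
  have I: "(indicator F :: _ \<Rightarrow> ennreal) \<in> borel_measurable (conf_algebra {..s})"
    using F by simp
  have FP: "(indicator F :: _ \<Rightarrow> ennreal) \<in> borel_measurable P"
    unfolding measurable_P_eq by (rule measurable_conf_algebra_mono[OF I]) simp
  let ?X = "\<integral>\<^sup>+c. indicator F c * ennreal (f c) \<partial>P"
  have mf: "(\<lambda>c. indicator F c * ennreal (k c)) \<in> borel_measurable P" if "k \<in> borel_measurable P" for k
    by (intro borel_measurable_times_ennreal FP measurable_compose[OF that measurable_ennreal])
  have "?X \<le> (\<integral>\<^sup>+c. indicator F c * ennreal (g c + 1 / 2 * f c) \<partial>P)"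
    by (rule cond_leD[OF le I])
  also have "\<dots> = (\<integral>\<^sup>+c. indicator F c * ennreal (g c) + ennreal (1 / 2) * (indicator F c * ennreal (f c)) \<partial>P)"
  proof (rule nn_integral_cong)
    fix c
    have "ennreal (g c + 1 / 2 * f c) = ennreal (g c) + ennreal (1 / 2) * ennreal (f c)"
      using nn[of c] by (subst ennreal_plus) (auto simp del: ennreal_half simp add: ennreal_mult[symmetric])
    then show "indicator F c * ennreal (g c + 1 / 2 * f c)
      = indicator F c * ennreal (g c) + ennreal (1 / 2) * (indicator F c * ennreal (f c))"
      by (simp only: distrib_left mult.left_commute)
  qed
  also have "\<dots> = (\<integral>\<^sup>+c. indicator F c * ennreal (g c) \<partial>P) + (\<integral>\<^sup>+c. ennreal (1 / 2) * (indicator F c * ennreal (f c)) \<partial>P)"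
    by (rule nn_integral_add) (intro mf m borel_measurable_times_ennreal borel_measurable_const)+
  also have "(\<integral>\<^sup>+c. ennreal (1 / 2) * (indicator F c * ennreal (f c)) \<partial>P) = ennreal (1 / 2) * ?X"
    by (rule nn_integral_cmult[OF mf[OF m(1)]])
  finally have "?X \<le> (\<integral>\<^sup>+c. indicator F c * ennreal (g c) \<partial>P) + ennreal (1 / 2) * ?X" .
  moreover have "?X \<le> (\<integral>\<^sup>+c. ennreal (f c) \<partial>P)"
    by (rule nn_integral_mono) (auto simp: indicator_def)
  then have "?X < \<infinity>" using fin by (rule le_less_trans)
  ultimately have "?X \<le> ennreal 2 * (\<integral>\<^sup>+c. indicator F c * ennreal (g c) \<partial>P)"
    by (rule ennreal_absorb_half)
  also have "\<dots> = (\<integral>\<^sup>+c. ennreal 2 * (indicator F c * ennreal (g c)) \<partial>P)"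
    by (rule nn_integral_cmult[symmetric, OF mf[OF m(2)]])
  also have "\<dots> = (\<integral>\<^sup>+c. indicator F c * ennreal (2 * g c) \<partial>P)"
    using nn(2) by (intro nn_integral_cong) (simp only: ennreal_mult mult.left_commute)
  finally show "?X \<le> (\<integral>\<^sup>+c. indicator F c * ennreal (2 * g c) \<partial>P)" .
qed (use m in simp_all)

text \<open>
  The factor \<open>2\<close> pays for the absorption of the points that are born during the time step
  itself.
\<close>

definition birth_const :: real where
  "birth_const = 2 * ((\<Sum>k\<in>UNIV. \<nu> k) + real CARD('k) * H)"

definition short_time :: "real \<Rightarrow> bool" where
  "short_time d \<longleftrightarrow> 0 < d \<and> birth_const * d \<le> 1"

lemma birth_const_pos: "0 < birth_const"
  unfolding birth_const_def using \<nu>_pos H_pos by (intro mult_pos_pos add_pos_pos sum_pos) auto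

text \<open>
  The compensator bounds the number of new points by itself, with a factor of at most \<open>1/2\<close>,
  plus a multiple of \<open>d\<close> times the load; the former is absorbed.
\<close>

lemma cond_le_births:
  assumes d: "short_time d"
  shows "cond_le s (\<lambda>c. real (tot c {s<..s + d})) (\<lambda>c. birth_const * d * load s c)"
proof -
  have d0: "0 < d" and "birth_const * d \<le> 1" using d by (auto simp: short_time_def)
  moreover have "0 \<le> (\<Sum>k\<in>UNIV. \<nu> k) * d"
    using d0 by (intro mult_nonneg_nonneg sum_nonneg less_imp_le[OF \<nu>_pos]) auto
  ultimately have d1: "real CARD('k) * H * d \<le> 1 / 2" unfolding birth_const_def by (simp add: algebra_simps)
  have "cond_le s (\<lambda>c. \<Sum>k\<in>UNIV. 1 * real (card (c k \<inter> {s<..s + d})))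
    (\<lambda>c. \<Sum>k\<in>UNIV. 1 * (\<nu> k * d + inherited k s d c + H * d * real (tot c {s<..s + d})))"
    by (rule cond_le_compensator[OF d0]) simp
  also have "cond_le s (\<lambda>c. \<Sum>k\<in>UNIV. 1 * (\<nu> k * d + inherited k s d c + H * d * real (tot c {s<..s + d})))
     (\<lambda>c. birth_const / 2 * d * load s c + 1 / 2 * real (tot c {s<..s + d}))"
  proof (rule cond_le_mono)
    fix c :: "'k conf"
    let ?T = "real (tot c {s<..s + d})" and ?L = "real (tot c {s - A..s})"
    have "(\<Sum>k\<in>UNIV. 1 * (\<nu> k * d + inherited k s d c + H * d * ?T))
       \<le> (\<Sum>k\<in>UNIV. \<nu> k * d + H * d * ?L + H * d * ?T)"
      using inherited_le[of d _ s c] d0 by (intro sum_mono) simp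
    also have "\<dots> = (\<Sum>k\<in>UNIV. \<nu> k) * d + real CARD('k) * H * d * ?L + real CARD('k) * H * d * ?T"
      by (simp add: sum.distrib sum_distrib_right)
    also have "\<dots> \<le> (\<Sum>k\<in>UNIV. \<nu> k) * d * load s c + real CARD('k) * H * d * load s c + 1 / 2 * ?T"
    proof (intro add_mono)
      have "0 \<le> (\<Sum>k\<in>UNIV. \<nu> k) * d"
        using d0 by (intro mult_nonneg_nonneg sum_nonneg less_imp_le[OF \<nu>_pos]) auto
      then show "(\<Sum>k\<in>UNIV. \<nu> k) * d \<le> (\<Sum>k\<in>UNIV. \<nu> k) * d * load s c"
        using load_ge_1[of s c] by (simp add: mult_le_cancel_left1)
      show "real CARD('k) * H * d * ?L \<le> real CARD('k) * H * d * load s c"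
        using d0 H_pos by (intro mult_left_mono) (auto simp: load_def)
      show "real CARD('k) * H * d * ?T \<le> 1 / 2 * ?T"
        using d1 by (rule mult_right_mono) simp
    qed
    also have "\<dots> = birth_const / 2 * d * load s c + 1 / 2 * ?T"
    proof -
      have "birth_const / 2 = (\<Sum>k\<in>UNIV. \<nu> k) + real CARD('k) * H" by (simp add: birth_const_def)
      then show ?thesis by (simp only: distrib_right)
    qed
    finally show "(\<Sum>k\<in>UNIV. 1 * (\<nu> k * d + inherited k s d c + H * d * ?T))
       \<le> birth_const / 2 * d * load s c + 1 / 2 * ?T" .
  qed
  finally have "cond_le s (\<lambda>c. real (tot c {s<..s + d})) (\<lambda>c. birth_const / 2 * d * load s c + 1 / 2 * real (tot c {s<..s + d}))"
    by (simp add: tot_def)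
  then have "cond_le s (\<lambda>c. real (tot c {s<..s + d})) (\<lambda>c. 2 * (birth_const / 2 * d * load s c))"
  proof (rule cond_le_absorb)
    show "(\<lambda>c. birth_const / 2 * d * load s c) \<in> borel_measurable P" by measurable
    show "0 \<le> birth_const / 2 * d * load s c" for c
      using birth_const_pos d0 load_ge_1[of s c] by (intro mult_nonneg_nonneg) auto
    show "(\<integral>\<^sup>+c. ennreal (real (tot c {s<..s + d})) \<partial>P) < \<infinity>" by (rule integral_tot_finite) simp
  qed auto
  then show ?thesis by simp
qed

lemma load_le_add_births:
  assumes "c \<in> configurations" "s \<le> t"
  shows "load t c \<le> load s c + real (tot c {s<..t})"
proof -
  have "tot c {t - A..t} \<le> tot c ({s - A..s} \<union> {s<..t})"
    using assms by (intro tot_mono) auto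
  also have "\<dots> \<le> tot c {s - A..s} + tot c {s<..t}" by (rule tot_Un_le)
  finally show ?thesis by (simp add: load_def)
qed

text \<open>
  Write \<open>(min N M) ^ p\<close> as the sum of its increments over the successive points. Along a fine
  mesh of \<open>(s, s + d]\<close>, the increment over a cell is the number of points in the cell times a
  function of the past, and \<open>cond_le_births\<close> applies to the cell. The truncation at \<open>M\<close> keeps
  the moment finite, as the absorption in the next step requires.
\<close>

lemma cond_le_truncated_moment:
  assumes d: "short_time d" and p: "0 < p"
  shows "cond_le s (\<lambda>c. real (min (tot c {s<..s + d}) M) ^ p)
    (\<lambda>c. birth_const * d * (((real (min (tot c {s<..s + d}) M) + 1) ^ p - real (min (tot c {s<..s + d}) M) ^ p)
        * (load s c + real (min (tot c {s<..s + d}) M))))"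
proof -
  define \<phi> where "\<phi> k = (if k < M then (real k + 1) ^ p - real k ^ p else 0)" for k
  define \<psi> where "\<psi> c = ((real (min (tot c {s<..s + d}) M) + 1) ^ p - real (min (tot c {s<..s + d}) M) ^ p)
        * (load s c + real (min (tot c {s<..s + d}) M))" for c
  define t where "t q i = s + d * real i / real (Suc q)" for q i
  have d0: "0 < d" using d by (simp add: short_time_def)
  have \<phi>0: "0 \<le> \<phi> k" for k unfolding \<phi>_def by (auto intro!: power_mono)
  have \<psi>0: "0 \<le> \<psi> c" for c
    unfolding \<psi>_def using load_ge_1[of s c] by (intro mult_nonneg_nonneg) (auto intro!: power_mono)
  have meas: "(\<lambda>c. u (tot c B)) \<in> borel_measurable (conf_algebra S)"
    if "B \<in> sets borel" "bounded B" "B \<subseteq> S" for u :: "nat \<Rightarrow> real" and B S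
    by (rule measurable_compose[OF measurable_tot_nat[OF that]]) simp
  have measP: "(\<lambda>c. u (tot c {a<..b})) \<in> borel_measurable P" for u :: "nat \<Rightarrow> real" and a b
    by (rule measurable_P[OF measurable_compose[OF measurable_tot_nat[of _ UNIV]]]) auto
  have \<psi>P: "\<psi> \<in> borel_measurable P"
    unfolding \<psi>_def
    by (intro borel_measurable_times borel_measurable_add load_P
        measP[of "\<lambda>n. (real (min n M) + 1) ^ p - real (min n M) ^ p"] measP[of "\<lambda>n. real (min n M)"])
  have cell: "cond_le s (\<lambda>c. \<phi> (tot c {s<..t q i}) * real (tot c {t q i<..t q (Suc i)}))
      (\<lambda>c. birth_const * (d / real (Suc q)) * \<psi> c)" if i: "i < Suc q" for q i
  proof -
    have si: "s \<le> t q i" unfolding t_def using d0 by simp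
    have te: "t q (Suc i) = t q i + d / real (Suc q)"
      unfolding t_def of_nat_Suc[of i] distrib_left add_divide_distrib by simp
    have "d / real (Suc q) \<le> d" using d0 by (simp add: divide_le_eq)
    then have "birth_const * (d / real (Suc q)) \<le> birth_const * d"
      using birth_const_pos by (intro mult_left_mono) auto
    then have dq: "short_time (d / real (Suc q))"
      using d by (simp add: short_time_def)
    have tle: "t q i \<le> s + d"
      unfolding t_def using d0 i by (simp add: divide_le_eq mult_left_mono)
    have "cond_le (t q i) (\<lambda>c. \<phi> (tot c {s<..t q i}) * real (tot c {t q i<..t q i + d / real (Suc q)}))
        (\<lambda>c. \<phi> (tot c {s<..t q i}) * (birth_const * (d / real (Suc q)) * load (t q i) c))"
      by (intro cond_le_mult cond_le_births dq meas \<phi>0) auto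
    also have "cond_le (t q i) (\<lambda>c. \<phi> (tot c {s<..t q i}) * (birth_const * (d / real (Suc q)) * load (t q i) c))
        (\<lambda>c. birth_const * (d / real (Suc q)) * \<psi> c)"
    proof (rule cond_le_mono)
      fix c :: "'k conf" assume c: "c \<in> configurations"
      let ?n = "tot c {s<..t q i}" and ?\<mu> = "min (tot c {s<..s + d}) M"
      have "\<phi> ?n * load (t q i) c \<le> \<psi> c"
      proof (cases "?n < M")
        case True
        have "?n \<le> tot c {s<..s + d}" using tle by (intro tot_mono c) auto
        then have n: "real ?n \<le> real ?\<mu>" using True by simp
        show ?thesis
          unfolding \<psi>_def \<phi>_def if_P[OF True]
        proof (rule mult_mono)
          show "(real ?n + 1) ^ p - real ?n ^ p \<le> (real ?\<mu> + 1) ^ p - real ?\<mu> ^ p"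
            by (rule increment_power_mono[OF _ n]) simp
          show "load (t q i) c \<le> load s c + real ?\<mu>" using load_le_add_births[OF c si] n by linarith
          show "0 \<le> load (t q i) c" using load_ge_1[of "t q i" c] by simp
          show "0 \<le> (real ?\<mu> + 1) ^ p - real ?\<mu> ^ p" by (simp add: power_mono)
        qed
      qed (simp add: \<phi>_def \<psi>0)
      then have "birth_const * (d / real (Suc q)) * (\<phi> ?n * load (t q i) c) \<le> birth_const * (d / real (Suc q)) * \<psi> c"
        using birth_const_pos d0 by (intro mult_left_mono) auto
      then show "\<phi> ?n * (birth_const * (d / real (Suc q)) * load (t q i) c) \<le> birth_const * (d / real (Suc q)) * \<psi> c"
        by (simp only: mult_ac)
    qed
    finally show ?thesis unfolding te by (rule cond_le_later[OF _ si])
  qed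
  have "cond_le s (\<lambda>c. real (min (tot c {s<..s + d}) M) ^ p) (\<lambda>c. birth_const * d * \<psi> c)"
  proof (rule cond_le_limit[where f="\<lambda>q c. \<Sum>i<Suc q. \<phi> (tot c {s<..t q i}) * real (tot c {t q i<..t q (Suc i)})"])
    fix q :: nat
    have "cond_le s (\<lambda>c. \<Sum>i\<in>{..<Suc q}. \<phi> (tot c {s<..t q i}) * real (tot c {t q i<..t q (Suc i)}))
       (\<lambda>c. \<Sum>i\<in>{..<Suc q}. birth_const * (d / real (Suc q)) * \<psi> c)"
    proof (rule cond_le_sum)
      fix i assume "i \<in> {..<Suc q}"
      then show "cond_le s (\<lambda>c. \<phi> (tot c {s<..t q i}) * real (tot c {t q i<..t q (Suc i)}))
          (\<lambda>c. birth_const * (d / real (Suc q)) * \<psi> c)" by (intro cell) simp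
      show "(\<lambda>c. birth_const * (d / real (Suc q)) * \<psi> c) \<in> borel_measurable P" using \<psi>P by measurable
    next
      fix i c
      show "0 \<le> birth_const * (d / real (Suc q)) * \<psi> c"
        using birth_const_pos d0 \<psi>0 by (intro mult_nonneg_nonneg) auto
    qed (auto intro!: borel_measurable_times measP tot_P mult_nonneg_nonneg \<phi>0)
    then show "cond_le s (\<lambda>c. \<Sum>i<Suc q. \<phi> (tot c {s<..t q i}) * real (tot c {t q i<..t q (Suc i)})) (\<lambda>c. birth_const * d * \<psi> c)"
      by (simp del: of_nat_Suc sum.lessThan_Suc)
    show "(\<lambda>c. \<Sum>i<Suc q. \<phi> (tot c {s<..t q i}) * real (tot c {t q i<..t q (Suc i)})) \<in> borel_measurable P"
      by (intro borel_measurable_sum borel_measurable_times measP tot_P)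
  next
    show "AE c in P. \<forall>\<^sub>F q in sequentially. (\<Sum>i<Suc q. \<phi> (tot c {s<..t q i}) * real (tot c {t q i<..t q (Suc i)}))
        = real (min (tot c {s<..s + d}) M) ^ p"
      using AE_disjoint AE_space
    proof eventually_elim
      case (elim c)
      have eq: "(\<Sum>k<tot c {s<..s + d}. \<phi> k) = real (min (tot c {s<..s + d}) M) ^ p"
        unfolding \<phi>_def by (rule sum_increment_power[OF p])
      have "c \<in> configurations" using elim(2) by (simp add: space_P)
      moreover have "c l \<inter> c k = {}" if "l \<noteq> k" for l k using elim(1) that by blast
      ultimately show ?case unfolding t_def eq[symmetric] by (rule mesh_sum_eventually[OF _ _ d0])
    qed
  qed
  then show ?thesis unfolding \<psi>_def .
qed

text \<open>
  The term of order \<open>p\<close> on the right-hand side of the truncated estimate is absorbed for small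
  \<open>d\<close>; the truncation is removed afterwards.
\<close>

lemma cond_le_moment_step:
  assumes d: "short_time d" and p: "0 < p" and small: "birth_const * d * (real p * 2 ^ p) \<le> 1 / 2"
  shows "cond_le s (\<lambda>c. real (tot c {s<..s + d}) ^ p)
    (\<lambda>c. 2 * (birth_const * d * (real p * 2 ^ p) * (load s c * real (tot c {s<..s + d}) ^ (p - 1) + load s c)))"
proof -
  define a where "a = birth_const * d * (real p * 2 ^ p)"
  define g where "g c = a * (load s c * real (tot c {s<..s + d}) ^ (p - 1) + load s c)" for c
  have d0: "0 < d" using d by (simp add: short_time_def)
  have a0: "0 \<le> a" unfolding a_def using birth_const_pos d0 by simp
  have g0: "0 \<le> g c" for c
    unfolding g_def using a0 load_ge_1[of s c] by (intro mult_nonneg_nonneg add_nonneg_nonneg) auto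
  have gP: "g \<in> borel_measurable P"
    unfolding g_def by (intro borel_measurable_times borel_measurable_add borel_measurable_const borel_measurable_power load_P tot_P)
  have mP: "(\<lambda>c. real (min (tot c {s<..s + d}) M) ^ p) \<in> borel_measurable P" for M
    by (rule measurable_P[of _ UNIV], rule measurable_compose[OF measurable_tot_nat]) auto
  have "cond_le s (\<lambda>c. real (min (tot c {s<..s + d}) M) ^ p) (\<lambda>c. 2 * g c)" for M
  proof (rule cond_le_absorb)
    have "cond_le s (\<lambda>c. real (min (tot c {s<..s + d}) M) ^ p)
    (\<lambda>c. birth_const * d * (((real (min (tot c {s<..s + d}) M) + 1) ^ p - real (min (tot c {s<..s + d}) M) ^ p)
        * (load s c + real (min (tot c {s<..s + d}) M))))"
      by (rule cond_le_truncated_moment[OF d p])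
    also have "cond_le s \<dots> (\<lambda>c. g c + 1 / 2 * real (min (tot c {s<..s + d}) M) ^ p)"
    proof (rule cond_le_mono)
      fix c :: "'k conf"
      define \<mu> where "\<mu> = real (min (tot c {s<..s + d}) M)"
      have "\<mu> = 0 \<or> 1 \<le> \<mu>" unfolding \<mu>_def by (cases "min (tot c {s<..s + d}) M") auto
      then have "((\<mu> + 1) ^ p - \<mu> ^ p) * (load s c + \<mu>) \<le> (real p * 2 ^ p) * (\<mu> ^ p + (load s c * \<mu> ^ (p - 1) + load s c))"
        by (rule increment_power_le[OF _ load_ge_1 p])
      then have "birth_const * d * (((\<mu> + 1) ^ p - \<mu> ^ p) * (load s c + \<mu>))
          \<le> birth_const * d * ((real p * 2 ^ p) * (\<mu> ^ p + (load s c * \<mu> ^ (p - 1) + load s c)))"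
        using birth_const_pos d0 by (intro mult_left_mono) auto
      also have "\<dots> = a * \<mu> ^ p + a * (load s c * \<mu> ^ (p - 1) + load s c)"
        unfolding a_def by (simp add: algebra_simps)
      also have "\<dots> \<le> 1 / 2 * \<mu> ^ p + g c"
      proof (rule add_mono)
        show "a * \<mu> ^ p \<le> 1 / 2 * \<mu> ^ p"
          using small unfolding a_def \<mu>_def by (intro mult_right_mono) auto
        have "\<mu> ^ (p - 1) \<le> real (tot c {s<..s + d}) ^ (p - 1)"
          unfolding \<mu>_def by (intro power_mono) auto
        then show "a * (load s c * \<mu> ^ (p - 1) + load s c) \<le> g c"
          unfolding g_def using a0 load_ge_1[of s c] by (intro mult_left_mono add_right_mono) auto
      qed
      finally show "birth_const * d * (((\<mu> + 1) ^ p - \<mu> ^ p) * (load s c + \<mu>)) \<le> g c + 1 / 2 * \<mu> ^ p"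
        by (simp add: add.commute)
    qed
    finally show "cond_le s (\<lambda>c. real (min (tot c {s<..s + d}) M) ^ p) (\<lambda>c. g c + 1 / 2 * real (min (tot c {s<..s + d}) M) ^ p)" .
    have "(\<integral>\<^sup>+c. ennreal (real (min (tot c {s<..s + d}) M) ^ p) \<partial>P) \<le> (\<integral>\<^sup>+c. ennreal (real M ^ p) \<partial>P)"
      by (intro nn_integral_mono ennreal_leI power_mono) auto
    also have "\<dots> = ennreal (real M ^ p)"
      using prob_space.emeasure_space_1[OF prob] by simp
    also have "\<dots> < \<infinity>" by simp
    finally show "(\<integral>\<^sup>+c. ennreal (real (min (tot c {s<..s + d}) M) ^ p) \<partial>P) < \<infinity>" .
  qed (use mP gP g0 in auto)
  then have "cond_le s (\<lambda>c. real (tot c {s<..s + d}) ^ p) (\<lambda>c. 2 * g c)"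
  proof (rule cond_le_limit[OF _ mP])
    show "AE c in P. \<forall>\<^sub>F M in sequentially. real (min (tot c {s<..s + d}) M) ^ p = real (tot c {s<..s + d}) ^ p"
    proof (rule AE_I2)
      fix c :: "'k conf"
      show "\<forall>\<^sub>F M in sequentially. real (min (tot c {s<..s + d}) M) ^ p = real (tot c {s<..s + d}) ^ p"
        using eventually_ge_at_top[of "tot c {s<..s + d}"] by eventually_elim simp
    qed
  qed
  then show ?thesis unfolding g_def a_def .
qed

text \<open>
  The term \<open>d * load\<close> is due to single points, the term of order \<open>d\<^sup>2\<close> to two or more. The
  absence of a higher power of the load at first order in \<open>d\<close> is crucial for \<open>drift\<close>. By
  induction on \<open>p\<close> with the previous lemma.
\<close>

lemma cond_le_moment:
  assumes "0 < p"
  shows "\<exists>C>0. \<exists>d0>0. d0 \<le> 1 \<and> (\<forall>s d. 0 < d \<longrightarrow> d \<le> d0 \<longrightarrow> short_time d \<and>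
    cond_le s (\<lambda>c. real (tot c {s<..s + d}) ^ p) (\<lambda>c. C * (d * load s c + d\<^sup>2 * load s c ^ p)))"
  using assms
proof (induction p)
  case (Suc p)
  define d1 where "d1 = min 1 (min (1 / birth_const) (1 / (2 * (birth_const * (real (Suc p) * 2 ^ Suc p)))))"
  have pos: "0 < birth_const" "0 < birth_const * (real (Suc p) * 2 ^ Suc p)"
    using H_pos birth_const_pos by auto
  have d1: "0 < d1" "d1 \<le> 1" unfolding d1_def using pos by auto
  have short: "short_time d" and small: "birth_const * d * (real (Suc p) * 2 ^ Suc p) \<le> 1 / 2"
    if "0 < d" "d \<le> d1" for d
  proof -
    have "d \<le> 1 / birth_const" using that unfolding d1_def by simp
    then have "d * birth_const \<le> 1" using pos by (simp add: pos_le_divide_eq)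
    then show "short_time d" using that by (simp add: short_time_def mult.commute)
    have "d \<le> 1 / (2 * (birth_const * (real (Suc p) * 2 ^ Suc p)))" using that unfolding d1_def by simp
    then have "d * (2 * (birth_const * (real (Suc p) * 2 ^ Suc p))) \<le> 1"
      using pos(2) by (simp add: pos_le_divide_eq del: power_Suc of_nat_Suc)
    then show "birth_const * d * (real (Suc p) * 2 ^ Suc p) \<le> 1 / 2" by (simp add: mult_ac)
  qed
  define a where "a = 2 * (birth_const * (real (Suc p) * 2 ^ Suc p))"
  have a: "0 < a" unfolding a_def using pos by simp
  have step: "cond_le s (\<lambda>c. real (tot c {s<..s + d}) ^ Suc p)
      (\<lambda>c. a * d * (load s c * real (tot c {s<..s + d}) ^ p) + a * d * load s c)" if "0 < d" "d \<le> d1" for s d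
    using cond_le_moment_step[OF short[OF that] _ small[OF that], of s]
    by (simp add: a_def algebra_simps del: power_Suc of_nat_Suc)
  show ?case
  proof (cases "p = 0")
    case True
    have "cond_le s (\<lambda>c. real (tot c {s<..s + d}) ^ Suc p) (\<lambda>c. (2 * a) * (d * load s c + d\<^sup>2 * load s c ^ Suc p))"
      if "0 < d" "d \<le> d1" for s d
    proof (rule cond_le_trans[OF step[OF that] cond_le_mono])
      fix c
      have "0 \<le> 2 * a * (d\<^sup>2 * load s c)" using a load_ge_1[of s c] by simp
      then show "a * d * (load s c * real (tot c {s<..s + d}) ^ p) + a * d * load s c
         \<le> (2 * a) * (d * load s c + d\<^sup>2 * load s c ^ Suc p)"
        using True by (simp add: algebra_simps)
    qed
    then show ?thesis using d1 a short by (intro exI[of _ "2 * a"] conjI exI[of _ d1]) auto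
  next
    case False
    then obtain C d2 where C: "C > 0" and d2: "0 < d2"
      and IH: "\<And>s d. 0 < d \<Longrightarrow> d \<le> d2 \<Longrightarrow> cond_le s (\<lambda>c. real (tot c {s<..s + d}) ^ p) (\<lambda>c. C * (d * load s c + d\<^sup>2 * load s c ^ p))"
      using Suc.IH by auto
    define d0 where "d0 = min d1 d2"
    have "cond_le s (\<lambda>c. real (tot c {s<..s + d}) ^ Suc p)
        (\<lambda>c. (2 * a * C + a) * (d * load s c + d\<^sup>2 * load s c ^ Suc p))" if d: "0 < d" "d \<le> d0" for s d
    proof -
      have dd: "d \<le> d1" "d \<le> d2" using d unfolding d0_def by auto
      have "cond_le s (\<lambda>c. real (tot c {s<..s + d}) ^ Suc p)
          (\<lambda>c. a * d * (load s c * real (tot c {s<..s + d}) ^ p) + a * d * load s c)"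
        by (rule step[OF d(1) dd(1)])
      also have "cond_le s \<dots> (\<lambda>c. a * d * (load s c * (C * (d * load s c + d\<^sup>2 * load s c ^ p))) + a * d * load s c)"
      proof (rule cond_le_add)
        have L: "0 \<le> load s c" for c using load_ge_1[of s c] by simp
        show "cond_le s (\<lambda>c. a * d * (load s c * real (tot c {s<..s + d}) ^ p))
            (\<lambda>c. a * d * (load s c * (C * (d * load s c + d\<^sup>2 * load s c ^ p))))"
          using a d L by (intro cond_le_cmult cond_le_mult IH dd load_measurable) auto
        show "cond_le s (\<lambda>c. a * d * load s c) (\<lambda>c. a * d * load s c)" by (rule cond_le_mono) simp
        show "0 \<le> a * d * (load s c * (C * (d * load s c + d\<^sup>2 * load s c ^ p)))" for c
          using a d L C by (intro mult_nonneg_nonneg add_nonneg_nonneg) auto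
        show "0 \<le> a * d * (load s c * real (tot c {s<..s + d}) ^ p)" "0 \<le> a * d * load s c" "0 \<le> a * d * load s c" for c
          using a d L by (auto intro!: mult_nonneg_nonneg)
      qed measurable
      also have "cond_le s \<dots> (\<lambda>c. (2 * a * C + a) * (d * load s c + d\<^sup>2 * load s c ^ Suc p))"
      proof (rule cond_le_mono)
        fix c
        let ?L = "load s c"
        have L1: "1 \<le> ?L" by (rule load_ge_1)
        have d_le: "d \<le> 1" using dd d1 by simp
        have "?L ^ 2 \<le> ?L ^ Suc p" using False L1 by (intro power_increasing) auto
        then have "d\<^sup>2 * ?L ^ 2 \<le> d\<^sup>2 * ?L ^ Suc p" by (intro mult_left_mono) auto
        moreover have "d ^ 3 * ?L ^ Suc p \<le> d\<^sup>2 * ?L ^ Suc p"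
          using d d_le L1 by (intro mult_right_mono power_decreasing) auto
        ultimately have "a * C * (d\<^sup>2 * ?L ^ 2 + d ^ 3 * ?L ^ Suc p) \<le> a * C * (2 * (d\<^sup>2 * ?L ^ Suc p))"
          using a C by (intro mult_left_mono) auto
        moreover have "0 \<le> a * C * (d * ?L)" "0 \<le> a * (d\<^sup>2 * ?L ^ Suc p)" using a C d L1 by auto
        ultimately show "a * d * (?L * (C * (d * ?L + d\<^sup>2 * ?L ^ p))) + a * d * ?L
            \<le> (2 * a * C + a) * (d * ?L + d\<^sup>2 * ?L ^ Suc p)"
          by (simp add: algebra_simps power2_eq_square power3_eq_cube)
      qed
      finally show ?thesis .
    qed
    moreover have "0 < 2 * a * C + a" using a C by (simp add: add_pos_pos)
    moreover have "0 < d0" "d0 \<le> 1" using d1 d2 unfolding d0_def by auto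
    moreover have "short_time d" if "0 < d" "d \<le> d0" for d using short that unfolding d0_def by simp
    ultimately show ?thesis by blast
  qed
qed simp

end

section \<open>A Lyapunov functional with finite moments\<close>

text \<open>
  The remainder is quadratic in the jump \<open>J\<close>, so that the term of first order in the time step
  comes with the exact constant \<open>p\<close>; with a larger constant, the drift would be lost.
\<close>

lemma power_add_le_second_order:
  fixes Y J :: real
  assumes "0 \<le> Y" "0 \<le> J" "2 \<le> p"
  shows "(Y + J) ^ p \<le> Y ^ p + real p * Y ^ (p - 1) * J + 2 ^ p * (Y ^ (p - 2) * J\<^sup>2 + J ^ p)"
proof -
  let ?E = "Y ^ (p - 2) * J\<^sup>2 + J ^ p"
  have nn: "0 \<le> Y ^ (p - 2) * J\<^sup>2" "0 \<le> J ^ p" using assms by auto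
  then have E: "0 \<le> ?E" by simp
  have summand: "J ^ j * Y ^ (p - j) \<le> ?E" if j: "2 \<le> j" "j \<le> p" for j
  proof (cases "J \<le> Y")
    case True
    have "J ^ j = J ^ (j - 2) * J\<^sup>2" by (metis j(1) le_add_diff_inverse2 power_add)
    then have "J ^ j * Y ^ (p - j) = J ^ (j - 2) * (J\<^sup>2 * Y ^ (p - j))" by simp
    also have "\<dots> \<le> Y ^ (j - 2) * (J\<^sup>2 * Y ^ (p - j))"
      using True assms by (intro mult_right_mono power_mono) auto
    also have "\<dots> = Y ^ (j - 2 + (p - j)) * J\<^sup>2" by (simp add: power_add)
    also have "j - 2 + (p - j) = p - 2" using j by simp
    finally show ?thesis using nn by linarith
  next
    case False
    have "J ^ j * Y ^ (p - j) \<le> J ^ j * J ^ (p - j)"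
      using False assms by (intro mult_left_mono power_mono) auto
    also have "\<dots> = J ^ p" using j by (simp add: power_add[symmetric])
    finally show ?thesis using nn by linarith
  qed
  have "(J + Y) ^ p = (\<Sum>j\<le>p. real (p choose j) * J ^ j * Y ^ (p - j))"
    by (rule binomial_ring)
  also have "{..p} = insert 0 (insert 1 {2..p})" using assms(3) by auto
  also have "(\<Sum>j\<in>insert 0 (insert 1 {2..p}). real (p choose j) * J ^ j * Y ^ (p - j))
      = Y ^ p + real p * Y ^ (p - 1) * J + (\<Sum>j=2..p. real (p choose j) * J ^ j * Y ^ (p - j))"
    by simp
  also have "(\<Sum>j=2..p. real (p choose j) * J ^ j * Y ^ (p - j)) \<le> (\<Sum>j=2..p. real (p choose j) * ?E)"
    unfolding mult.assoc by (intro sum_mono mult_left_mono summand) auto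
  also have "\<dots> \<le> (\<Sum>j\<le>p. real (p choose j) * ?E)"
    using E by (intro sum_mono2) auto
  also have "\<dots> = 2 ^ p * ?E"
    unfolding sum_distrib_right[symmetric] of_nat_sum[symmetric] choose_row_sum by simp
  finally show ?thesis by (simp add: add.commute)
qed

lemma power_first_order_le:
  fixes Y R :: real
  assumes "0 \<le> Y" "0 \<le> R" "0 < p"
  shows "Y ^ p + real p * Y ^ (p - 1) * R \<le> (Y + R) ^ p"
proof -
  have "(R + Y) ^ p = (\<Sum>j\<le>p. real (p choose j) * R ^ j * Y ^ (p - j))" by (rule binomial_ring)
  also have "\<dots> \<ge> (\<Sum>j\<in>{0, 1}. real (p choose j) * R ^ j * Y ^ (p - j))"
    using assms by (intro sum_mono2) auto
  also have "(\<Sum>j\<in>{0, 1}. real (p choose j) * R ^ j * Y ^ (p - j)) = Y ^ p + real p * Y ^ (p - 1) * R" by simp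
  finally show ?thesis by (simp add: add.commute)
qed

lemma power_add_le_first_order:
  fixes a b :: real
  assumes "0 \<le> a" "0 \<le> b" "0 < p"
  shows "(a + b) ^ p \<le> a ^ p + real p * b * (a + b) ^ (p - 1)"
proof -
  have "(a + b) ^ p - a ^ p = b * (\<Sum>i<p. a ^ (p - Suc i) * (a + b) ^ i)"
    using power_diff_sumr2[of "a + b" p a] by simp
  also have "\<dots> \<le> b * (\<Sum>i<p. (a + b) ^ (p - 1))"
  proof (intro mult_left_mono sum_mono)
    fix i assume i: "i \<in> {..<p}"
    have "a ^ (p - Suc i) * (a + b) ^ i \<le> (a + b) ^ (p - Suc i) * (a + b) ^ i"
      using assms by (intro mult_right_mono power_mono) auto
    also have "\<dots> = (a + b) ^ (p - 1)" using i by (simp add: power_add[symmetric])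
    finally show "a ^ (p - Suc i) * (a + b) ^ i \<le> (a + b) ^ (p - 1)" .
  qed (use assms in auto)
  finally show ?thesis by (simp add: mult_ac)
qed

lemma power_add_le_2:
  fixes a b :: real
  assumes "0 \<le> a" "0 \<le> b"
  shows "(a + b) ^ p \<le> 2 ^ p * (a ^ p + b ^ p)"
proof -
  have "(a + b) ^ p \<le> (2 * max a b) ^ p" using assms by (intro power_mono) auto
  also have "\<dots> = 2 ^ p * max a b ^ p" by (simp add: power_mult_distrib)
  also have "max a b ^ p \<le> a ^ p + b ^ p" using assms by (auto simp: max_def)
  finally show ?thesis by simp
qed

lemma lower_power_absorbed:
  fixes \<epsilon> :: real
  assumes "0 < \<epsilon>" "0 < p"
  shows "\<exists>C\<ge>0. \<forall>v\<ge>0. (1 + v) ^ (p - 1) \<le> \<epsilon> * v ^ p + C"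
proof -
  \<comment> \<open>Above v0, one additional factor v outweighs the constant; below it, the left-hand side is bounded.\<close>
  define v0 where "v0 = max 1 (2 ^ (p - 1) / \<epsilon>)"
  have "(1 + v) ^ (p - 1) \<le> \<epsilon> * v ^ p + (1 + v0) ^ (p - 1)" if v: "0 \<le> v" for v
  proof (cases "v \<le> v0")
    case True
    then have "(1 + v) ^ (p - 1) \<le> (1 + v0) ^ (p - 1)" using v by (intro power_mono) auto
    then show ?thesis using v assms by (simp add: add_increasing)
  next
    case False
    then have v1: "1 \<le> v" and "2 ^ (p - 1) / \<epsilon> \<le> v" unfolding v0_def by auto
    then have v2: "2 ^ (p - 1) \<le> \<epsilon> * v" using assms by (simp only: pos_divide_le_eq mult.commute)
    have "(1 + v) ^ (p - 1) \<le> (2 * v) ^ (p - 1)" using v1 by (intro power_mono) auto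
    also have "\<dots> = 2 ^ (p - 1) * v ^ (p - 1)" by (simp add: power_mult_distrib)
    also have "\<dots> \<le> (\<epsilon> * v) * v ^ (p - 1)" using v1 v2 by (intro mult_right_mono) auto
    also have "\<dots> = \<epsilon> * v ^ p" using assms by (simp add: power_eq_if)
    finally have "(1 + v) ^ (p - 1) \<le> \<epsilon> * v ^ p" .
    then show ?thesis by (simp add: v0_def add_increasing2)
  qed
  then show ?thesis by (intro exI[of _ "(1 + v0) ^ (p - 1)"]) (auto simp: v0_def)
qed

context linear_hawkes
begin

lemma weights_exist: "\<exists>w. \<forall>l. 1 \<le> w l \<and> (\<Sum>k\<in>UNIV. tail_mass l k 0 * w k) \<le> w l - 1 / 2"
proof -
  have nn: "0 \<le> (LINT x:{0..A}|lborel. h l k x)" for l k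
    unfolding set_lebesgue_integral_def by (intro integral_nonneg_AE) (auto simp: h_nonneg)
  obtain w where w: "\<And>l. 1 \<le> w l" "\<And>l. (\<Sum>k\<in>UNIV. (LINT x:{0..A}|lborel. h l k x) * w k) \<le> w l - 1 / 2"
    using subcritical_weights[of "\<lambda>l k. LINT x:{0..A}|lborel. h l k x"] subcritical nn
    unfolding interaction_matrix_def by blast
  have "tail_mass l k 0 \<le> (LINT x:{0..A}|lborel. h l k x)" for l k
    unfolding tail_mass_def set_lebesgue_integral_def
  proof (rule integral_mono)
    show "integrable lborel (\<lambda>x. indicator {0<..} x *\<^sub>R h l k x)"
      "integrable lborel (\<lambda>x. indicator {0..A} x *\<^sub>R h l k x)"
      using h_set_integrable unfolding set_integrable_def by auto
    show "indicator {0<..} x *\<^sub>R h l k x \<le> indicator {0..A} x *\<^sub>R h l k x" for x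
      using h_supp[of x l k] h_nonneg[of l k x] by (auto simp: indicator_def)
  qed
  then have "(\<Sum>k\<in>UNIV. tail_mass l k 0 * w k) \<le> (\<Sum>k\<in>UNIV. (LINT x:{0..A}|lborel. h l k x) * w k)" for l
    using w(1) by (intro sum_mono mult_right_mono) (auto intro: order_trans[of 0 1])
  then show ?thesis using w by (meson order_trans)
qed

definition weight :: "'k \<Rightarrow> real" where
  "weight = (SOME w. \<forall>l. 1 \<le> w l \<and> (\<Sum>k\<in>UNIV. tail_mass l k 0 * w k) \<le> w l - 1 / 2)"

lemma weight_ge_1: "1 \<le> weight l" and weight_subcritical: "(\<Sum>k\<in>UNIV. tail_mass l k 0 * weight k) \<le> weight l - 1 / 2"
  using someI_ex[OF weights_exist] unfolding weight_def by blast+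

definition weight_sum :: real where "weight_sum = (\<Sum>l\<in>UNIV. weight l)"

lemma weight_nonneg: "0 \<le> weight l"
  using weight_ge_1[of l] by simp

lemma weight_le_sum: "weight l \<le> weight_sum"
  unfolding weight_sum_def by (rule member_le_sum) (auto simp: weight_nonneg)

lemma weight_sum_ge_1: "1 \<le> weight_sum"
  using weight_le_sum weight_ge_1 order_trans by blast

text \<open>
  The weighted mean number of children that a point of age \<open>a\<close> has yet to produce, plus a
  reserve that falls linearly from \<open>1/2\<close> at age \<open>0\<close> to \<open>1/4\<close> at age \<open>A\<close>. The loss of reserve
  produces the negative drift.
\<close>

definition potential :: "'k \<Rightarrow> real \<Rightarrow> real" where
  "potential l a = (\<Sum>k\<in>UNIV. weight k * tail_mass l k a) + (1 - a / (2 * A)) / 2"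

lemma potential_measurable: "(\<lambda>u. potential l (s - u)) \<in> borel_measurable borel"
  unfolding potential_def by measurable

lemma potential_nonneg: "a \<le> 2 * A \<Longrightarrow> 0 \<le> potential l a"
  unfolding potential_def using A_pos
  by (intro add_nonneg_nonneg sum_nonneg mult_nonneg_nonneg weight_nonneg tail_mass_nonneg) (auto simp: field_simps)

lemma potential_ge: "a \<le> A \<Longrightarrow> 1 / 4 \<le> potential l a"
proof -
  assume "a \<le> A"
  then have "1 / 4 \<le> (1 - a / (2 * A)) / 2" using A_pos by (simp add: field_simps)
  moreover have "0 \<le> (\<Sum>k\<in>UNIV. weight k * tail_mass l k a)"
    by (intro sum_nonneg mult_nonneg_nonneg weight_nonneg tail_mass_nonneg)
  ultimately show ?thesis unfolding potential_def by linarith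
qed

lemma potential_antimono: "a \<le> b \<Longrightarrow> potential l b \<le> potential l a"
  unfolding potential_def using A_pos tail_mass_diff_nonneg[of a b l]
  by (intro add_mono sum_mono mult_left_mono weight_nonneg) (auto simp: field_simps)

text \<open>
  A newborn point of mark \<open>l\<close> adds at most \<open>weight l\<close>; the choice of the weights leaves just the
  room for the reserve \<open>1/2\<close>.
\<close>

lemma potential_le_weight:
  assumes "0 \<le> a"
  shows "potential l a \<le> weight l"
proof -
  have "potential l 0 = (\<Sum>k\<in>UNIV. tail_mass l k 0 * weight k) + 1 / 2"
    unfolding potential_def by (simp add: mult.commute)
  then show ?thesis using potential_antimono[OF assms, of l] weight_subcritical[of l] by linarith
qed

definition lyapunov :: "real \<Rightarrow> 'k conf \<Rightarrow> real" where
  "lyapunov s c = (\<Sum>l\<in>UNIV. \<Sum>u\<in>c l \<inter> {s - A..s}. potential l (s - u))"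

text \<open>
  What is left at time \<open>s + d\<close> of the potential of the points that are counted at time \<open>s\<close>.
\<close>

definition decayed :: "real \<Rightarrow> real \<Rightarrow> 'k conf \<Rightarrow> real" where
  "decayed s d c = (\<Sum>l\<in>UNIV. \<Sum>u\<in>c l \<inter> {s - A..s}. potential l (s + d - u))"

definition new_weight :: "real \<Rightarrow> real \<Rightarrow> 'k conf \<Rightarrow> real" where
  "new_weight s d c = (\<Sum>k\<in>UNIV. weight k * real (card (c k \<inter> {s<..s + d})))"

lemma lyapunov_measurable: "lyapunov s \<in> borel_measurable (conf_algebra {..s})"
  unfolding lyapunov_def by (intro borel_measurable_sum measurable_sum_conf potential_measurable) auto

lemma decayed_measurable: "decayed s d \<in> borel_measurable (conf_algebra {..s})"
  unfolding decayed_def by (intro borel_measurable_sum measurable_sum_conf potential_measurable) auto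

lemma lyapunov_P [measurable]: "lyapunov s \<in> borel_measurable P"
  and decayed_P [measurable]: "decayed s d \<in> borel_measurable P"
  by (rule measurable_P[OF lyapunov_measurable], rule measurable_P[OF decayed_measurable])

lemma new_weight_P [measurable]: "new_weight s d \<in> borel_measurable P"
  unfolding new_weight_def by (intro borel_measurable_sum borel_measurable_times borel_measurable_const card_P)

lemma lyapunov_nonneg: "0 \<le> lyapunov s c"
  unfolding lyapunov_def using A_pos by (intro sum_nonneg potential_nonneg) auto

lemma decayed_nonneg: "d \<le> A \<Longrightarrow> 0 \<le> decayed s d c"
  unfolding decayed_def by (intro sum_nonneg potential_nonneg) auto

lemma decayed_le: "0 \<le> d \<Longrightarrow> decayed s d c \<le> lyapunov s c"
  unfolding decayed_def lyapunov_def by (intro sum_mono potential_antimono) auto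

lemma new_weight_nonneg: "0 \<le> new_weight s d c"
  unfolding new_weight_def by (intro sum_nonneg mult_nonneg_nonneg weight_nonneg) auto

lemma new_weight_le: "new_weight s d c \<le> weight_sum * real (tot c {s<..s + d})"
  unfolding new_weight_def tot_def of_nat_sum sum_distrib_left
  by (intro sum_mono mult_right_mono weight_le_sum) auto

lemma lyapunov_le: "lyapunov s c \<le> weight_sum * real (tot c {s - A..s})"
proof -
  have "lyapunov s c \<le> (\<Sum>l\<in>UNIV. \<Sum>u\<in>c l \<inter> {s - A..s}. weight_sum)"
    unfolding lyapunov_def
    by (intro sum_mono order_trans[OF potential_le_weight weight_le_sum]) auto
  then show ?thesis by (simp add: tot_def sum_distrib_left mult.commute)
qed

lemma load_le_lyapunov: "load s c \<le> 1 + 4 * lyapunov s c"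
proof -
  have "(\<Sum>l\<in>UNIV. \<Sum>u\<in>c l \<inter> {s - A..s}. 1 / 4) \<le> lyapunov s c"
    unfolding lyapunov_def by (intro sum_mono potential_ge) auto
  then show ?thesis by (simp add: load_def tot_def sum_divide_distrib[symmetric])
qed

lemma lyapunov_step:
  assumes c: "c \<in> configurations" and d: "0 < d" "d \<le> A"
  shows "lyapunov (s + d) c \<le> decayed s d c + new_weight s d c"
proof -
  have "(\<Sum>u\<in>c l \<inter> {s + d - A..s + d}. potential l (s + d - u))
     \<le> (\<Sum>u\<in>c l \<inter> {s - A..s}. potential l (s + d - u)) + weight l * real (card (c l \<inter> {s<..s + d}))" for l
  proof -
    have fin: "finite (c l \<inter> {s - A..s})" "finite (c l \<inter> {s<..s + d})"
      using conf_finite[OF c] by auto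
    have "(\<Sum>u\<in>c l \<inter> {s + d - A..s + d}. potential l (s + d - u))
       \<le> (\<Sum>u\<in>(c l \<inter> {s - A..s}) \<union> (c l \<inter> {s<..s + d}). potential l (s + d - u))"
      using fin d by (intro sum_mono2) (auto intro!: potential_nonneg)
    also have "\<dots> = (\<Sum>u\<in>c l \<inter> {s - A..s}. potential l (s + d - u)) + (\<Sum>u\<in>c l \<inter> {s<..s + d}. potential l (s + d - u))"
      using fin by (intro sum.union_disjoint) auto
    also have "(\<Sum>u\<in>c l \<inter> {s<..s + d}. potential l (s + d - u)) \<le> (\<Sum>u\<in>c l \<inter> {s<..s + d}. weight l)"
      by (intro sum_mono potential_le_weight) auto
    finally show ?thesis by (simp add: mult.commute)
  qed
  then have "lyapunov (s + d) c \<le> (\<Sum>l\<in>UNIV. (\<Sum>u\<in>c l \<inter> {s - A..s}. potential l (s + d - u)) + weight l * real (card (c l \<inter> {s<..s + d})))"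
    unfolding lyapunov_def by (intro sum_mono)
  then show ?thesis by (simp add: sum.distrib decayed_def new_weight_def)
qed

text \<open>
  The old points lose the weighted mean number of their children born in \<open>(s, s + d]\<close>, which
  these children bring back on average, and a part \<open>d / (4 * A)\<close> of the reserve each, which is
  lost for good.
\<close>

lemma decay_balance:
  "decayed s d c + (\<Sum>k\<in>UNIV. weight k * inherited k s d c)
    = lyapunov s c - d / (4 * A) * real (tot c {s - A..s})"
proof -
  have inh: "(\<Sum>k\<in>UNIV. weight k * inherited k s d c)
     = (\<Sum>l\<in>UNIV. \<Sum>u\<in>c l \<inter> {s - A..s}. \<Sum>k\<in>UNIV. weight k * (tail_mass l k (s - u) - tail_mass l k (s + d - u)))"
    unfolding inherited_def sum_distrib_left
    by (subst sum.swap) (intro sum.cong refl sum.swap)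
  have "potential l (s + d - u) + (\<Sum>k\<in>UNIV. weight k * (tail_mass l k (s - u) - tail_mass l k (s + d - u)))
      = potential l (s - u) - d / (4 * A)" for l u
    unfolding potential_def right_diff_distrib sum_subtractf using A_pos by (simp add: field_simps)
  then have "decayed s d c + (\<Sum>k\<in>UNIV. weight k * inherited k s d c)
      = (\<Sum>l\<in>UNIV. \<Sum>u\<in>c l \<inter> {s - A..s}. potential l (s - u) - d / (4 * A))"
    unfolding decayed_def inh sum.distrib[symmetric] by simp
  also have "\<dots> = lyapunov s c - (\<Sum>l\<in>UNIV. \<Sum>u\<in>c l \<inter> {s - A..s}. d / (4 * A))"
    unfolding lyapunov_def sum_subtractf ..
  also have "(\<Sum>l\<in>UNIV. \<Sum>u\<in>c l \<inter> {s - A..s}. d / (4 * A)) = d / (4 * A) * real (tot c {s - A..s})"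
    by (simp add: tot_def sum_distrib_left mult.commute)
  finally show ?thesis .
qed

text \<open>
  Immigrants, children of the old points, and children of points born during the time step.
\<close>

definition new_bound :: "real \<Rightarrow> real \<Rightarrow> 'k conf \<Rightarrow> real" where
  "new_bound s d c = d * (\<Sum>k\<in>UNIV. weight k * \<nu> k) + (\<Sum>k\<in>UNIV. weight k * inherited k s d c)
     + weight_sum * H * birth_const * d\<^sup>2 * load s c"

lemma new_bound_nonneg: "0 \<le> d \<Longrightarrow> 0 \<le> new_bound s d c"
  unfolding new_bound_def using H_pos birth_const_pos load_ge_1[of s c] weight_sum_ge_1
  by (intro add_nonneg_nonneg mult_nonneg_nonneg sum_nonneg weight_nonneg inherited_nonneg less_imp_le[OF \<nu>_pos]) auto

lemma new_bound_P [measurable]: "new_bound s d \<in> borel_measurable P"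
  unfolding new_bound_def
  by (intro borel_measurable_add borel_measurable_times borel_measurable_sum borel_measurable_const inherited_P load_P)

lemma cond_le_new_weight:
  assumes d: "short_time d"
  shows "cond_le s (new_weight s d) (new_bound s d)"
proof -
  have d0: "0 < d" using d by (simp add: short_time_def)
  let ?base = "\<lambda>c. d * (\<Sum>k\<in>UNIV. weight k * \<nu> k) + (\<Sum>k\<in>UNIV. weight k * inherited k s d c)"
  have "cond_le s (new_weight s d)
    (\<lambda>c. \<Sum>k\<in>UNIV. weight k * (\<nu> k * d + inherited k s d c + H * d * real (tot c {s<..s + d})))"
    unfolding new_weight_def by (rule cond_le_compensator[OF d0 weight_nonneg])
  also have "(\<lambda>c. \<Sum>k\<in>UNIV. weight k * (\<nu> k * d + inherited k s d c + H * d * real (tot c {s<..s + d})))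
      = (\<lambda>c. ?base c + weight_sum * H * d * real (tot c {s<..s + d}))"
    by (simp add: fun_eq_iff sum.distrib distrib_left weight_sum_def sum_distrib_left sum_distrib_right mult_ac)
  also have "cond_le s \<dots> (\<lambda>c. ?base c + weight_sum * H * d * (birth_const * d * load s c))"
  proof (rule cond_le_add)
    have pos: "0 \<le> weight_sum * H * d" using weight_sum_ge_1 H_pos d0 by simp
    then show "cond_le s (\<lambda>c. weight_sum * H * d * real (tot c {s<..s + d}))
        (\<lambda>c. weight_sum * H * d * (birth_const * d * load s c))"
      by (intro cond_le_cmult cond_le_births d)
    show base: "0 \<le> ?base c" for c
      using d0 by (intro add_nonneg_nonneg mult_nonneg_nonneg sum_nonneg weight_nonneg inherited_nonneg less_imp_le[OF \<nu>_pos]) auto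
    show "0 \<le> ?base c" for c by (rule base)
    show "0 \<le> weight_sum * H * d * real (tot c {s<..s + d})" for c using pos by simp
    show "0 \<le> weight_sum * H * d * (birth_const * d * load s c)" for c
      using weight_sum_ge_1 H_pos birth_const_pos d0 load_ge_1[of s c] by (intro mult_nonneg_nonneg) auto
    show "?base \<in> borel_measurable P" "?base \<in> borel_measurable P"
      by (intro borel_measurable_add borel_measurable_times borel_measurable_sum borel_measurable_const inherited_P)+
  qed (auto intro!: cond_le_mono borel_measurable_times)
  finally show ?thesis unfolding new_bound_def by (simp add: power2_eq_square mult_ac)
qed

text \<open>
  To first order in \<open>d\<close>, the balance above makes \<open>lyapunov\<close> decrease by a fixed proportion
  \<open>\<kappa> * d\<close>, up to the constant due to immigration. The fluctuations contribute \<open>d\<close> times a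
  lower power of \<open>lyapunov\<close>, which any fraction of the highest power dominates up to a
  constant, and \<open>d\<^sup>2\<close> times the highest power, which is dominated by the drift if \<open>d\<close> is
  small.
\<close>

lemma drift:
  assumes p: "2 \<le> p"
  shows "\<exists>d \<rho> C. 0 < d \<and> 0 \<le> \<rho> \<and> \<rho> < 1 \<and> 0 \<le> C \<and>
    (\<forall>s. cond_le s (\<lambda>c. lyapunov (s + d) c ^ p) (\<lambda>c. \<rho> * lyapunov s c ^ p + C))"
proof -
  let ?W = weight_sum
  have W1: "1 \<le> ?W" by (rule weight_sum_ge_1)
  obtain C2 d2 where C2: "0 < C2" and d2: "0 < d2" "d2 \<le> 1"
    and m2: "\<And>s d. 0 < d \<Longrightarrow> d \<le> d2 \<Longrightarrow> short_time d \<and>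
      cond_le s (\<lambda>c. real (tot c {s<..s + d}) ^ 2) (\<lambda>c. C2 * (d * load s c + d\<^sup>2 * load s c ^ 2))"
    using cond_le_moment[of 2] by auto
  obtain Cp dp where Cp: "0 < Cp" and dp: "0 < dp" "dp \<le> 1"
    and mp: "\<And>s d. 0 < d \<Longrightarrow> d \<le> dp \<Longrightarrow>
      cond_le s (\<lambda>c. real (tot c {s<..s + d}) ^ p) (\<lambda>c. Cp * (d * load s c + d\<^sup>2 * load s c ^ p))"
    using cond_le_moment[of p] p by auto
  define b1 where "b1 = (\<Sum>k\<in>UNIV. weight k * \<nu> k)"
  define b2 where "b2 = ?W * H * birth_const"
  define \<kappa> where "\<kappa> = 1 / (8 * A * ?W)"
  define C3 where "C3 = b1 + b2"
  define C4 where "C4 = 2 ^ p * (?W ^ p * C2 + ?W ^ p * Cp)"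
  define C6 where "C6 = C4 * 8 ^ p"
  have b: "0 \<le> b1" "0 < b2" "0 < \<kappa>" "0 < C3" "0 < C4" "0 < C6"
  proof -
    show b1: "0 \<le> b1" unfolding b1_def
      by (intro sum_nonneg mult_nonneg_nonneg weight_nonneg less_imp_le[OF \<nu>_pos])
    show b2: "0 < b2" unfolding b2_def using W1 H_pos birth_const_pos by simp
    show "0 < \<kappa>" unfolding \<kappa>_def using W1 A_pos by simp
    show "0 < C3" unfolding C3_def using b1 b2 by simp
    show C4: "0 < C4" unfolding C4_def using W1 C2 Cp by (intro mult_pos_pos add_pos_pos) auto
    show "0 < C6" unfolding C6_def using C4 by simp
  qed
  \<comment> \<open>The fourth bound keeps the term with b2 below half of the lost reserve, the fifth one keeps 1 - \<kappa> * d nonnegative, and the last one makes the fluctuations of highest order at most half of the drift.\<close>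
  define d where "d = Min {d2, dp, A, 1 / (8 * A * b2), 1 / \<kappa>, \<kappa> / (2 * C6)}"
  have d_le: "d \<le> d2" "d \<le> dp" "d \<le> A" "d \<le> 1 / (8 * A * b2)" "d \<le> 1 / \<kappa>" "d \<le> \<kappa> / (2 * C6)"
    unfolding d_def by (intro Min_le, auto)+
  have d0: "0 < d" unfolding d_def using d2 dp A_pos b by auto
  have d1: "d \<le> 1" using d_le(1) d2 by simp
  have short: "short_time d" using m2 d0 d_le(1) by blast
  have \<kappa>d: "\<kappa> * d \<le> 1" using d_le(5) b by (simp add: field_simps)
  have C6d: "C6 * d\<^sup>2 \<le> \<kappa> * d / 2"
  proof -
    have "C6 * d \<le> \<kappa> / 2" using d_le(6) b by (simp add: field_simps)
    then have "(C6 * d) * d \<le> \<kappa> / 2 * d" using d0 by (intro mult_right_mono) auto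
    then show ?thesis by (simp add: power2_eq_square algebra_simps)
  qed
  define C7 where "C7 = real p * C3 * (1 + C3) ^ (p - 1) + C4 * 4 ^ p"
  have C7: "0 < C7" unfolding C7_def using b by (intro add_nonneg_pos mult_nonneg_nonneg) auto
  obtain C8 where C8: "0 \<le> C8" "\<And>v. 0 \<le> v \<Longrightarrow> (1 + v) ^ (p - 1) \<le> (\<kappa> * d / (4 * C7)) * v ^ p + C8"
    using lower_power_absorbed[of "\<kappa> * d / (4 * C7)" p] b d0 C7 p by auto
  define \<rho> where "\<rho> = 1 - \<kappa> * d / 4"
  have \<rho>: "0 \<le> \<rho>" "\<rho> < 1" unfolding \<rho>_def using \<kappa>d b d0 by auto
  have le: "cond_le s (\<lambda>c. lyapunov (s + d) c ^ p) (\<lambda>c. \<rho> * lyapunov s c ^ p + (C7 * C8 + C6))" for s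
  proof -
    let ?Y = "decayed s d" and ?J = "new_weight s d" and ?R = "new_bound s d" and ?V = "lyapunov s"
    let ?N = "\<lambda>c. real (tot c {s<..s + d})"
    have Y0: "0 \<le> ?Y c" for c using decayed_nonneg d_le(3) by simp
    have R0: "0 \<le> ?R c" for c using new_bound_nonneg d0 by simp
    have L1: "1 \<le> load s c" for c by (rule load_ge_1)
    have L0: "0 \<le> load s c" for c using L1[of c] by simp
    have "cond_le s (\<lambda>c. lyapunov (s + d) c ^ p)
       (\<lambda>c. ?Y c ^ p + (real p * ?Y c ^ (p - 1) * ?J c + (2 ^ p * ?W\<^sup>2 * ?Y c ^ (p - 2) * ?N c ^ 2 + 2 ^ p * ?W ^ p * ?N c ^ p)))"
    proof (rule cond_le_mono)
      fix c :: "'k conf" assume c: "c \<in> configurations"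
      have "lyapunov (s + d) c ^ p \<le> (?Y c + ?J c) ^ p"
        using lyapunov_step[OF c d0 d_le(3)] lyapunov_nonneg by (intro power_mono)
      also have "\<dots> \<le> ?Y c ^ p + real p * ?Y c ^ (p - 1) * ?J c + 2 ^ p * (?Y c ^ (p - 2) * (?J c)\<^sup>2 + ?J c ^ p)"
        by (rule power_add_le_second_order[OF Y0 new_weight_nonneg p])
      also have "2 ^ p * (?Y c ^ (p - 2) * (?J c)\<^sup>2 + ?J c ^ p) \<le> 2 ^ p * (?Y c ^ (p - 2) * (?W * ?N c)\<^sup>2 + (?W * ?N c) ^ p)"
        using new_weight_le[of s d c] new_weight_nonneg[of s d c] Y0[of c]
        by (intro mult_left_mono add_mono power_mono) auto
      also have "\<dots> = 2 ^ p * ?W\<^sup>2 * ?Y c ^ (p - 2) * ?N c ^ 2 + 2 ^ p * ?W ^ p * ?N c ^ p"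
        by (simp add: algebra_simps power_mult_distrib)
      finally show "lyapunov (s + d) c ^ p
        \<le> ?Y c ^ p + (real p * ?Y c ^ (p - 1) * ?J c + (2 ^ p * ?W\<^sup>2 * ?Y c ^ (p - 2) * ?N c ^ 2 + 2 ^ p * ?W ^ p * ?N c ^ p))"
        by simp
    qed
    also have "cond_le s \<dots>
       (\<lambda>c. ?Y c ^ p + (real p * ?Y c ^ (p - 1) * ?R c + (2 ^ p * ?W\<^sup>2 * ?Y c ^ (p - 2) * (C2 * (d * load s c + d\<^sup>2 * load s c ^ 2))
          + 2 ^ p * ?W ^ p * (Cp * (d * load s c + d\<^sup>2 * load s c ^ p)))))"
    proof (intro cond_le_add)
      have Ym: "(\<lambda>c. ?Y c ^ i) \<in> borel_measurable (conf_algebra {..s})" for i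
        by (intro borel_measurable_power decayed_measurable)
      show "cond_le s (\<lambda>c. ?Y c ^ p) (\<lambda>c. ?Y c ^ p)" by (rule cond_le_mono) simp
      show "cond_le s (\<lambda>c. real p * ?Y c ^ (p - 1) * ?J c) (\<lambda>c. real p * ?Y c ^ (p - 1) * ?R c)"
        using Y0 by (intro cond_le_mult cond_le_new_weight short borel_measurable_times borel_measurable_const Ym) auto
      show "cond_le s (\<lambda>c. 2 ^ p * ?W\<^sup>2 * ?Y c ^ (p - 2) * ?N c ^ 2)
          (\<lambda>c. 2 ^ p * ?W\<^sup>2 * ?Y c ^ (p - 2) * (C2 * (d * load s c + d\<^sup>2 * load s c ^ 2)))"
        using Y0 W1 m2[OF d0 d_le(1), of s]
        by (intro cond_le_mult borel_measurable_times borel_measurable_const Ym) auto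
      show "cond_le s (\<lambda>c. 2 ^ p * ?W ^ p * ?N c ^ p) (\<lambda>c. 2 ^ p * ?W ^ p * (Cp * (d * load s c + d\<^sup>2 * load s c ^ p)))"
        using W1 by (intro cond_le_cmult mp d0 d_le) auto
    qed (use Y0 R0 L0 W1 C2 Cp d0 new_weight_nonneg in \<open>auto intro!: add_nonneg_nonneg mult_nonneg_nonneg
       borel_measurable_add borel_measurable_times borel_measurable_power borel_measurable_const\<close>)
    also have "cond_le s \<dots> (\<lambda>c. \<rho> * ?V c ^ p + (C7 * C8 + C6))"
    proof (rule cond_le_mono)
      fix c :: "'k conf"
      let ?v = "?V c" and ?x = "load s c" and ?t = "real (tot c {s - A..s})"
      have v0: "0 \<le> ?v" by (rule lyapunov_nonneg)
      have x1: "1 \<le> ?x" by (rule L1)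
      have xt: "?x = 1 + ?t" by (simp add: load_def)
      have YV: "?Y c \<le> ?v" using decayed_le d0 by simp
      have VW: "?v \<le> ?W * ?t" by (rule lyapunov_le)
      have Yx: "?Y c \<le> ?W * ?x" using YV VW W1 by (simp add: xt algebra_simps)
      have main: "?Y c + ?R c \<le> (1 - \<kappa> * d) * ?v + C3 * d"
      proof -
        have "?Y c + ?R c = ?v - d / (4 * A) * ?t + d * b1 + b2 * d\<^sup>2 * (1 + ?t)"
          using decay_balance[of s d c] unfolding new_bound_def b1_def b2_def xt by simp
        also have "\<dots> = ?v + d * b1 + b2 * d\<^sup>2 + (b2 * d\<^sup>2 - d / (4 * A)) * ?t" by (simp add: algebra_simps)
        also have "(b2 * d\<^sup>2 - d / (4 * A)) * ?t \<le> - (\<kappa> * d) * ?v"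
        proof -
          have "b2 * d \<le> 1 / (8 * A)" using d_le(4) b A_pos by (simp add: field_simps)
          then have "b2 * d * d \<le> 1 / (8 * A) * d" using d0 by (intro mult_right_mono) auto
          then have "b2 * d\<^sup>2 - d / (4 * A) \<le> - (\<kappa> * d * ?W)"
            unfolding \<kappa>_def using W1 A_pos by (simp add: power2_eq_square mult.assoc field_simps)
          then have "(b2 * d\<^sup>2 - d / (4 * A)) * ?t \<le> - (\<kappa> * d * ?W) * ?t" by (intro mult_right_mono) auto
          also have "\<dots> = - (\<kappa> * d) * (?W * ?t)" by (simp add: mult.assoc)
          also have "\<dots> \<le> - (\<kappa> * d) * ?v" using VW b d0 by (intro mult_left_mono_neg) auto
          finally show ?thesis .
        qed
        also have "b2 * d\<^sup>2 \<le> b2 * d" using b d0 d1 by (simp add: power2_eq_square mult_le_cancel_left1)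
        finally show ?thesis unfolding C3_def by (simp add: algebra_simps)
      qed
      have a0: "0 \<le> (1 - \<kappa> * d) * ?v" using v0 \<kappa>d by simp
      have c0: "0 \<le> C3 * d" using b d0 by simp
      have "?Y c ^ p + real p * ?Y c ^ (p - 1) * ?R c \<le> (?Y c + ?R c) ^ p"
        using Y0 R0 p by (intro power_first_order_le) auto
      also have "\<dots> \<le> ((1 - \<kappa> * d) * ?v + C3 * d) ^ p"
        using main Y0[of c] R0[of c] by (intro power_mono) auto
      also have "\<dots> \<le> ((1 - \<kappa> * d) * ?v) ^ p + real p * (C3 * d) * ((1 - \<kappa> * d) * ?v + C3 * d) ^ (p - 1)"
        using a0 c0 p by (intro power_add_le_first_order) auto
      also have "((1 - \<kappa> * d) * ?v) ^ p \<le> (1 - \<kappa> * d) * ?v ^ p"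
      proof -
        have "(1 - \<kappa> * d) ^ p \<le> (1 - \<kappa> * d) ^ 1"
          using \<kappa>d b d0 p by (intro power_decreasing) auto
        then show ?thesis using v0 by (simp add: power_mult_distrib mult_right_mono)
      qed
      also have "real p * (C3 * d) * ((1 - \<kappa> * d) * ?v + C3 * d) ^ (p - 1)
          \<le> real p * C3 * ((1 + C3) * (1 + ?v)) ^ (p - 1)"
      proof (rule mult_mono)
        show "real p * (C3 * d) \<le> real p * C3" using d1 b d0 by (intro mult_left_mono) (auto simp: mult_le_cancel_left2)
        have "(1 - \<kappa> * d) * ?v \<le> 1 * ?v" using b d0 v0 by (intro mult_right_mono) auto
        moreover have "C3 * d \<le> C3" using d1 b by (simp add: mult_le_cancel_left2)
        moreover have "0 \<le> C3 * ?v" using b v0 by simp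
        ultimately have "(1 - \<kappa> * d) * ?v + C3 * d \<le> (1 + C3) * (1 + ?v)" by (simp add: algebra_simps)
        then show "((1 - \<kappa> * d) * ?v + C3 * d) ^ (p - 1) \<le> ((1 + C3) * (1 + ?v)) ^ (p - 1)"
          using a0 c0 by (intro power_mono) auto
      qed (use a0 c0 b in auto)
      finally have first: "?Y c ^ p + real p * ?Y c ^ (p - 1) * ?R c
          \<le> (1 - \<kappa> * d) * ?v ^ p + real p * C3 * (1 + C3) ^ (p - 1) * (1 + ?v) ^ (p - 1)"
        by (simp add: power_mult_distrib mult.assoc)
      have xp: "?x * ?x ^ (p - 2) = ?x ^ (p - 1)" "?x ^ 2 * ?x ^ (p - 2) = ?x ^ p"
      proof -
        obtain r where "p = 2 + r" using p le_iff_add by blast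
        then show "?x * ?x ^ (p - 2) = ?x ^ (p - 1)" "?x ^ 2 * ?x ^ (p - 2) = ?x ^ p"
          by (simp_all add: power_add power2_eq_square)
      qed
      have "2 ^ p * ?W\<^sup>2 * ?Y c ^ (p - 2) * (C2 * (d * ?x + d\<^sup>2 * ?x ^ 2))
          \<le> 2 ^ p * ?W\<^sup>2 * (?W * ?x) ^ (p - 2) * (C2 * (d * ?x + d\<^sup>2 * ?x ^ 2))"
        using Yx Y0[of c] C2 d0 x1 by (intro mult_right_mono mult_left_mono power_mono) auto
      also have "\<dots> = 2 ^ p * (?W\<^sup>2 * ?W ^ (p - 2)) * C2 * (d * (?x * ?x ^ (p - 2)) + d\<^sup>2 * (?x ^ 2 * ?x ^ (p - 2)))"
        by (simp add: power_mult_distrib algebra_simps)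
      also have "?W\<^sup>2 * ?W ^ (p - 2) = ?W ^ p" by (metis p le_add_diff_inverse power_add)
      finally have e1: "2 ^ p * ?W\<^sup>2 * ?Y c ^ (p - 2) * (C2 * (d * ?x + d\<^sup>2 * ?x ^ 2))
          \<le> 2 ^ p * ?W ^ p * C2 * (d * ?x ^ (p - 1) + d\<^sup>2 * ?x ^ p)" unfolding xp .
      have "?x ^ 1 \<le> ?x ^ (p - 1)" using x1 p by (intro power_increasing) auto
      then have e2: "2 ^ p * ?W ^ p * (Cp * (d * ?x + d\<^sup>2 * ?x ^ p))
          \<le> 2 ^ p * ?W ^ p * (Cp * (d * ?x ^ (p - 1) + d\<^sup>2 * ?x ^ p))"
        using d0 Cp W1 by (intro mult_left_mono add_mono) auto
      have x_le: "?x \<le> 4 * (1 + ?v)" using load_le_lyapunov[of s c] by simp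
      have "?x ^ (p - 1) \<le> (4 * (1 + ?v)) ^ (p - 1)" using x_le x1 by (intro power_mono) auto
      also have "\<dots> = 4 ^ (p - 1) * (1 + ?v) ^ (p - 1)" by (rule power_mult_distrib)
      also have "\<dots> \<le> 4 ^ p * (1 + ?v) ^ (p - 1)" using v0 by (intro mult_right_mono power_increasing) auto
      finally have x_p1: "d * ?x ^ (p - 1) \<le> 1 * (4 ^ p * (1 + ?v) ^ (p - 1))"
        using d0 d1 x1 by (intro mult_mono) auto
      have "?x ^ p \<le> (4 * (1 + ?v)) ^ p" using x_le x1 by (intro power_mono) auto
      also have "\<dots> = 4 ^ p * (1 + ?v) ^ p" by (rule power_mult_distrib)
      also have "\<dots> \<le> 4 ^ p * (2 ^ p * (1 ^ p + ?v ^ p))"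
        using v0 by (intro mult_left_mono power_add_le_2) auto
      also have "\<dots> = 8 ^ p * (1 + ?v ^ p)"
        unfolding mult.assoc[symmetric] power_mult_distrib[symmetric] by simp
      finally have x_p: "d\<^sup>2 * ?x ^ p \<le> d\<^sup>2 * (8 ^ p * (1 + ?v ^ p))" by (intro mult_left_mono) auto
      have "2 ^ p * ?W ^ p * C2 * (d * ?x ^ (p - 1) + d\<^sup>2 * ?x ^ p)
          + 2 ^ p * ?W ^ p * (Cp * (d * ?x ^ (p - 1) + d\<^sup>2 * ?x ^ p)) = C4 * (d * ?x ^ (p - 1) + d\<^sup>2 * ?x ^ p)"
        unfolding C4_def by (simp add: algebra_simps)
      also have "\<dots> \<le> C4 * (1 * (4 ^ p * (1 + ?v) ^ (p - 1)) + d\<^sup>2 * (8 ^ p * (1 + ?v ^ p)))"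
        by (intro mult_left_mono add_mono x_p1 x_p less_imp_le[OF b(5)])
      also have "\<dots> = C4 * 4 ^ p * (1 + ?v) ^ (p - 1) + C6 * d\<^sup>2 * (1 + ?v ^ p)"
        unfolding C6_def by (simp add: algebra_simps)
      also have "C6 * d\<^sup>2 * (1 + ?v ^ p) \<le> C6 + \<kappa> * d / 2 * ?v ^ p"
      proof -
        have "C6 * d\<^sup>2 \<le> C6 * 1" using b d0 d1 by (intro mult_left_mono) (auto simp: power_le_one)
        moreover have "C6 * d\<^sup>2 * ?v ^ p \<le> \<kappa> * d / 2 * ?v ^ p" using C6d v0 by (intro mult_right_mono) auto
        ultimately show ?thesis by (simp add: algebra_simps)
      qed
      finally have err: "2 ^ p * ?W ^ p * C2 * (d * ?x ^ (p - 1) + d\<^sup>2 * ?x ^ p)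
          + 2 ^ p * ?W ^ p * (Cp * (d * ?x ^ (p - 1) + d\<^sup>2 * ?x ^ p))
          \<le> C4 * 4 ^ p * (1 + ?v) ^ (p - 1) + (C6 + \<kappa> * d / 2 * ?v ^ p)" by simp
      have "C7 * (1 + ?v) ^ (p - 1) \<le> C7 * ((\<kappa> * d / (4 * C7)) * ?v ^ p + C8)"
        using C7 v0 by (intro mult_left_mono C8) auto
      also have "\<dots> = \<kappa> * d / 4 * ?v ^ p + C7 * C8" using C7 by (simp add: algebra_simps)
      finally have low: "C7 * (1 + ?v) ^ (p - 1) \<le> \<kappa> * d / 4 * ?v ^ p + C7 * C8" .
      have split: "C7 * (1 + ?v) ^ (p - 1) = real p * C3 * (1 + C3) ^ (p - 1) * (1 + ?v) ^ (p - 1) + C4 * 4 ^ p * (1 + ?v) ^ (p - 1)"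
        unfolding C7_def by (simp add: distrib_right)
      have fin: "(1 - \<kappa> * d) * ?v ^ p + \<kappa> * d / 2 * ?v ^ p + \<kappa> * d / 4 * ?v ^ p = \<rho> * ?v ^ p"
        unfolding \<rho>_def by (simp add: algebra_simps)
      show "?Y c ^ p + (real p * ?Y c ^ (p - 1) * ?R c + (2 ^ p * ?W\<^sup>2 * ?Y c ^ (p - 2) * (C2 * (d * ?x + d\<^sup>2 * ?x ^ 2))
          + 2 ^ p * ?W ^ p * (Cp * (d * ?x + d\<^sup>2 * ?x ^ p)))) \<le> \<rho> * ?v ^ p + (C7 * C8 + C6)"
        using first e1 e2 err low split fin by linarith
    qed
    finally show ?thesis .
  qed
  have "0 \<le> C7 * C8 + C6" using C7 C8 b by simp
  then show ?thesis using d0 \<rho> le by blast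
qed

lemma cond_le_integral: "cond_le s f g \<Longrightarrow> (\<integral>\<^sup>+c. ennreal (f c) \<partial>P) \<le> (\<integral>\<^sup>+c. ennreal (g c) \<partial>P)"
  using cond_leD[of s f g "\<lambda>_. 1"] by simp

lemma births_measurable: "b \<le> t \<Longrightarrow> (\<lambda>c. real (tot c {a<..b})) \<in> borel_measurable (conf_algebra {..t})"
  by (rule measurable_tot) auto

text \<open>
  The iteration of \<open>v \<mapsto> \<rho> * v + C\<close> never exceeds the start by more than the fixed point
  \<open>C / (1 - \<rho>)\<close>.
\<close>

lemma lyapunov_moment_propagates:
  assumes "2 \<le> p"
  shows "\<exists>d C. 0 < d \<and> 0 \<le> C \<and> (\<forall>s n. cond_le s (\<lambda>c. lyapunov (s + real n * d) c ^ p) (\<lambda>c. lyapunov s c ^ p + C))"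
proof -
  obtain d \<rho> C where d: "0 < d" and \<rho>: "0 \<le> \<rho>" "\<rho> < 1" and C: "0 \<le> C"
    and step: "\<And>s. cond_le s (\<lambda>c. lyapunov (s + d) c ^ p) (\<lambda>c. \<rho> * lyapunov s c ^ p + C)"
    using drift[OF assms] by blast
  define C' where "C' = C / (1 - \<rho>)"
  have C': "0 \<le> C'" "\<rho> * C' + C = C'" unfolding C'_def using \<rho> C by (auto simp: field_simps)
  have V0: "0 \<le> lyapunov s c ^ p" for s c using lyapunov_nonneg by simp
  have "cond_le s (\<lambda>c. lyapunov (s + real n * d) c ^ p) (\<lambda>c. lyapunov s c ^ p + C')" for s n
  proof (induction n)
    case 0
    show ?case using C' by (intro cond_le_mono) simp
  next
    case (Suc n)
    have eq: "s + real (Suc n) * d = (s + real n * d) + d" by (simp add: algebra_simps)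
    have "cond_le (s + real n * d) (\<lambda>c. lyapunov (s + real (Suc n) * d) c ^ p) (\<lambda>c. \<rho> * lyapunov (s + real n * d) c ^ p + C)"
      unfolding eq by (rule step)
    then have "cond_le s (\<lambda>c. lyapunov (s + real (Suc n) * d) c ^ p) (\<lambda>c. \<rho> * lyapunov (s + real n * d) c ^ p + C)"
      by (rule cond_le_later) (use d in simp)
    also have "cond_le s \<dots> (\<lambda>c. \<rho> * (lyapunov s c ^ p + C') + C)"
    proof (rule cond_le_add)
      show "cond_le s (\<lambda>c. \<rho> * lyapunov (s + real n * d) c ^ p) (\<lambda>c. \<rho> * (lyapunov s c ^ p + C'))"
        by (rule cond_le_cmult[OF Suc \<rho>(1)])
      show "cond_le s (\<lambda>_. C) (\<lambda>_. C)" by (rule cond_le_mono) simp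
    qed (use \<rho> C C' V0 in \<open>auto intro!: mult_nonneg_nonneg add_nonneg_nonneg\<close>)
    also have "cond_le s \<dots> (\<lambda>c. lyapunov s c ^ p + C')"
    proof (rule cond_le_mono)
      fix c
      have "\<rho> * lyapunov s c ^ p \<le> 1 * lyapunov s c ^ p" using \<rho> V0 by (intro mult_right_mono) auto
      then show "\<rho> * (lyapunov s c ^ p + C') + C \<le> lyapunov s c ^ p + C'"
        using C'(2) by (simp add: distrib_left)
    qed
    finally show ?case .
  qed
  then show ?thesis using d C' by blast
qed

lemma load_power_le_lyapunov: "load s c ^ p \<le> 8 ^ p * (1 + lyapunov s c ^ p)"
proof -
  have "load s c ^ p \<le> (4 * (1 + lyapunov s c)) ^ p"
    using load_le_lyapunov[of s c] load_ge_1[of s c] by (intro power_mono) auto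
  also have "\<dots> = 4 ^ p * (1 + lyapunov s c) ^ p" by (rule power_mult_distrib)
  also have "\<dots> \<le> 4 ^ p * (2 ^ p * (1 ^ p + lyapunov s c ^ p))"
    using lyapunov_nonneg by (intro mult_left_mono power_add_le_2) auto
  also have "\<dots> = 8 ^ p * (1 + lyapunov s c ^ p)"
    unfolding mult.assoc[symmetric] power_mult_distrib[symmetric] by simp
  finally show ?thesis .
qed

lemma lyapunov_power_le_load: "lyapunov s c ^ p \<le> weight_sum ^ p * load s c ^ p"
proof -
  have "lyapunov s c \<le> weight_sum * load s c"
    using lyapunov_le[of s c] weight_sum_ge_1 by (simp add: load_def algebra_simps)
  then have "lyapunov s c ^ p \<le> (weight_sum * load s c) ^ p" using lyapunov_nonneg by (intro power_mono)
  then show ?thesis by (simp add: power_mult_distrib)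
qed

lemma load_moment_propagates_short:
  assumes "0 < p"
  shows "\<exists>C>0. \<exists>d0>0. \<forall>s t. s \<le> t \<longrightarrow> t \<le> s + d0 \<longrightarrow> cond_le s (\<lambda>c. load t c ^ p) (\<lambda>c. C * load s c ^ p)"
proof -
  obtain Cp dp where Cp: "0 < Cp" and dp: "0 < dp" "dp \<le> 1"
    and mp: "\<And>s d. 0 < d \<Longrightarrow> d \<le> dp \<Longrightarrow>
      cond_le s (\<lambda>c. real (tot c {s<..s + d}) ^ p) (\<lambda>c. Cp * (d * load s c + d\<^sup>2 * load s c ^ p))"
    using cond_le_moment[OF assms] by auto
  have "cond_le s (\<lambda>c. load t c ^ p) (\<lambda>c. (2 ^ p * (1 + 2 * Cp)) * load s c ^ p)" if st: "s \<le> t" "t \<le> s + dp" for s t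
  proof -
    have L: "0 \<le> load s c" for c using load_ge_1[of s c] by simp
    have "cond_le s (\<lambda>c. load t c ^ p) (\<lambda>c. 2 ^ p * (load s c ^ p + real (tot c {s<..s + dp}) ^ p))"
    proof (rule cond_le_mono)
      fix c :: "'k conf" assume c: "c \<in> configurations"
      have "load t c \<le> load s c + real (tot c {s<..t})" by (rule load_le_add_births[OF c st(1)])
      also have "real (tot c {s<..t}) \<le> real (tot c {s<..s + dp})"
      proof -
        have "{s<..t} \<subseteq> {s<..s + dp}" using st(2) by auto
        then show ?thesis using tot_mono[OF c bounded_Ioc] by simp
      qed
      finally have "load t c ^ p \<le> (load s c + real (tot c {s<..s + dp})) ^ p"
        using load_ge_1[of t c] by (intro power_mono) auto
      also have "\<dots> \<le> 2 ^ p * (load s c ^ p + real (tot c {s<..s + dp}) ^ p)"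
        using L by (intro power_add_le_2) auto
      finally show "load t c ^ p \<le> 2 ^ p * (load s c ^ p + real (tot c {s<..s + dp}) ^ p)" .
    qed
    also have "cond_le s \<dots> (\<lambda>c. 2 ^ p * (load s c ^ p + Cp * (dp * load s c + dp\<^sup>2 * load s c ^ p)))"
    proof (intro cond_le_cmult cond_le_add mp dp order_refl)
      show "cond_le s (\<lambda>c. load s c ^ p) (\<lambda>c. load s c ^ p)" by (rule cond_le_mono) simp
    qed (use L Cp dp in \<open>auto intro!: mult_nonneg_nonneg add_nonneg_nonneg\<close>)
    also have "cond_le s \<dots> (\<lambda>c. (2 ^ p * (1 + 2 * Cp)) * load s c ^ p)"
    proof (rule cond_le_mono)
      fix c
      have "load s c ^ 1 \<le> load s c ^ p" using assms load_ge_1[of s c] by (intro power_increasing) auto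
      then have "dp * load s c \<le> 1 * load s c ^ p" using dp L by (intro mult_mono) auto
      moreover have "dp\<^sup>2 * load s c ^ p \<le> 1 * load s c ^ p"
        using dp L by (intro mult_right_mono) (auto simp: power_le_one)
      ultimately have "Cp * (dp * load s c + dp\<^sup>2 * load s c ^ p) \<le> Cp * (2 * load s c ^ p)"
        using Cp by (intro mult_left_mono) auto
      then have "2 ^ p * (load s c ^ p + Cp * (dp * load s c + dp\<^sup>2 * load s c ^ p)) \<le> 2 ^ p * (load s c ^ p + Cp * (2 * load s c ^ p))"
        by (rule mult_left_mono[OF add_left_mono]) simp
      then show "2 ^ p * (load s c ^ p + Cp * (dp * load s c + dp\<^sup>2 * load s c ^ p)) \<le> (2 ^ p * (1 + 2 * Cp)) * load s c ^ p"
        by (simp add: algebra_simps)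
    qed
    finally show ?thesis .
  qed
  moreover have "0 < 2 ^ p * (1 + 2 * Cp)" using Cp by simp
  ultimately show ?thesis using dp by blast
qed

text \<open>
  \<open>lyapunov\<close> is comparable to the load and controls it at the times \<open>s + n * d\<close> uniformly in
  \<open>n\<close>; the remaining time is bounded, and there the short-time estimate suffices.
\<close>

lemma load_moment_propagates:
  assumes p: "2 \<le> p"
  shows "\<exists>C>0. \<forall>s t. s \<le> t \<longrightarrow> cond_le s (\<lambda>c. load t c ^ p) (\<lambda>c. C * load s c ^ p)"
proof -
  obtain d C where d: "0 < d" and C: "0 \<le> C"
    and V: "\<And>s n. cond_le s (\<lambda>c. lyapunov (s + real n * d) c ^ p) (\<lambda>c. lyapunov s c ^ p + C)"
    using lyapunov_moment_propagates[OF p] by blast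
  obtain D d0 where D: "0 < D" and d0: "0 < d0"
    and short: "\<And>s t. s \<le> t \<Longrightarrow> t \<le> s + d0 \<Longrightarrow> cond_le s (\<lambda>c. load t c ^ p) (\<lambda>c. D * load s c ^ p)"
    using load_moment_propagates_short[of p] p by auto
  \<comment> \<open>The remainder of the division of t - s by d is bridged by finitely many steps of length d0.\<close>
  have many: "cond_le s (\<lambda>c. load t c ^ p) (\<lambda>c. D ^ m * load s c ^ p)"
    if "s \<le> t" "t \<le> s + real m * d0" for s t m
    using that
  proof (induction m arbitrary: t)
    case 0
    then show ?case by (intro cond_le_mono) simp
  next
    case (Suc m)
    define t' where "t' = max s (t - d0)"
    have t': "s \<le> t'" "t' \<le> s + real m * d0" "t' \<le> t" "t \<le> t' + d0"
      using Suc.prems d0 unfolding t'_def by (auto simp: algebra_simps max_def)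
    have "cond_le s (\<lambda>c. load t c ^ p) (\<lambda>c. D * load t' c ^ p)"
      by (rule cond_le_later[OF short[OF t'(3,4)] t'(1)])
    also have "cond_le s \<dots> (\<lambda>c. D * (D ^ m * load s c ^ p))"
      using D by (intro cond_le_cmult Suc.IH t') auto
    finally show ?case by (simp add: mult.assoc)
  qed
  define m where "m = nat \<lceil>d / d0\<rceil>"
  have "d / d0 \<le> real m" unfolding m_def by linarith
  then have m: "d \<le> real m * d0" using d0 by (simp add: pos_divide_le_eq)
  define E where "E = D ^ m * (8 ^ p * (1 + weight_sum ^ p + C))"
  have "cond_le s (\<lambda>c. load t c ^ p) (\<lambda>c. E * load s c ^ p)" if st: "s \<le> t" for s t
  proof -
    define n where "n = nat \<lfloor>(t - s) / d\<rfloor>"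
    have n: "real n \<le> (t - s) / d" "(t - s) / d < real n + 1"
      unfolding n_def using st d by (auto simp: of_nat_nat)
    have n': "s + real n * d \<le> t" "t \<le> s + real n * d + d"
      using n d by (auto simp: field_simps)
    have "cond_le s (\<lambda>c. load t c ^ p) (\<lambda>c. D ^ m * load (s + real n * d) c ^ p)"
      by (rule cond_le_later[OF many]) (use n' m d in auto)
    also have "cond_le s \<dots> (\<lambda>c. D ^ m * (8 ^ p * (1 + lyapunov (s + real n * d) c ^ p)))"
      using D by (intro cond_le_cmult cond_le_mono load_power_le_lyapunov) auto
    also have "cond_le s \<dots> (\<lambda>c. D ^ m * (8 ^ p * (1 + (lyapunov s c ^ p + C))))"
    proof (intro cond_le_cmult cond_le_add V)
      show "cond_le s (\<lambda>_. 1) (\<lambda>_. 1)" by (rule cond_le_mono) simp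
    qed (use D C lyapunov_nonneg in auto)
    also have "cond_le s \<dots> (\<lambda>c. E * load s c ^ p)"
    proof (rule cond_le_mono)
      fix c
      have L: "1 \<le> load s c ^ p" using load_ge_1[of s c] by simp
      have "C * 1 \<le> C * load s c ^ p" using C L by (intro mult_left_mono) auto
      then have "1 + (lyapunov s c ^ p + C) \<le> (1 + weight_sum ^ p + C) * load s c ^ p"
        using L lyapunov_power_le_load[of s c p] by (simp add: algebra_simps)
      then have "D ^ m * (8 ^ p * (1 + (lyapunov s c ^ p + C))) \<le> D ^ m * (8 ^ p * ((1 + weight_sum ^ p + C) * load s c ^ p))"
        using D by (intro mult_left_mono) auto
      then show "D ^ m * (8 ^ p * (1 + (lyapunov s c ^ p + C))) \<le> E * load s c ^ p"
        unfolding E_def by (simp add: mult.assoc)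
    qed
    finally show ?thesis .
  qed
  moreover have "0 < E" unfolding E_def using D C weight_sum_ge_1
    by (intro mult_pos_pos add_pos_nonneg) auto
  ultimately show ?thesis by blast
qed

lemma lyapunov_shift: "lyapunov s (shift_conf u c) = lyapunov (s - u) c"
proof -
  have "{x. x + u \<in> {s - A..s}} = {s - u - A..s - u}" by auto
  then show ?thesis unfolding lyapunov_def shift_conf_sum by (simp add: algebra_simps)
qed

text \<open>
  By stationarity, the moments at times \<open>s\<close> and \<open>s + d\<close> agree, and the drift gives
  \<open>m \<le> \<rho> * m + C\<close>. As \<open>m\<close> is not yet known to be finite, the comparison is made for the moment
  truncated at a level, with the drift applied on the set where the truncation has no effect.
\<close>

lemma lyapunov_moment_finite:
  assumes p: "2 \<le> p"
  shows "\<exists>C\<ge>0. \<forall>s. (\<integral>\<^sup>+c. ennreal (lyapunov s c ^ p) \<partial>P) \<le> ennreal C"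
proof -
  obtain d \<rho> C where d: "0 < d" and \<rho>: "0 \<le> \<rho>" "\<rho> < 1" and C: "0 \<le> C"
    and step: "\<And>s. cond_le s (\<lambda>c. lyapunov (s + d) c ^ p) (\<lambda>c. \<rho> * lyapunov s c ^ p + C)"
    using drift[OF p] by blast
  have V0: "0 \<le> lyapunov s c ^ p" for s c using lyapunov_nonneg by simp
  have bound: "(\<integral>\<^sup>+c. ennreal (lyapunov s c ^ p) \<partial>P) \<le> ennreal (C / (1 - \<rho>))" for s
  proof -
    \<comment> \<open>These sets belong to the history at time s, so that the conditional estimate applies on them.\<close>
    define F where "F m = {c \<in> space (conf_algebra {..s}). lyapunov s c ^ p \<le> real m}" for m :: nat
    have F: "F m \<in> sets (conf_algebra {..s})" for m
      unfolding F_def by (intro borel_measurable_le borel_measurable_power lyapunov_measurable borel_measurable_const)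
    have IF: "(indicator (F m) :: _ \<Rightarrow> ennreal) \<in> borel_measurable (conf_algebra {..s})" for m
      using F by simp
    have IFP: "(indicator (F m) :: _ \<Rightarrow> ennreal) \<in> borel_measurable P" for m
      unfolding measurable_P_eq by (rule measurable_conf_algebra_mono[OF IF]) simp
    have VP: "(\<lambda>c. ennreal (lyapunov t c ^ p)) \<in> borel_measurable P" for t by measurable
    have trunc: "(\<integral>\<^sup>+c. indicator (F m) c * ennreal (lyapunov s c ^ p) \<partial>P) \<le> ennreal (C / (1 - \<rho>))" for m
    proof -
      let ?X = "\<integral>\<^sup>+c. indicator (F m) c * ennreal (lyapunov s c ^ p) \<partial>P"
      let ?B = "\<integral>\<^sup>+c. (1 - indicator (F m) c) * ennreal (real m) \<partial>P"
      have cP: "(\<lambda>c. (1 - indicator (F m) c) * ennreal (real m)) \<in> borel_measurable P"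
        using IFP by measurable
      have "(\<integral>\<^sup>+c. ennreal (min (lyapunov s c ^ p) (real m)) \<partial>P)
          = (\<integral>\<^sup>+c. ennreal (min (lyapunov (s + d) (shift_conf d c) ^ p) (real m)) \<partial>P)"
        by (simp add: lyapunov_shift)
      also have "\<dots> = (\<integral>\<^sup>+c. ennreal (min (lyapunov (s + d) c ^ p) (real m)) \<partial>P)"
        by (rule nn_integral_shift[of "\<lambda>c. ennreal (min (lyapunov (s + d) c ^ p) (real m))"]) measurable
      also have "\<dots> \<le> (\<integral>\<^sup>+c. indicator (F m) c * ennreal (lyapunov (s + d) c ^ p) + (1 - indicator (F m) c) * ennreal (real m) \<partial>P)"
        by (intro nn_integral_mono) (auto simp: indicator_def intro: ennreal_leI)
      also have "\<dots> = (\<integral>\<^sup>+c. indicator (F m) c * ennreal (lyapunov (s + d) c ^ p) \<partial>P) + ?B"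
        by (rule nn_integral_add[OF borel_measurable_times_ennreal[OF IFP VP] cP])
      also have "(\<integral>\<^sup>+c. indicator (F m) c * ennreal (lyapunov (s + d) c ^ p) \<partial>P)
          \<le> (\<integral>\<^sup>+c. indicator (F m) c * ennreal (\<rho> * lyapunov s c ^ p + C) \<partial>P)"
        by (rule cond_leD[OF step IF])
      also have "\<dots> \<le> (\<integral>\<^sup>+c. ennreal \<rho> * (indicator (F m) c * ennreal (lyapunov s c ^ p)) + ennreal C \<partial>P)"
        using \<rho> C V0 by (intro nn_integral_mono) (auto simp: indicator_def ennreal_plus ennreal_mult)
      also have "\<dots> = ennreal \<rho> * ?X + ennreal C"
        using prob_space.emeasure_space_1[OF prob] IFP VP
        by (subst nn_integral_add) (auto simp: nn_integral_cmult)
      finally have up: "(\<integral>\<^sup>+c. ennreal (min (lyapunov s c ^ p) (real m)) \<partial>P) \<le> ennreal \<rho> * ?X + ennreal C + ?B"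
        by (simp add: add_right_mono)
      have "?X + ?B = (\<integral>\<^sup>+c. indicator (F m) c * ennreal (lyapunov s c ^ p) + (1 - indicator (F m) c) * ennreal (real m) \<partial>P)"
        by (rule nn_integral_add[symmetric, OF borel_measurable_times_ennreal[OF IFP VP] cP])
      also have "\<dots> = (\<integral>\<^sup>+c. ennreal (min (lyapunov s c ^ p) (real m)) \<partial>P)"
        by (intro nn_integral_cong) (auto simp: F_def indicator_def space_P min_def)
      finally have low: "?X + ?B \<le> ennreal \<rho> * ?X + ennreal C + ?B" using up by simp
      have fin: "(\<integral>\<^sup>+c. k c \<partial>P) \<le> ennreal (real m)" if "\<And>c. k c \<le> ennreal (real m)" for k :: "'k conf \<Rightarrow> ennreal"
        using nn_integral_mono[of P k "\<lambda>_. ennreal (real m)"] that prob_space.emeasure_space_1[OF prob] by simp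
      have "?X \<le> ennreal (real m)" by (rule fin) (auto simp: indicator_def F_def intro: ennreal_leI)
      then obtain x where x: "?X = ennreal x" "0 \<le> x" by (cases ?X) (auto simp: top_unique)
      have "?B \<le> ennreal (real m)" by (rule fin) (auto simp: indicator_def)
      then obtain y where y: "?B = ennreal y" "0 \<le> y" by (cases ?B) (auto simp: top_unique)
      have "ennreal (x + y) \<le> ennreal (\<rho> * x + C + y)"
        using low x y \<rho> C by (simp add: ennreal_plus ennreal_mult)
      then have "x + y \<le> \<rho> * x + C + y" using x y \<rho> C by (subst (asm) ennreal_le_iff) auto
      then have "x \<le> C / (1 - \<rho>)" using \<rho> by (simp add: field_simps)
      then show ?thesis unfolding x(1) by (rule ennreal_leI)
    qed
    have "(\<integral>\<^sup>+c. ennreal (lyapunov s c ^ p) \<partial>P) = (\<integral>\<^sup>+c. (SUP m. indicator (F m) c * ennreal (lyapunov s c ^ p)) \<partial>P)"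
    proof (rule nn_integral_cong)
      fix c assume "c \<in> space P"
      then have c: "c \<in> configurations" by (simp add: space_P)
      obtain m :: nat where "lyapunov s c ^ p \<le> real m" using real_arch_simple by blast
      then have "c \<in> F m" using c by (auto simp: F_def)
      then have "ennreal (lyapunov s c ^ p) \<le> (SUP m. indicator (F m) c * ennreal (lyapunov s c ^ p))"
        by (intro SUP_upper2[of m]) auto
      moreover have "(SUP m. indicator (F m) c * ennreal (lyapunov s c ^ p)) \<le> ennreal (lyapunov s c ^ p)"
        by (intro SUP_least) (auto simp: indicator_def)
      ultimately show "ennreal (lyapunov s c ^ p) = (SUP m. indicator (F m) c * ennreal (lyapunov s c ^ p))"
        by (rule antisym)
    qed
    also have "\<dots> = (SUP m. \<integral>\<^sup>+c. indicator (F m) c * ennreal (lyapunov s c ^ p) \<partial>P)"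
    proof (rule nn_integral_monotone_convergence_SUP)
      show "incseq (\<lambda>m c. indicator (F m) c * ennreal (lyapunov s c ^ p))"
        by (auto simp: incseq_def le_fun_def F_def indicator_def)
    qed (intro borel_measurable_times_ennreal IFP VP)
    also have "\<dots> \<le> ennreal (C / (1 - \<rho>))" by (intro SUP_least trunc)
    finally show ?thesis .
  qed
  have "0 \<le> C / (1 - \<rho>)" using C \<rho> by simp
  then show ?thesis using bound by blast
qed

lemma load_moment_finite:
  assumes p: "2 \<le> p"
  shows "\<exists>C\<ge>0. \<forall>s. (\<integral>\<^sup>+c. ennreal (load s c ^ p) \<partial>P) \<le> ennreal C"
proof -
  obtain C where C: "0 \<le> C" and V: "\<And>s. (\<integral>\<^sup>+c. ennreal (lyapunov s c ^ p) \<partial>P) \<le> ennreal C"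
    using lyapunov_moment_finite[OF p] by blast
  have "(\<integral>\<^sup>+c. ennreal (load s c ^ p) \<partial>P) \<le> ennreal (8 ^ p * (1 + C))" for s
  proof -
    have "(\<integral>\<^sup>+c. ennreal (load s c ^ p) \<partial>P) \<le> (\<integral>\<^sup>+c. ennreal (8 ^ p) * (1 + ennreal (lyapunov s c ^ p)) \<partial>P)"
    proof (rule nn_integral_mono)
      fix c
      have "ennreal (load s c ^ p) \<le> ennreal (8 ^ p * (1 + lyapunov s c ^ p))"
        by (rule ennreal_leI[OF load_power_le_lyapunov])
      also have "\<dots> = ennreal (8 ^ p) * (1 + ennreal (lyapunov s c ^ p))"
        using lyapunov_nonneg[of s c] by (subst ennreal_mult) (auto simp: ennreal_plus)
      finally show "ennreal (load s c ^ p) \<le> ennreal (8 ^ p) * (1 + ennreal (lyapunov s c ^ p))" .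
    qed
    also have "\<dots> = ennreal (8 ^ p) * (1 + (\<integral>\<^sup>+c. ennreal (lyapunov s c ^ p) \<partial>P))"
      using prob_space.emeasure_space_1[OF prob]
      by (subst nn_integral_cmult) (auto simp: nn_integral_add)
    also have "\<dots> \<le> ennreal (8 ^ p) * (1 + ennreal C)"
      by (intro mult_left_mono add_left_mono V) auto
    also have "\<dots> = ennreal (8 ^ p * (1 + C))"
      using C by (subst ennreal_mult) (auto simp: ennreal_plus)
    finally show ?thesis .
  qed
  then show ?thesis using C by (intro exI[of _ "8 ^ p * (1 + C)"]) auto
qed

section \<open>Points in short cells\<close>

text \<open>
  The product is a mixed moment of the load before the time step and of the number of new
  points; a factor \<open>d\<close> is gained because at least one point has to be born.
\<close>

lemma births_times_load:
  assumes p: "2 \<le> p"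
  shows "\<exists>C>0. \<exists>d0>0. \<forall>s d. 0 < d \<longrightarrow> d \<le> d0 \<longrightarrow>
    cond_le s (\<lambda>c. real (tot c {s<..s + d}) * load (s + d) c ^ p) (\<lambda>c. C * d * load s c ^ (p + 1))"
proof -
  obtain Cp dp where Cp: "0 < Cp" and dp: "0 < dp" "dp \<le> 1"
    and mp: "\<And>s d. 0 < d \<Longrightarrow> d \<le> dp \<Longrightarrow> short_time d \<and>
      cond_le s (\<lambda>c. real (tot c {s<..s + d}) ^ (p + 1)) (\<lambda>c. Cp * (d * load s c + d\<^sup>2 * load s c ^ (p + 1)))"
    using cond_le_moment[of "p + 1"] by auto
  define C where "C = 2 ^ p * (birth_const + 2 * Cp)"
  have C: "0 < C" unfolding C_def using birth_const_pos Cp by simp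
  have "cond_le s (\<lambda>c. real (tot c {s<..s + d}) * load (s + d) c ^ p) (\<lambda>c. C * d * load s c ^ (p + 1))"
    if d: "0 < d" "d \<le> dp" for s d
  proof -
    let ?N = "\<lambda>c. real (tot c {s<..s + d})"
    have L: "0 \<le> load s c" for c using load_ge_1[of s c] by simp
    have "cond_le s (\<lambda>c. ?N c * load (s + d) c ^ p) (\<lambda>c. 2 ^ p * (load s c ^ p * ?N c + ?N c ^ (p + 1)))"
    proof (rule cond_le_mono)
      fix c :: "'k conf" assume c: "c \<in> configurations"
      have "load (s + d) c ^ p \<le> (load s c + ?N c) ^ p"
        using load_le_add_births[OF c, of s "s + d"] load_ge_1[of "s + d" c] d by (intro power_mono) auto
      also have "\<dots> \<le> 2 ^ p * (load s c ^ p + ?N c ^ p)" using L by (intro power_add_le_2) auto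
      finally have "?N c * load (s + d) c ^ p \<le> ?N c * (2 ^ p * (load s c ^ p + ?N c ^ p))" by (intro mult_left_mono) auto
      then show "?N c * load (s + d) c ^ p \<le> 2 ^ p * (load s c ^ p * ?N c + ?N c ^ (p + 1))"
        by (simp add: algebra_simps)
    qed
    also have "cond_le s \<dots> (\<lambda>c. 2 ^ p * (load s c ^ p * (birth_const * d * load s c) + Cp * (d * load s c + d\<^sup>2 * load s c ^ (p + 1))))"
    proof (intro cond_le_cmult cond_le_add)
      show "cond_le s (\<lambda>c. load s c ^ p * ?N c) (\<lambda>c. load s c ^ p * (birth_const * d * load s c))"
        using mp[OF d] L by (intro cond_le_mult cond_le_births borel_measurable_power load_measurable) auto
      show "cond_le s (\<lambda>c. ?N c ^ (p + 1)) (\<lambda>c. Cp * (d * load s c + d\<^sup>2 * load s c ^ (p + 1)))"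
        using mp[OF d] by blast
      show "0 \<le> load s c ^ p * (birth_const * d * load s c)" for c
        using L birth_const_pos d by (intro mult_nonneg_nonneg) auto
      show "0 \<le> Cp * (d * load s c + d\<^sup>2 * load s c ^ (p + 1))" for c
        using L Cp d by (intro mult_nonneg_nonneg add_nonneg_nonneg) auto
      show "0 \<le> load s c ^ p * ?N c" for c using L by (intro mult_nonneg_nonneg) auto
    qed (auto intro!: borel_measurable_times borel_measurable_add borel_measurable_power)
    also have "cond_le s \<dots> (\<lambda>c. C * d * load s c ^ (p + 1))"
    proof (rule cond_le_mono)
      fix c
      have "load s c ^ 1 \<le> load s c ^ (p + 1)" using load_ge_1[of s c] by (intro power_increasing) auto
      then have "d * load s c \<le> d * load s c ^ (p + 1)" using d by (intro mult_left_mono) auto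
      moreover have "d\<^sup>2 * load s c ^ (p + 1) \<le> d * load s c ^ (p + 1)"
        using d dp L by (intro mult_right_mono) (auto simp: power2_eq_square mult_le_cancel_left1)
      ultimately have "Cp * (d * load s c + d\<^sup>2 * load s c ^ (p + 1)) \<le> Cp * (2 * (d * load s c ^ (p + 1)))"
        using Cp by (intro mult_left_mono) auto
      then have "2 ^ p * (load s c ^ p * (birth_const * d * load s c) + Cp * (d * load s c + d\<^sup>2 * load s c ^ (p + 1)))
         \<le> 2 ^ p * (load s c ^ p * (birth_const * d * load s c) + Cp * (2 * (d * load s c ^ (p + 1))))"
        by (rule mult_left_mono[OF add_left_mono]) simp
      then show "2 ^ p * (load s c ^ p * (birth_const * d * load s c) + Cp * (d * load s c + d\<^sup>2 * load s c ^ (p + 1)))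
         \<le> C * d * load s c ^ (p + 1)"
        unfolding C_def by (simp add: algebra_simps)
    qed
    finally show ?thesis .
  qed
  then show ?thesis using C dp by blast
qed

lemma births_then_load:
  assumes p: "2 \<le> p"
  shows "\<exists>C>0. \<exists>d0>0. \<forall>s d t. 0 < d \<longrightarrow> d \<le> d0 \<longrightarrow> s + d \<le> t \<longrightarrow>
    cond_le s (\<lambda>c. real (tot c {s<..s + d}) * load t c ^ p) (\<lambda>c. C * d * load s c ^ (p + 1))"
proof -
  obtain B d0 where B: "0 < B" and d0: "0 < d0" and b: "\<And>s d. 0 < d \<Longrightarrow> d \<le> d0 \<Longrightarrow>
    cond_le s (\<lambda>c. real (tot c {s<..s + d}) * load (s + d) c ^ p) (\<lambda>c. B * d * load s c ^ (p + 1))"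
    using births_times_load[OF p] by blast
  obtain L where L: "0 < L" and l: "\<And>s t. s \<le> t \<Longrightarrow> cond_le s (\<lambda>c. load t c ^ p) (\<lambda>c. L * load s c ^ p)"
    using load_moment_propagates[OF p] by blast
  have "cond_le s (\<lambda>c. real (tot c {s<..s + d}) * load t c ^ p) (\<lambda>c. (L * B) * d * load s c ^ (p + 1))"
    if d: "0 < d" "d \<le> d0" "s + d \<le> t" for s d t
  proof -
    have "cond_le (s + d) (\<lambda>c. real (tot c {s<..s + d}) * load t c ^ p) (\<lambda>c. real (tot c {s<..s + d}) * (L * load (s + d) c ^ p))"
      by (intro cond_le_mult l d births_measurable) auto
    then have "cond_le s (\<lambda>c. real (tot c {s<..s + d}) * load t c ^ p) (\<lambda>c. real (tot c {s<..s + d}) * (L * load (s + d) c ^ p))"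
      by (rule cond_le_later) (use d in simp)
    also have "(\<lambda>c. real (tot c {s<..s + d}) * (L * load (s + d) c ^ p)) = (\<lambda>c. L * (real (tot c {s<..s + d}) * load (s + d) c ^ p))"
      by (simp add: fun_eq_iff mult_ac)
    also have "cond_le s \<dots> (\<lambda>c. L * (B * d * load s c ^ (p + 1)))"
      using L by (intro cond_le_cmult b d) auto
    finally show ?thesis by (simp add: mult.assoc)
  qed
  then show ?thesis using L B d0 by (intro exI[of _ "L * B"] conjI exI[of _ d0]) auto
qed

text \<open>
  For \<open>d \<le> A\<close>, the windows at the ends of \<open>[s, s + d]\<close> cover every window in between.
\<close>

lemma load_le_two:
  assumes "c \<in> configurations" "s \<le> t" "t \<le> s + d" "0 < d" "d \<le> A"
  shows "load t c \<le> load s c + load (s + d) c"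
proof -
  have "tot c {t - A..t} \<le> tot c ({s - A..s} \<union> {s + d - A..s + d})"
    using assms by (intro tot_mono) auto
  also have "\<dots> \<le> tot c {s - A..s} + tot c {s + d - A..s + d}" by (rule tot_Un_le)
  finally show ?thesis by (simp add: load_def)
qed

lemma integral_load_bound:
  assumes le: "cond_le s f (\<lambda>c. K * load a c ^ 4)" and K: "0 \<le> K" and M: "0 \<le> M"
    and fin: "(\<integral>\<^sup>+c. ennreal (load a c ^ 4) \<partial>P) \<le> ennreal M"
  shows "(\<integral>\<^sup>+c. ennreal (f c) \<partial>P) \<le> ennreal (K * M)"
proof -
  have "(\<integral>\<^sup>+c. ennreal (f c) \<partial>P) \<le> (\<integral>\<^sup>+c. ennreal (K * load a c ^ 4) \<partial>P)" by (rule cond_le_integral[OF le])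
  also have "\<dots> = (\<integral>\<^sup>+c. ennreal K * ennreal (load a c ^ 4) \<partial>P)" using K by (simp add: ennreal_mult')
  also have "\<dots> = ennreal K * (\<integral>\<^sup>+c. ennreal (load a c ^ 4) \<partial>P)" by (rule nn_integral_cmult) measurable
  also have "\<dots> \<le> ennreal K * ennreal M" by (intro mult_left_mono fin) auto
  also have "\<dots> = ennreal (K * M)" using K M by (simp add: ennreal_mult)
  finally show ?thesis .
qed

lemma integral_le_add:
  assumes "\<And>c. c \<in> configurations \<Longrightarrow> f c \<le> g c + k c" "\<And>c. 0 \<le> g c" "\<And>c. 0 \<le> k c"
    and "g \<in> borel_measurable P" "k \<in> borel_measurable P" "0 \<le> G" "0 \<le> K"
    and "(\<integral>\<^sup>+c. ennreal (g c) \<partial>P) \<le> ennreal G" "(\<integral>\<^sup>+c. ennreal (k c) \<partial>P) \<le> ennreal K"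
  shows "(\<integral>\<^sup>+c. ennreal (f c) \<partial>P) \<le> ennreal (G + K)"
proof -
  have "(\<integral>\<^sup>+c. ennreal (f c) \<partial>P) \<le> (\<integral>\<^sup>+c. ennreal (g c) + ennreal (k c) \<partial>P)"
    using assms(1-3) by (intro nn_integral_mono) (simp add: space_P ennreal_plus[symmetric] ennreal_leI del: ennreal_plus)
  also have "\<dots> = (\<integral>\<^sup>+c. ennreal (g c) \<partial>P) + (\<integral>\<^sup>+c. ennreal (k c) \<partial>P)"
    using assms(4,5) by (intro nn_integral_add measurable_compose[OF _ measurable_ennreal])
  also have "\<dots> \<le> ennreal G + ennreal K" by (intro add_mono assms)
  finally show ?thesis using assms by simp
qed

text \<open>
  Each of the two cells yields a factor \<open>d\<close> when the conditional estimates are applied backwards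
  in time, from the last of the three times \<open>a\<close>, \<open>b\<close>, \<open>t\<close> to the first. A time \<open>t\<close> within one
  of the cells is first replaced by the ends of the cell.
\<close>

lemma pair_load_bound:
  "\<exists>C\<ge>0. \<exists>d0>0. \<forall>a b t d. 0 < d \<longrightarrow> d \<le> d0 \<longrightarrow> a + d \<le> b \<longrightarrow>
    (\<integral>\<^sup>+c. ennreal (real (tot c {a<..a + d}) * real (tot c {b<..b + d}) * load t c) \<partial>P) \<le> ennreal (C * d\<^sup>2)"
proof -
  obtain D2 e2 where D2: "0 < D2" and e2: "0 < e2" and bl2: "\<And>s d t. 0 < d \<Longrightarrow> d \<le> e2 \<Longrightarrow> s + d \<le> t \<Longrightarrow>
    cond_le s (\<lambda>c. real (tot c {s<..s + d}) * load t c ^ 2) (\<lambda>c. D2 * d * load s c ^ 3)"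
    using births_then_load[of 2] by auto
  obtain D3 e3 where D3: "0 < D3" and e3: "0 < e3" and bl3: "\<And>s d t. 0 < d \<Longrightarrow> d \<le> e3 \<Longrightarrow> s + d \<le> t \<Longrightarrow>
    cond_le s (\<lambda>c. real (tot c {s<..s + d}) * load t c ^ 3) (\<lambda>c. D3 * d * load s c ^ 4)"
    using births_then_load[of 3] by auto
  obtain L2 where L2: "0 < L2" and l2: "\<And>s t. s \<le> t \<Longrightarrow> cond_le s (\<lambda>c. load t c ^ 2) (\<lambda>c. L2 * load s c ^ 2)"
    using load_moment_propagates[of 2] by auto
  obtain M where M: "0 \<le> M" and m: "\<And>s. (\<integral>\<^sup>+c. ennreal (load s c ^ 4) \<partial>P) \<le> ennreal M"
    using load_moment_finite[of 4] by auto
  obtain e1 where e1: "0 < e1" and sh: "\<And>d. 0 < d \<Longrightarrow> d \<le> e1 \<Longrightarrow> short_time d"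
    using birth_const_pos by (intro that[of "1 / birth_const"]) (auto simp: short_time_def field_simps)
  define d0 where "d0 = min (min e1 A) (min e2 e3)"
  have d0: "0 < d0" unfolding d0_def using e1 e2 e3 A_pos by simp
  let ?\<beta> = birth_const
  have \<beta>: "0 < ?\<beta>" by (rule birth_const_pos)
  define C where "C = D2 * D3 * M + ?\<beta> * D2 * (2 * M) + ?\<beta> * L2 * D3 * M"
  have C: "0 \<le> C" "D2 * D3 * M \<le> C" "?\<beta> * D2 * (2 * M) \<le> C" "?\<beta> * L2 * D3 * M \<le> C"
    unfolding C_def using D2 D3 L2 M \<beta> by auto
  have L1: "1 \<le> load s c" and L0: "0 \<le> load s c" for s c using load_ge_1[of s c] by auto
  have L12: "load s c \<le> load s c ^ 2" for s c using power_increasing[of 1 2 "load s c"] L1 by simp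
  have mainC: "(\<integral>\<^sup>+c. ennreal (real (tot c {a<..a + d}) * real (tot c {b<..b + d}) * load t c) \<partial>P) \<le> ennreal (C * d\<^sup>2)"
    if d: "0 < d" "d \<le> d0" and ab: "a + d \<le> b" and t: "t \<le> a \<or> (a + d \<le> t \<and> t \<le> b) \<or> b + d \<le> t" for a b t d
  proof -
    let ?Na = "\<lambda>c. real (tot c {a<..a + d})" and ?Nb = "\<lambda>c. real (tot c {b<..b + d})"
    have dd: "d \<le> e1" "d \<le> e2" "d \<le> e3" using d unfolding d0_def by auto
    have ab': "a \<le> b" using ab d by simp
    have Na: "?Na \<in> borel_measurable (conf_algebra {..r})" if "a + d \<le> r" for r
      by (rule births_measurable[OF that])
    from t consider "b + d \<le> t" | "t \<le> a" | "a + d \<le> t" "t \<le> b" by blast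
    then obtain K where K: "0 \<le> K" "K \<le> C * d\<^sup>2"
      and int: "(\<integral>\<^sup>+c. ennreal (?Na c * ?Nb c * load t c) \<partial>P) \<le> ennreal K"
    proof cases
      case 1
      have "cond_le a (\<lambda>c. ?Na c * ?Nb c * load t c) (\<lambda>c. ?Na c * (?Nb c * load t c ^ 2))"
        using L12 by (intro cond_le_mono) (simp add: mult.assoc mult_left_mono)
      also have "cond_le a \<dots> (\<lambda>c. ?Na c * (D2 * d * load b c ^ 3))"
        by (rule cond_le_later[OF _ ab']) (intro cond_le_mult bl2 d dd 1 Na ab, simp)
      also have "(\<lambda>c. ?Na c * (D2 * d * load b c ^ 3)) = (\<lambda>c. D2 * d * (?Na c * load b c ^ 3))"
        by (simp add: fun_eq_iff mult_ac)
      also have "cond_le a \<dots> (\<lambda>c. D2 * d * (D3 * d * load a c ^ 4))"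
        using D2 d by (intro cond_le_cmult bl3 dd ab) auto
      finally have "cond_le a (\<lambda>c. ?Na c * ?Nb c * load t c) (\<lambda>c. (D2 * D3 * d\<^sup>2) * load a c ^ 4)"
        by (simp add: power2_eq_square mult_ac)
      from integral_load_bound[OF this _ M m] D2 D3
      have "(\<integral>\<^sup>+c. ennreal (?Na c * ?Nb c * load t c) \<partial>P) \<le> ennreal ((D2 * D3 * d\<^sup>2) * M)" by simp
      moreover have "(D2 * D3 * d\<^sup>2) * M \<le> C * d\<^sup>2"
        using mult_right_mono[OF C(2), of "d\<^sup>2"] by (simp add: mult_ac)
      ultimately show ?thesis using D2 D3 M by (intro that[of "(D2 * D3 * d\<^sup>2) * M"]) auto
    next
      case 2
      have "cond_le a (\<lambda>c. ?Na c * ?Nb c * load t c) (\<lambda>c. (?Na c * load t c) * ?Nb c)"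
        by (intro cond_le_mono) (simp add: mult_ac)
      also have "cond_le a \<dots> (\<lambda>c. (?Na c * load t c) * (?\<beta> * d * load b c))"
        using 2 ab d ab' L0
        by (intro cond_le_later[OF _ ab'] cond_le_mult cond_le_births sh dd borel_measurable_times Na load_measurable) auto
      also have "cond_le a \<dots> (\<lambda>c. (?\<beta> * d * load t c) * (?Na c * load b c ^ 2))"
      proof (rule cond_le_mono)
        fix c
        have "(?\<beta> * d * load t c * ?Na c) * load b c \<le> (?\<beta> * d * load t c * ?Na c) * load b c ^ 2"
          using \<beta> d L0 L12 by (intro mult_left_mono) auto
        then show "(?Na c * load t c) * (?\<beta> * d * load b c) \<le> (?\<beta> * d * load t c) * (?Na c * load b c ^ 2)"
          by (simp add: mult_ac)
      qed
      also have "cond_le a \<dots> (\<lambda>c. (?\<beta> * d * load t c) * (D2 * d * load a c ^ 3))"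
        using \<beta> d L0 2 by (intro cond_le_mult bl2 dd ab borel_measurable_times borel_measurable_const load_measurable) auto
      finally have "(\<integral>\<^sup>+c. ennreal (?Na c * ?Nb c * load t c) \<partial>P) \<le> (\<integral>\<^sup>+c. ennreal ((?\<beta> * d * load t c) * (D2 * d * load a c ^ 3)) \<partial>P)"
        by (rule cond_le_integral)
      also have "\<dots> \<le> ennreal ((?\<beta> * D2 * d\<^sup>2) * M + (?\<beta> * D2 * d\<^sup>2) * M)"
      proof (rule integral_le_add[where g="\<lambda>c. (?\<beta> * D2 * d\<^sup>2) * load t c ^ 4" and k="\<lambda>c. (?\<beta> * D2 * d\<^sup>2) * load a c ^ 4"])
        fix c
        have "load t c * load a c ^ 3 \<le> load t c ^ 4 + load a c ^ 4"
        proof (cases "load t c \<le> load a c")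
          case True
          then have "load t c * load a c ^ 3 \<le> load a c * load a c ^ 3" using L0 by (intro mult_right_mono) auto
          also have "\<dots> = load a c ^ 4" by (simp add: power_Suc[symmetric] del: power_Suc)
          also have "\<dots> \<le> load t c ^ 4 + load a c ^ 4" by simp
          finally show ?thesis .
        next
          case False
          then have "load t c * load a c ^ 3 \<le> load t c * load t c ^ 3" using L0 by (intro mult_left_mono power_mono) auto
          also have "\<dots> = load t c ^ 4" by (simp add: power_Suc[symmetric] del: power_Suc)
          also have "\<dots> \<le> load t c ^ 4 + load a c ^ 4" by simp
          finally show ?thesis .
        qed
        then have "(?\<beta> * D2 * d\<^sup>2) * (load t c * load a c ^ 3) \<le> (?\<beta> * D2 * d\<^sup>2) * (load t c ^ 4 + load a c ^ 4)"
          using \<beta> D2 by (intro mult_left_mono) auto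
        then show "(?\<beta> * d * load t c) * (D2 * d * load a c ^ 3) \<le> (?\<beta> * D2 * d\<^sup>2) * load t c ^ 4 + (?\<beta> * D2 * d\<^sup>2) * load a c ^ 4"
          by (simp add: power2_eq_square algebra_simps)
      next
        have k: "0 \<le> ?\<beta> * D2 * d\<^sup>2" using \<beta> D2 by simp
        show "(\<integral>\<^sup>+c. ennreal ((?\<beta> * D2 * d\<^sup>2) * load t c ^ 4) \<partial>P) \<le> ennreal ((?\<beta> * D2 * d\<^sup>2) * M)"
          by (rule integral_load_bound[OF cond_le_mono k M m]) (rule order_refl)
        show "(\<integral>\<^sup>+c. ennreal ((?\<beta> * D2 * d\<^sup>2) * load a c ^ 4) \<partial>P) \<le> ennreal ((?\<beta> * D2 * d\<^sup>2) * M)"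
          by (rule integral_load_bound[OF cond_le_mono k M m]) (rule order_refl)
      qed (use \<beta> D2 M L0 in auto)
      also have "(?\<beta> * D2 * d\<^sup>2) * M + (?\<beta> * D2 * d\<^sup>2) * M = (?\<beta> * D2 * (2 * M)) * d\<^sup>2" by simp
      finally show ?thesis
        using \<beta> D2 M mult_right_mono[OF C(3), of "d\<^sup>2"] by (intro that[of "(?\<beta> * D2 * (2 * M)) * d\<^sup>2"]) auto
    next
      case 3
      have "cond_le a (\<lambda>c. ?Na c * ?Nb c * load t c) (\<lambda>c. (?Na c * load t c) * ?Nb c)"
        by (intro cond_le_mono) (simp add: mult_ac)
      also have "cond_le a \<dots> (\<lambda>c. (?Na c * load t c) * (?\<beta> * d * load b c))"
        using 3 ab d ab' L0
        by (intro cond_le_later[OF _ ab'] cond_le_mult cond_le_births sh dd borel_measurable_times Na load_measurable) auto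
      also have "cond_le a \<dots> (\<lambda>c. (?\<beta> * d * ?Na c * load t c) * load b c ^ 2)"
      proof (rule cond_le_mono)
        fix c
        have "(?\<beta> * d * load t c * ?Na c) * load b c \<le> (?\<beta> * d * load t c * ?Na c) * load b c ^ 2"
          using \<beta> d L0 L12 by (intro mult_left_mono) auto
        then show "(?Na c * load t c) * (?\<beta> * d * load b c) \<le> (?\<beta> * d * ?Na c * load t c) * load b c ^ 2"
          by (simp add: mult_ac)
      qed
      also have "cond_le a \<dots> (\<lambda>c. (?\<beta> * d * ?Na c * load t c) * (L2 * load t c ^ 2))"
      proof (rule cond_le_later[of t])
        show "a \<le> t" using 3 d by simp
        show "cond_le t (\<lambda>c. (?\<beta> * d * ?Na c * load t c) * load b c ^ 2) (\<lambda>c. (?\<beta> * d * ?Na c * load t c) * (L2 * load t c ^ 2))"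
          using \<beta> d L0 3 by (intro cond_le_mult l2 borel_measurable_times borel_measurable_const Na load_measurable) auto
      qed
      also have "(\<lambda>c. (?\<beta> * d * ?Na c * load t c) * (L2 * load t c ^ 2)) = (\<lambda>c. (?\<beta> * d * L2) * (?Na c * load t c ^ 3))"
        by (simp add: fun_eq_iff power2_eq_square power3_eq_cube mult_ac)
      also have "cond_le a \<dots> (\<lambda>c. (?\<beta> * d * L2) * (D3 * d * load a c ^ 4))"
        using \<beta> d L2 3 by (intro cond_le_cmult bl3 dd) auto
      finally have "cond_le a (\<lambda>c. ?Na c * ?Nb c * load t c) (\<lambda>c. (?\<beta> * L2 * D3 * d\<^sup>2) * load a c ^ 4)"
        by (simp add: power2_eq_square mult_ac)
      from integral_load_bound[OF this _ M m] \<beta> L2 D3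
      have "(\<integral>\<^sup>+c. ennreal (?Na c * ?Nb c * load t c) \<partial>P) \<le> ennreal ((?\<beta> * L2 * D3 * d\<^sup>2) * M)" by simp
      moreover have "(?\<beta> * L2 * D3 * d\<^sup>2) * M \<le> C * d\<^sup>2"
        using mult_right_mono[OF C(4), of "d\<^sup>2"] by (simp add: mult_ac)
      ultimately show ?thesis using \<beta> L2 D3 M by (intro that[of "(?\<beta> * L2 * D3 * d\<^sup>2) * M"]) auto
    qed
    show ?thesis using int ennreal_leI[OF K(2)] by (rule order_trans)
  qed
  have all: "(\<integral>\<^sup>+c. ennreal (real (tot c {a<..a + d}) * real (tot c {b<..b + d}) * load t c) \<partial>P) \<le> ennreal ((2 * C) * d\<^sup>2)"
    if d: "0 < d" "d \<le> d0" and ab: "a + d \<le> b" for a b t d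
  proof -
    have dA: "d \<le> A" using d unfolding d0_def by simp
    let ?N = "\<lambda>c. real (tot c {a<..a + d}) * real (tot c {b<..b + d})"
    have two: "(\<integral>\<^sup>+c. ennreal (?N c * load t c) \<partial>P) \<le> ennreal (C * d\<^sup>2 + C * d\<^sup>2)" if s: "s = a \<or> s = b" "s < t" "t < s + d" for s
    proof (rule integral_le_add[where g="\<lambda>c. ?N c * load s c" and k="\<lambda>c. ?N c * load (s + d) c"])
      show "?N c * load t c \<le> ?N c * load s c + ?N c * load (s + d) c" if c: "c \<in> configurations" for c
        using load_le_two[OF c, of s t d] s d dA
        by (simp add: distrib_left[symmetric] mult_left_mono)
      show "(\<integral>\<^sup>+c. ennreal (?N c * load s c) \<partial>P) \<le> ennreal (C * d\<^sup>2)"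
        "(\<integral>\<^sup>+c. ennreal (?N c * load (s + d) c) \<partial>P) \<le> ennreal (C * d\<^sup>2)"
        using s ab by (auto intro!: mainC d)
    qed (use C L0 in \<open>auto intro!: mult_nonneg_nonneg\<close>)
    show ?thesis
    proof (cases "t \<le> a \<or> (a + d \<le> t \<and> t \<le> b) \<or> b + d \<le> t")
      case True
      have "C * d\<^sup>2 \<le> (2 * C) * d\<^sup>2" using C by simp
      then show ?thesis using mainC[OF d ab True] ennreal_leI order_trans by blast
    next
      case False
      then have "(a < t \<and> t < a + d) \<or> (b < t \<and> t < b + d)" by auto
      then show ?thesis using two[of a] two[of b] by (auto simp: mult.assoc)
    qed
  qed
  show ?thesis using C(1) d0 all by (intro exI[of _ "2 * C"] conjI exI[of _ d0]) auto
qed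

text \<open>
  The analogue for one cell.
\<close>

lemma births_load_bound:
  "\<exists>C\<ge>0. \<exists>d0>0. \<forall>a t d. 0 < d \<longrightarrow> d \<le> d0 \<longrightarrow>
    (\<integral>\<^sup>+c. ennreal (real (tot c {a<..a + d}) * load t c) \<partial>P) \<le> ennreal (C * d)"
proof -
  obtain D2 e2 where D2: "0 < D2" and e2: "0 < e2" and bl2: "\<And>s d t. 0 < d \<Longrightarrow> d \<le> e2 \<Longrightarrow> s + d \<le> t \<Longrightarrow>
    cond_le s (\<lambda>c. real (tot c {s<..s + d}) * load t c ^ 2) (\<lambda>c. D2 * d * load s c ^ 3)"
    using births_then_load[of 2] by auto
  obtain M where M: "0 \<le> M" and m: "\<And>s. (\<integral>\<^sup>+c. ennreal (load s c ^ 4) \<partial>P) \<le> ennreal M"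
    using load_moment_finite[of 4] by auto
  obtain e1 where e1: "0 < e1" and sh: "\<And>d. 0 < d \<Longrightarrow> d \<le> e1 \<Longrightarrow> short_time d"
    using birth_const_pos by (intro that[of "1 / birth_const"]) (auto simp: short_time_def field_simps)
  define d0 where "d0 = min (min e1 A) e2"
  have d0: "0 < d0" unfolding d0_def using e1 e2 A_pos by simp
  let ?\<beta> = birth_const
  have \<beta>: "0 < ?\<beta>" by (rule birth_const_pos)
  define C where "C = D2 * M + ?\<beta> * (2 * M)"
  have C: "0 \<le> C" "D2 * M \<le> C" "?\<beta> * (2 * M) \<le> C"
    unfolding C_def using D2 M \<beta> by auto
  have L1: "1 \<le> load s c" and L0: "0 \<le> load s c" for s c using load_ge_1[of s c] by auto
  have Lp: "load s c ^ i \<le> load s c ^ j" if "i \<le> j" for s c i j using power_increasing[of i j "load s c"] L1 that by simp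
  have main: "(\<integral>\<^sup>+c. ennreal (real (tot c {a<..a + d}) * load t c) \<partial>P) \<le> ennreal (C * d)"
    if d: "0 < d" "d \<le> d0" and t: "t \<le> a \<or> a + d \<le> t" for a t d
  proof -
    let ?N = "\<lambda>c. real (tot c {a<..a + d})"
    have dd: "d \<le> e1" "d \<le> e2" using d unfolding d0_def by auto
    show ?thesis
    proof (cases "a + d \<le> t")
      case True
      have "cond_le a (\<lambda>c. ?N c * load t c) (\<lambda>c. ?N c * load t c ^ 2)"
        using Lp[of 1 2] by (intro cond_le_mono mult_left_mono) auto
      also have "cond_le a \<dots> (\<lambda>c. D2 * d * load a c ^ 3)" by (intro bl2 d dd True)
      also have "cond_le a \<dots> (\<lambda>c. (D2 * d) * load a c ^ 4)"
        using D2 d Lp[of 3 4] by (intro cond_le_mono mult_left_mono) auto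
      finally have "cond_le a (\<lambda>c. ?N c * load t c) (\<lambda>c. (D2 * d) * load a c ^ 4)" .
      from integral_load_bound[OF this _ M m] D2 d
      have "(\<integral>\<^sup>+c. ennreal (?N c * load t c) \<partial>P) \<le> ennreal ((D2 * d) * M)" by simp
      also have "\<dots> \<le> ennreal (C * d)"
        using mult_right_mono[OF C(2), of d] d by (intro ennreal_leI) (simp add: mult_ac)
      finally show ?thesis .
    next
      case False
      then have ta: "t \<le> a" using t by simp
      have "cond_le a (\<lambda>c. ?N c * load t c) (\<lambda>c. load t c * ?N c)"
        by (intro cond_le_mono) (simp add: mult.commute)
      also have "cond_le a \<dots> (\<lambda>c. load t c * (?\<beta> * d * load a c))"
        using ta L0 d by (intro cond_le_mult cond_le_births sh dd load_measurable) auto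
      finally have "(\<integral>\<^sup>+c. ennreal (?N c * load t c) \<partial>P) \<le> (\<integral>\<^sup>+c. ennreal (load t c * (?\<beta> * d * load a c)) \<partial>P)"
        by (rule cond_le_integral)
      also have "\<dots> \<le> ennreal ((?\<beta> * d) * M + (?\<beta> * d) * M)"
      proof (rule integral_le_add[where g="\<lambda>c. (?\<beta> * d) * load t c ^ 4" and k="\<lambda>c. (?\<beta> * d) * load a c ^ 4"])
        fix c
        have "load t c * load a c \<le> load t c ^ 2 + load a c ^ 2"
          using sum_squares_bound[of "load t c" "load a c"] L0[of t c] L0[of a c] mult_nonneg_nonneg[OF L0 L0, of t c a c] by linarith
        also have "\<dots> \<le> load t c ^ 4 + load a c ^ 4" by (intro add_mono Lp) auto
        finally have "(?\<beta> * d) * (load t c * load a c) \<le> (?\<beta> * d) * (load t c ^ 4 + load a c ^ 4)"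
          using \<beta> d by (intro mult_left_mono) auto
        then show "load t c * (?\<beta> * d * load a c) \<le> (?\<beta> * d) * load t c ^ 4 + (?\<beta> * d) * load a c ^ 4"
          by (simp add: algebra_simps)
      next
        have k: "0 \<le> ?\<beta> * d" using \<beta> d by simp
        show "(\<integral>\<^sup>+c. ennreal ((?\<beta> * d) * load t c ^ 4) \<partial>P) \<le> ennreal ((?\<beta> * d) * M)"
          by (rule integral_load_bound[OF cond_le_mono k M m]) (rule order_refl)
        show "(\<integral>\<^sup>+c. ennreal ((?\<beta> * d) * load a c ^ 4) \<partial>P) \<le> ennreal ((?\<beta> * d) * M)"
          by (rule integral_load_bound[OF cond_le_mono k M m]) (rule order_refl)
      qed (use \<beta> d M L0 in auto)
      also have "\<dots> \<le> ennreal (C * d)"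
        using mult_right_mono[OF C(3), of d] d by (intro ennreal_leI) (simp add: algebra_simps)
      finally show ?thesis .
    qed
  qed
  have all: "(\<integral>\<^sup>+c. ennreal (real (tot c {a<..a + d}) * load t c) \<partial>P) \<le> ennreal ((2 * C) * d)"
    if d: "0 < d" "d \<le> d0" for a t d
  proof -
    have dA: "d \<le> A" using d unfolding d0_def by simp
    let ?N = "\<lambda>c. real (tot c {a<..a + d})"
    show ?thesis
    proof (cases "t \<le> a \<or> a + d \<le> t")
      case True
      have "C * d \<le> (2 * C) * d" using C d by simp
      then show ?thesis using main[OF d True] ennreal_leI order_trans by blast
    next
      case False
      have "(\<integral>\<^sup>+c. ennreal (?N c * load t c) \<partial>P) \<le> ennreal (C * d + C * d)"
      proof (rule integral_le_add[where g="\<lambda>c. ?N c * load a c" and k="\<lambda>c. ?N c * load (a + d) c"])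
        show "?N c * load t c \<le> ?N c * load a c + ?N c * load (a + d) c" if c: "c \<in> configurations" for c
          using load_le_two[OF c, of a t d] False d dA
          by (simp add: distrib_left[symmetric] mult_left_mono)
        show "(\<integral>\<^sup>+c. ennreal (?N c * load a c) \<partial>P) \<le> ennreal (C * d)"
          "(\<integral>\<^sup>+c. ennreal (?N c * load (a + d) c) \<partial>P) \<le> ennreal (C * d)"
          by (auto intro!: main d)
      qed (use C L0 d in \<open>auto intro!: mult_nonneg_nonneg\<close>)
      then show ?thesis by (simp add: mult.assoc)
    qed
  qed
  show ?thesis using C(1) d0 all by (intro exI[of _ "2 * C"] conjI exI[of _ d0]) auto
qed

end

section \<open>Windows under the Palm distributions\<close>

text \<open>
  The configuration without the Palm point, once this point of mark \<open>l\<close> has been shifted to the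
  origin.
\<close>

definition punctured :: "'k \<Rightarrow> 'k conf \<Rightarrow> 'k conf" where
  "punctured l c = c(l := c l - {0})"

lemma punctured_in_configurations: "c \<in> configurations \<Longrightarrow> punctured l c \<in> configurations"
  unfolding configurations_def punctured_def by (auto intro: finite_subset)

lemma punctured_Int: "punctured l c k \<inter> B = c k \<inter> (B - (if k = l then {0} else {}))"
  unfolding punctured_def by auto

lemma measurable_tot_punctured:
  assumes "B \<in> sets borel" "bounded B"
  shows "(\<lambda>c. real (tot (punctured l c) B)) \<in> borel_measurable conf_borel"
  unfolding tot_def of_nat_sum punctured_Int
  by (intro borel_measurable_sum measurable_compose[OF measurable_card_conf])
    (use assms in \<open>auto intro: bounded_subset\<close>)

lemma power4_sum_le:
  fixes f :: "'a \<Rightarrow> real"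
  assumes "finite I" "\<And>i. i \<in> I \<Longrightarrow> 0 \<le> f i"
  shows "(\<Sum>i\<in>I. f i) ^ 4 \<le> real (card I) ^ 4 * (\<Sum>i\<in>I. f i ^ 4)"
proof (cases "I = {}")
  case False
  define m where "m = Max (f ` I)"
  have "m \<in> f ` I" unfolding m_def using assms(1) False by (intro Max_in) auto
  then obtain i where i: "i \<in> I" "m = f i" by blast
  have "(\<Sum>i\<in>I. f i) \<le> (\<Sum>i\<in>I. m)" unfolding m_def using assms(1) by (intro sum_mono) simp
  then have "(\<Sum>i\<in>I. f i) ^ 4 \<le> (real (card I) * m) ^ 4"
    using assms by (intro power_mono sum_nonneg) auto
  also have "\<dots> = real (card I) ^ 4 * f i ^ 4" by (simp add: power_mult_distrib i)
  also have "\<dots> \<le> real (card I) ^ 4 * (\<Sum>i\<in>I. f i ^ 4)"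
    using assms i by (intro mult_left_mono member_le_sum) auto
  finally show ?thesis .
qed simp

context linear_hawkes
begin

lemma tot_window_le_loads:
  assumes c: "c \<in> configurations" and R: "L \<le> real R * A" "0 < R"
  shows "1 + real (tot c {y..y + L}) \<le> (\<Sum>i<R. load (y + real (Suc i) * A) c)"
proof -
  have *: "real (tot c {y..y + real (Suc n) * A}) \<le> (\<Sum>i<Suc n. load (y + real (Suc i) * A) c - 1)" for n
  proof (induction n)
    case 0
    show ?case by (simp add: load_def)
  next
    case (Suc n)
    have eq: "y + real (Suc (Suc n)) * A - A = y + real (Suc n) * A" by (simp add: algebra_simps)
    have "tot c {y..y + real (Suc (Suc n)) * A}
        \<le> tot c ({y..y + real (Suc n) * A} \<union> {y + real (Suc n) * A..y + real (Suc (Suc n)) * A})"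
      by (intro tot_mono c) auto
    also have "\<dots> \<le> tot c {y..y + real (Suc n) * A} + tot c {y + real (Suc n) * A..y + real (Suc (Suc n)) * A}"
      by (rule tot_Un_le)
    finally have "real (tot c {y..y + real (Suc (Suc n)) * A})
        \<le> real (tot c {y..y + real (Suc n) * A}) + (load (y + real (Suc (Suc n)) * A) c - 1)"
      unfolding load_def eq by simp
    then show ?case using Suc by (simp del: of_nat_Suc)
  qed
  obtain n where n: "R = Suc n" using R(2) by (cases R) auto
  have "real (tot c {y..y + L}) \<le> real (tot c {y..y + real (Suc n) * A})"
    unfolding of_nat_le_iff using R(1) n by (intro tot_mono c) auto
  also have "\<dots> \<le> (\<Sum>i<Suc n. load (y + real (Suc i) * A) c - 1)" by (rule *)
  also have "\<dots> = (\<Sum>i<Suc n. load (y + real (Suc i) * A) c) - real (Suc n)"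
    by (simp add: sum_subtractf del: of_nat_Suc sum.lessThan_Suc)
  finally show ?thesis unfolding n by (simp del: sum.lessThan_Suc)
qed

lemma integral_sum_bound:
  assumes "finite I" "\<And>i. i \<in> I \<Longrightarrow> (\<integral>\<^sup>+c. ennreal (f i c) \<partial>P) \<le> ennreal K" "0 \<le> K"
    and "\<And>i. i \<in> I \<Longrightarrow> f i \<in> borel_measurable P" "\<And>i c. i \<in> I \<Longrightarrow> 0 \<le> f i c"
  shows "(\<integral>\<^sup>+c. ennreal (\<Sum>i\<in>I. f i c) \<partial>P) \<le> ennreal (real (card I) * K)"
proof -
  have "(\<integral>\<^sup>+c. ennreal (\<Sum>i\<in>I. f i c) \<partial>P) = (\<integral>\<^sup>+c. (\<Sum>i\<in>I. ennreal (f i c)) \<partial>P)"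
    using assms by (intro nn_integral_cong) (simp add: sum_ennreal)
  also have "\<dots> = (\<Sum>i\<in>I. \<integral>\<^sup>+c. ennreal (f i c) \<partial>P)"
    using assms by (intro nn_integral_sum measurable_compose[OF _ measurable_ennreal])
  also have "\<dots> \<le> (\<Sum>i\<in>I. ennreal K)" by (intro sum_mono assms)
  also have "\<dots> = ennreal (real (card I) * K)"
    using assms by (simp add: ennreal_mult ennreal_of_nat_eq_real_of_nat)
  finally show ?thesis .
qed

lemma window_covering: "\<exists>R::nat. L \<le> real R * A \<and> 0 < R"
proof -
  obtain n :: nat where "L / A \<le> real n" using real_arch_simple by blast
  then have "L \<le> real n * A" using A_pos by (simp add: pos_divide_le_eq)
  also have "\<dots> \<le> real (Suc n) * A" using A_pos by (intro mult_right_mono) auto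
  finally show ?thesis by blast
qed

lemma window_moment_bound:
  "\<exists>C\<ge>0. \<forall>y. (\<integral>\<^sup>+c. ennreal ((1 + real (tot c {y..y + L})) ^ 4) \<partial>P) \<le> ennreal C"
proof -
  obtain R where R: "L \<le> real R * A" "0 < R" using window_covering by blast
  obtain M where M: "0 \<le> M" and m: "\<And>s. (\<integral>\<^sup>+c. ennreal (load s c ^ 4) \<partial>P) \<le> ennreal M"
    using load_moment_finite[of 4] by auto
  have "(\<integral>\<^sup>+c. ennreal ((1 + real (tot c {y..y + L})) ^ 4) \<partial>P) \<le> ennreal (real (card {..<R}) * (real R ^ 4 * M))" for y
  proof -
    have "(\<integral>\<^sup>+c. ennreal ((1 + real (tot c {y..y + L})) ^ 4) \<partial>P)
       \<le> (\<integral>\<^sup>+c. ennreal (\<Sum>i\<in>{..<R}. real R ^ 4 * load (y + real (Suc i) * A) c ^ 4) \<partial>P)"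
    proof (intro nn_integral_mono ennreal_leI)
      fix c assume "c \<in> space P"
      then have "(1 + real (tot c {y..y + L})) ^ 4 \<le> (\<Sum>i<R. load (y + real (Suc i) * A) c) ^ 4"
        by (intro power_mono tot_window_le_loads R) (auto simp: space_P)
      also have "\<dots> \<le> real (card {..<R}) ^ 4 * (\<Sum>i<R. load (y + real (Suc i) * A) c ^ 4)"
        by (intro power4_sum_le finite_lessThan order_trans[OF zero_le_one load_ge_1])
      finally show "(1 + real (tot c {y..y + L})) ^ 4 \<le> (\<Sum>i<R. real R ^ 4 * load (y + real (Suc i) * A) c ^ 4)"
        by (simp add: sum_distrib_left)
    qed
    also have "\<dots> \<le> ennreal (real (card {..<R}) * (real R ^ 4 * M))"
    proof (rule integral_sum_bound)
      show "(\<integral>\<^sup>+c. ennreal (real R ^ 4 * load (y + real (Suc i) * A) c ^ 4) \<partial>P) \<le> ennreal (real R ^ 4 * M)" for i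
        by (rule integral_load_bound[OF cond_le_mono _ M m]) auto
    qed (use M in \<open>auto simp del: of_nat_Suc\<close>)
    finally show ?thesis .
  qed
  moreover have "0 \<le> real (card {..<R}) * (real R ^ 4 * M)" using M by simp
  ultimately show ?thesis by blast
qed

lemma pair_window_bound:
  "\<exists>C\<ge>0. \<exists>d0>0. \<forall>a b y d. 0 < d \<longrightarrow> d \<le> d0 \<longrightarrow> a + d \<le> b \<longrightarrow>
    (\<integral>\<^sup>+c. ennreal (real (tot c {a<..a + d}) * real (tot c {b<..b + d}) * (1 + real (tot c {y..y + L}))) \<partial>P) \<le> ennreal (C * d\<^sup>2)"
proof -
  obtain R where R: "L \<le> real R * A" "0 < R" using window_covering by blast
  obtain C d0 where C: "0 \<le> C" and d0: "0 < d0" and b: "\<And>a b t d. 0 < d \<Longrightarrow> d \<le> d0 \<Longrightarrow> a + d \<le> b \<Longrightarrow>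
    (\<integral>\<^sup>+c. ennreal (real (tot c {a<..a + d}) * real (tot c {b<..b + d}) * load t c) \<partial>P) \<le> ennreal (C * d\<^sup>2)"
    using pair_load_bound by blast
  have "(\<integral>\<^sup>+c. ennreal (real (tot c {a<..a + d}) * real (tot c {b<..b + d}) * (1 + real (tot c {y..y + L}))) \<partial>P) \<le> ennreal ((real R * C) * d\<^sup>2)"
    if d: "0 < d" "d \<le> d0" "a + d \<le> b" for a b y d
  proof -
    let ?N = "\<lambda>c. real (tot c {a<..a + d}) * real (tot c {b<..b + d})"
    have "(\<integral>\<^sup>+c. ennreal (?N c * (1 + real (tot c {y..y + L}))) \<partial>P) \<le> (\<integral>\<^sup>+c. ennreal (\<Sum>i\<in>{..<R}. ?N c * load (y + real (Suc i) * A) c) \<partial>P)"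
      unfolding sum_distrib_left[symmetric]
      by (intro nn_integral_mono ennreal_leI mult_left_mono tot_window_le_loads R) (auto simp: space_P)
    also have "\<dots> \<le> ennreal (real (card {..<R}) * (C * d\<^sup>2))"
      using C load_ge_1 by (intro integral_sum_bound b d) (auto intro!: mult_nonneg_nonneg order_trans[OF zero_le_one load_ge_1])
    finally show ?thesis by (simp add: mult.assoc)
  qed
  then show ?thesis using C d0 by (intro exI[of _ "real R * C"] conjI exI[of _ d0]) auto
qed

lemma births_window_bound:
  "\<exists>C\<ge>0. \<exists>d0>0. \<forall>a y d. 0 < d \<longrightarrow> d \<le> d0 \<longrightarrow>
    (\<integral>\<^sup>+c. ennreal (real (tot c {a<..a + d}) * (1 + real (tot c {y..y + L}))) \<partial>P) \<le> ennreal (C * d)"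
proof -
  obtain R where R: "L \<le> real R * A" "0 < R" using window_covering by blast
  obtain C d0 where C: "0 \<le> C" and d0: "0 < d0" and b: "\<And>a t d. 0 < d \<Longrightarrow> d \<le> d0 \<Longrightarrow>
    (\<integral>\<^sup>+c. ennreal (real (tot c {a<..a + d}) * load t c) \<partial>P) \<le> ennreal (C * d)"
    using births_load_bound by blast
  have "(\<integral>\<^sup>+c. ennreal (real (tot c {a<..a + d}) * (1 + real (tot c {y..y + L}))) \<partial>P) \<le> ennreal ((real R * C) * d)"
    if d: "0 < d" "d \<le> d0" for a y d
  proof -
    let ?N = "\<lambda>c. real (tot c {a<..a + d})"
    have "(\<integral>\<^sup>+c. ennreal (?N c * (1 + real (tot c {y..y + L}))) \<partial>P) \<le> (\<integral>\<^sup>+c. ennreal (\<Sum>i\<in>{..<R}. ?N c * load (y + real (Suc i) * A) c) \<partial>P)"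
      unfolding sum_distrib_left[symmetric]
      by (intro nn_integral_mono ennreal_leI mult_left_mono tot_window_le_loads R) (auto simp: space_P)
    also have "\<dots> \<le> ennreal (real (card {..<R}) * (C * d))"
      using C d by (intro integral_sum_bound b d) (auto intro!: mult_nonneg_nonneg order_trans[OF zero_le_one load_ge_1])
    finally show ?thesis by (simp add: mult.assoc)
  qed
  then show ?thesis using C d0 by (intro exI[of _ "real R * C"] conjI exI[of _ d0]) auto
qed

text \<open>
  Immigration alone makes the rate at least \<open>\<nu> l\<close>.
\<close>

lemma mean_rate_pos: "0 < mean_rate P l"
proof -
  have "ennreal (\<nu> l) = (\<integral>\<^sup>+c. ennreal (\<nu> l) \<partial>P)"
    using prob_space.emeasure_space_1[OF prob] by simp
  also have "\<dots> \<le> (\<integral>\<^sup>+c. indicator configurations c * (\<integral>\<^sup>+v\<in>{0<..1}. ennreal (intensity A \<nu> h l v c) \<partial>lborel) \<partial>P)"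
  proof (rule nn_integral_mono)
    fix c assume c: "c \<in> space P"
    have "ennreal (\<nu> l) = (\<integral>\<^sup>+v\<in>{0<..1::real}. ennreal (\<nu> l) \<partial>lborel)"
      by (simp add: nn_integral_cmult_indicator)
    also have "\<dots> \<le> (\<integral>\<^sup>+v\<in>{0<..1}. ennreal (intensity A \<nu> h l v c) \<partial>lborel)"
      unfolding intensity_def
      by (intro nn_integral_mono mult_right_mono ennreal_leI) (auto intro!: sum_nonneg h_nonneg)
    finally show "ennreal (\<nu> l) \<le> indicator configurations c * (\<integral>\<^sup>+v\<in>{0<..1}. ennreal (intensity A \<nu> h l v c) \<partial>lborel)"
      using c by (simp add: space_P)
  qed
  also have "\<dots> = (\<integral>\<^sup>+c. indicator configurations c * of_nat (card (c l \<inter> {0<..1})) \<partial>P)"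
    using sets.top[of "conf_algebra {..0}"] by (intro compensator[symmetric]) auto
  also have "\<dots> \<le> (\<integral>\<^sup>+c. ennreal (real (card (c l \<inter> {0..1}))) \<partial>P)"
  proof (rule nn_integral_mono)
    fix c assume "c \<in> space P"
    then have "card (c l \<inter> {0<..1}) \<le> card (c l \<inter> {0..1})"
      by (intro card_mono conf_finite) (auto simp: space_P)
    then show "indicator configurations c * of_nat (card (c l \<inter> {0<..1})) \<le> ennreal (real (card (c l \<inter> {0..1})))"
      by (auto simp: indicator_def ennreal_of_nat_eq_real_of_nat intro: ennreal_leI)
  qed
  also have "\<dots> = ennreal (mean_rate P l)"
    unfolding mean_rate_def using integrable_count by (intro nn_integral_eq_integral) auto
  finally have "\<nu> l \<le> mean_rate P l"
    unfolding mean_rate_def by (subst (asm) ennreal_le_iff) (auto intro: integral_nonneg_AE)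
  then show ?thesis using \<nu>_pos[of l] by simp
qed

end

locale hawkes_palm = linear_hawkes A \<nu> h P H
  for A :: real and \<nu> :: "'k::finite \<Rightarrow> real" and h and P and H +
  fixes Q :: "real \<Rightarrow> 'k \<Rightarrow> 'k conf measure"
  assumes palm: "palm_distributions P Q"
begin

lemma Q_prob: "prob_space (Q u l)" and Q_sets: "sets (Q u l) = sets conf_borel"
  and Q_shift: "Q u l = distr (Q 0 l) conf_borel (shift_conf u)"
  using palm unfolding palm_distributions_def by blast+

lemma measurable_Q_eq: "measurable (Q u l) N = measurable conf_borel N"
  by (rule measurable_cong_sets[OF Q_sets refl])

lemma space_Q: "space (Q u l) = configurations"
  using sets_eq_imp_space_eq[OF Q_sets] by simp

lemma palm_eq:
  "\<Phi> \<in> borel_measurable (borel \<Otimes>\<^sub>M count_space UNIV \<Otimes>\<^sub>M conf_borel) \<Longrightarrow>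
        (\<integral>\<^sup>+c. (\<Sum>l\<in>UNIV. \<integral>\<^sup>+u. \<Phi> (u, l, c) \<partial>count_space (c l)) \<partial>P) =
        (\<Sum>l\<in>UNIV. ennreal (mean_rate P l) * (\<integral>\<^sup>+u. (\<integral>\<^sup>+c. \<Phi> (u, l, c) \<partial>Q u l) \<partial>lborel))"
  using palm unfolding palm_distributions_def by blast

lemma shift_conf_Q: "shift_conf u \<in> Q v l \<rightarrow>\<^sub>M conf_borel"
  unfolding measurable_Q_eq by (rule measurable_shift_conf)

lemma nn_integral_Q_shift:
  assumes "f \<in> borel_measurable conf_borel"
  shows "(\<integral>\<^sup>+c. f c \<partial>Q u l) = (\<integral>\<^sup>+c. f (shift_conf u c) \<partial>Q 0 l)"
  by (subst Q_shift, subst nn_integral_distr[OF shift_conf_Q]) (use assms in simp_all)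

lemma integral_Q_shift:
  fixes f :: "'k conf \<Rightarrow> real"
  assumes "f \<in> borel_measurable conf_borel"
  shows "(\<integral>c. f c \<partial>Q u l) = (\<integral>c. f (shift_conf u c) \<partial>Q 0 l)"
  by (subst Q_shift, subst integral_distr[OF shift_conf_Q]) (use assms in simp_all)

lemma measurable_shifted:
  fixes \<Psi> :: "'k conf \<Rightarrow> ennreal"
  shows "\<Psi> \<in> borel_measurable conf_borel \<Longrightarrow>
    (\<lambda>x. \<Psi> (shift_conf (a * fst x) (snd (snd x)))) \<in> borel_measurable (borel \<Otimes>\<^sub>M (count_space UNIV :: 'k measure) \<Otimes>\<^sub>M conf_borel)"
proof -
  assume \<Psi>: "\<Psi> \<in> borel_measurable conf_borel"
  have "(\<lambda>x. (a * fst x, snd (snd x))) \<in> (borel \<Otimes>\<^sub>M (count_space UNIV :: 'k measure) \<Otimes>\<^sub>M conf_borel) \<rightarrow>\<^sub>M borel \<Otimes>\<^sub>M (conf_borel :: 'k conf measure)"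
    by measurable
  from measurable_compose[OF measurable_compose[OF this measurable_shift_conf_joint] \<Psi>]
  show ?thesis by simp
qed

text \<open>
  The Palm formula for the points \<open>u\<close> of mark \<open>l\<close> in \<open>(0, 1]\<close>, each seen from itself.
\<close>

lemma palm_at_origin:
  assumes \<Psi>: "\<Psi> \<in> borel_measurable conf_borel"
  shows "ennreal (mean_rate P l) * (\<integral>\<^sup>+c. \<Psi> c \<partial>Q 0 l)
    = (\<integral>\<^sup>+c. (\<integral>\<^sup>+u. indicator {0<..1} u * \<Psi> (shift_conf (- u) c) \<partial>count_space (c l)) \<partial>P)"
proof -
  define \<Phi> :: "real \<times> 'k \<times> 'k conf \<Rightarrow> ennreal" where
    "\<Phi> x = indicator {l} (fst (snd x)) * (indicator {0<..1} (fst x) * \<Psi> (shift_conf (- 1 * fst x) (snd (snd x))))" for x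
  have m: "\<Phi> \<in> borel_measurable (borel \<Otimes>\<^sub>M count_space UNIV \<Otimes>\<^sub>M conf_borel)"
    unfolding \<Phi>_def
  proof (intro borel_measurable_times_ennreal measurable_shifted \<Psi>)
    show "(\<lambda>x. indicator {l} (fst (snd x)) :: ennreal) \<in> borel_measurable (borel \<Otimes>\<^sub>M count_space UNIV \<Otimes>\<^sub>M conf_borel)"
      by (rule measurable_compose[OF measurable_compose[OF measurable_snd measurable_fst]]) simp
    show "(\<lambda>x. indicator {0<..1::real} (fst x) :: ennreal) \<in> borel_measurable (borel \<Otimes>\<^sub>M count_space UNIV \<Otimes>\<^sub>M conf_borel)"
      by (rule measurable_compose[OF measurable_fst borel_measurable_indicator]) simp
  qed
  have sum_single: "(\<Sum>l'\<in>UNIV. if l' = l then f l' else 0) = f l" for f :: "'k \<Rightarrow> ennreal"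
    by (simp add: sum.delta)
  have "(\<integral>\<^sup>+c. (\<Sum>l'\<in>UNIV. \<integral>\<^sup>+u. \<Phi> (u, l', c) \<partial>count_space (c l')) \<partial>P)
      = (\<integral>\<^sup>+c. (\<Sum>l'\<in>UNIV. if l' = l then (\<integral>\<^sup>+u. indicator {0<..1} u * \<Psi> (shift_conf (- u) c) \<partial>count_space (c l')) else 0) \<partial>P)"
    by (intro nn_integral_cong sum.cong refl) (simp add: \<Phi>_def)
  also have "\<dots> = (\<integral>\<^sup>+c. (\<integral>\<^sup>+u. indicator {0<..1} u * \<Psi> (shift_conf (- u) c) \<partial>count_space (c l)) \<partial>P)"
    by (simp only: sum_single)
  finally have lhs: "(\<integral>\<^sup>+c. (\<Sum>l'\<in>UNIV. \<integral>\<^sup>+u. \<Phi> (u, l', c) \<partial>count_space (c l')) \<partial>P)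
      = (\<integral>\<^sup>+c. (\<integral>\<^sup>+u. indicator {0<..1} u * \<Psi> (shift_conf (- u) c) \<partial>count_space (c l)) \<partial>P)" .
  have inner: "(\<integral>\<^sup>+c. \<Psi> (shift_conf (- u) c) \<partial>Q u l) = (\<integral>\<^sup>+c. \<Psi> c \<partial>Q 0 l)" for u
  proof -
    have "(\<lambda>c. \<Psi> (shift_conf (- u) c)) \<in> borel_measurable conf_borel"
      by (rule measurable_compose[OF measurable_shift_conf \<Psi>])
    from nn_integral_Q_shift[OF this, of u l] show ?thesis by (simp add: shift_conf_add)
  qed
  have "(\<integral>\<^sup>+u. (\<integral>\<^sup>+c. \<Phi> (u, l', c) \<partial>Q u l') \<partial>lborel) = (if l' = l then (\<integral>\<^sup>+c. \<Psi> c \<partial>Q 0 l) else 0)" for l'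
  proof (cases "l' = l")
    case True
    have "(\<integral>\<^sup>+c. \<Phi> (u, l', c) \<partial>Q u l') = (\<integral>\<^sup>+c. \<Psi> c \<partial>Q 0 l) * indicator {0<..1} u" for u
      using True inner[of u] by (cases "u \<in> {0<..1}") (auto simp: \<Phi>_def)
    then show ?thesis using True by (simp add: nn_integral_cmult_indicator)
  qed (simp add: \<Phi>_def)
  then have "(\<Sum>l'\<in>UNIV. ennreal (mean_rate P l') * (\<integral>\<^sup>+u. (\<integral>\<^sup>+c. \<Phi> (u, l', c) \<partial>Q u l') \<partial>lborel))
      = (\<Sum>l'\<in>UNIV. if l' = l then ennreal (mean_rate P l') * (\<integral>\<^sup>+c. \<Psi> c \<partial>Q 0 l) else 0)"
    by (intro sum.cong refl) simp
  also have "\<dots> = ennreal (mean_rate P l) * (\<integral>\<^sup>+c. \<Psi> c \<partial>Q 0 l)" by (simp only: sum_single)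
  finally show ?thesis using palm_eq[OF m] lhs by simp
qed

text \<open>
  Seen from one of its points, a configuration has a point at the origin.
\<close>

lemma Q_AE_anchor: "AE c in Q 0 l. 0 \<in> c l"
proof -
  define \<Psi> :: "'k conf \<Rightarrow> ennreal" where "\<Psi> c = indicator {0} (card (c l \<inter> {0}))" for c
  have \<Psi>: "\<Psi> \<in> borel_measurable conf_borel"
    unfolding \<Psi>_def by (rule measurable_compose[OF measurable_card_conf]) auto
  have "ennreal (mean_rate P l) * (\<integral>\<^sup>+c. \<Psi> c \<partial>Q 0 l)
    = (\<integral>\<^sup>+c. (\<integral>\<^sup>+u. indicator {0<..1} u * \<Psi> (shift_conf (- u) c) \<partial>count_space (c l)) \<partial>P)"
    by (rule palm_at_origin[OF \<Psi>])
  also have "\<dots> = (\<integral>\<^sup>+c. 0 \<partial>P)"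
  proof (rule nn_integral_cong)
    fix c :: "'k conf"
    have "(\<integral>\<^sup>+u. indicator {0<..1} u * \<Psi> (shift_conf (- u) c) \<partial>count_space (c l)) = (\<integral>\<^sup>+u. 0 \<partial>count_space (c l))"
    proof (rule nn_integral_cong)
      fix u assume "u \<in> space (count_space (c l))"
      then have "shift_conf (- u) c l \<inter> {0} = {0}" by (auto simp: shift_conf_def image_iff)
      then show "indicator {0<..1} u * \<Psi> (shift_conf (- u) c) = 0" by (simp add: \<Psi>_def)
    qed
    then show "(\<integral>\<^sup>+u. indicator {0<..1} u * \<Psi> (shift_conf (- u) c) \<partial>count_space (c l)) = 0" by simp
  qed
  finally have "(\<integral>\<^sup>+c. \<Psi> c \<partial>Q 0 l) = 0" using mean_rate_pos[of l] by simp
  then have "AE c in Q 0 l. \<Psi> c = 0"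
    using \<Psi> by (subst (asm) nn_integral_0_iff_AE) (simp_all add: measurable_Q_eq)
  then show ?thesis
  proof eventually_elim
    case (elim c)
    show ?case by (rule ccontr) (use elim in \<open>simp add: \<Psi>_def\<close>)
  qed
qed

lemma Q_bound_from_P:
  assumes \<Psi>: "\<Psi> \<in> borel_measurable conf_borel" and C: "0 \<le> C"
    and le: "(\<integral>\<^sup>+c. (\<integral>\<^sup>+u. indicator {0<..1} u * ennreal (\<Psi> (shift_conf (- u) c)) \<partial>count_space (c l)) \<partial>P) \<le> ennreal C"
  shows "(\<integral>\<^sup>+c. ennreal (\<Psi> c) \<partial>Q 0 l) \<le> ennreal (C / mean_rate P l)"
proof -
  let ?\<mu> = "mean_rate P l" and ?X = "\<integral>\<^sup>+c. ennreal (\<Psi> c) \<partial>Q 0 l"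
  have \<mu>: "0 < ?\<mu>" by (rule mean_rate_pos)
  have "ennreal ?\<mu> * ?X \<le> ennreal C"
    using palm_at_origin[OF measurable_compose[OF \<Psi> measurable_ennreal], of l] le by simp
  then have "ennreal (1 / ?\<mu>) * (ennreal ?\<mu> * ?X) \<le> ennreal (1 / ?\<mu>) * ennreal C" by (rule mult_left_mono) simp
  also have "ennreal (1 / ?\<mu>) * (ennreal ?\<mu> * ?X) = ennreal (1 / ?\<mu> * ?\<mu>) * ?X"
    using \<mu> by (subst ennreal_mult) (auto simp: mult.assoc)
  also have "ennreal (1 / ?\<mu>) * ennreal C = ennreal (C / ?\<mu>)"
    using \<mu> C by (subst ennreal_mult[symmetric]) auto
  finally show ?thesis using \<mu> by simp
qed

lemma count_space_sum_le:
  fixes g :: "real \<Rightarrow> real"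
  assumes fin: "finite (X \<inter> {0<..1})" and g: "\<And>u. u \<in> X \<inter> {0<..1} \<Longrightarrow> f u \<le> g u"
    and g0: "\<And>u. u \<in> X \<inter> {0<..1} \<Longrightarrow> 0 \<le> g u"
  shows "(\<integral>\<^sup>+u. indicator {0<..1} u * ennreal (f u) \<partial>count_space X) \<le> ennreal (\<Sum>u\<in>X \<inter> {0<..1}. g u)"
proof -
  have "(\<integral>\<^sup>+u. indicator {0<..1} u * ennreal (f u) \<partial>count_space X)
     = (\<Sum>u\<in>X \<inter> {0<..1}. indicator {0<..1} u * ennreal (f u))"
    using fin by (intro nn_integral_count_space'[of "X \<inter> {0<..1}"]) (auto simp: indicator_def)
  also have "\<dots> \<le> (\<Sum>u\<in>X \<inter> {0<..1}. ennreal (g u))"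
    using g by (intro sum_mono) (auto intro: ennreal_leI)
  also have "\<dots> = ennreal (\<Sum>u\<in>X \<inter> {0<..1}. g u)" using g0 by (rule sum_ennreal)
  finally show ?thesis .
qed

lemma Q_window_bound:
  "\<exists>C\<ge>0. \<forall>x. (\<integral>\<^sup>+c. ennreal ((1 + real (tot c {x - L..x}))\<^sup>2) \<partial>Q 0 l) \<le> ennreal C"
proof -
  obtain M where M: "0 \<le> M" and m: "\<And>y. (\<integral>\<^sup>+c. ennreal ((1 + real (tot c {y..y + (L + 1)})) ^ 4) \<partial>P) \<le> ennreal M"
    using window_moment_bound by blast
  obtain M' where M': "0 \<le> M'" and m': "\<And>y. (\<integral>\<^sup>+c. ennreal ((1 + real (tot c {y..y + 1})) ^ 4) \<partial>P) \<le> ennreal M'"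
    using window_moment_bound by blast
  have "(\<integral>\<^sup>+c. ennreal ((1 + real (tot c {x - L..x}))\<^sup>2) \<partial>Q 0 l) \<le> ennreal ((M' + M) / mean_rate P l)" for x
  proof (rule Q_bound_from_P)
    show "(\<lambda>c. (1 + real (tot c {x - L..x}))\<^sup>2) \<in> borel_measurable conf_borel"
      by (intro borel_measurable_power borel_measurable_add borel_measurable_const measurable_tot) auto
    have "(\<integral>\<^sup>+c. (\<integral>\<^sup>+u. indicator {0<..1} u * ennreal ((1 + real (tot (shift_conf (- u) c) {x - L..x}))\<^sup>2) \<partial>count_space (c l)) \<partial>P)
       \<le> (\<integral>\<^sup>+c. ennreal (real (tot c {0<..1}) * (1 + real (tot c {x - L..x - L + (L + 1)}))\<^sup>2) \<partial>P)"
    proof (rule nn_integral_mono)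
      fix c assume "c \<in> space P"
      then have c: "c \<in> configurations" by (simp add: space_P)
      let ?W = "(1 + real (tot c {x - L..x - L + (L + 1)}))\<^sup>2"
      have "(\<integral>\<^sup>+u. indicator {0<..1} u * ennreal ((1 + real (tot (shift_conf (- u) c) {x - L..x}))\<^sup>2) \<partial>count_space (c l))
         \<le> ennreal (\<Sum>u\<in>c l \<inter> {0<..1}. ?W)"
      proof (rule count_space_sum_le)
        fix u assume u: "u \<in> c l \<inter> {0<..1}"
        have "tot (shift_conf (- u) c) {x - L..x} \<le> tot c {x - L..x - L + (L + 1)}"
          unfolding tot_shift using u by (intro tot_mono c) auto
        then show "(1 + real (tot (shift_conf (- u) c) {x - L..x}))\<^sup>2 \<le> ?W" by (intro power_mono) auto
      qed (use conf_finite[OF c] in auto)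
      also have "(\<Sum>u\<in>c l \<inter> {0<..1}. ?W) \<le> real (tot c {0<..1}) * ?W"
        by (simp add: card_le_tot mult_right_mono)
      finally show "(\<integral>\<^sup>+u. indicator {0<..1} u * ennreal ((1 + real (tot (shift_conf (- u) c) {x - L..x}))\<^sup>2) \<partial>count_space (c l))
         \<le> ennreal (real (tot c {0<..1}) * ?W)" by (simp add: ennreal_leI order_trans)
    qed
    also have "\<dots> \<le> ennreal (M' + M)"
    proof (rule integral_le_add[where g="\<lambda>c. (1 + real (tot c {0..0 + 1})) ^ 4" and k="\<lambda>c. (1 + real (tot c {x - L..x - L + (L + 1)})) ^ 4"])
      fix c :: "'k conf" assume c: "c \<in> configurations"
      let ?n = "1 + real (tot c {0..0 + 1})" and ?w = "1 + real (tot c {x - L..x - L + (L + 1)})"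
      have "tot c {0<..1} \<le> tot c {0..0 + 1}" by (intro tot_mono c) auto
      then have "real (tot c {0<..1}) \<le> ?n" by simp
      then have "real (tot c {0<..1}) * ?w\<^sup>2 \<le> ?n * ?w\<^sup>2" by (intro mult_right_mono) auto
      also have "\<dots> \<le> ?n ^ 4 + ?w ^ 4"
      proof (cases "?n \<le> ?w")
        case True
        then have "?n * ?w\<^sup>2 \<le> ?w * ?w\<^sup>2" by (intro mult_right_mono) auto
        also have "\<dots> = ?w ^ 3" by (simp add: power2_eq_square power3_eq_cube)
        also have "\<dots> \<le> ?w ^ 4" by (intro power_increasing) auto
        finally show ?thesis by (rule add_increasing[rotated]) simp
      next
        case False
        then have "?n * ?w\<^sup>2 \<le> ?n * ?n\<^sup>2" by (intro mult_left_mono power_mono) auto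
        also have "\<dots> = ?n ^ 3" by (simp add: power2_eq_square power3_eq_cube)
        also have "\<dots> \<le> ?n ^ 4" by (intro power_increasing) auto
        finally show ?thesis by (rule add_increasing2[rotated]) simp
      qed
      finally show "real (tot c {0<..1}) * ?w\<^sup>2 \<le> ?n ^ 4 + ?w ^ 4" .
    next
      show "(\<integral>\<^sup>+c. ennreal ((1 + real (tot c {0..0 + 1})) ^ 4) \<partial>P) \<le> ennreal M'" by (rule m')
      show "(\<integral>\<^sup>+c. ennreal ((1 + real (tot c {x - L..x - L + (L + 1)})) ^ 4) \<partial>P) \<le> ennreal M" by (rule m)
    qed (use M M' in auto)
    finally show "(\<integral>\<^sup>+c. (\<integral>\<^sup>+u. indicator {0<..1} u * ennreal ((1 + real (tot (shift_conf (- u) c) {x - L..x}))\<^sup>2) \<partial>count_space (c l)) \<partial>P) \<le> ennreal (M' + M)" .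
  qed (use M M' in simp)
  moreover have "0 \<le> (M' + M) / mean_rate P l" using M M' mean_rate_pos[of l] by simp
  ultimately show ?thesis by blast
qed

end

section \<open>Translating the observation window\<close>

lemma sum_diff_le:
  fixes F G :: "'a \<Rightarrow> real"
  assumes fin: "finite X" "finite Y"
    and F: "\<And>s. s \<in> X \<Longrightarrow> \<bar>F s\<bar> \<le> M" and G: "\<And>s. s \<in> Y \<Longrightarrow> \<bar>G s\<bar> \<le> M"
    and FG: "\<And>s. s \<in> X \<Longrightarrow> s \<in> Y \<Longrightarrow> \<bar>F s - G s\<bar> \<le> \<epsilon>"
  shows "\<bar>sum F X - sum G Y\<bar> \<le> \<epsilon> * real (card (X \<inter> Y)) + M * (real (card (X - Y)) + real (card (Y - X)))"
proof -
  have "sum F X = sum F (X \<inter> Y) + sum F (X - Y)"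
    by (subst sum.union_disjoint[symmetric]) (use fin in \<open>auto intro!: sum.cong\<close>)
  moreover have "sum G Y = sum G (X \<inter> Y) + sum G (Y - X)"
    by (subst sum.union_disjoint[symmetric]) (use fin in \<open>auto intro!: sum.cong\<close>)
  ultimately have "sum F X - sum G Y = (\<Sum>s\<in>X \<inter> Y. F s - G s) + sum F (X - Y) - sum G (Y - X)"
    by (simp add: sum_subtractf)
  moreover have "\<bar>\<Sum>s\<in>X \<inter> Y. F s - G s\<bar> \<le> (\<Sum>s\<in>X \<inter> Y. \<epsilon>)"
    by (rule order_trans[OF sum_abs sum_mono]) (use FG in auto)
  moreover have "\<bar>sum F (X - Y)\<bar> \<le> (\<Sum>s\<in>X - Y. M)"
    by (rule order_trans[OF sum_abs sum_mono]) (use F in auto)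
  moreover have "\<bar>sum G (Y - X)\<bar> \<le> (\<Sum>s\<in>Y - X. M)"
    by (rule order_trans[OF sum_abs sum_mono]) (use G in auto)
  ultimately have "\<bar>sum F X - sum G Y\<bar> \<le> real (card (X \<inter> Y)) * \<epsilon> + real (card (X - Y)) * M + real (card (Y - X)) * M"
    by simp
  then show ?thesis by (simp add: algebra_simps)
qed

definition window_sum :: "real \<Rightarrow> ('k::finite \<Rightarrow> real \<Rightarrow> real) \<Rightarrow> real \<Rightarrow> 'k conf \<Rightarrow> real" where
  "window_sum A f x c = (\<Sum>j\<in>UNIV. \<Sum>s\<in>c j \<inter> {x - A..<x}. f j s)"

text \<open>
  The points by which the windows \<open>{x - A..<x}\<close> and \<open>{x - y - A..<x - y}\<close> can differ. The
  intervals are written as \<open>{p..p + y}\<close>, to fit the bound for such intervals under the Palm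
  distribution.
\<close>

definition edge_count :: "real \<Rightarrow> real \<Rightarrow> real \<Rightarrow> 'k::finite conf \<Rightarrow> real" where
  "edge_count A x y c = real (tot c {x - y..x - y + y}) + real (tot c {x - y - A..x - y - A + y})"

text \<open>
  The interval of length \<open>A + 1\<close> contains all windows translated by some \<open>y \<le> 1\<close>.
\<close>

definition window_count :: "real \<Rightarrow> real \<Rightarrow> 'k::finite conf \<Rightarrow> real" where
  "window_count A x c = 1 + real (tot c {x - (A + 1)..x})"

lemma window_count_ge_1: "1 \<le> window_count A x c"
  by (simp add: window_count_def)

lemma edge_count_nonneg: "0 \<le> edge_count A x y c"
  by (simp add: edge_count_def)

lemma window_sum_diff_le:
  fixes f g :: "'k::finite \<Rightarrow> real \<Rightarrow> real"
  assumes c: "c \<in> configurations" and y: "0 < y" "y \<le> 1" and \<epsilon>: "0 \<le> \<epsilon>" and M: "0 \<le> M"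
    and f: "\<And>j s. \<bar>f j s\<bar> \<le> M" and g: "\<And>j s. \<bar>g j s\<bar> \<le> M"
    and fg: "\<And>j s. s \<in> {x - A..<x} \<Longrightarrow> s \<in> {x - y - A..<x - y} \<Longrightarrow> \<bar>f j s - g j s\<bar> \<le> \<epsilon>"
  shows "\<bar>window_sum A f x c - window_sum A g (x - y) c\<bar> \<le> \<epsilon> * window_count A x c + M * edge_count A x y c"
proof -
  let ?X = "\<lambda>j. c j \<inter> {x - A..<x}" and ?Y = "\<lambda>j. c j \<inter> {x - y - A..<x - y}"
  have fin: "finite (c j \<inter> B)" if "bounded B" for j B by (rule conf_finite[OF c that])
  have one: "\<bar>sum (f j) (?X j) - sum (g j) (?Y j)\<bar>
     \<le> \<epsilon> * real (card (c j \<inter> {x - (A + 1)..x})) + M * (real (card (c j \<inter> {x - y..x - y + y})) + real (card (c j \<inter> {x - y - A..x - y - A + y})))" for j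
  proof -
    have "\<bar>sum (f j) (?X j) - sum (g j) (?Y j)\<bar>
       \<le> \<epsilon> * real (card (?X j \<inter> ?Y j)) + M * (real (card (?X j - ?Y j)) + real (card (?Y j - ?X j)))"
      by (rule sum_diff_le) (use f g fg fin in auto)
    also have "\<dots> \<le> \<epsilon> * real (card (c j \<inter> {x - (A + 1)..x})) + M * (real (card (c j \<inter> {x - y..x - y + y})) + real (card (c j \<inter> {x - y - A..x - y - A + y})))"
    proof (intro add_mono mult_left_mono \<epsilon> M)
      show "real (card (?X j \<inter> ?Y j)) \<le> real (card (c j \<inter> {x - (A + 1)..x}))"
        unfolding of_nat_le_iff using y by (intro card_mono fin) auto
      show "real (card (?X j - ?Y j)) \<le> real (card (c j \<inter> {x - y..x - y + y}))"
        unfolding of_nat_le_iff using y by (intro card_mono fin) auto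
      show "real (card (?Y j - ?X j)) \<le> real (card (c j \<inter> {x - y - A..x - y - A + y}))"
        unfolding of_nat_le_iff using y by (intro card_mono fin) auto
    qed
    finally show ?thesis .
  qed
  have "\<bar>window_sum A f x c - window_sum A g (x - y) c\<bar> \<le> (\<Sum>j\<in>UNIV. \<bar>sum (f j) (?X j) - sum (g j) (?Y j)\<bar>)"
    unfolding window_sum_def sum_subtractf[symmetric] by (rule sum_abs)
  also have "\<dots> \<le> (\<Sum>j\<in>UNIV. \<epsilon> * real (card (c j \<inter> {x - (A + 1)..x})) + M * (real (card (c j \<inter> {x - y..x - y + y})) + real (card (c j \<inter> {x - y - A..x - y - A + y}))))"
    by (intro sum_mono one)
  also have "\<dots> = \<epsilon> * real (tot c {x - (A + 1)..x}) + M * edge_count A x y c"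
    unfolding edge_count_def tot_def by (simp add: sum.distrib sum_distrib_left distrib_left)
  also have "\<dots> \<le> \<epsilon> * window_count A x c + M * edge_count A x y c"
    using \<epsilon> by (intro add_right_mono mult_left_mono) (auto simp: window_count_def)
  finally show ?thesis .
qed

lemma window_sum_le:
  assumes c: "c \<in> configurations" and y: "0 \<le> y" "y \<le> 1" and f: "\<And>j s. \<bar>f j s\<bar> \<le> M" and M: "0 \<le> M"
  shows "\<bar>window_sum A f (x - y) c\<bar> \<le> M * window_count A x c"
proof -
  have "\<bar>window_sum A f (x - y) c\<bar> \<le> (\<Sum>j\<in>UNIV. \<Sum>s\<in>c j \<inter> {x - y - A..<x - y}. M)"
    unfolding window_sum_def by (intro order_trans[OF sum_abs] sum_mono f)
  also have "\<dots> = M * real (tot c {x - y - A..<x - y})"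
    by (simp add: tot_def sum_distrib_left mult.commute)
  also have "\<dots> \<le> M * window_count A x c"
  proof (rule mult_left_mono[OF _ M])
    have "tot c {x - y - A..<x - y} \<le> tot c {x - (A + 1)..x}" using y by (intro tot_mono c) auto
    then show "real (tot c {x - y - A..<x - y}) \<le> window_count A x c" by (simp add: window_count_def)
  qed
  finally show ?thesis .
qed

lemma reciprocal_diff_le:
  fixes a b m :: real
  assumes "0 < m" "m \<le> a" "m \<le> b"
  shows "\<bar>1 / a - 1 / b\<bar> \<le> \<bar>a - b\<bar> / m\<^sup>2"
proof -
  have ab: "0 < a" "0 < b" using assms by auto
  have "1 / a - 1 / b = (b - a) / (a * b)" using ab by (simp add: field_simps)
  then have "\<bar>1 / a - 1 / b\<bar> = \<bar>a - b\<bar> / (a * b)" using ab by (simp add: abs_mult abs_minus_commute)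
  also have "\<dots> \<le> \<bar>a - b\<bar> / m\<^sup>2"
    using assms ab unfolding power2_eq_square by (intro divide_left_mono mult_mono) auto
  finally show ?thesis .
qed

lemma ratio_diff_le:
  fixes G G' a b m :: real
  assumes m: "0 < m" "m \<le> a" "m \<le> b"
  shows "\<bar>G / a - G' / b\<bar> \<le> \<bar>G - G'\<bar> / m + \<bar>G'\<bar> * (\<bar>a - b\<bar> / m\<^sup>2)"
proof -
  have ab: "0 < a" "0 < b" using m by auto
  have "G / a - G' / b = (G - G') / a + G' * (1 / a - 1 / b)" using ab by (simp add: field_simps)
  then have "\<bar>G / a - G' / b\<bar> \<le> \<bar>(G - G') / a\<bar> + \<bar>G' * (1 / a - 1 / b)\<bar>" by (simp only: abs_triangle_ineq)
  also have "\<dots> = \<bar>G - G'\<bar> / a + \<bar>G'\<bar> * \<bar>1 / a - 1 / b\<bar>" using ab by (simp add: abs_mult)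
  also have "\<dots> \<le> \<bar>G - G'\<bar> / m + \<bar>G'\<bar> * (\<bar>a - b\<bar> / m\<^sup>2)"
    using m ab by (intro add_mono mult_left_mono reciprocal_diff_le divide_left_mono) auto
  finally show ?thesis .
qed

context hawkes_palm
begin

text \<open>
  The Palm point is exchanged for the points \<open>u\<close> of mark \<open>l\<close> in \<open>(0, 1]\<close>, and the task is to
  count pairs of distinct points \<open>u\<close> and \<open>r\<close> with \<open>r - u\<close> in the given interval of length \<open>y\<close>.
  Cut the line into cells of length \<open>1/q\<close>. For large \<open>q\<close>, distinct points lie in different
  cells, and about \<open>q * (y * q + 3)\<close> pairs of different cells matter. With at most \<open>C / q\<^sup>2\<close>
  for each pair, the sum is \<open>C * (y + 3 / q)\<close>, and Fatou's lemma concludes. Puncturing is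
  essential: the Palm point itself may lie in the interval, however small \<open>y\<close> is.
\<close>

lemma Q_pair_bound:
  "\<exists>C\<ge>0. \<forall>x p y. 0 < y \<longrightarrow> y \<le> 1 \<longrightarrow>
    (\<integral>\<^sup>+c. ennreal ((1 + real (tot c {x - L..x})) * real (tot (punctured l c) {p..p + y})) \<partial>Q 0 l) \<le> ennreal (C * y)"
proof -
  obtain C d0 where C: "0 \<le> C" and d0: "0 < d0" and pair: "\<And>a b y d. 0 < d \<Longrightarrow> d \<le> d0 \<Longrightarrow> a + d \<le> b \<Longrightarrow>
    (\<integral>\<^sup>+c. ennreal (real (tot c {a<..a + d}) * real (tot c {b<..b + d}) * (1 + real (tot c {y..y + (L + 1)}))) \<partial>P) \<le> ennreal (C * d\<^sup>2)"
    using pair_window_bound[of "L + 1"] by blast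
  have bound: "(\<integral>\<^sup>+c. ennreal ((1 + real (tot c {x - L..x})) * real (tot (punctured l c) {p..p + y})) \<partial>Q 0 l)
      \<le> ennreal ((4 * C * y) / mean_rate P l)" if y: "0 < y" "y \<le> 1" for x p y
  proof (rule Q_bound_from_P)
    show "(\<lambda>c. (1 + real (tot c {x - L..x})) * real (tot (punctured l c) {p..p + y})) \<in> borel_measurable conf_borel"
      by (intro borel_measurable_times borel_measurable_add borel_measurable_const measurable_tot measurable_tot_punctured) auto
    define \<Psi> where "\<Psi> c = (1 + real (tot c {x - L..x})) * real (tot (punctured l c) {p..p + y})" for c
    define W where "W c = 1 + real (tot c {x - L..x - L + (L + 1)})" for c :: "'k conf"
    define cell where "cell q i = {of_int i / real (Suc q)<..of_int i / real (Suc q) + 1 / real (Suc q)}" for q and i :: int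
    \<comment> \<open>The cells, other than cell i, that meet the translate of {p..p + y} by some point of cell i.\<close>
    define S where "S q i = {\<lfloor>of_int i + p * real (Suc q) - 1\<rfloor> + 1..\<lceil>of_int i + 1 + (p + y) * real (Suc q)\<rceil> - 1} - {i}" for q and i :: int
    define G where "G q c = (\<Sum>i\<in>{0..<int (Suc q)}. \<Sum>m\<in>S q i. real (tot c (cell q i)) * real (tot c (cell q m)) * W c)" for q c
    have W0: "1 \<le> W c" for c unfolding W_def by simp
    have finS: "finite (S q i)" for q i unfolding S_def by simp
    have cell_meas: "(\<lambda>c. real (tot c (cell q i))) \<in> borel_measurable P" for q i
      unfolding cell_def by (rule tot_P)
    have W_meas: "W \<in> borel_measurable P" unfolding W_def by measurable
    have G_meas: "G q \<in> borel_measurable P" for q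
      unfolding G_def by (intro borel_measurable_sum borel_measurable_times cell_meas W_meas)
    have cardS: "real (card (S q i)) \<le> y * real (Suc q) + 3" for q i
    proof -
      let ?\<alpha> = "of_int i + p * real (Suc q) - 1" and ?\<beta> = "of_int i + 1 + (p + y) * real (Suc q)"
      have "card (S q i) \<le> card {\<lfloor>?\<alpha>\<rfloor> + 1..\<lceil>?\<beta>\<rceil> - 1}" unfolding S_def by (intro card_mono) auto
      also have "\<dots> = nat (\<lceil>?\<beta>\<rceil> - 1 - \<lfloor>?\<alpha>\<rfloor>)" by simp
      finally have "real (card (S q i)) \<le> real (nat (\<lceil>?\<beta>\<rceil> - 1 - \<lfloor>?\<alpha>\<rfloor>))" by simp
      also have "\<dots> \<le> max 0 (?\<beta> - ?\<alpha> + 1)" by linarith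
      also have "?\<beta> - ?\<alpha> + 1 = y * real (Suc q) + 3" by (simp add: algebra_simps)
      finally show ?thesis using y by simp
    qed
    have int_G: "(\<integral>\<^sup>+c. ennreal (G q c) \<partial>P) \<le> ennreal (4 * C * y)"
      if q: "1 / real (Suc q) \<le> d0" "1 / real (Suc q) \<le> y" for q
    proof -
      let ?d = "1 / real (Suc q)"
      have pq: "(\<integral>\<^sup>+c. ennreal (real (tot c (cell q i)) * real (tot c (cell q m)) * W c) \<partial>P) \<le> ennreal (C * ?d\<^sup>2)"
        if "i \<noteq> m" for i m
      proof -
        have lt: "of_int i / real (Suc q) + ?d \<le> of_int m / real (Suc q)" if "i < m" for i m :: int
        proof -
          have "of_int i + 1 \<le> (of_int m :: real)" using that by linarith
          then have "(of_int i + 1) / real (Suc q) \<le> of_int m / real (Suc q)" by (intro divide_right_mono) auto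
          then show ?thesis by (simp only: add_divide_distrib)
        qed
        show ?thesis
        proof (cases "i < m")
          case True
          show ?thesis unfolding cell_def W_def by (rule pair[OF _ q(1) lt[OF True]]) simp
        next
          case False
          then have "m < i" using that by simp
          have "(\<integral>\<^sup>+c. ennreal (real (tot c (cell q m)) * real (tot c (cell q i)) * W c) \<partial>P) \<le> ennreal (C * ?d\<^sup>2)"
            unfolding cell_def W_def by (rule pair[OF _ q(1) lt[OF \<open>m < i\<close>]]) simp
          then show ?thesis by (simp only: mult.commute[of "real (tot _ (cell q i))"])
        qed
      qed
      let ?K = "(y * real (Suc q) + 3) * (C * ?d\<^sup>2)"
      have K0: "0 \<le> ?K" using y C by (intro mult_nonneg_nonneg add_nonneg_nonneg) auto
      have "(\<integral>\<^sup>+c. ennreal (\<Sum>m\<in>S q i. real (tot c (cell q i)) * real (tot c (cell q m)) * W c) \<partial>P) \<le> ennreal ?K" for i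
      proof -
        have "(\<integral>\<^sup>+c. ennreal (\<Sum>m\<in>S q i. real (tot c (cell q i)) * real (tot c (cell q m)) * W c) \<partial>P)
           \<le> ennreal (real (card (S q i)) * (C * ?d\<^sup>2))"
        proof (rule integral_sum_bound[OF finS])
          fix m assume "m \<in> S q i"
          then have "i \<noteq> m" unfolding S_def by auto
          then show "(\<integral>\<^sup>+c. ennreal (real (tot c (cell q i)) * real (tot c (cell q m)) * W c) \<partial>P) \<le> ennreal (C * ?d\<^sup>2)"
            by (rule pq)
          show "0 \<le> real (tot c (cell q i)) * real (tot c (cell q m)) * W c" for c using W0[of c] by simp
          show "(\<lambda>c. real (tot c (cell q i)) * real (tot c (cell q m)) * W c) \<in> borel_measurable P"
            by (intro borel_measurable_times cell_meas W_meas)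
        qed (use C in simp)
        also have "\<dots> \<le> ennreal ?K" using C cardS[of q i] by (intro ennreal_leI mult_right_mono) auto
        finally show ?thesis .
      qed
      then have "(\<integral>\<^sup>+c. ennreal (G q c) \<partial>P) \<le> ennreal (real (card {0..<int (Suc q)}) * ?K)"
        unfolding G_def
      proof (intro integral_sum_bound)
        fix i
        show "(\<lambda>c. \<Sum>m\<in>S q i. real (tot c (cell q i)) * real (tot c (cell q m)) * W c) \<in> borel_measurable P"
          by (intro borel_measurable_sum borel_measurable_times cell_meas W_meas)
        show "0 \<le> (\<Sum>m\<in>S q i. real (tot c (cell q i)) * real (tot c (cell q m)) * W c)" for c
          using W0[of c] by (intro sum_nonneg) simp
      qed (use K0 in auto)
      also have "real (card {0..<int (Suc q)}) * ?K = C * (y + 3 * ?d)"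
      proof -
        have "r * ((y * r + 3) * (C * (1 / r)\<^sup>2)) = C * (y + 3 * (1 / r))" if "0 < r" for r :: real
          using that by (simp add: field_simps power2_eq_square)
        from this[of "real (Suc q)"] show ?thesis by simp
      qed
      also have "C * (y + 3 * ?d) \<le> C * (4 * y)" using C q(2) by (intro mult_left_mono) auto
      finally show ?thesis by (simp add: ennreal_leI mult_ac)
    qed
    have lim0: "(\<lambda>q. 1 / real (Suc q)) \<longlonglongrightarrow> 0" by (rule LIMSEQ_Suc) (rule lim_const_over_n)
    have pointwise: "AE c in P. (\<integral>\<^sup>+u. indicator {0<..1} u * ennreal (\<Psi> (shift_conf (- u) c)) \<partial>count_space (c l)) \<le> liminf (\<lambda>q. ennreal (G q c))"
      using AE_disjoint AE_space
    proof eventually_elim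
      case (elim c)
      have c: "c \<in> configurations" using elim(2) by (simp add: space_P)
      have dis: "j \<noteq> k \<Longrightarrow> c j \<inter> c k = {}" for j k using elim(1) by blast
      obtain \<eta> where \<eta>: "0 < \<eta>" and sep: "\<And>k j r s. r \<in> c k \<inter> {- (\<bar>p\<bar> + 3)..\<bar>p\<bar> + 3} \<Longrightarrow> s \<in> c j \<inter> {- (\<bar>p\<bar> + 3)..\<bar>p\<bar> + 3} \<Longrightarrow> r \<noteq> s \<Longrightarrow> \<eta> \<le> \<bar>r - s\<bar>"
        using conf_separation[OF c bounded_closed_interval[of "- (\<bar>p\<bar> + 3)" "\<bar>p\<bar> + 3"]] by blast
      have "\<forall>\<^sub>F q in sequentially. 1 / real (Suc q) < \<eta>"
        using lim0 \<eta> by (intro order_tendstoD(2)) auto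
      then have "\<forall>\<^sub>F q in sequentially. (\<integral>\<^sup>+u. indicator {0<..1} u * ennreal (\<Psi> (shift_conf (- u) c)) \<partial>count_space (c l)) \<le> ennreal (G q c)"
      proof eventually_elim
        case (elim q)
        let ?q = "real (Suc q)"
        define I where "I u = \<lceil>u * ?q\<rceil> - 1" for u :: real
        have in_cell: "u \<in> cell q (I u)" for u
        proof -
          have "of_int (I u) < u * ?q" "u * ?q \<le> of_int (I u) + 1" unfolding I_def by linarith+
          then have "of_int (I u) / ?q < u" "u \<le> (of_int (I u) + 1) / ?q"
            by (simp_all only: pos_divide_less_eq pos_le_divide_eq of_nat_0_less_iff zero_less_Suc)
          then show ?thesis unfolding cell_def by (simp add: add_divide_distrib)
        qed
        have cell_close: "\<bar>r - u\<bar> < \<eta>" if "r \<in> cell q i" "u \<in> cell q i" for r u i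
          using that elim unfolding cell_def by auto
        have finX: "finite (c j \<inter> cell q i)" for j i
          unfolding cell_def by (rule conf_finite[OF c]) simp
        have I_range: "I u \<in> {0..<int (Suc q)}" if "u \<in> {0<..1}" for u
        proof -
          have "0 < u * ?q" "u * ?q \<le> of_int (int (Suc q))" using that by auto
          then have "0 < \<lceil>u * ?q\<rceil>" "\<lceil>u * ?q\<rceil> \<le> int (Suc q)"
            by (simp_all only: zero_less_ceiling ceiling_le_iff)
          then show ?thesis unfolding I_def atLeastLessThan_iff by linarith
        qed
        have T: "real (tot (punctured l (shift_conf (- u) c)) {p..p + y}) \<le> (\<Sum>m\<in>S q (I u). real (tot c (cell q m)))"
          if u: "u \<in> c l \<inter> {0<..1}" for u
        proof -
          have card_j: "card (punctured l (shift_conf (- u) c) j \<inter> {p..p + y}) \<le> (\<Sum>m\<in>S q (I u). card (c j \<inter> cell q m))" for j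
          proof -
            let ?D = "punctured l (shift_conf (- u) c) j \<inter> {p..p + y}"
            have "(\<lambda>s. s + u) ` ?D \<subseteq> (\<Union>m\<in>S q (I u). c j \<inter> cell q m)"
            proof
              fix r assume "r \<in> (\<lambda>s. s + u) ` ?D"
              then obtain s where s: "s \<in> ?D" "r = s + u" by blast
              have r: "r \<in> c j" using s by (auto simp: punctured_def shift_conf_def split: if_splits)
              have ru: "p \<le> r - u" "r - u \<le> p + y" using s by auto
              have "r \<noteq> u"
              proof (cases "j = l")
                case True
                then show ?thesis using s by (auto simp: punctured_def)
              next
                case False
                then show ?thesis using dis[of j l] r u by auto
              qed
              have "I r \<noteq> I u"
              proof
                assume "I r = I u"
                then have "\<bar>r - u\<bar> < \<eta>" using cell_close[of r "I u" u] in_cell[of r] in_cell[of u] by simp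
                moreover have "r \<in> c j \<inter> {- (\<bar>p\<bar> + 3)..\<bar>p\<bar> + 3}" "u \<in> c l \<inter> {- (\<bar>p\<bar> + 3)..\<bar>p\<bar> + 3}"
                  using r u ru y by auto
                ultimately show False using sep[of r j u l] \<open>r \<noteq> u\<close> by simp
              qed
              moreover have "of_int (I u) + p * ?q - 1 < of_int (I r)"
              proof -
                have "(u + p) * ?q \<le> r * ?q" using ru by (intro mult_right_mono) auto
                then have "u * ?q + p * ?q \<le> r * ?q" by (simp only: distrib_right)
                moreover have "of_int (I u) < u * ?q" "r * ?q \<le> of_int (I r) + 1" unfolding I_def by linarith+
                ultimately show ?thesis by linarith
              qed
              moreover have "of_int (I r) < of_int (I u) + 1 + (p + y) * ?q"
              proof -
                have "r * ?q \<le> (u + (p + y)) * ?q" using ru by (intro mult_right_mono) auto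
                then have "r * ?q \<le> u * ?q + (p + y) * ?q" by (simp only: distrib_right)
                moreover have "of_int (I r) < r * ?q" "u * ?q \<le> of_int (I u) + 1" unfolding I_def by linarith+
                ultimately show ?thesis by linarith
              qed
              ultimately have "I r \<in> S q (I u)"
                unfolding S_def Diff_iff atLeastAtMost_iff singleton_iff by linarith
              then show "r \<in> (\<Union>m\<in>S q (I u). c j \<inter> cell q m)" using r in_cell[of r] by blast
            qed
            then have "card ((\<lambda>s. s + u) ` ?D) \<le> card (\<Union>m\<in>S q (I u). c j \<inter> cell q m)"
              using finS finX by (intro card_mono finite_UN_I)
            also have "\<dots> \<le> (\<Sum>m\<in>S q (I u). card (c j \<inter> cell q m))" by (rule card_UN_le[OF finS])
            finally show ?thesis by (simp add: card_image inj_on_def)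
          qed
          have "tot (punctured l (shift_conf (- u) c)) {p..p + y} \<le> (\<Sum>j\<in>UNIV. \<Sum>m\<in>S q (I u). card (c j \<inter> cell q m))"
            unfolding tot_def by (intro sum_mono card_j)
          also have "\<dots> = (\<Sum>m\<in>S q (I u). tot c (cell q m))" unfolding tot_def by (rule sum.swap)
          finally show ?thesis unfolding of_nat_sum[symmetric] of_nat_le_iff .
        qed
        let ?X = "c l \<inter> {0<..1}"
        let ?F = "\<lambda>i. W c * (\<Sum>m\<in>S q i. real (tot c (cell q m)))"
        have F0: "0 \<le> ?F i" for i using W0[of c] by (intro mult_nonneg_nonneg sum_nonneg) auto
        have fX: "finite ?X" by (rule conf_finite[OF c]) simp
        have "(\<integral>\<^sup>+u. indicator {0<..1} u * ennreal (\<Psi> (shift_conf (- u) c)) \<partial>count_space (c l)) \<le> ennreal (\<Sum>u\<in>?X. ?F (I u))"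
        proof (rule count_space_sum_le[OF fX])
          fix u assume u: "u \<in> ?X"
          have "tot (shift_conf (- u) c) {x - L..x} \<le> tot c {x - L..x - L + (L + 1)}"
            unfolding tot_shift using u by (intro tot_mono c) auto
          then show "\<Psi> (shift_conf (- u) c) \<le> ?F (I u)"
            unfolding \<Psi>_def W_def by (intro mult_mono T[OF u]) auto
        qed (rule F0)
        also have "(\<Sum>u\<in>?X. ?F (I u)) = (\<Sum>i\<in>{0..<int (Suc q)}. \<Sum>u\<in>{u \<in> ?X. I u = i}. ?F (I u))"
          using I_range by (intro sum.group[symmetric] fX) auto
        also have "\<dots> = (\<Sum>i\<in>{0..<int (Suc q)}. real (card {u \<in> ?X. I u = i}) * ?F i)"
          by (intro sum.cong refl) simp
        also have "\<dots> \<le> (\<Sum>i\<in>{0..<int (Suc q)}. real (tot c (cell q i)) * ?F i)"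
        proof (intro sum_mono mult_right_mono F0)
          fix i
          have "card {u \<in> ?X. I u = i} \<le> card (c l \<inter> cell q i)"
            using in_cell by (intro card_mono finX) auto
          also have "\<dots> \<le> tot c (cell q i)" by (rule card_le_tot)
          finally show "real (card {u \<in> ?X. I u = i}) \<le> real (tot c (cell q i))" by simp
        qed
        also have "\<dots> = G q c"
          unfolding G_def by (simp add: sum_distrib_left mult_ac)
        finally show ?case by (simp add: ennreal_leI order_trans)
      qed
      then show ?case by (rule Liminf_bounded)
    qed
    have "(\<integral>\<^sup>+c. (\<integral>\<^sup>+u. indicator {0<..1} u * ennreal (\<Psi> (shift_conf (- u) c)) \<partial>count_space (c l)) \<partial>P)
       \<le> (\<integral>\<^sup>+c. liminf (\<lambda>q. ennreal (G q c)) \<partial>P)"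
      by (rule nn_integral_mono_AE[OF pointwise])
    also have "\<dots> \<le> liminf (\<lambda>q. \<integral>\<^sup>+c. ennreal (G q c) \<partial>P)"
      by (rule nn_integral_liminf) (intro measurable_compose[OF G_meas measurable_ennreal])
    also have "\<dots> \<le> limsup (\<lambda>q. \<integral>\<^sup>+c. ennreal (G q c) \<partial>P)" by (rule Liminf_le_Limsup) simp
    also have "\<dots> \<le> ennreal (4 * C * y)"
    proof (rule Limsup_bounded)
      have "\<forall>\<^sub>F q in sequentially. 1 / real (Suc q) < d0" "\<forall>\<^sub>F q in sequentially. 1 / real (Suc q) < y"
        using lim0 d0 y by (intro order_tendstoD(2); simp)+
      then show "\<forall>\<^sub>F q in sequentially. (\<integral>\<^sup>+c. ennreal (G q c) \<partial>P) \<le> ennreal (4 * C * y)"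
        by eventually_elim (intro int_G, auto)
    qed
    finally show "(\<integral>\<^sup>+c. (\<integral>\<^sup>+u. indicator {0<..1} u * ennreal ((1 + real (tot (shift_conf (- u) c) {x - L..x})) * real (tot (punctured l (shift_conf (- u) c)) {p..p + y})) \<partial>count_space (c l)) \<partial>P)
      \<le> ennreal (4 * C * y)" unfolding \<Psi>_def .
  qed (use C y in simp)
  show ?thesis
    using bound C mean_rate_pos[of l] by (intro exI[of _ "4 * C / mean_rate P l"]) auto
qed

end

section \<open>Commutators with translations\<close>

lemma AE_lborel_affine:
  fixes R :: "real \<Rightarrow> bool"
  assumes "AE x in lborel. R x" "a \<noteq> 0"
  shows "AE x in lborel. R (t + a * x)"
proof -
  obtain N where N: "N \<in> null_sets lborel" "{x \<in> space lborel. \<not> R x} \<subseteq> N"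
    using assms(1) unfolding eventually_ae_filter by blast
  have "N \<in> sets borel" using N(1) by auto
  then have "Measurable.pred borel (\<lambda>x. x \<notin> N)" by measurable
  moreover have "AE x in lborel. x \<notin> N" using N(1) by (rule AE_not_in)
  ultimately have "AE x in lborel. t + a * x \<notin> N" by (rule AE_borel_affine[OF assms(2)])
  then show ?thesis by eventually_elim (use N(2) in auto)
qed

lemma holder_uniform:
  fixes f :: "'k::finite \<Rightarrow> 'k \<Rightarrow> real \<Rightarrow> real"
  assumes "\<And>l k. holder_on \<beta> S (f l k)"
  shows "\<exists>L\<ge>0. \<forall>l k. \<forall>x\<in>S. \<forall>y\<in>S. \<bar>f l k x - f l k y\<bar> \<le> L * \<bar>x - y\<bar> powr \<beta>"
proof -
  obtain L where L: "\<And>l k x y. x \<in> S \<Longrightarrow> y \<in> S \<Longrightarrow> \<bar>f l k x - f l k y\<bar> \<le> L l k * \<bar>x - y\<bar> powr \<beta>"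
    using assms unfolding holder_on_def by metis
  define L' where "L' = (\<Sum>l\<in>UNIV. \<Sum>k\<in>UNIV. \<bar>L l k\<bar>)"
  have "L l k \<le> L'" for l k
  proof -
    have "\<bar>L l k\<bar> \<le> (\<Sum>k\<in>UNIV. \<bar>L l k\<bar>)" by (rule member_le_sum) auto
    also have "\<dots> \<le> L'" unfolding L'_def by (rule member_le_sum) (auto intro: sum_nonneg)
    finally show ?thesis by linarith
  qed
  then have "\<bar>f l k x - f l k y\<bar> \<le> L' * \<bar>x - y\<bar> powr \<beta>" if "x \<in> S" "y \<in> S" for l k x y
    using order_trans[OF L[OF that] mult_right_mono] by simp
  moreover have "0 \<le> L'" unfolding L'_def by (intro sum_nonneg) auto
  ultimately show ?thesis by blast
qed

lemma integral_diff_bound: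
  fixes f g :: "'a \<Rightarrow> real"
  assumes f: "integrable M f" "integrable M g" and K: "0 \<le> K" and C: "0 \<le> C"
    and le: "AE x in M. \<bar>f x - g x\<bar> \<le> K * e x"
    and e: "e \<in> borel_measurable M" "(\<integral>\<^sup>+x. ennreal (e x) \<partial>M) \<le> ennreal C"
  shows "\<bar>(\<integral>x. f x \<partial>M) - (\<integral>x. g x \<partial>M)\<bar> \<le> K * C"
proof -
  have "ennreal \<bar>(\<integral>x. f x \<partial>M) - (\<integral>x. g x \<partial>M)\<bar> = ennreal \<bar>\<integral>x. f x - g x \<partial>M\<bar>"
    using f by (simp add: Bochner_Integration.integral_diff)
  also have "\<dots> \<le> (\<integral>\<^sup>+x. ennreal \<bar>f x - g x\<bar> \<partial>M)"
    using integral_norm_bound_ennreal[of M "\<lambda>x. f x - g x"] f by simp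
  also have "\<dots> \<le> (\<integral>\<^sup>+x. ennreal K * ennreal (e x) \<partial>M)"
    by (rule nn_integral_mono_AE) (use le in eventually_elim, auto simp: ennreal_mult'[OF K, symmetric] intro: ennreal_leI)
  also have "\<dots> = ennreal K * (\<integral>\<^sup>+x. ennreal (e x) \<partial>M)"
    using e(1) by (intro nn_integral_cmult measurable_compose[OF _ measurable_ennreal])
  also have "\<dots> \<le> ennreal K * ennreal C" by (intro mult_left_mono e) auto
  also have "\<dots> = ennreal (K * C)" using K C by (simp add: ennreal_mult)
  finally show ?thesis using K C by (simp add: ennreal_le_iff)
qed

lemma ennreal_combine:
  "0 \<le> p \<Longrightarrow> 0 \<le> q \<Longrightarrow> 0 \<le> r \<Longrightarrow> ennreal p * ennreal q + (ennreal r + ennreal r) = ennreal (p * q + (r + r))"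
  by (simp only: ennreal_mult ennreal_plus mult_nonneg_nonneg add_nonneg_nonneg)

lemma nn_integral_combine:
  assumes "f \<in> borel_measurable M" "g \<in> borel_measurable M" "k \<in> borel_measurable M"
  shows "(\<integral>\<^sup>+c. a * f c + (g c + k c) \<partial>M) = a * (\<integral>\<^sup>+c. f c \<partial>M) + ((\<integral>\<^sup>+c. g c \<partial>M) + (\<integral>\<^sup>+c. k c \<partial>M))"
  using assms by (simp add: nn_integral_add nn_integral_cmult)

lemma powr_ge_self:
  fixes y \<beta> :: real
  assumes "0 < y" "y \<le> 1" "0 < \<beta>" "\<beta> \<le> 1"
  shows "y \<le> y powr \<beta>"
  using powr_mono'[of \<beta> 1 y] assms by simp

locale hawkes_operator = hawkes_palm A \<nu> h P H Q
  for A :: real and \<nu> :: "'k::finite \<Rightarrow> real" and h and P and H and Q +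
  fixes \<beta> :: real and he :: "'k \<Rightarrow> 'k \<Rightarrow> real \<Rightarrow> real"
  assumes \<beta>_pos: "0 < \<beta>" and \<beta>_le: "\<beta> \<le> 1"
    and h_holder: "\<And>l k. holder_on \<beta> {0..A} (h l k)"
    and he_holder: "\<And>l k. holder_on \<beta> UNIV (he l k)"
    and he_eq: "\<And>l k x. x \<in> {0..A} \<Longrightarrow> he l k x = h l k x"
    and he_ge: "\<And>l k x. he l k x \<ge> - \<nu> k / 2"
begin

text \<open>
  A random variable of size \<open>y powr \<beta>\<close> in mean that bounds, up to constants, all changes caused
  by a translation of the window by \<open>y\<close>.
\<close>

definition error :: "real \<Rightarrow> real \<Rightarrow> 'k conf \<Rightarrow> real" where
  "error x y c = y powr \<beta> * (window_count A x c)\<^sup>2 + window_count A x c * edge_count A x y c"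

lemma window_count_punctured_le:
  assumes "c \<in> configurations"
  shows "window_count A x (punctured l c) \<le> window_count A x c"
proof -
  have "tot (punctured l c) B \<le> tot c B" if "bounded B" for B
    unfolding tot_def punctured_Int
    by (intro sum_mono card_mono conf_finite[OF assms that]) auto
  then show ?thesis by (simp add: window_count_def)
qed

lemma window_count_punctured_measurable:
  "(\<lambda>c. window_count A x (punctured l c)) \<in> borel_measurable conf_borel"
  unfolding window_count_def
  by (intro borel_measurable_add borel_measurable_const measurable_tot_punctured) auto

lemma error_punctured_measurable: "(\<lambda>c. error x y (punctured l c)) \<in> borel_measurable conf_borel"
  unfolding error_def edge_count_def window_count_def
  by (intro borel_measurable_add borel_measurable_times borel_measurable_power borel_measurable_const measurable_tot_punctured) auto

lemma error_measurable: "error x y \<in> borel_measurable conf_borel"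
  unfolding error_def edge_count_def window_count_def
  by (intro borel_measurable_add borel_measurable_times borel_measurable_power borel_measurable_const measurable_tot) auto

lemma Q_error_bound:
  "\<exists>C\<ge>0. \<forall>x y. 0 < y \<longrightarrow> y \<le> 1 \<longrightarrow> (\<integral>\<^sup>+c. ennreal (error x y (punctured l c)) \<partial>Q 0 l) \<le> ennreal (C * y powr \<beta>)"
proof -
  obtain C1 where C1: "0 \<le> C1" and c1: "\<And>x. (\<integral>\<^sup>+c. ennreal ((1 + real (tot c {x - (A + 1)..x}))\<^sup>2) \<partial>Q 0 l) \<le> ennreal C1"
    using Q_window_bound[where L="A + 1" and l=l] by blast
  obtain C2 where C2: "0 \<le> C2" and c2: "\<And>x p y. 0 < y \<Longrightarrow> y \<le> 1 \<Longrightarrow>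
    (\<integral>\<^sup>+c. ennreal ((1 + real (tot c {x - (A + 1)..x})) * real (tot (punctured l c) {p..p + y})) \<partial>Q 0 l) \<le> ennreal (C2 * y)"
    using Q_pair_bound[where L="A + 1" and l=l] by blast
  have "(\<integral>\<^sup>+c. ennreal (error x y (punctured l c)) \<partial>Q 0 l) \<le> ennreal ((C1 + 2 * C2) * y powr \<beta>)"
    if y: "0 < y" "y \<le> 1" for x y
  proof -
    let ?W = "\<lambda>c. 1 + real (tot c {x - (A + 1)..x})"
    let ?E = "\<lambda>p c. real (tot (punctured l c) {p..p + y})"
    have WQ: "?W \<in> borel_measurable (Q 0 l)"
      unfolding measurable_Q_eq by (intro borel_measurable_add borel_measurable_const measurable_tot) auto
    have EQ: "?E p \<in> borel_measurable (Q 0 l)" for p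
      unfolding measurable_Q_eq by (intro measurable_tot_punctured) auto
    have "(\<integral>\<^sup>+c. ennreal (error x y (punctured l c)) \<partial>Q 0 l)
      \<le> (\<integral>\<^sup>+c. ennreal (y powr \<beta>) * ennreal ((?W c)\<^sup>2) + (ennreal (?W c * ?E (x - y) c) + ennreal (?W c * ?E (x - y - A) c)) \<partial>Q 0 l)"
    proof (rule nn_integral_mono)
      fix c assume "c \<in> space (Q 0 l)"
      then have c: "c \<in> configurations" by (simp add: space_Q)
      have W: "window_count A x (punctured l c) \<le> ?W c"
        using window_count_punctured_le[OF c] by (simp add: window_count_def)
      have W1: "1 \<le> window_count A x (punctured l c)" by (rule window_count_ge_1)
      have "error x y (punctured l c) \<le> y powr \<beta> * (?W c)\<^sup>2 + ?W c * (?E (x - y) c + ?E (x - y - A) c)"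
        unfolding error_def edge_count_def using W W1 by (intro add_mono mult_left_mono mult_right_mono power_mono) auto
      then have "ennreal (error x y (punctured l c)) \<le> ennreal (y powr \<beta> * (?W c)\<^sup>2 + (?W c * ?E (x - y) c + ?W c * ?E (x - y - A) c))"
        by (intro ennreal_leI) (simp add: distrib_left)
      also have "\<dots> = ennreal (y powr \<beta>) * ennreal ((?W c)\<^sup>2) + (ennreal (?W c * ?E (x - y) c) + ennreal (?W c * ?E (x - y - A) c))"
        by (subst ennreal_plus, simp, simp, subst ennreal_plus, simp, simp, subst ennreal_mult) auto
      finally show "ennreal (error x y (punctured l c)) \<le> \<dots>" .
    qed
    also have "\<dots> = ennreal (y powr \<beta>) * (\<integral>\<^sup>+c. ennreal ((?W c)\<^sup>2) \<partial>Q 0 l)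
       + ((\<integral>\<^sup>+c. ennreal (?W c * ?E (x - y) c) \<partial>Q 0 l) + (\<integral>\<^sup>+c. ennreal (?W c * ?E (x - y - A) c) \<partial>Q 0 l))"
      by (intro nn_integral_combine measurable_compose[OF _ measurable_ennreal] borel_measurable_power borel_measurable_times WQ EQ)
    also have "\<dots> \<le> ennreal (y powr \<beta>) * ennreal C1 + (ennreal (C2 * y) + ennreal (C2 * y))"
      by (intro add_mono mult_left_mono c1 c2 y) auto
    also have "\<dots> = ennreal (y powr \<beta> * C1 + (C2 * y + C2 * y))"
      using y C1 C2 by (intro ennreal_combine) auto
    also have "\<dots> \<le> ennreal ((C1 + 2 * C2) * y powr \<beta>)"
    proof (rule ennreal_leI)
      have "C2 * y \<le> C2 * y powr \<beta>" using powr_ge_self[OF y \<beta>_pos \<beta>_le] C2 by (intro mult_left_mono)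
      then show "y powr \<beta> * C1 + (C2 * y + C2 * y) \<le> (C1 + 2 * C2) * y powr \<beta>" by (simp add: algebra_simps)
    qed
    finally show ?thesis .
  qed
  then show ?thesis using C1 C2 by (intro exI[of _ "C1 + 2 * C2"]) auto
qed

lemma P_error_bound:
  "\<exists>C\<ge>0. \<exists>y0>0. y0 \<le> 1 \<and> (\<forall>x y. 0 < y \<longrightarrow> y \<le> y0 \<longrightarrow> (\<integral>\<^sup>+c. ennreal (error x y c) \<partial>P) \<le> ennreal (C * y powr \<beta>))"
proof -
  obtain C1 where C1: "0 \<le> C1" and c1: "\<And>y. (\<integral>\<^sup>+c. ennreal ((1 + real (tot c {y..y + (A + 1)})) ^ 4) \<partial>P) \<le> ennreal C1"
    using window_moment_bound[of "A + 1"] by blast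
  obtain C2 d0 where C2: "0 \<le> C2" and d0: "0 < d0" and c2: "\<And>a y d. 0 < d \<Longrightarrow> d \<le> d0 \<Longrightarrow>
    (\<integral>\<^sup>+c. ennreal (real (tot c {a<..a + d}) * (1 + real (tot c {y..y + (A + 1)}))) \<partial>P) \<le> ennreal (C2 * d)"
    using births_window_bound[of "A + 1"] by blast
  define y0 where "y0 = min 1 (d0 / 2)"
  have y0: "0 < y0" "y0 \<le> 1" unfolding y0_def using d0 by auto
  have "(\<integral>\<^sup>+c. ennreal (error x y c) \<partial>P) \<le> ennreal ((C1 + 4 * C2) * y powr \<beta>)"
    if y: "0 < y" "y \<le> y0" for x y
  proof -
    have y1: "y \<le> 1" "2 * y \<le> d0" using y unfolding y0_def by auto
    let ?W = "\<lambda>c. 1 + real (tot c {x - (A + 1)..x - (A + 1) + (A + 1)})"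
    let ?N = "\<lambda>p c. real (tot c {p - y<..p - y + 2 * y})"
    have "(\<integral>\<^sup>+c. ennreal (error x y c) \<partial>P)
      \<le> (\<integral>\<^sup>+c. ennreal (y powr \<beta>) * ennreal ((?W c) ^ 4) + (ennreal (?N (x - y) c * ?W c) + ennreal (?N (x - y - A) c * ?W c)) \<partial>P)"
    proof (rule nn_integral_mono)
      fix c assume "c \<in> space P"
      then have c: "c \<in> configurations" by (simp add: space_P)
      have W: "window_count A x c = ?W c" by (simp add: window_count_def)
      have W2: "(?W c)\<^sup>2 \<le> (?W c) ^ 4" by (intro power_increasing) auto
      have N: "real (tot c {p..p + y}) \<le> ?N p c" for p
        unfolding of_nat_le_iff using y by (intro tot_mono c) auto
      have "error x y c \<le> y powr \<beta> * (?W c) ^ 4 + ?W c * (?N (x - y) c + ?N (x - y - A) c)"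
        unfolding error_def edge_count_def W by (intro add_mono mult_left_mono W2 N) auto
      then have "ennreal (error x y c) \<le> ennreal (y powr \<beta> * (?W c) ^ 4 + (?N (x - y) c * ?W c + ?N (x - y - A) c * ?W c))"
        by (intro ennreal_leI) (simp add: distrib_left mult.commute)
      also have "\<dots> = ennreal (y powr \<beta>) * ennreal ((?W c) ^ 4) + (ennreal (?N (x - y) c * ?W c) + ennreal (?N (x - y - A) c * ?W c))"
        by (subst ennreal_plus, simp, simp, subst ennreal_plus, simp, simp, subst ennreal_mult) auto
      finally show "ennreal (error x y c) \<le> \<dots>" .
    qed
    also have "\<dots> = ennreal (y powr \<beta>) * (\<integral>\<^sup>+c. ennreal ((?W c) ^ 4) \<partial>P)
       + ((\<integral>\<^sup>+c. ennreal (?N (x - y) c * ?W c) \<partial>P) + (\<integral>\<^sup>+c. ennreal (?N (x - y - A) c * ?W c) \<partial>P))"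
    proof -
      have "?W \<in> borel_measurable P" "?N p \<in> borel_measurable P" for p by measurable
      then show ?thesis
        by (intro nn_integral_combine measurable_compose[OF _ measurable_ennreal] borel_measurable_power borel_measurable_times)
    qed
    also have "\<dots> \<le> ennreal (y powr \<beta>) * ennreal C1 + (ennreal (C2 * (2 * y)) + ennreal (C2 * (2 * y)))"
      using y y1 by (intro add_mono mult_left_mono c1 c2) auto
    also have "\<dots> = ennreal (y powr \<beta> * C1 + (C2 * (2 * y) + C2 * (2 * y)))"
      using y C1 C2 by (intro ennreal_combine) auto
    also have "\<dots> \<le> ennreal ((C1 + 4 * C2) * y powr \<beta>)"
    proof (rule ennreal_leI)
      have "C2 * y \<le> C2 * y powr \<beta>" using powr_ge_self[OF y(1) y1(1) \<beta>_pos \<beta>_le] C2 by (intro mult_left_mono)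
      then show "y powr \<beta> * C1 + (C2 * (2 * y) + C2 * (2 * y)) \<le> (C1 + 4 * C2) * y powr \<beta>" by (simp add: algebra_simps)
    qed
    finally show ?thesis .
  qed
  then show ?thesis using C1 C2 y0 by (intro exI[of _ "C1 + 4 * C2"] conjI exI[of _ y0]) auto
qed

definition excitation :: "'k \<Rightarrow> real \<Rightarrow> 'k conf \<Rightarrow> real" where
  "excitation k x c = window_sum A (\<lambda>j s. h j k (x - s)) x c"

lemma excitation_nonneg: "0 \<le> excitation k x c"
  unfolding excitation_def window_sum_def by (intro sum_nonneg h_nonneg)

lemma window_sum_measurable:
  assumes "\<And>j. f j \<in> borel_measurable borel"
  shows "window_sum A f x \<in> borel_measurable conf_borel"
    "(\<lambda>c. window_sum A f x (punctured l c)) \<in> borel_measurable conf_borel"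
  unfolding window_sum_def punctured_Int
  by (intro borel_measurable_sum measurable_sum_conf assms, auto intro: bounded_subset[of "{x - A..<x}"])+

lemma h_reflected [measurable]: "(\<lambda>s. h j k (x - s)) \<in> borel_measurable borel"
  by measurable

lemma excitation_measurable:
  "excitation k x \<in> borel_measurable conf_borel" "(\<lambda>c. excitation k x (punctured l c)) \<in> borel_measurable conf_borel"
  unfolding excitation_def by (rule window_sum_measurable[OF h_reflected])+

text \<open>
  The case \<open>e = (\<lambda>_. 0)\<close> is for the intensity under the stationary law; under the Palm
  distributions, \<open>e = he l k\<close> is the contribution of the Palm point.
\<close>

lemma error_controls_differences:
  "\<exists>K\<ge>0. \<forall>k (e :: real \<Rightarrow> real) x y c (f :: 'k \<Rightarrow> real \<Rightarrow> real) M.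
     (e = (\<lambda>_. 0) \<or> (\<exists>l. e = he l k)) \<longrightarrow> c \<in> configurations \<longrightarrow> 0 < y \<longrightarrow> y \<le> 1 \<longrightarrow> 0 \<le> M \<longrightarrow> (\<forall>j s. \<bar>f j s\<bar> \<le> M) \<longrightarrow>
     \<bar>1 / (\<nu> k + e x + excitation k x c) - 1 / (\<nu> k + e (x - y) + excitation k (x - y) c)\<bar> \<le> K * error x y c \<and>
     \<bar>window_sum A f x c / (\<nu> k + e x + excitation k x c)
       - window_sum A f (x - y) c / (\<nu> k + e (x - y) + excitation k (x - y) c)\<bar> \<le> (M * K) * error x y c"
proof -
  obtain Lh where Lh: "0 \<le> Lh" and lh: "\<And>l k x y. x \<in> {0..A} \<Longrightarrow> y \<in> {0..A} \<Longrightarrow> \<bar>h l k x - h l k y\<bar> \<le> Lh * \<bar>x - y\<bar> powr \<beta>"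
    using holder_uniform[of \<beta> "{0..A}" h] h_holder by blast
  obtain Le where Le: "0 \<le> Le" and le: "\<And>l k x y. \<bar>he l k x - he l k y\<bar> \<le> Le * \<bar>x - y\<bar> powr \<beta>"
    using holder_uniform[of \<beta> UNIV he] he_holder by blast
  \<comment> \<open>The extension is at least minus half the immigration rate, hence m is a lower bound for all denominators.\<close>
  define m where "m = Min (range \<nu>) / 2"
  have m: "0 < m" and m_le: "m \<le> \<nu> k / 2" for k
    unfolding m_def using \<nu>_pos by (auto simp: Min_gr_iff)
  define B where "B = Le + Lh + H"
  have B: "0 \<le> B" unfolding B_def using Le Lh H_pos by simp
  define K where "K = B / m\<^sup>2 + 1 / m"
  have K: "0 \<le> K" "B / m\<^sup>2 \<le> K" unfolding K_def using B m by auto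
  have main: "\<bar>1 / (\<nu> k + e x + excitation k x c) - 1 / (\<nu> k + e (x - y) + excitation k (x - y) c)\<bar> \<le> K * error x y c \<and>
     \<bar>window_sum A f x c / (\<nu> k + e x + excitation k x c)
       - window_sum A f (x - y) c / (\<nu> k + e (x - y) + excitation k (x - y) c)\<bar> \<le> (M * K) * error x y c"
    if e: "e = (\<lambda>_. 0) \<or> (\<exists>l. e = he l k)" and c: "c \<in> configurations" and y: "0 < y" "y \<le> 1"
      and M: "0 \<le> M" and f: "\<And>j s. \<bar>f j s\<bar> \<le> M" for k e x y c f M
  proof -
    let ?W = "window_count A x c" and ?E = "edge_count A x y c"
    let ?a = "\<nu> k + e x + excitation k x c" and ?b = "\<nu> k + e (x - y) + excitation k (x - y) c"
    have W1: "1 \<le> ?W" by (rule window_count_ge_1)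
    have E0: "0 \<le> ?E" by (rule edge_count_nonneg)
    have e_ge: "- \<nu> k / 2 \<le> e r" for r using e he_ge[of k] \<nu>_pos[of k] by auto
    have am: "m \<le> ?a" "m \<le> ?b"
      using e_ge[of x] e_ge[of "x - y"] m_le[of k] excitation_nonneg[of k x c] excitation_nonneg[of k "x - y" c] by linarith+
    have e_diff: "\<bar>e x - e (x - y)\<bar> \<le> Le * y powr \<beta>"
      using e le[of _ k x "x - y"] y Le by auto
    have "\<bar>excitation k x c - excitation k (x - y) c\<bar> \<le> (Lh * y powr \<beta>) * ?W + H * ?E"
      unfolding excitation_def
    proof (rule window_sum_diff_le[OF c y])
      show "\<bar>h j k (x - s)\<bar> \<le> H" "\<bar>h j k (x - y - s)\<bar> \<le> H" for j s
        using h_le h_nonneg by (simp_all add: abs_le_iff)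
      show "\<bar>h j k (x - s) - h j k (x - y - s)\<bar> \<le> Lh * y powr \<beta>" if "s \<in> {x - A..<x}" "s \<in> {x - y - A..<x - y}" for j s
        using lh[of "x - s" "x - y - s" j k] that y by auto
    qed (use Lh H_pos in auto)
    then have "\<bar>?a - ?b\<bar> \<le> Le * y powr \<beta> + ((Lh * y powr \<beta>) * ?W + H * ?E)" using e_diff by linarith
    also have "Le * y powr \<beta> \<le> Le * y powr \<beta> * ?W" using mult_left_mono[OF W1, of "Le * y powr \<beta>"] Le by simp
    also have "Le * y powr \<beta> * ?W + ((Lh * y powr \<beta>) * ?W + H * ?E) \<le> B * (y powr \<beta> * ?W + ?E)"
    proof -
      have "0 \<le> H * (y powr \<beta> * ?W)" "0 \<le> (Le + Lh) * ?E" using H_pos W1 Le Lh E0 by auto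
      then show ?thesis unfolding B_def by (simp add: algebra_simps)
    qed
    finally have ab: "\<bar>?a - ?b\<bar> \<le> B * (y powr \<beta> * ?W + ?E)" by simp
    have err: "error x y c = ?W * (y powr \<beta> * ?W + ?E)"
      unfolding error_def by (simp add: power2_eq_square algebra_simps)
    have inner0: "0 \<le> y powr \<beta> * ?W + ?E" using W1 E0 by simp
    have inner_le: "y powr \<beta> * ?W + ?E \<le> error x y c"
      unfolding err using W1 inner0 by (simp add: mult_le_cancel_right1)
    have ab': "\<bar>?a - ?b\<bar> / m\<^sup>2 \<le> B / m\<^sup>2 * (y powr \<beta> * ?W + ?E)"
      using ab m by (simp add: divide_right_mono)
    have "\<bar>1 / ?a - 1 / ?b\<bar> \<le> \<bar>?a - ?b\<bar> / m\<^sup>2" by (rule reciprocal_diff_le[OF m am])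
    also have "\<dots> \<le> B / m\<^sup>2 * (y powr \<beta> * ?W + ?E)" by (rule ab')
    also have "\<dots> \<le> K * error x y c" using K inner_le inner0 by (intro mult_mono) auto
    finally have first: "\<bar>1 / ?a - 1 / ?b\<bar> \<le> K * error x y c" .
    have G: "\<bar>window_sum A f x c - window_sum A f (x - y) c\<bar> \<le> 0 * ?W + M * ?E"
      by (rule window_sum_diff_le[OF c y]) (use f M in auto)
    have G': "\<bar>window_sum A f (x - y) c\<bar> \<le> M * ?W"
      by (rule window_sum_le[OF c _ y(2) f M]) (use y in simp)
    have "\<bar>window_sum A f x c / ?a - window_sum A f (x - y) c / ?b\<bar>
        \<le> \<bar>window_sum A f x c - window_sum A f (x - y) c\<bar> / m + \<bar>window_sum A f (x - y) c\<bar> * (\<bar>?a - ?b\<bar> / m\<^sup>2)"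
      by (rule ratio_diff_le[OF m am])
    also have "\<dots> \<le> (M * ?E) / m + (M * ?W) * (B / m\<^sup>2 * (y powr \<beta> * ?W + ?E))"
      using G G' ab' m M W1 by (intro add_mono divide_right_mono mult_mono) auto
    also have "(M * ?W) * (B / m\<^sup>2 * (y powr \<beta> * ?W + ?E)) = M * (B / m\<^sup>2) * error x y c" unfolding err by simp
    also have "(M * ?E) / m \<le> M * (1 / m) * error x y c"
    proof -
      have "?E \<le> y powr \<beta> * ?W + ?E" using W1 by simp
      then have "?E \<le> error x y c" using inner_le by linarith
      then have "M * (1 / m) * ?E \<le> M * (1 / m) * error x y c" using M m by (intro mult_left_mono) auto
      then show ?thesis by simp
    qed
    also have "M * (1 / m) * error x y c + M * (B / m\<^sup>2) * error x y c = (M * K) * error x y c"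
      unfolding K_def by (simp add: algebra_simps)
    finally show ?thesis using first by simp
  qed
  show ?thesis using K(1) main by (intro exI[of _ K]) blast
qed

text \<open>
  The extended intensity at time \<open>A\<close>, seen from the Palm point at \<open>A - x\<close>.
\<close>

definition extended :: "'k \<Rightarrow> 'k \<Rightarrow> real \<Rightarrow> 'k conf \<Rightarrow> real" where
  "extended l k x c = \<nu> k + he l k x + excitation k x (punctured l c)"

lemma extended_ge: "\<nu> k / 2 \<le> extended l k x c"
  using he_ge[of k l x] excitation_nonneg[of k x "punctured l c"] unfolding extended_def by linarith

lemma extended_measurable: "extended l k x \<in> borel_measurable conf_borel"
  unfolding extended_def by (intro borel_measurable_add borel_measurable_const excitation_measurable)

lemma shifted_window: "{s :: real. s + (A - x) \<in> {0..<A}} = {x - A..<x}"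
  by auto

lemma sum_punctured:
  assumes c: "c \<in> configurations" and anchor: "0 \<in> c l" and B: "bounded B"
  shows "(\<Sum>s\<in>c j \<inter> B. F s) = (\<Sum>s\<in>punctured l c j \<inter> B. F s) + (if j = l \<and> 0 \<in> B then F 0 else (0 :: real))"
proof (cases "j = l \<and> 0 \<in> B")
  case True
  have "c j \<inter> B = insert 0 (punctured l c j \<inter> B)" using True anchor by (auto simp: punctured_def)
  moreover have "finite (punctured l c j \<inter> B)" by (rule conf_finite[OF punctured_in_configurations[OF c] B])
  moreover have "0 \<notin> punctured l c j \<inter> B" using True by (simp add: punctured_def)
  ultimately show ?thesis using True by (simp add: add.commute)
next
  case False
  then have "c j \<inter> B = punctured l c j \<inter> B" by (auto simp: punctured_def)
  then show ?thesis using False by auto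
qed

text \<open>
  If the Palm point lies in the window, it contributes \<open>h l k x = he l k x\<close> to the intensity;
  otherwise, the extension supplies \<open>he l k x\<close>. In both cases the result depends on \<open>x\<close>
  without a jump.
\<close>

lemma intensity_ext_shift:
  assumes c: "c \<in> configurations" and anchor: "0 \<in> c l"
  shows "intensity_ext A \<nu> h he k A (A - x, l) (shift_conf (A - x) c) = extended l k x c"
proof -
  have "intensity A \<nu> h k A (shift_conf (A - x) c) = \<nu> k + (\<Sum>j\<in>UNIV. \<Sum>s\<in>c j \<inter> {x - A..<x}. h j k (x - s))"
    unfolding intensity_def shift_conf_sum diff_self shifted_window by (simp add: algebra_simps)
  also have "(\<Sum>j\<in>UNIV. \<Sum>s\<in>c j \<inter> {x - A..<x}. h j k (x - s))
      = excitation k x (punctured l c) + (\<Sum>j\<in>UNIV. if j = l \<and> 0 \<in> {x - A..<x} then h j k (x - 0) else 0)"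
    unfolding excitation_def window_sum_def sum.distrib[symmetric]
    by (intro sum.cong refl sum_punctured c anchor) simp
  also have "(\<Sum>j\<in>UNIV. if j = l \<and> 0 \<in> {x - A..<x} then h j k (x - 0) else 0)
      = (\<Sum>j\<in>UNIV. if j = l then (if 0 \<in> {x - A..<x} then h j k x else 0) else 0)"
    by (intro sum.cong) auto
  also have "\<dots> = (if 0 \<in> {x - A..<x} then h l k x else 0)" by (subst sum.delta) auto
  finally have I: "intensity A \<nu> h k A (shift_conf (A - x) c)
      = \<nu> k + (excitation k x (punctured l c) + (if 0 \<in> {x - A..<x} then h l k x else 0))" .
  show ?thesis
  proof (cases "0 \<in> {x - A..<x}")
    case True
    then have "A - x \<in> {A - A..<A}" "x \<in> {0..A}" by auto
    then show ?thesis using I True he_eq[of x l k] unfolding intensity_ext_def extended_def by simp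
  next
    case False
    then have "A - x \<notin> {A - A..<A}" by auto
    then show ?thesis using I unfolding intensity_ext_def extended_def if_not_P[OF False] by simp
  qed
qed

lemma intensity_measurable: "intensity A \<nu> h k t \<in> borel_measurable conf_borel"
  unfolding intensity_def
  by (intro borel_measurable_add borel_measurable_const borel_measurable_sum measurable_sum_conf h_reflected) auto

lemma intensity_ext_measurable: "intensity_ext A \<nu> h he k t z \<in> borel_measurable conf_borel"
  unfolding intensity_ext_def split_beta
  by (intro borel_measurable_add borel_measurable_const intensity_measurable)

lemma AE_Q_anchored: "AE c in Q 0 l. c \<in> configurations \<and> 0 \<in> c l"
  using Q_AE_anchor[of l] AE_space by eventually_elim (simp add: space_Q)

lemma p_ext_eq: "p_ext A \<nu> h he Q l k x = (\<integral>c. 1 / extended l k x c \<partial>Q 0 l)"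
proof -
  have "p_ext A \<nu> h he Q l k x = (\<integral>c. 1 / intensity_ext A \<nu> h he k A (A - x, l) (shift_conf (A - x) c) \<partial>Q 0 l)"
    unfolding p_ext_def Let_def
    by (rule integral_Q_shift) (intro borel_measurable_divide borel_measurable_const intensity_ext_measurable)
  also have "\<dots> = (\<integral>c. 1 / extended l k x c \<partial>Q 0 l)"
  proof (rule integral_cong_AE)
    show "(\<lambda>c. 1 / intensity_ext A \<nu> h he k A (A - x, l) (shift_conf (A - x) c)) \<in> borel_measurable (Q 0 l)"
      unfolding measurable_Q_eq
      by (intro borel_measurable_divide borel_measurable_const measurable_compose[OF measurable_shift_conf intensity_ext_measurable])
    show "(\<lambda>c. 1 / extended l k x c) \<in> borel_measurable (Q 0 l)"
      unfolding measurable_Q_eq by (intro borel_measurable_divide borel_measurable_const extended_measurable)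
    show "AE c in Q 0 l. 1 / intensity_ext A \<nu> h he k A (A - x, l) (shift_conf (A - x) c) = 1 / extended l k x c"
      using AE_Q_anchored by eventually_elim (simp add: intensity_ext_shift)
  qed
  finally show ?thesis .
qed

text \<open>
  Restricts \<open>window_sum\<close> to the points of mark \<open>j\<close>.
\<close>

definition on_mark :: "'k \<Rightarrow> (real \<Rightarrow> real) \<Rightarrow> 'k \<Rightarrow> real \<Rightarrow> real" where
  "on_mark j f i s = of_bool (i = j) * f s"

lemma window_sum_on_mark: "window_sum A (on_mark j f) x c = (\<Sum>s\<in>c j \<inter> {x - A..<x}. f s)"
proof -
  have "window_sum A (on_mark j f) x c = (\<Sum>i\<in>UNIV. if i = j then (\<Sum>s\<in>c i \<inter> {x - A..<x}. f s) else 0)"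
    unfolding window_sum_def on_mark_def by (intro sum.cong) auto
  also have "\<dots> = (\<Sum>s\<in>c j \<inter> {x - A..<x}. f s)" by (subst sum.delta) auto
  finally show ?thesis .
qed

lemma on_mark_measurable: "f \<in> borel_measurable borel \<Longrightarrow> on_mark j f i \<in> borel_measurable borel"
  unfolding on_mark_def by measurable

lemma on_mark_le: "(\<And>s. \<bar>f s\<bar> \<le> M) \<Longrightarrow> 0 \<le> M \<Longrightarrow> \<bar>on_mark j f i s\<bar> \<le> M"
  unfolding on_mark_def by simp

lemma zeta_ext_eq:
  assumes g: "g \<in> borel_measurable borel"
  shows "zeta_ext A \<nu> h he Q l j k g x
    = (\<integral>c. window_sum A (on_mark j (\<lambda>s. g (x - s))) x (punctured l c) / extended l k x c \<partial>Q 0 l)"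
proof -
  let ?n = "\<lambda>c. \<Sum>s\<in>c j \<inter> {0..<A}. of_bool ((s, j) \<noteq> (A - x, l)) * g (A - s)"
  have n: "?n \<in> borel_measurable conf_borel"
    using g by (intro measurable_sum_conf) auto
  have gx: "(\<lambda>s. g (x - s)) \<in> borel_measurable borel" using g by measurable
  have "zeta_ext A \<nu> h he Q l j k g x
     = (\<integral>c. ?n (shift_conf (A - x) c) / intensity_ext A \<nu> h he k A (A - x, l) (shift_conf (A - x) c) \<partial>Q 0 l)"
    unfolding zeta_ext_def Let_def
    by (rule integral_Q_shift) (intro borel_measurable_divide n intensity_ext_measurable)
  also have "\<dots> = (\<integral>c. window_sum A (on_mark j (\<lambda>s. g (x - s))) x (punctured l c) / extended l k x c \<partial>Q 0 l)"
  proof (rule integral_cong_AE)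
    show "(\<lambda>c. ?n (shift_conf (A - x) c) / intensity_ext A \<nu> h he k A (A - x, l) (shift_conf (A - x) c)) \<in> borel_measurable (Q 0 l)"
      unfolding measurable_Q_eq
      by (intro borel_measurable_divide measurable_compose[OF measurable_shift_conf intensity_ext_measurable] measurable_compose[OF measurable_shift_conf n])
    show "(\<lambda>c. window_sum A (on_mark j (\<lambda>s. g (x - s))) x (punctured l c) / extended l k x c) \<in> borel_measurable (Q 0 l)"
      unfolding measurable_Q_eq
      by (intro borel_measurable_divide extended_measurable window_sum_measurable on_mark_measurable gx)
    show "AE c in Q 0 l. ?n (shift_conf (A - x) c) / intensity_ext A \<nu> h he k A (A - x, l) (shift_conf (A - x) c)
        = window_sum A (on_mark j (\<lambda>s. g (x - s))) x (punctured l c) / extended l k x c"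
      using AE_Q_anchored
    proof eventually_elim
      case (elim c)
      then have c: "c \<in> configurations" and anchor: "0 \<in> c l" by auto
      have "?n (shift_conf (A - x) c) = (\<Sum>s\<in>c j \<inter> {x - A..<x}. of_bool (\<not> (s = 0 \<and> j = l)) * g (x - s))"
        unfolding shift_conf_sum shifted_window by (intro sum.cong refl) (auto simp: algebra_simps)
      also have "\<dots> = (\<Sum>s\<in>punctured l c j \<inter> {x - A..<x}. of_bool (\<not> (s = 0 \<and> j = l)) * g (x - s))"
        by (subst sum_punctured[OF c anchor]) auto
      also have "\<dots> = (\<Sum>s\<in>punctured l c j \<inter> {x - A..<x}. g (x - s))"
        by (intro sum.cong refl) (auto simp: punctured_def split: if_splits)
      finally show ?case
        using intensity_ext_shift[OF c anchor] by (simp only: window_sum_on_mark)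
    qed
  qed
  finally show ?thesis .
qed

lemma Q_integrable_window: "integrable (Q 0 l) (\<lambda>c. window_count A x (punctured l c))"
proof (rule integrableI_bounded)
  show "(\<lambda>c. window_count A x (punctured l c)) \<in> borel_measurable (Q 0 l)"
    unfolding measurable_Q_eq by (rule window_count_punctured_measurable)
  obtain C where C: "(\<integral>\<^sup>+c. ennreal ((1 + real (tot c {x - (A + 1)..x}))\<^sup>2) \<partial>Q 0 l) \<le> ennreal C"
    using Q_window_bound[where L="A + 1" and l=l] by blast
  have "(\<integral>\<^sup>+c. ennreal (norm (window_count A x (punctured l c))) \<partial>Q 0 l)
     \<le> (\<integral>\<^sup>+c. ennreal ((1 + real (tot c {x - (A + 1)..x}))\<^sup>2) \<partial>Q 0 l)"
  proof (intro nn_integral_mono ennreal_leI)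
    fix c assume "c \<in> space (Q 0 l)"
    then have c: "c \<in> configurations" by (simp add: space_Q)
    have "norm (window_count A x (punctured l c)) = window_count A x (punctured l c)"
      using window_count_ge_1[of A x "punctured l c"] by simp
    also have "\<dots> \<le> (1 + real (tot c {x - (A + 1)..x})) ^ 1"
      using window_count_punctured_le[OF c, of x l] by (simp add: window_count_def)
    also have "\<dots> \<le> (1 + real (tot c {x - (A + 1)..x}))\<^sup>2" by (intro power_increasing) auto
    finally show "norm (window_count A x (punctured l c)) \<le> (1 + real (tot c {x - (A + 1)..x}))\<^sup>2" .
  qed
  also have "\<dots> \<le> ennreal C" by (rule C)
  finally show "(\<integral>\<^sup>+c. ennreal (norm (window_count A x (punctured l c))) \<partial>Q 0 l) < \<infinity>"
    by (rule le_less_trans) simp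
qed

lemma P_integrable_window: "integrable P (\<lambda>c. window_count A x c)"
proof (rule integrableI_bounded)
  show "(\<lambda>c. window_count A x c) \<in> borel_measurable P"
    unfolding window_count_def by measurable
  obtain C where C: "\<And>y. (\<integral>\<^sup>+c. ennreal ((1 + real (tot c {y..y + (A + 1)})) ^ 4) \<partial>P) \<le> ennreal C"
    using window_moment_bound[of "A + 1"] by blast
  have "(\<integral>\<^sup>+c. ennreal (norm (window_count A x c)) \<partial>P)
     \<le> (\<integral>\<^sup>+c. ennreal ((1 + real (tot c {x - (A + 1)..x - (A + 1) + (A + 1)})) ^ 4) \<partial>P)"
  proof (intro nn_integral_mono ennreal_leI)
    fix c :: "'k conf"
    have "window_count A x c ^ 1 \<le> window_count A x c ^ 4"
      using window_count_ge_1[of A x c] by (intro power_increasing) auto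
    then show "norm (window_count A x c) \<le> (1 + real (tot c {x - (A + 1)..x - (A + 1) + (A + 1)})) ^ 4"
      using window_count_ge_1[of A x c] by (simp add: window_count_def)
  qed
  also have "\<dots> \<le> ennreal C" by (rule C)
  finally show "(\<integral>\<^sup>+c. ennreal (norm (window_count A x c)) \<partial>P) < \<infinity>"
    by (rule le_less_trans) simp
qed

lemma abs_ratio_le:
  fixes a b :: real
  assumes "\<bar>a\<bar> \<le> M * W" "\<nu> k / 2 \<le> b"
  shows "\<bar>a / b\<bar> \<le> (M / (\<nu> k / 2)) * W"
proof -
  have b: "0 < \<nu> k / 2" "0 < b" using \<nu>_pos[of k] assms(2) by linarith+
  have "\<bar>a / b\<bar> = \<bar>a\<bar> / b" using b by simp
  also have "\<dots> \<le> \<bar>a\<bar> / (\<nu> k / 2)" using b assms(2) by (intro divide_left_mono) auto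
  also have "\<dots> \<le> (M * W) / (\<nu> k / 2)" using b assms(1) by (intro divide_right_mono) auto
  finally show ?thesis by (simp add: mult_ac)
qed

lemma Q_integrable_ratio:
  assumes f: "\<And>j. f j \<in> borel_measurable borel" "\<And>j s. \<bar>f j s\<bar> \<le> M" and M: "0 \<le> M"
  shows "integrable (Q 0 l) (\<lambda>c. window_sum A f x (punctured l c) / extended l k x c)"
proof (rule Bochner_Integration.integrable_bound)
  show "integrable (Q 0 l) (\<lambda>c. (M / (\<nu> k / 2)) * window_count A x (punctured l c))"
    by (intro integrable_mult_right Q_integrable_window)
  show "(\<lambda>c. window_sum A f x (punctured l c) / extended l k x c) \<in> borel_measurable (Q 0 l)"
    unfolding measurable_Q_eq by (intro borel_measurable_divide extended_measurable window_sum_measurable f)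
  show "AE c in Q 0 l. norm (window_sum A f x (punctured l c) / extended l k x c)
      \<le> norm ((M / (\<nu> k / 2)) * window_count A x (punctured l c))"
  proof (rule AE_I2)
    fix c assume "c \<in> space (Q 0 l)"
    then have c: "punctured l c \<in> configurations" by (simp add: space_Q punctured_in_configurations)
    have "\<bar>window_sum A f x (punctured l c)\<bar> \<le> M * window_count A x (punctured l c)"
      using window_sum_le[OF c, of 0 f M A x] f(2) M by simp
    from abs_ratio_le[OF this extended_ge[of k l x c]]
    show "norm (window_sum A f x (punctured l c) / extended l k x c)
      \<le> norm ((M / (\<nu> k / 2)) * window_count A x (punctured l c))"
      unfolding real_norm_def by (rule order_trans[OF _ abs_ge_self])
  qed
qed

lemma Q_integrable_reciprocal: "integrable (Q 0 l) (\<lambda>c. 1 / extended l k x c)"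
proof (rule Bochner_Integration.integrable_bound)
  show "integrable (Q 0 l) (\<lambda>c. (1 / (\<nu> k / 2)) * window_count A x (punctured l c))"
    by (intro integrable_mult_right Q_integrable_window)
  show "(\<lambda>c. 1 / extended l k x c) \<in> borel_measurable (Q 0 l)"
    unfolding measurable_Q_eq by (intro borel_measurable_divide borel_measurable_const extended_measurable)
  show "AE c in Q 0 l. norm (1 / extended l k x c) \<le> norm ((1 / (\<nu> k / 2)) * window_count A x (punctured l c))"
  proof (rule AE_I2)
    fix c
    have "\<bar>1 :: real\<bar> \<le> 1 * window_count A x (punctured l c)" using window_count_ge_1[of A x "punctured l c"] by simp
    from abs_ratio_le[OF this extended_ge[of k l x c]]
    show "norm (1 / extended l k x c) \<le> norm ((1 / (\<nu> k / 2)) * window_count A x (punctured l c))"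
      unfolding real_norm_def by (rule order_trans[OF _ abs_ge_self])
  qed
qed

lemma P_integrable_ratio:
  assumes f: "\<And>j. f j \<in> borel_measurable borel" "\<And>j s. \<bar>f j s\<bar> \<le> M" and M: "0 \<le> M"
  shows "integrable P (\<lambda>c. window_sum A f x c / (\<nu> k + 0 + excitation k x c))"
proof (rule Bochner_Integration.integrable_bound)
  show "integrable P (\<lambda>c. (M / (\<nu> k / 2)) * window_count A x c)"
    by (intro integrable_mult_right P_integrable_window)
  show "(\<lambda>c. window_sum A f x c / (\<nu> k + 0 + excitation k x c)) \<in> borel_measurable P"
    unfolding measurable_P_eq
    by (intro borel_measurable_divide borel_measurable_add borel_measurable_const window_sum_measurable f excitation_measurable)
  show "AE c in P. norm (window_sum A f x c / (\<nu> k + 0 + excitation k x c)) \<le> norm ((M / (\<nu> k / 2)) * window_count A x c)"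
  proof (rule AE_I2)
    fix c assume "c \<in> space P"
    then have c: "c \<in> configurations" by (simp add: space_P)
    have "\<bar>window_sum A f x c\<bar> \<le> M * window_count A x c"
      using window_sum_le[OF c, of 0 f M A x] f(2) M by simp
    moreover have "\<nu> k / 2 \<le> \<nu> k + 0 + excitation k x c"
      using \<nu>_pos[of k] excitation_nonneg[of k x c] by linarith
    ultimately have "\<bar>window_sum A f x c / (\<nu> k + 0 + excitation k x c)\<bar> \<le> (M / (\<nu> k / 2)) * window_count A x c"
      by (rule abs_ratio_le)
    then show "norm (window_sum A f x c / (\<nu> k + 0 + excitation k x c)) \<le> norm ((M / (\<nu> k / 2)) * window_count A x c)"
      unfolding real_norm_def by (rule order_trans[OF _ abs_ge_self])
  qed
qed

lemma window_sum_diff: "window_sum A (\<lambda>j s. f j s - g j s) x c = window_sum A f x c - window_sum A g x c"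
  unfolding window_sum_def by (simp only: sum_subtractf)

lemma zeta_ext_diff:
  assumes g: "g \<in> borel_measurable borel" "\<And>x. \<bar>g x\<bar> \<le> M" and f: "f \<in> borel_measurable borel" "\<And>x. \<bar>f x\<bar> \<le> M"
  shows "zeta_ext A \<nu> h he Q l j k (\<lambda>r. f r - g r) x = zeta_ext A \<nu> h he Q l j k f x - zeta_ext A \<nu> h he Q l j k g x"
proof -
  have M: "0 \<le> M" using g(2)[of 0] by linarith
  have m: "(\<lambda>s. f (x - s)) \<in> borel_measurable borel" "(\<lambda>s. g (x - s)) \<in> borel_measurable borel"
    using f g by measurable
  have int: "integrable (Q 0 l) (\<lambda>c. window_sum A (on_mark j (\<lambda>s. u (x - s))) x (punctured l c) / extended l k x c)"
    if "(\<lambda>s. u (x - s)) \<in> borel_measurable borel" "\<And>s. \<bar>u s\<bar> \<le> M" for u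
    by (rule Q_integrable_ratio[OF _ _ M]) (use that M in \<open>auto intro!: on_mark_measurable on_mark_le\<close>)
  have eq: "on_mark j (\<lambda>s. f (x - s) - g (x - s)) = (\<lambda>i s. on_mark j (\<lambda>s. f (x - s)) i s - on_mark j (\<lambda>s. g (x - s)) i s)"
    by (auto simp: on_mark_def fun_eq_iff)
  have "zeta_ext A \<nu> h he Q l j k (\<lambda>r. f r - g r) x
    = (\<integral>c. window_sum A (on_mark j (\<lambda>s. f (x - s) - g (x - s))) x (punctured l c) / extended l k x c \<partial>Q 0 l)"
    by (rule zeta_ext_eq) (use f g in measurable)
  also have "\<dots> = (\<integral>c. window_sum A (on_mark j (\<lambda>s. f (x - s))) x (punctured l c) / extended l k x c
      - window_sum A (on_mark j (\<lambda>s. g (x - s))) x (punctured l c) / extended l k x c \<partial>Q 0 l)"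
    unfolding eq window_sum_diff by (simp only: diff_divide_distrib)
  also have "\<dots> = zeta_ext A \<nu> h he Q l j k f x - zeta_ext A \<nu> h he Q l j k g x"
    unfolding zeta_ext_eq[OF f(1)] zeta_ext_eq[OF g(1)]
    by (rule Bochner_Integration.integral_diff[OF int[OF m(1) f(2)] int[OF m(2) g(2)]])
  finally show ?thesis .
qed

text \<open>
  Seen from the Palm point, both terms are integrals over the same configurations, with windows
  that differ by the translation \<open>y\<close>. In \<open>\<zeta>\<^sup>e\<close>, the function \<open>g(x - y - s)\<close> that is summed is
  the same in both terms.
\<close>

lemma palm_commutator:
  "\<exists>C\<ge>0. \<forall>l k j x y g M. 0 < y \<longrightarrow> y \<le> 1 \<longrightarrow> g \<in> borel_measurable borel \<longrightarrow> (\<forall>s. \<bar>g s\<bar> \<le> M) \<longrightarrow>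
    \<bar>p_ext A \<nu> h he Q l k x - p_ext A \<nu> h he Q l k (x - y)\<bar> \<le> C * y powr \<beta> \<and>
    \<bar>zeta_ext A \<nu> h he Q l j k (\<lambda>r. g (r - y)) x - zeta_ext A \<nu> h he Q l j k g (x - y)\<bar> \<le> M * C * y powr \<beta>"
proof -
  obtain K where K: "0 \<le> K" and ctrl: "\<And>k (e :: real \<Rightarrow> real) x y c (f :: 'k \<Rightarrow> real \<Rightarrow> real) M.
     e = (\<lambda>_. 0) \<or> (\<exists>l. e = he l k) \<Longrightarrow> c \<in> configurations \<Longrightarrow> 0 < y \<Longrightarrow> y \<le> 1 \<Longrightarrow> 0 \<le> M \<Longrightarrow> (\<forall>j s. \<bar>f j s\<bar> \<le> M) \<Longrightarrow>
     \<bar>1 / (\<nu> k + e x + excitation k x c) - 1 / (\<nu> k + e (x - y) + excitation k (x - y) c)\<bar> \<le> K * error x y c \<and>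
     \<bar>window_sum A f x c / (\<nu> k + e x + excitation k x c)
       - window_sum A f (x - y) c / (\<nu> k + e (x - y) + excitation k (x - y) c)\<bar> \<le> (M * K) * error x y c"
    using error_controls_differences by metis
  obtain Cl where Cl: "\<And>l. 0 \<le> Cl l" and cl: "\<And>l x y. 0 < y \<Longrightarrow> y \<le> 1 \<Longrightarrow>
    (\<integral>\<^sup>+c. ennreal (error x y (punctured l c)) \<partial>Q 0 l) \<le> ennreal (Cl l * y powr \<beta>)"
    using Q_error_bound by metis
  define C where "C = K * (\<Sum>l\<in>UNIV. Cl l)"
  have C: "0 \<le> C" unfolding C_def using K Cl by (intro mult_nonneg_nonneg sum_nonneg) auto
  have Cl_le: "K * Cl l \<le> C" for l
    unfolding C_def using K Cl by (intro mult_left_mono member_le_sum) auto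
  have "\<bar>p_ext A \<nu> h he Q l k x - p_ext A \<nu> h he Q l k (x - y)\<bar> \<le> C * y powr \<beta> \<and>
    \<bar>zeta_ext A \<nu> h he Q l j k (\<lambda>r. g (r - y)) x - zeta_ext A \<nu> h he Q l j k g (x - y)\<bar> \<le> M * C * y powr \<beta>"
    if y: "0 < y" "y \<le> 1" and g: "g \<in> borel_measurable borel" "\<And>s. \<bar>g s\<bar> \<le> M" for l k j x y g M
  proof
    have M: "0 \<le> M" using g(2)[of 0] by linarith
    have eQ: "(\<lambda>c. error x y (punctured l c)) \<in> borel_measurable (Q 0 l)"
      unfolding measurable_Q_eq by (rule error_punctured_measurable)
    have CC: "0 \<le> Cl l * y powr \<beta>" using Cl[of l] by simp
    let ?f = "on_mark j (\<lambda>s. g (x - y - s))"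
    have gs: "(\<lambda>s. g (x - y - s)) \<in> borel_measurable borel" using g(1) by measurable
    have f: "?f i \<in> borel_measurable borel" "\<bar>?f i s\<bar> \<le> M" for i s
      using gs g(2) M by (auto intro: on_mark_measurable on_mark_le)
    have ctrl': "\<bar>1 / extended l k x c - 1 / extended l k (x - y) c\<bar> \<le> K * error x y (punctured l c) \<and>
      \<bar>window_sum A ?f x (punctured l c) / extended l k x c - window_sum A ?f (x - y) (punctured l c) / extended l k (x - y) c\<bar>
        \<le> (M * K) * error x y (punctured l c)" if "c \<in> space (Q 0 l)" for c
      unfolding extended_def
      by (rule ctrl) (use that y M f(2) in \<open>auto simp: space_Q punctured_in_configurations\<close>)
    have "\<bar>p_ext A \<nu> h he Q l k x - p_ext A \<nu> h he Q l k (x - y)\<bar> \<le> K * (Cl l * y powr \<beta>)"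
      unfolding p_ext_eq
      by (rule integral_diff_bound[OF Q_integrable_reciprocal Q_integrable_reciprocal K CC _ eQ cl[OF y]])
        (use ctrl' in \<open>intro AE_I2, blast\<close>)
    also have "\<dots> \<le> C * y powr \<beta>" using mult_right_mono[OF Cl_le[of l], of "y powr \<beta>"] by (simp add: mult.assoc)
    finally show "\<bar>p_ext A \<nu> h he Q l k x - p_ext A \<nu> h he Q l k (x - y)\<bar> \<le> C * y powr \<beta>" .
    have z1: "zeta_ext A \<nu> h he Q l j k (\<lambda>r. g (r - y)) x = (\<integral>c. window_sum A ?f x (punctured l c) / extended l k x c \<partial>Q 0 l)"
      by (subst zeta_ext_eq) (use g(1) in \<open>auto simp: algebra_simps\<close>)
    have z2: "zeta_ext A \<nu> h he Q l j k g (x - y) = (\<integral>c. window_sum A ?f (x - y) (punctured l c) / extended l k (x - y) c \<partial>Q 0 l)"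
      by (rule zeta_ext_eq[OF g(1)])
    have MK: "0 \<le> M * K" using M K by simp
    have "\<bar>zeta_ext A \<nu> h he Q l j k (\<lambda>r. g (r - y)) x - zeta_ext A \<nu> h he Q l j k g (x - y)\<bar> \<le> (M * K) * (Cl l * y powr \<beta>)"
      unfolding z1 z2
      by (rule integral_diff_bound[OF Q_integrable_ratio[OF f M] Q_integrable_ratio[OF f M] MK CC _ eQ cl[OF y]])
        (use ctrl' in \<open>intro AE_I2, blast\<close>)
    also have "\<dots> = M * ((K * Cl l) * y powr \<beta>)" by simp
    also have "\<dots> \<le> M * (C * y powr \<beta>)" using M by (intro mult_left_mono mult_right_mono Cl_le) auto
    finally show "\<bar>zeta_ext A \<nu> h he Q l j k (\<lambda>r. g (r - y)) x - zeta_ext A \<nu> h he Q l j k g (x - y)\<bar> \<le> M * C * y powr \<beta>"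
      by (simp add: mult.assoc)
  qed
  then show ?thesis using C by blast
qed

lemma intensity_at_A: "intensity A \<nu> h k A c = \<nu> k + 0 + excitation k A c"
  unfolding intensity_def excitation_def window_sum_def by simp

lemma lin_intensity_window: "lin_intensity A g k c = window_sum A (\<lambda>j s. g j k (A - s)) A c"
  unfolding lin_intensity_def window_sum_def by simp

lemma integral_P_shift:
  fixes f :: "'k conf \<Rightarrow> real"
  assumes "f \<in> borel_measurable conf_borel"
  shows "(\<integral>c. f (shift_conf u c) \<partial>P) = (\<integral>c. f c \<partial>P)"
proof -
  have "shift_conf u \<in> P \<rightarrow>\<^sub>M conf_borel" unfolding measurable_P_eq by (rule measurable_shift_conf)
  then have "(\<integral>c. f c \<partial>distr P conf_borel (shift_conf u)) = (\<integral>c. f (shift_conf u c) \<partial>P)"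
    using assms by (rule integral_distr)
  then show ?thesis by (simp add: stationary)
qed

lemma window_sum_shift: "window_sum A f x (shift_conf u c) = window_sum A (\<lambda>j s. f j (s + u)) (x - u) c"
proof -
  have "{s. s + u \<in> {x - A..<x}} = {x - u - A..<x - u}" by auto
  then show ?thesis unfolding window_sum_def shift_conf_sum by simp
qed

lemma excitation_shift: "excitation k x (shift_conf u c) = excitation k (x - u) c"
  unfolding excitation_def window_sum_shift by (simp add: algebra_simps)

text \<open>
  Stationarity turns the integral of \<open>g\<close> over the window at \<open>A\<close> into that of \<open>g(\<cdot> - y)\<close> over the
  window at \<open>A - y\<close>, so that, again, one function is summed over two windows.
\<close>

lemma stationary_commutator:
  "\<exists>C\<ge>0. \<exists>y0>0. y0 \<le> 1 \<and> (\<forall>k y g M. 0 < y \<longrightarrow> y \<le> y0 \<longrightarrow> (\<forall>j. g j k \<in> borel_measurable borel) \<longrightarrow> (\<forall>j s. \<bar>g j k s\<bar> \<le> M) \<longrightarrow>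
    \<bar>\<integral>c. lin_intensity A (\<lambda>j k r. g j k (r - y) - g j k r) k c / intensity A \<nu> h k A c \<partial>P\<bar> \<le> M * C * y powr \<beta>)"
proof -
  obtain K where K: "0 \<le> K" and ctrl: "\<And>k (e :: real \<Rightarrow> real) x y c (f :: 'k \<Rightarrow> real \<Rightarrow> real) M.
     e = (\<lambda>_. 0) \<or> (\<exists>l. e = he l k) \<Longrightarrow> c \<in> configurations \<Longrightarrow> 0 < y \<Longrightarrow> y \<le> 1 \<Longrightarrow> 0 \<le> M \<Longrightarrow> (\<forall>j s. \<bar>f j s\<bar> \<le> M) \<Longrightarrow>
     \<bar>1 / (\<nu> k + e x + excitation k x c) - 1 / (\<nu> k + e (x - y) + excitation k (x - y) c)\<bar> \<le> K * error x y c \<and>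
     \<bar>window_sum A f x c / (\<nu> k + e x + excitation k x c)
       - window_sum A f (x - y) c / (\<nu> k + e (x - y) + excitation k (x - y) c)\<bar> \<le> (M * K) * error x y c"
    using error_controls_differences by metis
  obtain C y0 where C: "0 \<le> C" and y0: "0 < y0" "y0 \<le> 1" and ce: "\<And>x y. 0 < y \<Longrightarrow> y \<le> y0 \<Longrightarrow>
    (\<integral>\<^sup>+c. ennreal (error x y c) \<partial>P) \<le> ennreal (C * y powr \<beta>)"
    using P_error_bound by blast
  have "\<bar>\<integral>c. lin_intensity A (\<lambda>j k r. g j k (r - y) - g j k r) k c / intensity A \<nu> h k A c \<partial>P\<bar> \<le> M * (K * C) * y powr \<beta>"
    if y: "0 < y" "y \<le> y0" and g: "\<And>j. g j k \<in> borel_measurable borel" "\<And>j s. \<bar>g j k s\<bar> \<le> M" for k y g M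
  proof -
    have M: "0 \<le> M" using g(2)[of undefined 0] by linarith
    let ?f = "\<lambda>j s. g j k (A - y - s)" and ?g = "\<lambda>j s. g j k (A - s)"
    have f: "?f j \<in> borel_measurable borel" "?g j \<in> borel_measurable borel" for j using g(1) by measurable
    have eP: "(\<lambda>c. error A y c) \<in> borel_measurable P"
      unfolding measurable_P_eq by (rule error_measurable)
    have intf: "integrable P (\<lambda>c. window_sum A ?f x c / (\<nu> k + 0 + excitation k x c))" for x
      by (rule P_integrable_ratio[OF f(1) g(2) M])
    have intg: "integrable P (\<lambda>c. window_sum A ?g x c / (\<nu> k + 0 + excitation k x c))" for x
      by (rule P_integrable_ratio[OF f(2) g(2) M])
    have "(\<integral>c. lin_intensity A (\<lambda>j k r. g j k (r - y) - g j k r) k c / intensity A \<nu> h k A c \<partial>P)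
      = (\<integral>c. window_sum A ?f A c / (\<nu> k + 0 + excitation k A c) - window_sum A ?g A c / (\<nu> k + 0 + excitation k A c) \<partial>P)"
      unfolding lin_intensity_window intensity_at_A window_sum_diff diff_divide_distrib
      by (simp add: algebra_simps)
    also have "\<dots> = (\<integral>c. window_sum A ?f A c / (\<nu> k + 0 + excitation k A c) \<partial>P) - (\<integral>c. window_sum A ?g A c / (\<nu> k + 0 + excitation k A c) \<partial>P)"
      by (rule Bochner_Integration.integral_diff[OF intf intg])
    also have "(\<integral>c. window_sum A ?g A c / (\<nu> k + 0 + excitation k A c) \<partial>P)
      = (\<integral>c. window_sum A ?g A (shift_conf y c) / (\<nu> k + 0 + excitation k A (shift_conf y c)) \<partial>P)"
      by (rule integral_P_shift[symmetric])
        (intro borel_measurable_divide borel_measurable_add borel_measurable_const window_sum_measurable f excitation_measurable)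
    also have "\<dots> = (\<integral>c. window_sum A ?f (A - y) c / (\<nu> k + 0 + excitation k (A - y) c) \<partial>P)"
      unfolding window_sum_shift excitation_shift by (simp add: algebra_simps)
    finally have "\<bar>\<integral>c. lin_intensity A (\<lambda>j k r. g j k (r - y) - g j k r) k c / intensity A \<nu> h k A c \<partial>P\<bar>
      = \<bar>(\<integral>c. window_sum A ?f A c / (\<nu> k + 0 + excitation k A c) \<partial>P) - (\<integral>c. window_sum A ?f (A - y) c / (\<nu> k + 0 + excitation k (A - y) c) \<partial>P)\<bar>"
      by simp
    also have "\<dots> \<le> (M * K) * (C * y powr \<beta>)"
    proof (rule integral_diff_bound[OF intf intf _ _ _ eP ce[OF y]])
      show "AE c in P. \<bar>window_sum A ?f A c / (\<nu> k + 0 + excitation k A c) - window_sum A ?f (A - y) c / (\<nu> k + 0 + excitation k (A - y) c)\<bar>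
          \<le> M * K * error A y c"
      proof (rule AE_I2)
        fix c assume c: "c \<in> space P"
        show "\<bar>window_sum A ?f A c / (\<nu> k + 0 + excitation k A c) - window_sum A ?f (A - y) c / (\<nu> k + 0 + excitation k (A - y) c)\<bar>
          \<le> M * K * error A y c"
          using ctrl[of "\<lambda>_. 0" k c y M ?f A] c y y0 M g(2) by (simp add: space_P)
      qed
    qed (use M K C in auto)
    finally show ?thesis by (simp add: mult_ac)
  qed
  then show ?thesis using K C y0 by (intro exI[of _ "K * C"] conjI exI[of _ y0]) auto
qed

section \<open>Translation regularity of the inverse image\<close>

text \<open>
  The mean number of points in a set is a multiple of its Lebesgue measure. This and the next
  lemma make \<open>\<Gamma>\<^sup>e\<close> independent of the choice of representatives in \<open>L\<^sub>\<infinity>\<close>.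
\<close>

lemma P_avoids_null:
  assumes N: "N \<in> null_sets lborel" and b: "bounded N"
  shows "AE c in P. tot c N = 0"
proof -
  have Nb: "N \<in> sets borel" using N by auto
  define \<Phi> :: "real \<times> 'k \<times> 'k conf \<Rightarrow> ennreal" where "\<Phi> x = indicator N (fst x)" for x
  have m: "\<Phi> \<in> borel_measurable (borel \<Otimes>\<^sub>M count_space UNIV \<Otimes>\<^sub>M conf_borel)"
    unfolding \<Phi>_def by (rule measurable_compose[OF measurable_fst borel_measurable_indicator[OF Nb]])
  have "(\<integral>\<^sup>+u. (\<integral>\<^sup>+c. \<Phi> (u, l, c) \<partial>Q u l) \<partial>lborel) = 0" for l
  proof -
    have "(\<integral>\<^sup>+c. \<Phi> (u, l, c) \<partial>Q u l) = indicator N u" for u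
      using prob_space.emeasure_space_1[OF Q_prob] by (simp add: \<Phi>_def)
    then show ?thesis using N by (auto simp: null_sets_def)
  qed
  then have "(\<integral>\<^sup>+c. (\<Sum>l\<in>UNIV. \<integral>\<^sup>+u. \<Phi> (u, l, c) \<partial>count_space (c l)) \<partial>P) = 0"
    using palm_eq[OF m] by simp
  moreover have "(\<integral>\<^sup>+c. (\<Sum>l\<in>UNIV. \<integral>\<^sup>+u. \<Phi> (u, l, c) \<partial>count_space (c l)) \<partial>P) = (\<integral>\<^sup>+c. ennreal (real (tot c N)) \<partial>P)"
  proof (rule nn_integral_cong)
    fix c assume "c \<in> space P"
    then have c: "c \<in> configurations" by (simp add: space_P)
    have "(\<integral>\<^sup>+u. \<Phi> (u, l, c) \<partial>count_space (c l)) = ennreal (real (card (c l \<inter> N)))" for l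
    proof -
      have "(\<integral>\<^sup>+u. \<Phi> (u, l, c) \<partial>count_space (c l)) = (\<Sum>u\<in>c l \<inter> N. \<Phi> (u, l, c))"
        using conf_finite[OF c b] by (intro nn_integral_count_space'[of "c l \<inter> N"]) (auto simp: \<Phi>_def indicator_def)
      also have "\<dots> = (\<Sum>u\<in>c l \<inter> N. 1)" by (intro sum.cong) (auto simp: \<Phi>_def)
      finally show ?thesis by (simp add: ennreal_of_nat_eq_real_of_nat)
    qed
    then show "(\<Sum>l\<in>UNIV. \<integral>\<^sup>+u. \<Phi> (u, l, c) \<partial>count_space (c l)) = ennreal (real (tot c N))"
      by (simp add: tot_def)
  qed
  ultimately have "(\<integral>\<^sup>+c. ennreal (real (tot c N)) \<partial>P) = 0" by simp
  then have "AE c in P. ennreal (real (tot c N)) = 0"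
    using measurable_tot_P[OF Nb b] by (subst (asm) nn_integral_0_iff_AE) auto
  then show ?thesis by eventually_elim simp
qed

lemma Q_avoids_null:
  assumes N: "N \<in> null_sets lborel" and b: "bounded N"
  shows "AE u in lborel. AE c in Q u l. tot c N = 0"
proof -
  have Nb: "N \<in> sets borel" using N by auto
  define f :: "'k conf \<Rightarrow> ennreal" where "f c = ennreal (real (tot c N))" for c
  have f: "f \<in> borel_measurable conf_borel"
    unfolding f_def by (intro measurable_compose[OF measurable_tot[OF Nb b] measurable_ennreal]) simp
  define \<Phi> :: "real \<times> 'k \<times> 'k conf \<Rightarrow> ennreal" where "\<Phi> x = f (snd (snd x))" for x
  have m: "\<Phi> \<in> borel_measurable (borel \<Otimes>\<^sub>M count_space UNIV \<Otimes>\<^sub>M conf_borel)"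
    unfolding \<Phi>_def by (rule measurable_compose[OF measurable_compose[OF measurable_snd measurable_snd] f])
  have "(\<integral>\<^sup>+c. (\<Sum>l\<in>UNIV. \<integral>\<^sup>+u. \<Phi> (u, l, c) \<partial>count_space (c l)) \<partial>P) = (\<integral>\<^sup>+c. 0 \<partial>P)"
  proof (rule nn_integral_cong_AE)
    show "AE c in P. (\<Sum>l\<in>UNIV. \<integral>\<^sup>+u. \<Phi> (u, l, c) \<partial>count_space (c l)) = 0"
      using P_avoids_null[OF N b] by eventually_elim (simp add: \<Phi>_def f_def)
  qed
  then have "(\<Sum>l\<in>UNIV. ennreal (mean_rate P l) * (\<integral>\<^sup>+u. (\<integral>\<^sup>+c. \<Phi> (u, l, c) \<partial>Q u l) \<partial>lborel)) = 0"
    using palm_eq[OF m] by simp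
  then have "ennreal (mean_rate P l) * (\<integral>\<^sup>+u. (\<integral>\<^sup>+c. \<Phi> (u, l, c) \<partial>Q u l) \<partial>lborel) = 0"
    by (simp add: sum_nonneg_eq_0_iff)
  then have zero: "(\<integral>\<^sup>+u. (\<integral>\<^sup>+c. f c \<partial>Q u l) \<partial>lborel) = 0"
    using mean_rate_pos[of l] by (simp add: \<Phi>_def)
  have joint: "(\<lambda>x. f (shift_conf (fst x) (snd x))) \<in> borel_measurable (lborel \<Otimes>\<^sub>M Q 0 l)"
  proof -
    have "(\<lambda>x. shift_conf (fst x) (snd x)) \<in> (borel \<Otimes>\<^sub>M (conf_borel :: 'k conf measure)) \<rightarrow>\<^sub>M conf_borel"
      using measurable_shift_conf_joint[where 'k='k] by (simp add: split_beta)
    from measurable_compose[OF this f]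
    have b: "(\<lambda>x. f (shift_conf (fst x) (snd x))) \<in> borel_measurable (borel \<Otimes>\<^sub>M conf_borel)" .
    have "sets (lborel \<Otimes>\<^sub>M Q 0 l) = sets (borel \<Otimes>\<^sub>M conf_borel)"
      by (rule sets_pair_measure_cong[OF sets_lborel Q_sets])
    from measurable_cong_sets[OF this refl] b show ?thesis by blast
  qed
  interpret Q0: prob_space "Q 0 l" by (rule Q_prob)
  have "(\<lambda>u. \<integral>\<^sup>+c. f (shift_conf u c) \<partial>Q 0 l) \<in> borel_measurable lborel"
    using Q0.borel_measurable_nn_integral_fst[OF joint] unfolding fst_conv snd_conv .
  then have "(\<lambda>u. \<integral>\<^sup>+c. f c \<partial>Q u l) \<in> borel_measurable lborel"
    by (simp only: nn_integral_Q_shift[OF f])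
  then have "AE u in lborel. (\<integral>\<^sup>+c. f c \<partial>Q u l) = 0"
    using zero by (subst (asm) nn_integral_0_iff_AE) auto
  then show ?thesis
  proof eventually_elim
    case (elim u)
    then have "AE c in Q u l. f c = 0"
      using f by (subst (asm) nn_integral_0_iff_AE) (auto simp: measurable_Q_eq)
    then show ?case by eventually_elim (simp add: f_def)
  qed
qed

abbreviation \<Gamma> :: "'k param \<Rightarrow> 'k param" where
  "\<Gamma> \<equiv> Gamma_ext A \<nu> h he P Q"

lemma \<Gamma>_fst: "fst (\<Gamma> (\<xi>, g)) k = \<xi> k * (\<integral>c. 1 / intensity A \<nu> h k A c \<partial>P)
   + (\<integral>c. lin_intensity A g k c / intensity A \<nu> h k A c \<partial>P)"
  by (simp add: Gamma_ext_def)

lemma \<Gamma>_snd: "snd (\<Gamma> (\<xi>, g)) l k x = mean_rate P l * p_ext A \<nu> h he Q l k x * g l k x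
   + mean_rate P l * p_ext A \<nu> h he Q l k x * \<xi> k
   + mean_rate P l * (\<Sum>j\<in>UNIV. zeta_ext A \<nu> h he Q l j k (g j k) x)"
  by (simp add: Gamma_ext_def)

lemma \<Gamma>_snd_cong_AE:
  assumes g: "\<And>l k. g l k \<in> borel_measurable borel" "\<And>l k. g' l k \<in> borel_measurable borel"
    and eq: "\<And>l k. AE x in lborel. g l k x = g' l k x"
  shows "AE x in lborel. snd (\<Gamma> (\<xi>, g)) l k x = snd (\<Gamma> (\<xi>, g')) l k x"
proof -
  define N where "N = {s \<in> {0..A}. \<exists>j\<in>UNIV. g j k (A - s) \<noteq> g' j k (A - s)}"
  have Nb: "N \<in> sets borel"
  proof -
    have "{s \<in> space borel. g j k (A - s) \<noteq> g' j k (A - s)} \<in> sets borel" for j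
      using g by measurable
    then have "(\<Union>j\<in>UNIV. {s. g j k (A - s) \<noteq> g' j k (A - s)}) \<in> sets borel"
      by (intro sets.finite_UN) auto
    moreover have "N = {0..A} \<inter> (\<Union>j\<in>UNIV. {s. g j k (A - s) \<noteq> g' j k (A - s)})" unfolding N_def by auto
    ultimately show ?thesis by (simp add: sets.Int)
  qed
  have "AE s in lborel. \<forall>j\<in>UNIV. g j k (A + (- 1) * s) = g' j k (A + (- 1) * s)"
    by (intro AE_finite_allI AE_lborel_affine[OF eq]) auto
  then have "AE s in lborel. s \<notin> N" by eventually_elim (auto simp: N_def)
  then have N: "N \<in> null_sets lborel" using Nb by (simp add: AE_iff_null_sets)
  have bN: "bounded N" unfolding N_def by (rule bounded_subset[of "{0..A}"]) auto
  have "AE x in lborel. AE c in Q (A + (- 1) * x) l. tot c N = 0"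
    by (rule AE_lborel_affine[OF Q_avoids_null[OF N bN]]) simp
  then show ?thesis using eq[of l k]
  proof eventually_elim
    case (elim x)
    have "zeta_ext A \<nu> h he Q l j k (g j k) x = zeta_ext A \<nu> h he Q l j k (g' j k) x" for j
      unfolding zeta_ext_def Let_def
    proof (rule integral_cong_AE)
      let ?n = "\<lambda>g c. \<Sum>s\<in>c j \<inter> {0..<A}. of_bool ((s, j) \<noteq> (A - x, l)) * g j k (A - s)"
      have n: "?n u \<in> borel_measurable conf_borel" if "\<And>l k. u l k \<in> borel_measurable borel" for u :: "'k \<Rightarrow> 'k \<Rightarrow> real \<Rightarrow> real"
        by (intro measurable_sum_conf borel_measurable_times borel_measurable_const measurable_compose[OF _ that]) auto
      show "(\<lambda>c. ?n g c / intensity_ext A \<nu> h he k A (A - x, l) c) \<in> borel_measurable (Q (A - x) l)"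
        unfolding measurable_Q_eq by (intro borel_measurable_divide intensity_ext_measurable n g(1))
      show "(\<lambda>c. ?n g' c / intensity_ext A \<nu> h he k A (A - x, l) c) \<in> borel_measurable (Q (A - x) l)"
        unfolding measurable_Q_eq by (intro borel_measurable_divide intensity_ext_measurable n g(2))
      have "A + (- 1) * x = A - x" by simp
      then have "AE c in Q (A - x) l. tot c N = 0" using elim(1) by metis
      moreover have "AE c in Q (A - x) l. c \<in> configurations" using AE_space[of "Q (A - x) l"] unfolding space_Q .
      ultimately show "AE c in Q (A - x) l. ?n g c / intensity_ext A \<nu> h he k A (A - x, l) c
          = ?n g' c / intensity_ext A \<nu> h he k A (A - x, l) c"
      proof eventually_elim
        case (elim c)
        have "g j k (A - s) = g' j k (A - s)" if s: "s \<in> c j \<inter> {0..<A}" for s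
        proof (rule ccontr)
          assume "g j k (A - s) \<noteq> g' j k (A - s)"
          then have "s \<in> c j \<inter> N" using s by (auto simp: N_def)
          then have "0 < card (c j \<inter> N)" using conf_finite[OF elim(2) bN, of j] by (auto simp: card_gt_0_iff)
          then show False using card_le_tot[of c j N] elim(1) by simp
        qed
        then have "?n g c = ?n g' c" by (intro sum.cong refl) simp
        then show ?case by simp
      qed
    qed
    then show ?case using elim(2) by (simp add: \<Gamma>_snd)
  qed
qed

lemma Linf_norm_le:
  assumes "f \<in> borel_measurable borel" "AE x in lborel. \<bar>f x\<bar> \<le> C"
  shows "Linf_norm f \<le> ereal C"
  unfolding Linf_norm_def by (rule esssup_I) (use assms in auto)

lemma Linf_norm_leD:
  assumes "Linf_norm f \<le> ereal C"
  shows "AE x in lborel. \<bar>f x\<bar> \<le> C"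
proof -
  have "AE x in lborel. ereal \<bar>f x\<bar> \<le> Linf_norm f" unfolding Linf_norm_def by (rule esssup_AE)
  then show ?thesis
  proof eventually_elim
    case (elim x)
    then have "ereal \<bar>f x\<bar> \<le> ereal C" using assms by (rule order_trans)
    then show ?case by simp
  qed
qed

text \<open>
  With \<open>w\<close> for the second component of \<open>\<Gamma> (\<xi>, g)\<close>, the second component of \<open>\<Gamma> (0, g(\<cdot> - y) - g)\<close>
  is the translation difference of \<open>w\<close>, plus the commutator terms. Both are \<open>O(y powr \<beta>)\<close>, and
  the bounded inverse carries this over to \<open>g(\<cdot> - y) - g\<close>.
\<close>

lemma translation_bound_small:
  assumes bij: "bounded_bijective \<Gamma>"
    and g: "\<And>l k. g l k \<in> borel_measurable borel" "\<And>l k s. \<bar>g l k s\<bar> \<le> M"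
    and w: "\<And>l k. holder_on \<beta> UNIV (w l k)"
    and \<Gamma>g: "\<And>l k. AE x in lborel. snd (\<Gamma> (\<xi>, g)) l k x = w l k x"
  shows "\<exists>C y0. 0 \<le> C \<and> 0 < y0 \<and> (\<forall>l k y. 0 < y \<longrightarrow> y \<le> y0 \<longrightarrow> (AE x in lborel. \<bar>g l k (x - y) - g l k x\<bar> \<le> C * y powr \<beta>))"
proof -
  have M: "0 \<le> M" using g(2)[of undefined undefined 0] by linarith
  obtain Lw where Lw: "0 \<le> Lw" and lw: "\<And>l k x y. \<bar>w l k x - w l k y\<bar> \<le> Lw * \<bar>x - y\<bar> powr \<beta>"
    using holder_uniform[of \<beta> UNIV w] w by blast
  obtain C1 where C1: "0 \<le> C1" and c1: "\<And>l k j x y g M. 0 < y \<Longrightarrow> y \<le> 1 \<Longrightarrow> g \<in> borel_measurable borel \<Longrightarrow> (\<forall>s. \<bar>g s\<bar> \<le> M) \<Longrightarrow>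
    \<bar>p_ext A \<nu> h he Q l k x - p_ext A \<nu> h he Q l k (x - y)\<bar> \<le> C1 * y powr \<beta> \<and>
    \<bar>zeta_ext A \<nu> h he Q l j k (\<lambda>r. g (r - y)) x - zeta_ext A \<nu> h he Q l j k g (x - y)\<bar> \<le> M * C1 * y powr \<beta>"
    using palm_commutator by blast
  obtain C2 y0 where C2: "0 \<le> C2" and y0: "0 < y0" "y0 \<le> 1" and c2: "\<And>k y g M. 0 < y \<Longrightarrow> y \<le> y0 \<Longrightarrow>
    (\<forall>j. g j k \<in> borel_measurable borel) \<Longrightarrow> (\<forall>j s. \<bar>g j k s\<bar> \<le> M) \<Longrightarrow>
    \<bar>\<integral>c. lin_intensity A (\<lambda>j k r. g j k (r - y) - g j k r) k c / intensity A \<nu> h k A c \<partial>P\<bar> \<le> M * C2 * y powr \<beta>"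
    using stationary_commutator by blast
  obtain B :: real where B: "\<And>z. z \<in> params Linf \<Longrightarrow> param_norm z \<le> ereal B * param_norm (\<Gamma> z)"
    using bij unfolding bounded_bijective_def by blast
  have maps: "z \<in> params Linf \<Longrightarrow> \<Gamma> z \<in> params Linf" for z
    using bij unfolding bounded_bijective_def by blast
  define mu where "mu = (\<Sum>l\<in>UNIV. mean_rate P l)"
  define X where "X = (\<Sum>k\<in>UNIV. \<bar>\<xi> k\<bar>)"
  have mu0: "0 \<le> mu" unfolding mu_def by (intro sum_nonneg less_imp_le[OF mean_rate_pos])
  have mu: "mean_rate P l \<le> mu" for l
    unfolding mu_def by (rule member_le_sum) (auto intro: less_imp_le[OF mean_rate_pos])
  have X0: "0 \<le> X" unfolding X_def by (intro sum_nonneg) simp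
  have X: "\<bar>\<xi> k\<bar> \<le> X" for k
    unfolding X_def by (rule member_le_sum) auto
  define K where "K = real CARD('k)"
  define C where "C = Lw + mu * C1 * (M + X) + mu * (K * (M * C1)) + M * C2"
  have C: "0 \<le> C" "M * C2 \<le> C" "Lw + mu * C1 * (M + X) + mu * (K * (M * C1)) \<le> C"
    unfolding C_def K_def using Lw mu0 C1 C2 M X0 by simp_all
  have main: "AE x in lborel. \<bar>g l k (x - y) - g l k x\<bar> \<le> (max B 0 * C) * y powr \<beta>" if y: "0 < y" "y \<le> y0" for l k y
  proof -
    have y1: "y \<le> 1" using y y0 by simp
    define \<delta> where "\<delta> = (\<lambda>l k x. g l k (x - y) - g l k x)"
    have g_shift: "(\<lambda>r. g l k (r - y)) \<in> borel_measurable borel" for l k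
      using measurable_compose[OF _ g(1), of "\<lambda>r. r - y"] by simp
    have \<delta>m: "\<delta> l k \<in> borel_measurable borel" for l k
      unfolding \<delta>_def by (intro borel_measurable_diff g_shift g(1))
    have "\<bar>\<delta> l k x\<bar> \<le> 2 * M" for l k x
      unfolding \<delta>_def using g(2)[of l k "x - y"] g(2)[of l k x] by linarith
    then have "Linf_norm (\<delta> l k) \<le> ereal (2 * M)" for l k by (intro Linf_norm_le \<delta>m AE_I2)
    then have "Linf_norm (\<delta> l k) < \<infinity>" for l k by (rule le_less_trans) simp
    then have z: "((\<lambda>_. 0), \<delta>) \<in> params Linf"
      using \<delta>m unfolding params_def Linf_def by auto
    let ?T = "\<Gamma> ((\<lambda>_. 0), \<delta>)"
    have Tm: "snd ?T l k \<in> borel_measurable borel" for l k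
      using maps[OF z] unfolding params_def Linf_def by (auto simp: split_beta)
    have first: "\<bar>fst ?T k\<bar> \<le> C * y powr \<beta>" for k
    proof -
      have "\<bar>fst ?T k\<bar> \<le> M * C2 * y powr \<beta>"
        unfolding \<Gamma>_fst \<delta>_def using c2[OF y, of g k M] g by simp
      also have "\<dots> \<le> C * y powr \<beta>" using C(2) by (intro mult_right_mono) auto
      finally show ?thesis .
    qed
    have second: "AE x in lborel. \<bar>snd ?T l k x\<bar> \<le> C * y powr \<beta>" for l k
    proof -
      have "AE x in lborel. snd (\<Gamma> (\<xi>, g)) l k (- y + 1 * x) = w l k (- y + 1 * x)"
        by (rule AE_lborel_affine[OF \<Gamma>g]) simp
      then show ?thesis using \<Gamma>g[of l k]
      proof eventually_elim
        case (elim x)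
        let ?\<mu> = "mean_rate P l" and ?p = "p_ext A \<nu> h he Q l k"
        let ?\<zeta> = "\<lambda>j. zeta_ext A \<nu> h he Q l j k"
        have e1: "snd (\<Gamma> (\<xi>, g)) l k (x - y) = w l k (x - y)" and e2: "snd (\<Gamma> (\<xi>, g)) l k x = w l k x"
          using elim by simp_all
        have zd: "?\<zeta> j (\<delta> j k) x = ?\<zeta> j (\<lambda>r. g j k (r - y)) x - ?\<zeta> j (g j k) x" for j
          unfolding \<delta>_def by (rule zeta_ext_diff[OF g g_shift g(2)])
        have eq: "snd ?T l k x = (w l k (x - y) - w l k x) + ?\<mu> * ((?p x - ?p (x - y)) * (g l k (x - y) + \<xi> k))
            + ?\<mu> * (\<Sum>j\<in>UNIV. ?\<zeta> j (\<lambda>r. g j k (r - y)) x - ?\<zeta> j (g j k) (x - y))"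
          unfolding \<Gamma>_snd zd sum_subtractf e1[symmetric] e2[symmetric]
          by (simp add: \<delta>_def algebra_simps)
        have b1: "\<bar>w l k (x - y) - w l k x\<bar> \<le> Lw * y powr \<beta>"
          using lw[of l k "x - y" x] y by simp
        have pz: "\<bar>?p x - ?p (x - y)\<bar> \<le> C1 * y powr \<beta>"
          "\<bar>?\<zeta> j (\<lambda>r. g j k (r - y)) x - ?\<zeta> j (g j k) (x - y)\<bar> \<le> M * C1 * y powr \<beta>" for j
          using c1[OF y(1) y1 g(1), of j k M l k x j] g(2) by auto
        have "\<bar>(?p x - ?p (x - y)) * (g l k (x - y) + \<xi> k)\<bar> \<le> (C1 * y powr \<beta>) * (M + X)"
          unfolding abs_mult using g(2)[of l k "x - y"] X[of k] C1
          by (intro mult_mono pz) auto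
        then have b2: "\<bar>?\<mu> * ((?p x - ?p (x - y)) * (g l k (x - y) + \<xi> k))\<bar> \<le> mu * ((C1 * y powr \<beta>) * (M + X))"
          unfolding abs_mult[of ?\<mu>] using mu[of l] mu0 mean_rate_pos[of l] C1 M X0 by (intro mult_mono) auto
        have "\<bar>\<Sum>j\<in>UNIV. ?\<zeta> j (\<lambda>r. g j k (r - y)) x - ?\<zeta> j (g j k) (x - y)\<bar> \<le> (\<Sum>j\<in>(UNIV :: 'k set). M * C1 * y powr \<beta>)"
          by (rule order_trans[OF sum_abs sum_mono]) (rule pz)
        then have "\<bar>\<Sum>j\<in>UNIV. ?\<zeta> j (\<lambda>r. g j k (r - y)) x - ?\<zeta> j (g j k) (x - y)\<bar> \<le> K * (M * C1 * y powr \<beta>)"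
          by (simp add: K_def)
        then have b3: "\<bar>?\<mu> * (\<Sum>j\<in>UNIV. ?\<zeta> j (\<lambda>r. g j k (r - y)) x - ?\<zeta> j (g j k) (x - y))\<bar> \<le> mu * (K * (M * C1 * y powr \<beta>))"
          unfolding abs_mult[of ?\<mu>] using mu[of l] mu0 mean_rate_pos[of l] C1 M by (intro mult_mono) (auto simp: K_def)
        have "\<bar>snd ?T l k x\<bar> \<le> Lw * y powr \<beta> + mu * ((C1 * y powr \<beta>) * (M + X)) + mu * (K * (M * C1 * y powr \<beta>))"
          unfolding eq using b1 b2 b3 by linarith
        also have "\<dots> = (Lw + mu * C1 * (M + X) + mu * (K * (M * C1))) * y powr \<beta>"
          by (simp add: algebra_simps)
        also have "\<dots> \<le> C * y powr \<beta>" using C(3) by (intro mult_right_mono) auto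
        finally show ?case .
      qed
    qed
    have Tnorm: "param_norm ?T \<le> ereal (C * y powr \<beta>)"
      unfolding param_norm_def Linf_mat_norm_def
      by (intro max.boundedI SUP_least Linf_norm_le Tm second) (use first in auto)
    have T0: "0 \<le> param_norm ?T"
    proof -
      have "0 \<le> ereal \<bar>fst ?T undefined\<bar>" by simp
      also have "\<dots> \<le> (SUP k. ereal \<bar>fst ?T k\<bar>)" by (rule SUP_upper) simp
      also have "\<dots> \<le> param_norm ?T" unfolding param_norm_def by (rule max.cobounded1)
      finally show ?thesis .
    qed
    have "Linf_norm (\<delta> l k) \<le> (SUP k. Linf_norm (\<delta> l k))" by (rule SUP_upper) simp
    also have "\<dots> \<le> Linf_mat_norm \<delta>" unfolding Linf_mat_norm_def by (rule SUP_upper) simp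
    also have "\<dots> \<le> param_norm ((\<lambda>_. 0), \<delta>)" unfolding param_norm_def by simp
    also have "\<dots> \<le> ereal B * param_norm ?T" by (rule B[OF z])
    also have "\<dots> \<le> ereal (max B 0) * param_norm ?T" by (rule ereal_mult_right_mono[OF _ T0]) simp
    also have "\<dots> \<le> ereal (max B 0) * ereal (C * y powr \<beta>)" by (rule ereal_mult_left_mono[OF Tnorm]) (simp add: le_max_iff_disj)
    also have "\<dots> = ereal ((max B 0 * C) * y powr \<beta>)" by (simp only: times_ereal.simps mult.assoc)
    finally show ?thesis unfolding \<delta>_def by (rule Linf_norm_leD)
  qed
  then show ?thesis using C y0 by (intro exI[of _ "max B 0 * C"] exI[of _ y0]) auto
qed

text \<open>
  For large \<open>\<bar>y\<bar>\<close>, the bound is trivial because \<open>g\<close> is bounded; the substitution of \<open>x + y\<close> for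
  \<open>x\<close> changes the sign of \<open>y\<close>.
\<close>

lemma translation_bound:
  assumes bij: "bounded_bijective \<Gamma>"
    and w: "(\<xi>', w) \<in> params (holder_b \<beta>)" and inv: "is_inverse_at \<Gamma> (\<xi>', w) (\<xi>, g)"
  shows "\<exists>C\<ge>0. \<forall>l k y. AE x in lborel. \<bar>g l k (x - y) - g l k x\<bar> \<le> C * \<bar>y\<bar> powr \<beta>"
proof -
  have gL: "g l k \<in> Linf" for l k
    using inv unfolding is_inverse_at_def params_def by auto
  have gm: "g l k \<in> borel_measurable borel" for l k using gL[of l k] by (simp add: Linf_def)
  have "\<exists>M\<ge>0. AE x in lborel. \<bar>g l k x\<bar> \<le> M" for l k
  proof -
    have "Linf_norm (g l k) < \<infinity>" using gL[of l k] by (simp add: Linf_def)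
    then obtain M :: real where "Linf_norm (g l k) \<le> ereal M" by (cases "Linf_norm (g l k)") (auto intro: that)
    then have "AE x in lborel. \<bar>g l k x\<bar> \<le> M" by (rule Linf_norm_leD)
    then have "AE x in lborel. \<bar>g l k x\<bar> \<le> max M 0" by eventually_elim simp
    then show ?thesis by (intro exI[of _ "max M 0"]) simp
  qed
  then obtain Mlk where Mlk: "\<And>l k. 0 \<le> Mlk l k" "\<And>l k. AE x in lborel. \<bar>g l k x\<bar> \<le> Mlk l k" by metis
  define M where "M = (\<Sum>l\<in>UNIV. \<Sum>k\<in>UNIV. Mlk l k)"
  have M: "Mlk l k \<le> M" "0 \<le> M" for l k
  proof -
    have "Mlk l k \<le> (\<Sum>k\<in>UNIV. Mlk l k)" by (rule member_le_sum) (auto simp: Mlk)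
    also have "\<dots> \<le> M" unfolding M_def by (rule member_le_sum) (auto intro: sum_nonneg Mlk)
    finally show "Mlk l k \<le> M" .
    show "0 \<le> M" unfolding M_def by (intro sum_nonneg Mlk)
  qed
  \<comment> \<open>Elements of the space are classes; a representative that is bounded everywhere makes all functionals integrable.\<close>
  define gb where "gb l k x = max (- M) (min M (g l k x))" for l k x
  have gbm: "gb l k \<in> borel_measurable borel" for l k unfolding gb_def using gm[of l k] by measurable
  have gbM: "\<bar>gb l k x\<bar> \<le> M" for l k x unfolding gb_def using M by auto
  have gb_eq: "AE x in lborel. g l k x = gb l k x" for l k
    using Mlk(2)[of l k]
  proof eventually_elim
    case (elim x)
    then show ?case using M(1)[of l k] by (auto simp: gb_def)
  qed
  have \<Gamma>gb: "AE x in lborel. snd (\<Gamma> (\<xi>, gb)) l k x = w l k x" for l k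
  proof -
    have "AE x in lborel. snd (\<Gamma> (\<xi>, g)) l k x = w l k x"
      using inv unfolding is_inverse_at_def param_eq_def by simp
    then show ?thesis using \<Gamma>_snd_cong_AE[where g=g and g'=gb, OF gm gbm gb_eq, where \<xi>=\<xi> and l=l and k=k]
      by eventually_elim simp
  qed
  have wh: "holder_on \<beta> UNIV (w l k)" for l k using w unfolding params_def holder_b_def by auto
  obtain C y0 where C: "0 \<le> C" and y0: "0 < y0" and small: "\<And>l k y. 0 < y \<Longrightarrow> y \<le> y0 \<Longrightarrow>
      AE x in lborel. \<bar>gb l k (x - y) - gb l k x\<bar> \<le> C * y powr \<beta>"
    using translation_bound_small[OF bij gbm gbM wh \<Gamma>gb] by blast
  define D where "D = C + 2 * M / y0 powr \<beta>"
  have D: "C \<le> D" "2 * M / y0 powr \<beta> \<le> D" "0 \<le> D" unfolding D_def using C M by auto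
  have pos: "AE x in lborel. \<bar>gb l k (x - y) - gb l k x\<bar> \<le> D * y powr \<beta>" if y: "0 < y" for l k y
  proof (cases "y \<le> y0")
    case True
    show ?thesis using small[OF y True, of l k]
    proof eventually_elim
      case (elim x)
      have "C * y powr \<beta> \<le> D * y powr \<beta>" using D by (intro mult_right_mono) auto
      then show ?case using elim by simp
    qed
  next
    case False
    have "2 * M = 2 * M / y0 powr \<beta> * y0 powr \<beta>" using y0 by simp
    also have "\<dots> \<le> D * y powr \<beta>"
      using D False y0 \<beta>_pos M by (intro mult_mono powr_mono2) auto
    finally have "2 * M \<le> D * y powr \<beta>" .
    then show ?thesis using gbM[of l k] by (intro AE_I2) (smt (verit))
  qed
  have all: "AE x in lborel. \<bar>gb l k (x - y) - gb l k x\<bar> \<le> D * \<bar>y\<bar> powr \<beta>" for l k y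
  proof -
    consider "y = 0" | "0 < y" | "y < 0" by linarith
    then show ?thesis
    proof cases
      case 1
      then show ?thesis using D by simp
    next
      case 2
      then show ?thesis using pos[OF 2, of l k] by simp
    next
      case 3
      have "AE x in lborel. \<bar>gb l k ((- y + 1 * x) - (- y)) - gb l k (- y + 1 * x)\<bar> \<le> D * (- y) powr \<beta>"
        by (rule AE_lborel_affine[OF pos]) (use 3 in auto)
      then show ?thesis
      proof eventually_elim
        case (elim x)
        then show ?case using 3 by (simp add: abs_minus_commute)
      qed
    qed
  qed
  have "AE x in lborel. \<bar>g l k (x - y) - g l k x\<bar> \<le> D * \<bar>y\<bar> powr \<beta>" for l k y
  proof -
    have "AE x in lborel. g l k (- y + 1 * x) = gb l k (- y + 1 * x)" by (rule AE_lborel_affine[OF gb_eq]) simp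
    then show ?thesis using gb_eq[of l k] all[of l k y] by eventually_elim simp
  qed
  then show ?thesis using D by blast
qed

end

section \<open>Smoothing and Besov regularity\<close>

text \<open>
  For \<open>\<beta> < 1\<close> the differences are of first order. For \<open>\<beta> = 1\<close> they are of second order, that is,
  differences of two first-order ones.
\<close>

lemma besov_from_translations:
  assumes g: "g \<in> Linf" and \<beta>: "0 < \<beta>" "\<beta> \<le> 1"
    and tr: "\<And>y. AE x in lborel. \<bar>g (x - y) - g x\<bar> \<le> C * \<bar>y\<bar> powr \<beta>"
  shows "g \<in> besov_inf_inf \<beta>"
proof -
  have gm: "g \<in> borel_measurable borel" using g by (simp add: Linf_def)
  have tr': "AE x in lborel. \<bar>g (x + y) - g x\<bar> \<le> C * \<bar>y\<bar> powr \<beta>" for y using tr[of "- y"] by simp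
  have shift: "(\<lambda>x. g (x + a)) \<in> borel_measurable borel" for a
    using measurable_compose[OF _ gm, of "\<lambda>x. x + a"] by simp
  have meas: "finite_difference r y g \<in> borel_measurable borel" for r y
    unfolding finite_difference_def by (intro borel_measurable_sum borel_measurable_times borel_measurable_const shift)
  have "AE x in lborel. \<bar>finite_difference (nat \<lfloor>\<beta>\<rfloor> + 1) y g x\<bar> \<le> (2 * C) * \<bar>y\<bar> powr \<beta>" for y
  proof -
    have C: "0 \<le> C * \<bar>y\<bar> powr \<beta>"
    proof -
      have "AE x::real in lborel. 0 \<le> C * \<bar>y\<bar> powr \<beta>"
        by (rule eventually_mono[OF tr[of y]]) (meson abs_ge_zero order_trans)
      moreover have "ae_filter (lborel :: real measure) \<noteq> bot" by (simp add: ae_filter_eq_bot_iff)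
      ultimately show ?thesis by simp
    qed
    show ?thesis
    proof (cases "\<beta> = 1")
      case True
      have "AE x in lborel. \<bar>g ((y + 1 * x) + y) - g (y + 1 * x)\<bar> \<le> C * \<bar>y\<bar> powr \<beta>"
        by (rule AE_lborel_affine[OF tr']) simp
      then show ?thesis using tr'[of y]
      proof eventually_elim
        case (elim x)
        have "finite_difference 2 y g x = (g (y + x + y) - g (y + x)) - (g (x + y) - g x)"
          by (simp add: finite_difference_def numeral_2_eq_2 algebra_simps)
        then have "\<bar>finite_difference 2 y g x\<bar> \<le> 2 * C * \<bar>y\<bar> powr \<beta>" using elim by simp
        moreover have "nat \<lfloor>\<beta>\<rfloor> + 1 = 2" using True by simp
        ultimately show ?case by (simp only:)
      qed
    next
      case False
      then have "\<lfloor>\<beta>\<rfloor> = 0" using \<beta> by (simp add: floor_eq_iff)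
      then have r: "nat \<lfloor>\<beta>\<rfloor> + 1 = 1" by simp
      show ?thesis unfolding r using tr'[of y]
      proof eventually_elim
        case (elim x)
        have "finite_difference 1 y g x = g (x + y) - g x" by (simp add: finite_difference_def)
        then show ?case using elim C by simp
      qed
    qed
  qed
  then have "Linf_norm (finite_difference (nat \<lfloor>\<beta>\<rfloor> + 1) y g) \<le> ereal ((2 * C) * \<bar>y\<bar> powr \<beta>)" for y
    unfolding Linf_norm_def by (intro esssup_I) (use meas in auto)
  then show ?thesis using g unfolding besov_inf_inf_def by blast
qed

text \<open>
  Since the kernel has integral \<open>1\<close>, the error is the kernel-weighted mean of \<open>g x - g (x - y)\<close>
  over \<open>\<bar>y\<bar> \<le> 1/n\<close>. The translation bound holds for almost all \<open>x\<close>, depending on \<open>y\<close>; by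
  Fubini's theorem, for almost all \<open>x\<close> it holds for almost all \<open>y\<close>.
\<close>

lemma smoothing_from_translations:
  assumes g: "g \<in> Linf" and \<beta>: "0 < \<beta>" and n: "1 \<le> n" and K: "smoothing_kernel \<K>" and b: "\<And>x. \<bar>\<K> x\<bar> \<le> b"
    and C: "0 \<le> C" and tr: "\<And>y. AE x in lborel. \<bar>g (x - y) - g x\<bar> \<le> C * \<bar>y\<bar> powr \<beta>"
  shows "Linf_norm (\<lambda>x. g x - smooth \<K> n g x) \<le> ereal ((2 * b * C) * real n powr (- \<beta>))"
proof -
  have gm [measurable]: "g \<in> borel_measurable borel" using g by (simp add: Linf_def)
  have Km [measurable]: "\<K> \<in> borel_measurable borel" and supp: "\<And>x. x \<notin> {-1..1} \<Longrightarrow> \<K> x = 0" and one: "(\<integral>x. \<K> x \<partial>lborel) = 1"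
    using K unfolding smoothing_kernel_def by auto
  have n0: "0 < real n" using n by simp
  have b0: "0 \<le> b" using b[of 0] by linarith
  define k where "k = scaled_kernel \<K> n"
  have km [measurable]: "k \<in> borel_measurable borel" unfolding k_def scaled_kernel_def by measurable
  define r where "r = 1 / real n"
  have r: "0 < r" unfolding r_def using n0 by simp
  have k_le: "\<bar>k y\<bar> \<le> (real n * b) * indicator {-r..r} y" for y
  proof (cases "y \<in> {-r..r}")
    case True
    then show ?thesis unfolding k_def scaled_kernel_def using b[of "real n * y"] n0 by (simp add: abs_mult)
  next
    case False
    then have "real n * y \<notin> {-1..1}" unfolding r_def using n0 by (auto simp: field_simps)
    then show ?thesis using False supp by (simp add: k_def scaled_kernel_def)
  qed
  have k_one: "(\<integral>y. k y \<partial>lborel) = 1"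
  proof -
    have "(\<integral>x. \<K> x \<partial>lborel) = \<bar>real n\<bar> *\<^sub>R (\<integral>y. \<K> (0 + real n * y) \<partial>lborel)"
      by (rule lborel_integral_real_affine) (use n0 in simp)
    then show ?thesis using one by (simp add: k_def scaled_kernel_def)
  qed
  have ind: "integrable lborel (\<lambda>y. indicator {-r..r} y :: real)"
    by (rule integrable_real_indicator) (simp_all add: r less_imp_le)
  have k_int: "integrable lborel k"
  proof (rule Bochner_Integration.integrable_bound)
    show "integrable lborel (\<lambda>y. (real n * b) * indicator {-r..r} y)" using ind by (rule integrable_mult_right)
    show "AE y in lborel. norm (k y) \<le> norm ((real n * b) * indicator {-r..r} y)"
      using k_le b0 n0 by (intro AE_I2) (simp add: abs_mult)
  qed simp
  obtain M :: real where M: "Linf_norm g \<le> ereal M"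
    using g by (cases "Linf_norm g") (auto simp: Linf_def intro: that)
  have gM: "AE x in lborel. \<bar>g x\<bar> \<le> M"
  proof -
    have "AE x in lborel. ereal \<bar>g x\<bar> \<le> Linf_norm g" unfolding Linf_norm_def by (rule esssup_AE)
    then show ?thesis
    proof eventually_elim
      case (elim x)
      then have "ereal \<bar>g x\<bar> \<le> ereal M" using M by (rule order_trans)
      then show ?case by simp
    qed
  qed
  have prod_int: "integrable lborel (\<lambda>y. k y * g (x - y))" for x
  proof (rule Bochner_Integration.integrable_bound)
    show "integrable lborel (\<lambda>y. M * k y)" using k_int by (rule integrable_mult_right)
    have "AE y in lborel. \<bar>g (x + (- 1) * y)\<bar> \<le> M" by (rule AE_lborel_affine[OF gM]) simp
    then show "AE y in lborel. norm (k y * g (x - y)) \<le> norm (M * k y)"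
    proof eventually_elim
      case (elim y)
      then have "\<bar>g (x - y)\<bar> \<le> \<bar>M\<bar>" by simp
      then show ?case using mult_right_mono[OF _ abs_ge_zero[of "k y"]] by (simp add: abs_mult mult.commute[of "\<bar>k y\<bar>"])
    qed
  qed measurable
  have smooth_eq: "g x - smooth \<K> n g x = (\<integral>y. k y * (g x - g (x - y)) \<partial>lborel)" for x
  proof -
    have "(\<integral>y. k y * (g x - g (x - y)) \<partial>lborel) = (\<integral>y. k y * g x - k y * g (x - y) \<partial>lborel)"
      by (simp add: right_diff_distrib)
    also have "\<dots> = (\<integral>y. k y * g x \<partial>lborel) - (\<integral>y. k y * g (x - y) \<partial>lborel)"
      using k_int prod_int by (intro Bochner_Integration.integral_diff) auto
    also have "(\<integral>y. k y * g x \<partial>lborel) = g x" using k_one by simp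
    finally show ?thesis by (simp add: smooth_def k_def)
  qed
  have joint: "AE x in lborel. AE y in lborel. \<bar>g (x - y) - g x\<bar> \<le> C * \<bar>y\<bar> powr \<beta>"
  proof -
    have "{z \<in> space (lborel \<Otimes>\<^sub>M lborel). \<bar>g (snd z - fst z) - g (snd z)\<bar> \<le> C * \<bar>fst z\<bar> powr \<beta>} \<in> sets (lborel \<Otimes>\<^sub>M lborel)"
      by measurable
    then have "AE z in lborel \<Otimes>\<^sub>M lborel. \<bar>g (snd z - fst z) - g (snd z)\<bar> \<le> C * \<bar>fst z\<bar> powr \<beta>"
      using tr by (intro lborel_pair.AE_pair_measure) auto
    moreover have "{z \<in> space (lborel \<Otimes>\<^sub>M lborel). (\<lambda>y x. \<bar>g (x - y) - g x\<bar> \<le> C * \<bar>y\<bar> powr \<beta>) (fst z) (snd z)} \<in> sets (lborel \<Otimes>\<^sub>M lborel)"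
      by measurable
    ultimately show ?thesis
      using lborel_pair.AE_commute[of "\<lambda>y x. \<bar>g (x - y) - g x\<bar> \<le> C * \<bar>y\<bar> powr \<beta>"] tr by auto
  qed
  have bound: "AE x in lborel. \<bar>g x - smooth \<K> n g x\<bar> \<le> (2 * b * C) * real n powr (- \<beta>)"
    using joint
  proof eventually_elim
    case (elim x)
    have "\<bar>g x - smooth \<K> n g x\<bar> \<le> (\<integral>y. (real n * b * (C * r powr \<beta>)) * indicator {-r..r} y \<partial>lborel)"
      unfolding smooth_eq
    proof (rule order_trans[OF integral_abs_bound integral_mono_AE])
      have "integrable lborel (\<lambda>y. k y * g x - k y * g (x - y))"
        using k_int prod_int by (intro Bochner_Integration.integrable_diff) auto
      then show "integrable lborel (\<lambda>y. \<bar>k y * (g x - g (x - y))\<bar>)"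
        by (intro integrable_abs) (simp add: right_diff_distrib)
      show "integrable lborel (\<lambda>y. (real n * b * (C * r powr \<beta>)) * indicator {-r..r} y)"
        using ind by (rule integrable_mult_right)
      show "AE y in lborel. \<bar>k y * (g x - g (x - y))\<bar> \<le> (real n * b * (C * r powr \<beta>)) * indicator {-r..r} y"
        using elim
      proof eventually_elim
        case (elim y)
        show ?case
        proof (cases "y \<in> {-r..r}")
          case True
          then have "\<bar>y\<bar> \<le> r" by auto
          then have "C * \<bar>y\<bar> powr \<beta> \<le> C * r powr \<beta>" using \<beta> C by (intro mult_left_mono powr_mono2) auto
          then have "\<bar>g x - g (x - y)\<bar> \<le> C * r powr \<beta>" using elim by (simp add: abs_minus_commute)
          moreover have "\<bar>k y\<bar> \<le> real n * b" using k_le[of y] True by simp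
          ultimately show ?thesis using True n0 b0 by (simp add: abs_mult mult_mono)
        next
          case False
          then show ?thesis using k_le[of y] by simp
        qed
      qed
    qed
    also have "(\<integral>y. (real n * b * (C * r powr \<beta>)) * indicator {-r..r} y \<partial>lborel) = (real n * b * (C * r powr \<beta>)) * (2 * r)"
      using r by simp
    also have "\<dots> = (2 * b * C) * r powr \<beta>" unfolding r_def using n0 by simp
    also have "r powr \<beta> = real n powr (- \<beta>)"
      unfolding r_def using n0 by (simp add: powr_minus powr_divide inverse_eq_divide)
    finally show ?case .
  qed
  have "(\<lambda>x. smooth \<K> n g x) \<in> borel_measurable borel"
    unfolding smooth_def k_def[symmetric] by measurable
  then show ?thesis
    unfolding Linf_norm_def using bound by (intro esssup_I) auto
qed

theorem lemma4p2:
  fixes A \<beta> :: real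
    and \<nu>0 :: "'k::finite \<Rightarrow> real"
    and h0 h0e :: "'k \<Rightarrow> 'k \<Rightarrow> real \<Rightarrow> real"
    and P0 :: "'k conf measure"
    and Q :: "real \<Rightarrow> 'k \<Rightarrow> 'k conf measure"
    and \<Gamma>e :: "'k param \<Rightarrow> 'k param"
  assumes "A > 0"
    and "stationary_hawkes A \<nu>0 h0 P0"
    and "palm_distributions P0 Q"
    and "0 < \<beta>" and "\<beta> \<le> 1"
    and "\<And>l k. holder_on \<beta> {0..A} (h0 l k)"
    and "\<And>l k. h0e l k \<in> holder_b \<beta>"
    and "\<And>l k x. x \<in> {0..A} \<Longrightarrow> h0e l k x = h0 l k x"
    and "\<And>l k x. h0e l k x \<ge> - \<nu>0 k / 2"
    and "\<Gamma>e = Gamma_ext A \<nu>0 h0 h0e P0 Q"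
    and "bounded_bijective \<Gamma>e"
  shows "(\<forall>\<K>. smoothing_kernel \<K> \<longrightarrow>
           (\<exists>C. (\<forall>g. C g > 0) \<and>
             (\<forall>\<xi>' g' \<xi> g. (\<xi>', g') \<in> params (holder_b \<beta>) \<longrightarrow> is_inverse_at \<Gamma>e (\<xi>', g') (\<xi>, g) \<longrightarrow>
               (\<forall>n::nat. n \<ge> 1 \<longrightarrow>
                 Linf_mat_norm (\<lambda>l k x. g l k x - smooth \<K> n (g l k) x)
                   \<le> ereal (C g * real n powr (- \<beta>)))))) \<and>
         (\<forall>\<xi>' g' \<xi> g. (\<xi>', g') \<in> params (holder_b \<beta>) \<longrightarrow> is_inverse_at \<Gamma>e (\<xi>', g') (\<xi>, g) \<longrightarrow>
           (\<forall>l k. g l k \<in> besov_inf_inf \<beta>)) \<and>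
         {z. \<exists>w\<in>params (holder_b \<beta>). is_inverse_at \<Gamma>e w z} \<subseteq> params (besov_inf_inf_b \<beta>)"
proof -
  have hp: "hawkes_parameter A \<nu>0 h0" using assms(2) by (simp add: stationary_hawkes_def)
  have h0: "0 \<le> h0 l k x" and h0': "x \<notin> {0..A} \<Longrightarrow> h0 l k x = 0" for l k x
    using hp unfolding hawkes_parameter_def by blast+
  obtain L where L: "0 \<le> L" "\<And>l k x y. x \<in> {0..A} \<Longrightarrow> y \<in> {0..A} \<Longrightarrow> \<bar>h0 l k x - h0 l k y\<bar> \<le> L * \<bar>x - y\<bar> powr \<beta>"
    using holder_uniform[of \<beta> "{0..A}" h0] assms(6) by blast
  define H where "H = L * A powr \<beta> + (\<Sum>l\<in>UNIV. \<Sum>k\<in>UNIV. h0 l k 0) + 1"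
  have Hpos: "0 < H" unfolding H_def using L h0 by (intro add_nonneg_pos add_nonneg_nonneg mult_nonneg_nonneg sum_nonneg) auto
  have h_le: "h0 l k x \<le> H" for l k x
  proof (cases "x \<in> {0..A}")
    case True
    have "h0 l k 0 \<le> (\<Sum>k\<in>UNIV. h0 l k 0)" by (rule member_le_sum) (auto simp: h0)
    also have "\<dots> \<le> (\<Sum>l\<in>UNIV. \<Sum>k\<in>UNIV. h0 l k 0)" by (rule member_le_sum) (auto intro: sum_nonneg h0)
    finally have "h0 l k 0 \<le> (\<Sum>l\<in>UNIV. \<Sum>k\<in>UNIV. h0 l k 0)" .
    moreover have "L * \<bar>x - 0\<bar> powr \<beta> \<le> L * A powr \<beta>"
      using True L assms(4) by (intro mult_left_mono powr_mono2) auto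
    ultimately show ?thesis using L(2)[OF True, of 0 l k] assms(1) unfolding H_def by simp
  next
    case False
    then show ?thesis using h0' Hpos by simp
  qed
  interpret hawkes_operator A \<nu>0 h0 P0 H Q \<beta> h0e
    by unfold_locales (use assms Hpos h_le in \<open>auto simp: holder_b_def\<close>)
  have tr: "\<exists>C\<ge>0. \<forall>l k y. AE x in lborel. \<bar>g l k (x - y) - g l k x\<bar> \<le> C * \<bar>y\<bar> powr \<beta>"
    if "(\<xi>', g') \<in> params (holder_b \<beta>)" "is_inverse_at \<Gamma>e (\<xi>', g') (\<xi>, g)" for \<xi>' g' \<xi> g
    using translation_bound[of \<xi>' g' \<xi> g] that assms(10,11) by simp
  have gL: "g l k \<in> Linf" if "is_inverse_at \<Gamma>e (\<xi>', g') (\<xi>, g)" for \<xi>' g' \<xi> g l k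
    using that unfolding is_inverse_at_def params_def by auto
  have besov: "g l k \<in> besov_inf_inf \<beta>"
    if "(\<xi>', g') \<in> params (holder_b \<beta>)" "is_inverse_at \<Gamma>e (\<xi>', g') (\<xi>, g)" for \<xi>' g' \<xi> g l k
    using tr[OF that] besov_from_translations[OF gL[OF that(2)] assms(4,5)] by blast
  \<comment> \<open>The bound on the translations of g is a property of g alone, so that a choice of it may serve as constant.\<close>
  define D where "D g = (SOME C. C \<ge> 0 \<and> (\<forall>l k y. AE x in lborel. \<bar>g l k (x - y) - g l k x\<bar> \<le> C * \<bar>y\<bar> powr \<beta>))"
    for g :: "'k \<Rightarrow> 'k \<Rightarrow> real \<Rightarrow> real"
  have smoothing: "\<exists>C. (\<forall>g. C g > 0) \<and>
             (\<forall>\<xi>' g' \<xi> g. (\<xi>', g') \<in> params (holder_b \<beta>) \<longrightarrow> is_inverse_at \<Gamma>e (\<xi>', g') (\<xi>, g) \<longrightarrow>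
               (\<forall>n::nat. n \<ge> 1 \<longrightarrow>
                 Linf_mat_norm (\<lambda>l k x. g l k x - smooth \<K> n (g l k) x)
                   \<le> ereal (C g * real n powr (- \<beta>))))" if K: "smoothing_kernel \<K>" for \<K>
  proof -
    obtain b where b: "\<And>x. \<bar>\<K> x\<bar> \<le> b"
      using K unfolding smoothing_kernel_def bounded_iff by auto
    have b0: "0 \<le> b" using b[of 0] by linarith
    define C where "C g = max 0 (2 * b * D g) + 1" for g
    have "Linf_mat_norm (\<lambda>l k x. g l k x - smooth \<K> n (g l k) x) \<le> ereal (C g * real n powr (- \<beta>))"
      if w: "(\<xi>', g') \<in> params (holder_b \<beta>)" and inv: "is_inverse_at \<Gamma>e (\<xi>', g') (\<xi>, g)" and n: "n \<ge> 1" for \<xi>' g' \<xi> g and n :: nat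
    proof -
      have D: "D g \<ge> 0" "\<And>l k y. AE x in lborel. \<bar>g l k (x - y) - g l k x\<bar> \<le> D g * \<bar>y\<bar> powr \<beta>"
        using someI_ex[OF tr[OF w inv]] unfolding D_def by blast+
      have "Linf_norm (\<lambda>x. g l k x - smooth \<K> n (g l k) x) \<le> ereal (C g * real n powr (- \<beta>))" for l k
      proof -
        have "Linf_norm (\<lambda>x. g l k x - smooth \<K> n (g l k) x) \<le> ereal ((2 * b * D g) * real n powr (- \<beta>))"
          by (rule smoothing_from_translations[OF gL[OF inv] assms(4) n K b D])
        also have "\<dots> \<le> ereal (C g * real n powr (- \<beta>))"
          unfolding C_def ereal_less_eq by (intro mult_right_mono) auto
        finally show ?thesis .
      qed
      then show ?thesis unfolding Linf_mat_norm_def by (intro SUP_least)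
    qed
    moreover have "C g > 0" for g unfolding C_def by (simp add: add_nonneg_pos)
    ultimately show ?thesis by (intro exI[of _ C] conjI allI impI)
  qed
  have "{z. \<exists>w\<in>params (holder_b \<beta>). is_inverse_at \<Gamma>e w z} \<subseteq> params (besov_inf_inf_b \<beta>)"
  proof
    fix z assume "z \<in> {z. \<exists>w\<in>params (holder_b \<beta>). is_inverse_at \<Gamma>e w z}"
    then obtain \<xi>' g' \<xi> g where z: "z = (\<xi>, g)" "(\<xi>', g') \<in> params (holder_b \<beta>)" "is_inverse_at \<Gamma>e (\<xi>', g') (\<xi>, g)"
      by (cases z) auto
    then show "z \<in> params (besov_inf_inf_b \<beta>)"
      using besov[OF z(2,3)] gL[OF z(3)] by (auto simp: params_def besov_inf_inf_b_def)
  qed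
  then show ?thesis by (intro conjI allI impI smoothing besov)
qed

end
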